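(* Let $S$ be a finite $\mathrm{GM}$ semigroup generated by a set $X$, with associated transformation semigroup $(G\times B,S)$, let $n$ be a non-negative integer, and assume that $\mathrm{RLM}(S)c\le n$. Then the following are equivalent: 1. $Sc\le n$. 2. There is an aperiodic relational morphism $\Theta:S\to H\wr T$, where $H$ is a group and $T$ is a transformation semigroup with $Tc\le n-1$. 3. There is a relational morphism $\Phi:S\to T$ (that is, of transformation semigroups $(G\times B,S)\to (Q,T)$), where $Tc\le n-1$, such that the derived transformation semigroup $D(\Phi)$ is in $Ap*Gp$. 4. There is a relational morphism $\Phi:S\to T$ (that is, of transformation semigroups $(G\times B,S)\to (Q,T)$), where $Tc\le n-1$, such that the Tilson congruence $\tau$ on the derived transformation semigroup $D(\Phi)$ is a cross-section. 5. $(G\times B,S)$ admits a flow to $Rh_B(G)$ from a transformation semigroup $(Q,T)$ with $(Q,T)c\le n-1$. 6. $S\prec (G\wr Sym(B)\wr T)\times \mathrm{RLM}(S)$ for some transformation semigroup $T$ with $Tc\le n-1$.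
   Context: All semigroups are finite. A semigroup is aperiodic if all its subgroups are trivial. A transformation semigroup (ts) $(Q,T)$ is a set $Q$ with a semigroup $T$ of partial functions acting on the right of $Q$. GM semigroups. A semigroup $S$ is $\mathrm{GM}$ (group mapping) if it has a unique $0$-minimal ideal $I(S)$ (if $S$ has no zero, $I(S)$ is its minimal ideal), this ideal is regular, isomorphic to a Rees matrix semigroup $M^0(G,A,B,C)$ (respectively $M(G,A,B,C)$) with $G$ a non-trivial group, and $S$ acts faithfully by both the right and the left Schützenberger representations on any $\mathcal R$-class, respectively $\mathcal L$-class, contained in $I(S)\setminus\{0\}$ (right representation on an $\mathcal R$-class $R$: $r\cdot s=rs$ if $rs\in R$, undefined otherwise; dually on the left). Fix an $\mathcal R$-class in $I(S)\setminus\{0\}$ and identify it with $G\times B$; this gives the faithful ts $(G\times B,S)$, whose action commutes with the left action $h(g,b)=(hg,b)$ of $G$. The induced action of $S$ on $B$ has faithful image denoted $\mathrm{RLM}(S)$, giving the ts $(B,\mathrm{RLM}(S))$. Wreath products, division, complexity. $(P,T)\wr(Q,S)=(P\times Q,W)$, $W=\{(f,s): s\in S,\ f:\mathrm{Dom}(s)\to T\}$, with $(p,q)(f,s)=(p\cdot f(q),qs)$ when defined. A group $H$ is regarded as the ts $(H,H)$ via right multiplication, and $Sym(B)$ as $(B,Sym(B))$. When a ts appears where a semigroup is expected, its semigroup is meant. For semigroups, $S\prec U$ (division) means $S$ is a homomorphic image of a subsemigroup of $U$. The Krohn-Rhodes complexity $Sc$ of $S$ is the least number of groups in any decomposition of $S$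 as a divisor of a wreath product of groups and aperiodic semigroups; the complexity $(Q,T)c$, also written $Tc$, of a ts is that of $T$. $Ap*Gp$ is the class of all semigroups dividing a wreath product $A\wr K$ with $A$ aperiodic and $K$ a group; a ts is said to be in it if its semigroup is. Relational morphisms. A relational morphism $\Theta:S\to U$ of semigroups assigns to each $s\in S$ a non-empty subset $s\Theta\subseteq U$ with $(s\Theta)(s'\Theta)\subseteq (ss')\Theta$; it is aperiodic if the inverse image of every aperiodic subsemigroup of $U$ is aperiodic. A relational morphism of ts $\Phi:(P,S)\to(Q,T)$ consists of a relational morphism of semigroups $s\mapsto s\Phi\subseteq T$ and a relation assigning to each $p\in P$ a non-empty subset $p\Phi\subseteq Q$, such that if $q\in p\Phi$, $t\in s\Phi$ and $ps$ is defined, then $qt$ is defined and $qt\in(ps)\Phi$. Its derived transformation semigroup $D(\Phi)$ has state set $\{(p,q):q\in p\Phi\}$ and semigroup generated by the partial functions $[q,s,t]$ ($q\in Q$, $t\in s\Phi$, $qt$ defined) given by $(p,q)[q,s,t]=(ps,qt)$ if $ps$ is defined, and undefined on all other states. Tilson congruence. A congruence on a ts $(Q,S)$ is an equivalence relation $\approx$ on $Q$ such that $q\approx q'$ implies $qs\approx q's$ whenever both are defined; each $s$ induces a partial function on $Q/{\approx}$ by $[q]s=[q's]$ if $q's$ is defined for some $q'\in[q]$. It is injective if every $s$ induces a partial one-to-one function on $Q/{\approx}$. There is a unique minimal injective congruence $\tau$, called the Tilson congruence. For $\Phi:(G\times B,S)\to(Q,T)$, $\tau$ on $D(\Phi)$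 is a cross-section if for all $g,h\in G$, $b\in B$, $q\in Q$: $((g,b),q)\,\tau\,((h,b),q)$ implies $g=h$. Flows. Consider pairs $(Y,\Pi)$ with $Y\subseteq G\times B$ and $\Pi$ a partition of $Y$. Such a pair is a cross-section if no block of $\Pi$ contains $(g,b)$ and $(h,b)$ with $g\ne h$; it is invariant if $gY=Y$ and $g\Pi=\Pi$ for all $g\in G$. The Rhodes lattice $Rh_B(G)$ is identified with the set of invariant cross-sections together with an extra top element (contradiction). Let $\mathcal A$ be an automaton with alphabet $X$ and state set $Q$, each letter acting as a partial function on $Q$. A (complete) flow $f:Q\to Rh_B(G)$ assigns to each $q$ an invariant cross-section $qf$ such that: (i) every $(g,b)\in G\times B$ lies in $Y$ for some $q$ with $qf=(Y,\Pi)$; (ii) for $q\in Q$, $x\in X$, with $qf=(Y,\Pi)$ and $(qx)f=(Z,\Theta)$ (taking $(Z,\Theta)=(\emptyset,\emptyset)$ if $qx$ is undefined), one has $Yx\subseteq Z$ and, for $y,y'\in Y$ with $yx,y'x$ both defined, $y,y'$ lie in the same $\Pi$-block iff $yx,y'x$ lie in the same $\Theta$-block. A flow from a ts $(Q,T)$ is a flow on an automaton with alphabet $X$ and state set $Q$ whose transition semigroup is $T$. *)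

theory Defs
  imports "HOL-Algebra.Group" "HOL-Library.Disjoint_Sets" "HOL-Library.Extended_Nat"
begin

section \<open>Semigroups\<close>

record 'a sgp = "'a partial_object" +
  sprod :: "'a \<Rightarrow> 'a \<Rightarrow> 'a"  (infixl "\<cdot>\<index>" 70)

definition is_sgp :: "'a sgp \<Rightarrow> bool" where
  "is_sgp S \<longleftrightarrow> carrier S \<noteq> {} \<and>
     (\<forall>x\<in>carrier S. \<forall>y\<in>carrier S. x \<cdot>\<^bsub>S\<^esub> y \<in> carrier S) \<and>
     (\<forall>x\<in>carrier S. \<forall>y\<in>carrier S. \<forall>z\<in>carrier S.
        (x \<cdot>\<^bsub>S\<^esub> y) \<cdot>\<^bsub>S\<^esub> z = x \<cdot>\<^bsub>S\<^esub> (y \<cdot>\<^bsub>S\<^esub> z))"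

definition finite_sgp :: "'a sgp \<Rightarrow> bool" where
  "finite_sgp S \<longleftrightarrow> is_sgp S \<and> finite (carrier S)"

definition subsgp :: "'a set \<Rightarrow> 'a sgp \<Rightarrow> bool" where
  "subsgp V S \<longleftrightarrow> V \<noteq> {} \<and> V \<subseteq> carrier S \<and> (\<forall>x\<in>V. \<forall>y\<in>V. x \<cdot>\<^bsub>S\<^esub> y \<in> V)"

inductive_set sgp_generated :: "'a sgp \<Rightarrow> 'a set \<Rightarrow> 'a set" for S X where
  gen: "x \<in> X \<Longrightarrow> x \<in> sgp_generated S X"
| prod: "x \<in> sgp_generated S X \<Longrightarrow> y \<in> sgp_generated S X \<Longrightarrow> x \<cdot>\<^bsub>S\<^esub> y \<in> sgp_generated S X"

definition sgp_subgroup :: "'a set \<Rightarrow> 'a sgp \<Rightarrow> bool" where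
  "sgp_subgroup K S \<longleftrightarrow> K \<subseteq> carrier S \<and>
     (\<exists>e. Group.group \<lparr>carrier = K, mult = sprod S, one = e\<rparr>)"

definition aperiodic :: "'a sgp \<Rightarrow> bool" where
  "aperiodic S \<longleftrightarrow> (\<forall>K. sgp_subgroup K S \<longrightarrow> (\<exists>e. K = {e}))"

definition sgp_times :: "'a sgp \<Rightarrow> 'b sgp \<Rightarrow> ('a \<times> 'b) sgp" where
  "sgp_times S U = \<lparr>carrier = carrier S \<times> carrier U,
     sprod = (\<lambda>(s, u) (s', u'). (s \<cdot>\<^bsub>S\<^esub> s', u \<cdot>\<^bsub>U\<^esub> u'))\<rparr>"

definition divides :: "'a sgp \<Rightarrow> 'b sgp \<Rightarrow> bool"  (infix "\<prec>\<^sub>s" 50) where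
  "S \<prec>\<^sub>s U \<longleftrightarrow> (\<exists>V h. subsgp V U \<and> h ` V = carrier S \<and>
     (\<forall>u\<in>V. \<forall>v\<in>V. h (u \<cdot>\<^bsub>U\<^esub> v) = h u \<cdot>\<^bsub>S\<^esub> h v))"

definition rel_morphism :: "'a sgp \<Rightarrow> 'b sgp \<Rightarrow> ('a \<Rightarrow> 'b set) \<Rightarrow> bool" where
  "rel_morphism S U \<Theta> \<longleftrightarrow>
     (\<forall>s\<in>carrier S. \<Theta> s \<noteq> {} \<and> \<Theta> s \<subseteq> carrier U) \<and>
     (\<forall>s\<in>carrier S. \<forall>s'\<in>carrier S. \<forall>u\<in>\<Theta> s. \<forall>u'\<in>\<Theta> s'. u \<cdot>\<^bsub>U\<^esub> u' \<in> \<Theta> (s \<cdot>\<^bsub>S\<^esub> s'))"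

definition aperiodic_rel_morphism :: "'a sgp \<Rightarrow> 'b sgp \<Rightarrow> ('a \<Rightarrow> 'b set) \<Rightarrow> bool" where
  "aperiodic_rel_morphism S U \<Theta> \<longleftrightarrow> rel_morphism S U \<Theta> \<and>
     (\<forall>V. subsgp V U \<and> aperiodic (U\<lparr>carrier := V\<rparr>) \<longrightarrow>
        aperiodic (S\<lparr>carrier := {s \<in> carrier S. \<Theta> s \<inter> V \<noteq> {}}\<rparr>))"


section \<open>Transformation semigroups\<close>

text \<open>Partial functions act on the right, so the product of \<open>f\<close> and \<open>g\<close> is ``first \<open>f\<close>, then \<open>g\<close>''.\<close>

definition pfun_sgp :: "('q \<rightharpoonup> 'q) set \<Rightarrow> ('q \<rightharpoonup> 'q) sgp" where
  "pfun_sgp F = \<lparr>carrier = F, sprod = (\<lambda>f g. g \<circ>\<^sub>m f)\<rparr>"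

record 'q ts =
  states :: "'q set"
  pfuns :: "('q \<rightharpoonup> 'q) set"

abbreviation sgp_of :: "'q ts \<Rightarrow> ('q \<rightharpoonup> 'q) sgp" where
  "sgp_of T \<equiv> pfun_sgp (pfuns T)"

definition is_ts :: "'q ts \<Rightarrow> bool" where
  "is_ts T \<longleftrightarrow> finite (states T) \<and> is_sgp (sgp_of T) \<and>
     (\<forall>t\<in>pfuns T. dom t \<subseteq> states T \<and> ran t \<subseteq> states T)"

definition group_ts :: "'g monoid \<Rightarrow> 'g ts" where
  "group_ts H = \<lparr>states = carrier H,
     pfuns = {\<lambda>g. if g \<in> carrier H then Some (g \<otimes>\<^bsub>H\<^esub> h) else None | h. h \<in> carrier H}\<rparr>"

definition sym_ts :: "'b set \<Rightarrow> 'b ts" where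
  "sym_ts B = \<lparr>states = B, pfuns = {\<lambda>b. if b \<in> B then Some (\<pi> b) else None | \<pi>. bij_betw \<pi> B B}\<rparr>"

text \<open>The partial function on \<open>P \<times> Q\<close> given by the pair \<open>(f, s)\<close>; only the values of \<open>f\<close> on
  the domain of \<open>s\<close> matter.\<close>

definition wreath_act :: "('q \<Rightarrow> 'p \<rightharpoonup> 'p) \<Rightarrow> ('q \<rightharpoonup> 'q) \<Rightarrow> ('p \<times> 'q \<rightharpoonup> 'p \<times> 'q)" where
  "wreath_act f s = (\<lambda>(p, q). case s q of None \<Rightarrow> None
     | Some q' \<Rightarrow> (case f q p of None \<Rightarrow> None | Some p' \<Rightarrow> Some (p', q')))"

definition wreath :: "'p ts \<Rightarrow> 'q ts \<Rightarrow> ('p \<times> 'q) ts"  (infixr "\<wr>" 75) where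
  "P \<wr> Q = \<lparr>states = states P \<times> states Q,
     pfuns = {wreath_act f s | f s. s \<in> pfuns Q \<and> (\<forall>q\<in>dom s. f q \<in> pfuns P)}\<rparr>"


section \<open>Complexity\<close>

text \<open>Iterated wreath product \<open>T\<^sub>1 \<wr> (T\<^sub>2 \<wr> (\<dots> \<wr> T\<^sub>k))\<close>, with tuples of states written as lists.\<close>

fun wreath_list :: "'q ts list \<Rightarrow> 'q list ts" where
  "wreath_list [] = \<lparr>states = {[]}, pfuns = {\<lambda>qs. if qs = [] then Some [] else None}\<rparr>"
| "wreath_list (T # Ts) = (let W = T \<wr> wreath_list Ts in
     \<lparr>states = (\<lambda>(q, qs). q # qs) ` states W,
      pfuns = {\<lambda>r. case r of [] \<Rightarrow> None
                 | q # qs \<Rightarrow> map_option (\<lambda>(q', qs'). q' # qs') (w (q, qs)) | w. w \<in> pfuns W}\<rparr>)"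

text \<open>Finite objects have isomorphic copies on \<^typ>\<open>nat\<close>, so restricting the factors to this type
  loses no generality.  A group \<open>H\<close> enters as \<open>(H, H)\<close>; an aperiodic factor is any transformation
  semigroup whose semigroup is aperiodic.\<close>

datatype kr_factor = Group_Factor "nat monoid" | Aperiodic_Factor "nat ts"

fun factor_ok :: "kr_factor \<Rightarrow> bool" where
  "factor_ok (Group_Factor H) \<longleftrightarrow> Group.group H \<and> finite (carrier H)"
| "factor_ok (Aperiodic_Factor T) \<longleftrightarrow> is_ts T \<and> aperiodic (sgp_of T)"

fun factor_ts :: "kr_factor \<Rightarrow> nat ts" where
  "factor_ts (Group_Factor H) = group_ts H"
| "factor_ts (Aperiodic_Factor T) = T"

fun is_group_factor :: "kr_factor \<Rightarrow> bool" where
  "is_group_factor (Group_Factor H) = True"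
| "is_group_factor (Aperiodic_Factor T) = False"

definition kr_decomposition :: "'a sgp \<Rightarrow> kr_factor list \<Rightarrow> bool" where
  "kr_decomposition S Fs \<longleftrightarrow> (\<forall>F\<in>set Fs. factor_ok F) \<and>
     S \<prec>\<^sub>s sgp_of (wreath_list (map factor_ts Fs))"

text \<open>The infimum in \<^typ>\<open>enat\<close> of a nonempty set is its least element.  (That a decomposition
  always exists, so that the complexity is finite, is the Krohn-Rhodes theorem.)\<close>

definition complexity :: "'a sgp \<Rightarrow> enat" where
  "complexity S = Inf {enat (length (filter is_group_factor Fs)) | Fs. kr_decomposition S Fs}"

lemma complexity_le_iff:
  "complexity S \<le> enat n \<longleftrightarrow>
     (\<exists>Fs. kr_decomposition S Fs \<and> length (filter is_group_factor Fs) \<le> n)"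
  (is "_ \<longleftrightarrow> ?R")
proof
  let ?M = "{enat (length (filter is_group_factor Fs)) | Fs. kr_decomposition S Fs}"
  assume le: "complexity S \<le> enat n"
  have "?M \<noteq> {}"
  proof
    assume "?M = {}"
    then have "complexity S = \<infinity>" unfolding complexity_def by (simp only: Inf_enat_def) simp
    with le show False by simp
  qed
  then have "Inf ?M \<in> ?M" by (metis (mono_tags, lifting) Inf_enat_def LeastI ex_in_conv)
  with le show ?R unfolding complexity_def by auto
next
  assume ?R
  then obtain Fs where "kr_decomposition S Fs" "length (filter is_group_factor Fs) \<le> n" by blast
  then show "complexity S \<le> enat n"
    unfolding complexity_def by (intro Inf_lower2[of "enat (length (filter is_group_factor Fs))"]) auto
qed

definition in_Ap_Gp :: "'a sgp \<Rightarrow> bool" where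
  "in_Ap_Gp S \<longleftrightarrow> (\<exists>(A :: nat ts) (K :: nat monoid). is_ts A \<and> aperiodic (sgp_of A) \<and>
     Group.group K \<and> finite (carrier K) \<and> S \<prec>\<^sub>s sgp_of (A \<wr> group_ts K))"


section \<open>Relational morphisms of transformation semigroups, the derived semigroup\<close>

text \<open>\<open>\<Phi>Q\<close> is the relation on states, \<open>\<Phi>T\<close> the relation on transformations.\<close>

definition ts_rel_morphism ::
  "'p ts \<Rightarrow> 'q ts \<Rightarrow> ('p \<Rightarrow> 'q set) \<Rightarrow> (('p \<rightharpoonup> 'p) \<Rightarrow> ('q \<rightharpoonup> 'q) set) \<Rightarrow> bool" where
  "ts_rel_morphism P T \<Phi>Q \<Phi>T \<longleftrightarrow>
     rel_morphism (sgp_of P) (sgp_of T) \<Phi>T \<and>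
     (\<forall>p\<in>states P. \<Phi>Q p \<noteq> {} \<and> \<Phi>Q p \<subseteq> states T) \<and>
     (\<forall>p\<in>states P. \<forall>s\<in>pfuns P. \<forall>q\<in>\<Phi>Q p. \<forall>t\<in>\<Phi>T s. \<forall>p'.
        s p = Some p' \<longrightarrow> (\<exists>q'. t q = Some q' \<and> q' \<in> \<Phi>Q p'))"

definition derived_states :: "'p ts \<Rightarrow> ('p \<Rightarrow> 'q set) \<Rightarrow> ('p \<times> 'q) set" where
  "derived_states P \<Phi>Q = {(p, q). p \<in> states P \<and> q \<in> \<Phi>Q p}"

definition derived_gen ::
  "'p ts \<Rightarrow> ('p \<Rightarrow> 'q set) \<Rightarrow> 'q \<Rightarrow> ('p \<rightharpoonup> 'p) \<Rightarrow> ('q \<rightharpoonup> 'q) \<Rightarrow> ('p \<times> 'q \<rightharpoonup> 'p \<times> 'q)" where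
  "derived_gen P \<Phi>Q q s t = (\<lambda>(p, r). if (p, r) \<in> derived_states P \<Phi>Q \<and> r = q
     then (case (s p, t q) of (Some p', Some q') \<Rightarrow> Some (p', q') | _ \<Rightarrow> None) else None)"

definition derived_ts ::
  "'p ts \<Rightarrow> 'q ts \<Rightarrow> ('p \<Rightarrow> 'q set) \<Rightarrow> (('p \<rightharpoonup> 'p) \<Rightarrow> ('q \<rightharpoonup> 'q) set) \<Rightarrow> ('p \<times> 'q) ts" where
  "derived_ts P T \<Phi>Q \<Phi>T = \<lparr>states = derived_states P \<Phi>Q,
     pfuns = sgp_generated (pfun_sgp UNIV)
       {derived_gen P \<Phi>Q q s t | q s t. q \<in> states T \<and> s \<in> pfuns P \<and> t \<in> \<Phi>T s \<and> t q \<noteq> None}\<rparr>"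


section \<open>The Tilson congruence\<close>

definition ts_congruence :: "'q ts \<Rightarrow> ('q \<times> 'q) set \<Rightarrow> bool" where
  "ts_congruence T r \<longleftrightarrow> equiv (states T) r \<and>
     (\<forall>s\<in>pfuns T. \<forall>q q' p p'. (q, q') \<in> r \<and> s q = Some p \<and> s q' = Some p' \<longrightarrow> (p, p') \<in> r)"

text \<open>The action of \<open>s\<close> on classes.  For a congruence the union below has only one distinct member.\<close>

definition class_act :: "'q ts \<Rightarrow> ('q \<times> 'q) set \<Rightarrow> ('q \<rightharpoonup> 'q) \<Rightarrow> ('q set \<rightharpoonup> 'q set)" where
  "class_act T r s = (\<lambda>c. if c \<in> states T // r \<and> (\<exists>q\<in>c. s q \<noteq> None)
     then Some (\<Union>{r `` {p} | p. \<exists>q\<in>c. s q = Some p}) else None)"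

definition injective_congruence :: "'q ts \<Rightarrow> ('q \<times> 'q) set \<Rightarrow> bool" where
  "injective_congruence T r \<longleftrightarrow> ts_congruence T r \<and>
     (\<forall>s\<in>pfuns T. inj_on (class_act T r s) (dom (class_act T r s)))"

definition tilson_congruence :: "'q ts \<Rightarrow> ('q \<times> 'q) set" where
  "tilson_congruence T = (THE r. injective_congruence T r \<and>
     (\<forall>r'. injective_congruence T r' \<and> r' \<subseteq> r \<longrightarrow> r' = r))"

lemma class_act_class:
  assumes r: "ts_congruence T r" and T: "is_ts T" and s: "s \<in> pfuns T" and q: "s q = Some p"
  shows "class_act T r s (r `` {q}) = Some (r `` {p})"
proof -
  have eq: "equiv (states T) r" using r by (simp add: ts_congruence_def)
  have qs: "q \<in> states T" using T s q unfolding is_ts_def by blast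
  have qc: "q \<in> r `` {q}" using eq qs by (rule equiv_class_self)
  have "r `` {p'} = r `` {p}" if "x \<in> r `` {q}" "s x = Some p'" for x p'
  proof -
    have "(p, p') \<in> r" using r s q that unfolding ts_congruence_def by blast
    then show ?thesis using eq equiv_class_eq by metis
  qed
  then have "{r `` {p'} | p'. \<exists>x\<in>r `` {q}. s x = Some p'} = {r `` {p}}" using qc q by blast
  then show ?thesis using qc q qs unfolding class_act_def by (auto intro: quotientI)
qed

lemma injective_congruence_iff:
  assumes T: "is_ts T"
  shows "injective_congruence T r \<longleftrightarrow> ts_congruence T r \<and>
    (\<forall>s\<in>pfuns T. \<forall>q q' p p'. s q = Some p \<and> s q' = Some p' \<and> (p, p') \<in> r \<longrightarrow> (q, q') \<in> r)"
  (is "_ \<longleftrightarrow> _ \<and> ?inj")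
proof (cases "ts_congruence T r")
  case True
  then have eq: "equiv (states T) r" by (simp add: ts_congruence_def)
  have st: "q \<in> states T" "p \<in> states T" if "s \<in> pfuns T" "s q = Some p" for s q p
    using T that unfolding is_ts_def by (blast intro: ranI)+
  have "(\<forall>s\<in>pfuns T. inj_on (class_act T r s) (dom (class_act T r s))) \<longleftrightarrow> ?inj"
  proof
    assume inj: "\<forall>s\<in>pfuns T. inj_on (class_act T r s) (dom (class_act T r s))"
    show ?inj
    proof (intro ballI allI impI)
      fix s q q' p p'
      assume s: "s \<in> pfuns T" and h: "s q = Some p \<and> s q' = Some p' \<and> (p, p') \<in> r"
      then have "class_act T r s (r `` {q}) = class_act T r s (r `` {q'})"
        using class_act_class[OF True T s] eq by (metis equiv_class_eq)
      moreover have "r `` {q} \<in> dom (class_act T r s)" "r `` {q'} \<in> dom (class_act T r s)"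
        using class_act_class[OF True T s] h by blast+
      ultimately have "r `` {q} = r `` {q'}" using inj s by (meson inj_onD)
      then show "(q, q') \<in> r" using eq st s h by (meson eq_equiv_class)
    qed
  next
    assume inj: ?inj
    show "\<forall>s\<in>pfuns T. inj_on (class_act T r s) (dom (class_act T r s))"
    proof (intro ballI inj_onI)
      fix s c d
      assume s: "s \<in> pfuns T" and c: "c \<in> dom (class_act T r s)" and d: "d \<in> dom (class_act T r s)"
        and e: "class_act T r s c = class_act T r s d"
      obtain q p where q: "c \<in> states T // r" "q \<in> c" "s q = Some p"
        using c by (auto simp: class_act_def split: if_splits)
      obtain q' p' where q': "d \<in> states T // r" "q' \<in> d" "s q' = Some p'"
        using d by (auto simp: class_act_def split: if_splits)
      have cd: "c = r `` {q}" "d = r `` {q'}"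
        using eq q q' by (metis quotientE Image_singleton_iff equiv_class_eq)+
      have "r `` {p} = r `` {p'}"
        using e class_act_class[OF True T s] q q' cd by simp
      then have "(p, p') \<in> r" using eq st s q q' by (meson eq_equiv_class)
      then have "(q, q') \<in> r" using inj s q q' by blast
      then show "c = d" using cd eq by (metis equiv_class_eq)
    qed
  qed
  with True show ?thesis by (simp add: injective_congruence_def)
qed (simp add: injective_congruence_def)

lemma injective_congruence_Inter:
  assumes T: "is_ts T"
  shows "injective_congruence T (\<Inter> (Collect (injective_congruence T)))"
proof -
  have "equiv (states T) (states T \<times> states T)"
    by (auto simp: equiv_def refl_on_def sym_def intro: transI)
  moreover have "q \<in> states T" "p \<in> states T" if "s \<in> pfuns T" "s q = Some p" for s q p
    using T that unfolding is_ts_def by (blast intro: ranI)+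
  ultimately have ex: "injective_congruence T (states T \<times> states T)"
    unfolding injective_congruence_iff[OF T] ts_congruence_def by blast
  let ?C = "Collect (injective_congruence T)"
  have eq: "equiv (states T) r" if "r \<in> ?C" for r
    using that by (simp add: injective_congruence_def ts_congruence_def)
  have "equiv (states T) (\<Inter> ?C)"
  proof (rule equivI)
    show "\<Inter> ?C \<subseteq> states T \<times> states T" using ex by blast
    show "refl_on (states T) (\<Inter> ?C)" using eq unfolding equiv_def refl_on_def by blast
    show "sym (\<Inter> ?C)" using eq unfolding equiv_def sym_def by blast
    show "Relation.trans (\<Inter> ?C)" using eq unfolding equiv_def Relation.trans_def by blast
  qed
  then show ?thesis
    unfolding injective_congruence_iff[OF T] ts_congruence_def by blast
qed

lemma tilson_congruence_eq:
  assumes "is_ts T"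
  shows "tilson_congruence T = \<Inter> (Collect (injective_congruence T))"
  unfolding tilson_congruence_def
proof (rule the_equality)
  show "injective_congruence T (\<Inter> (Collect (injective_congruence T))) \<and>
    (\<forall>r'. injective_congruence T r' \<and> r' \<subseteq> \<Inter> (Collect (injective_congruence T)) \<longrightarrow>
       r' = \<Inter> (Collect (injective_congruence T)))"
    using injective_congruence_Inter[OF assms] by blast
next
  fix r
  assume "injective_congruence T r \<and> (\<forall>r'. injective_congruence T r' \<and> r' \<subseteq> r \<longrightarrow> r' = r)"
  then show "r = \<Inter> (Collect (injective_congruence T))"
    using injective_congruence_Inter[OF assms] by (metis CollectI Inter_lower)
qed

definition is_cross_section ::
  "'g monoid \<Rightarrow> 'b set \<Rightarrow> 'q set \<Rightarrow> ((('g \<times> 'b) \<times> 'q) \<times> (('g \<times> 'b) \<times> 'q)) set \<Rightarrow> bool" where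
  "is_cross_section G B Q \<tau> \<longleftrightarrow> (\<forall>g\<in>carrier G. \<forall>h\<in>carrier G. \<forall>b\<in>B. \<forall>q\<in>Q.
     (((g, b), q), ((h, b), q)) \<in> \<tau> \<longrightarrow> g = h)"


section \<open>GM semigroups\<close>

definition is_zero :: "'s sgp \<Rightarrow> 's \<Rightarrow> bool" where
  "is_zero S z \<longleftrightarrow> z \<in> carrier S \<and> (\<forall>s\<in>carrier S. s \<cdot>\<^bsub>S\<^esub> z = z \<and> z \<cdot>\<^bsub>S\<^esub> s = z)"

definition is_ideal :: "'s sgp \<Rightarrow> 's set \<Rightarrow> bool" where
  "is_ideal S I \<longleftrightarrow> I \<noteq> {} \<and> I \<subseteq> carrier S \<and>
     (\<forall>x\<in>I. \<forall>s\<in>carrier S. s \<cdot>\<^bsub>S\<^esub> x \<in> I \<and> x \<cdot>\<^bsub>S\<^esub> s \<in> I)"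

text \<open>An ideal containing an element other than zero.  If \<open>S\<close> has no zero this is any ideal, so
  the notion of 0-minimal ideal below then becomes that of minimal ideal.\<close>

definition nonzero_ideal :: "'s sgp \<Rightarrow> 's set \<Rightarrow> bool" where
  "nonzero_ideal S I \<longleftrightarrow> is_ideal S I \<and> (\<exists>x\<in>I. \<not> is_zero S x)"

definition zero_minimal_ideal :: "'s sgp \<Rightarrow> 's set \<Rightarrow> bool" where
  "zero_minimal_ideal S I \<longleftrightarrow> nonzero_ideal S I \<and> (\<forall>J. nonzero_ideal S J \<and> J \<subseteq> I \<longrightarrow> J = I)"

text \<open>Rees matrix semigroups: \<open>None\<close> is the zero, \<open>C b a = None\<close> means that the \<open>(b, a)\<close> entry of
  the sandwich matrix is zero.\<close>

definition rees_mult ::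
  "'g monoid \<Rightarrow> ('b \<Rightarrow> 'a \<Rightarrow> 'g option) \<Rightarrow>
     ('a \<times> 'g \<times> 'b) option \<Rightarrow> ('a \<times> 'g \<times> 'b) option \<Rightarrow> ('a \<times> 'g \<times> 'b) option" where
  "rees_mult G C u v = (case (u, v) of
     (Some (a, g, b), Some (a', g', b')) \<Rightarrow>
       (case C b a' of None \<Rightarrow> None | Some c \<Rightarrow> Some (a, g \<otimes>\<^bsub>G\<^esub> c \<otimes>\<^bsub>G\<^esub> g', b'))
   | _ \<Rightarrow> None)"

definition rees :: "'g monoid \<Rightarrow> 'a set \<Rightarrow> 'b set \<Rightarrow> ('b \<Rightarrow> 'a \<Rightarrow> 'g option) \<Rightarrow> ('a \<times> 'g \<times> 'b) option sgp"
  where "rees G A B C = \<lparr>carrier = Some ` (A \<times> carrier G \<times> B), sprod = rees_mult G C\<rparr>"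

definition rees0 :: "'g monoid \<Rightarrow> 'a set \<Rightarrow> 'b set \<Rightarrow> ('b \<Rightarrow> 'a \<Rightarrow> 'g option) \<Rightarrow> ('a \<times> 'g \<times> 'b) option sgp"
  where "rees0 G A B C =
    \<lparr>carrier = insert None (Some ` (A \<times> carrier G \<times> B)), sprod = rees_mult G C\<rparr>"

definition sgp_iso :: "'a sgp \<Rightarrow> 'b sgp \<Rightarrow> ('a \<Rightarrow> 'b) \<Rightarrow> bool" where
  "sgp_iso S U h \<longleftrightarrow> bij_betw h (carrier S) (carrier U) \<and>
     (\<forall>x\<in>carrier S. \<forall>y\<in>carrier S. h (x \<cdot>\<^bsub>S\<^esub> y) = h x \<cdot>\<^bsub>U\<^esub> h y)"

definition R_class :: "'s sgp \<Rightarrow> 's \<Rightarrow> 's set" where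
  "R_class S x = {y \<in> carrier S.
     insert x ((\<lambda>s. x \<cdot>\<^bsub>S\<^esub> s) ` carrier S) = insert y ((\<lambda>s. y \<cdot>\<^bsub>S\<^esub> s) ` carrier S)}"

definition L_class :: "'s sgp \<Rightarrow> 's \<Rightarrow> 's set" where
  "L_class S x = {y \<in> carrier S.
     insert x ((\<lambda>s. s \<cdot>\<^bsub>S\<^esub> x) ` carrier S) = insert y ((\<lambda>s. s \<cdot>\<^bsub>S\<^esub> y) ` carrier S)}"

definition right_schutz :: "'s sgp \<Rightarrow> 's set \<Rightarrow> 's \<Rightarrow> ('s \<rightharpoonup> 's)" where
  "right_schutz S R s = (\<lambda>r. if r \<in> R \<and> r \<cdot>\<^bsub>S\<^esub> s \<in> R then Some (r \<cdot>\<^bsub>S\<^esub> s) else None)"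

definition left_schutz :: "'s sgp \<Rightarrow> 's set \<Rightarrow> 's \<Rightarrow> ('s \<rightharpoonup> 's)" where
  "left_schutz S L s = (\<lambda>l. if l \<in> L \<and> s \<cdot>\<^bsub>S\<^esub> l \<in> L then Some (s \<cdot>\<^bsub>S\<^esub> l) else None)"

text \<open>\<open>S\<close> is a finite GM semigroup with distinguished ideal \<open>I\<close>, coordinatized by the isomorphism
  \<open>\<phi>\<close> onto a Rees matrix semigroup.\<close>

definition GM ::
  "'s sgp \<Rightarrow> 's set \<Rightarrow> 'g monoid \<Rightarrow> 'a set \<Rightarrow> 'b set \<Rightarrow> ('b \<Rightarrow> 'a \<Rightarrow> 'g option) \<Rightarrow>
     ('s \<Rightarrow> ('a \<times> 'g \<times> 'b) option) \<Rightarrow> bool" where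
  "GM S I G A B C \<phi> \<longleftrightarrow>
     finite_sgp S \<and>
     zero_minimal_ideal S I \<and> (\<forall>J. zero_minimal_ideal S J \<longrightarrow> J = I) \<and>
     (\<forall>x\<in>I. \<exists>y\<in>carrier S. x \<cdot>\<^bsub>S\<^esub> y \<cdot>\<^bsub>S\<^esub> x = x) \<and>
     Group.group G \<and> carrier G \<noteq> {\<one>\<^bsub>G\<^esub>} \<and> A \<noteq> {} \<and> B \<noteq> {} \<and>
     (\<forall>b\<in>B. \<forall>a\<in>A. \<forall>c. C b a = Some c \<longrightarrow> c \<in> carrier G) \<and>
     (if \<exists>z. is_zero S z then sgp_iso (S\<lparr>carrier := I\<rparr>) (rees0 G A B C) \<phi>
      else (\<forall>b\<in>B. \<forall>a\<in>A. C b a \<noteq> None) \<and> sgp_iso (S\<lparr>carrier := I\<rparr>) (rees G A B C) \<phi>) \<and>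
     (\<forall>x\<in>I. \<not> is_zero S x \<longrightarrow>
        inj_on (right_schutz S (R_class S x)) (carrier S) \<and>
        inj_on (left_schutz S (L_class S x)) (carrier S))"

text \<open>The \<open>\<R>\<close>-classes in \<open>I\<close> without zero are the sets of elements with a fixed first coordinate
  \<open>a0\<close>; such a class is identified with \<open>G \<times> B\<close> through the other two coordinates.\<close>

definition GM_act ::
  "'s sgp \<Rightarrow> 's set \<Rightarrow> 'g monoid \<Rightarrow> 'b set \<Rightarrow> ('s \<Rightarrow> ('a \<times> 'g \<times> 'b) option) \<Rightarrow> 'a \<Rightarrow>
     's \<Rightarrow> ('g \<times> 'b \<rightharpoonup> 'g \<times> 'b)" where
  "GM_act S I G B \<phi> a0 s = (\<lambda>(g, b). if g \<in> carrier G \<and> b \<in> B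
     then (case \<phi> (inv_into I \<phi> (Some (a0, g, b)) \<cdot>\<^bsub>S\<^esub> s) of
             None \<Rightarrow> None
           | Some (a, g', b') \<Rightarrow> if a = a0 then Some (g', b') else None)
     else None)"

definition GM_ts ::
  "'s sgp \<Rightarrow> 's set \<Rightarrow> 'g monoid \<Rightarrow> 'b set \<Rightarrow> ('s \<Rightarrow> ('a \<times> 'g \<times> 'b) option) \<Rightarrow> 'a \<Rightarrow> ('g \<times> 'b) ts"
  where "GM_ts S I G B \<phi> a0 =
    \<lparr>states = carrier G \<times> B, pfuns = GM_act S I G B \<phi> a0 ` carrier S\<rparr>"

text \<open>The action on \<open>G \<times> B\<close> commutes with the left action of \<open>G\<close>, so the induced action on \<open>B\<close> can be
  read off from the representatives \<open>(\<one>, b)\<close> of the \<open>G\<close>-orbits.\<close>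

definition RLM_act ::
  "'s sgp \<Rightarrow> 's set \<Rightarrow> 'g monoid \<Rightarrow> 'b set \<Rightarrow> ('s \<Rightarrow> ('a \<times> 'g \<times> 'b) option) \<Rightarrow> 'a \<Rightarrow> 's \<Rightarrow> ('b \<rightharpoonup> 'b)"
  where "RLM_act S I G B \<phi> a0 s = (\<lambda>b. map_option snd (GM_act S I G B \<phi> a0 s (\<one>\<^bsub>G\<^esub>, b)))"

definition RLM ::
  "'s sgp \<Rightarrow> 's set \<Rightarrow> 'g monoid \<Rightarrow> 'b set \<Rightarrow> ('s \<Rightarrow> ('a \<times> 'g \<times> 'b) option) \<Rightarrow> 'a \<Rightarrow> 'b ts"
  where "RLM S I G B \<phi> a0 = \<lparr>states = B, pfuns = RLM_act S I G B \<phi> a0 ` carrier S\<rparr>"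


section \<open>Flows\<close>

definition left_translate :: "'g monoid \<Rightarrow> 'g \<Rightarrow> ('g \<times> 'b) set \<Rightarrow> ('g \<times> 'b) set" where
  "left_translate G g Y = (\<lambda>(h, b). (g \<otimes>\<^bsub>G\<^esub> h, b)) ` Y"

text \<open>The elements of \<open>Rh\<^sub>B(G)\<close> other than the top element; complete flows never take the top value.\<close>

definition invariant_cross_sections ::
  "'g monoid \<Rightarrow> 'b set \<Rightarrow> (('g \<times> 'b) set \<times> ('g \<times> 'b) set set) set" where
  "invariant_cross_sections G B = {(Y, \<P>). Y \<subseteq> carrier G \<times> B \<and> partition_on Y \<P> \<and>
     (\<forall>P\<in>\<P>. \<forall>g h b. (g, b) \<in> P \<and> (h, b) \<in> P \<longrightarrow> g = h) \<and>
     (\<forall>g\<in>carrier G. left_translate G g Y = Y \<and> left_translate G g ` \<P> = \<P>)}"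

definition same_block :: "'y set set \<Rightarrow> 'y \<Rightarrow> 'y \<Rightarrow> bool" where
  "same_block \<P> y y' \<longleftrightarrow> (\<exists>P\<in>\<P>. y \<in> P \<and> y' \<in> P)"

text \<open>A letter \<open>x\<close> acts on the states of the automaton by \<open>\<delta> x\<close> and on \<open>G \<times> B\<close> by \<open>act x\<close>.\<close>

definition automaton :: "'x set \<Rightarrow> 'q set \<Rightarrow> ('x \<Rightarrow> 'q \<rightharpoonup> 'q) \<Rightarrow> bool" where
  "automaton X Q \<delta> \<longleftrightarrow> finite Q \<and> (\<forall>x\<in>X. dom (\<delta> x) \<subseteq> Q \<and> ran (\<delta> x) \<subseteq> Q)"

definition transition_sgp :: "'x set \<Rightarrow> ('x \<Rightarrow> 'q \<rightharpoonup> 'q) \<Rightarrow> ('q \<rightharpoonup> 'q) set" where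
  "transition_sgp X \<delta> = sgp_generated (pfun_sgp UNIV) (\<delta> ` X)"

definition automaton_flow ::
  "'g monoid \<Rightarrow> 'b set \<Rightarrow> ('x \<Rightarrow> ('g \<times> 'b \<rightharpoonup> 'g \<times> 'b)) \<Rightarrow> 'x set \<Rightarrow> 'q set \<Rightarrow> ('x \<Rightarrow> 'q \<rightharpoonup> 'q) \<Rightarrow>
     ('q \<Rightarrow> ('g \<times> 'b) set \<times> ('g \<times> 'b) set set) \<Rightarrow> bool" where
  "automaton_flow G B act X Q \<delta> f \<longleftrightarrow>
     (\<forall>q\<in>Q. f q \<in> invariant_cross_sections G B) \<and>
     (\<forall>y\<in>carrier G \<times> B. \<exists>q\<in>Q. y \<in> fst (f q)) \<and>
     (\<forall>q\<in>Q. \<forall>x\<in>X. \<forall>Y \<P> Z \<Theta>.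
        f q = (Y, \<P>) \<and> (Z, \<Theta>) = (case \<delta> x q of None \<Rightarrow> ({}, {}) | Some q' \<Rightarrow> f q') \<longrightarrow>
        (\<forall>y\<in>Y. \<forall>z. act x y = Some z \<longrightarrow> z \<in> Z) \<and>
        (\<forall>y\<in>Y. \<forall>y'\<in>Y. \<forall>z z'. act x y = Some z \<and> act x y' = Some z' \<longrightarrow>
           (same_block \<P> y y' \<longleftrightarrow> same_block \<Theta> z z')))"

definition admits_flow_from ::
  "'g monoid \<Rightarrow> 'b set \<Rightarrow> ('x \<Rightarrow> ('g \<times> 'b \<rightharpoonup> 'g \<times> 'b)) \<Rightarrow> 'x set \<Rightarrow> 'q ts \<Rightarrow> bool" where
  "admits_flow_from G B act X T \<longleftrightarrow>
     (\<exists>\<delta> f. automaton X (states T) \<delta> \<and> transition_sgp X \<delta> = pfuns T \<and>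
        automaton_flow G B act X (states T) \<delta> f)"

end

theory Submission
  imports Defs "HOL-Library.Nat_Bijection"
begin

text \<open>The six conditions are linked by the implications 1-2-5-6-1, 5-4-1 and 1-3-2.

  \<open>S\<close> has complexity at most \<open>n\<close> iff its right regular representation (with an identity adjoined) is
  covered by an iterated wreath product with at most \<open>n\<close> group factors; adjacent aperiodic factors
  can be merged, so a semigroup that is not aperiodic is covered by \<open>A \<wr> H \<wr> T\<close> with \<open>A\<close> aperiodic,
  \<open>H\<close> a group and \<open>T\<close> of complexity at most \<open>n - 1\<close>.  Relating the elements of \<open>S\<close> to the projections
  of their lifts to \<open>H \<wr> T\<close> gives 2, to those in \<open>T\<close> gives 3, and a division of the derived
  transformation semigroup turns 3 into 2.

  The core is 2-5.  Choose, among the \<open>T\<close>-components of the elements related to the left identity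
  \<open>lm 1\<close> of the chosen \<open>\<R>\<close>-class, an idempotent \<open>y\<close> whose local semigroup is a group.  Cutting
  elements of \<open>H \<wr> T\<close> down to \<open>y\<close> yields a group \<open>J\<close>, and the elements related to \<open>lm 1\<close> yield a
  subgroup \<open>Z\<close> of it.  The states of the flow are the elements \<open>q\<close> of \<open>T\<close>; the elements of \<open>J\<close> arising
  from a point \<open>v\<close> of \<open>G \<times> B\<close> at \<open>q\<close> form a coset of \<open>Z\<close> or the empty set, and two points lie in the
  same block iff their cosets agree.  The cross-section property is where aperiodicity enters: if the
  cosets of \<open>(g, b)\<close> and \<open>(h, b)\<close> meet, then some element of \<open>H \<wr> T\<close> is related both to \<open>lm 1\<close> and to
  \<open>lm (h g\<^sup>-\<^sup>1)\<close>, and its idempotent power forces \<open>g = h\<close>.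

  For a flow, relating a point to the states containing it makes the relation of lying in the same
  block an injective congruence on the derived transformation semigroup (5-4), and moving each block
  to a representative lets \<open>G \<wr> Sym(B) \<wr> T\<close> simulate the action of \<open>S\<close> on blocks (5-6).  Since
  \<open>RLM(S)\<close> determines the domain of the action and the coordinate in \<open>B\<close> of the result, the block then
  determines the coordinate in \<open>G\<close>.  Finally, permutations of the \<open>\<tau>\<close>-classes or of \<open>G \<times> B\<close> add one
  group factor to \<open>T\<close> (4-1 and 6-1).\<close>

section \<open>Powers and aperiodicity\<close>

text \<open>Division forgets states, whereas a wreath product depends on the states of its right
  factor. Coverings of the regular representation bridge the gap: they compose along wreath
  products, and a lift determines the element it covers. Partiality adds a second difficulty: a
  simulating element may be defined where the simulated one is not, so the points at which an
  element of S acts have to be recorded separately, which is the role of RLM(S) in 4-1 and 5-6.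

  In 2-5 the condition on blocks is an equivalence, and its backward direction asks for
  cancellation, which a relation over \<open>H \<wr> T\<close> does not offer. This is why
  everything is moved into a group: elements over \<open>lm g\<close> act on it from the left, the
  letters of the automaton from the right, and the two actions commute. The left action yields the
  invariance of the blocks under G, cancellation on the right yields the equivalence. Elements of T
  serve as states, instead of states of T, since a whole T-component has to be remembered; the
  resulting action is total.\<close>

primrec spow :: "'a sgp \<Rightarrow> 'a \<Rightarrow> nat \<Rightarrow> 'a" where
  "spow S x 0 = x"
| "spow S x (Suc n) = spow S x n \<cdot>\<^bsub>S\<^esub> x"

lemma is_sgpD:
  assumes "is_sgp S"
  shows "carrier S \<noteq> {}" "x \<in> carrier S \<Longrightarrow> y \<in> carrier S \<Longrightarrow> x \<cdot>\<^bsub>S\<^esub> y \<in> carrier S"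
    "x \<in> carrier S \<Longrightarrow> y \<in> carrier S \<Longrightarrow> z \<in> carrier S \<Longrightarrow> (x \<cdot>\<^bsub>S\<^esub> y) \<cdot>\<^bsub>S\<^esub> z = x \<cdot>\<^bsub>S\<^esub> (y \<cdot>\<^bsub>S\<^esub> z)"
  using assms by (auto simp: is_sgp_def)

lemma spow_closed: "is_sgp S \<Longrightarrow> x \<in> carrier S \<Longrightarrow> spow S x n \<in> carrier S"
  by (induction n) (auto simp: is_sgpD)

text \<open>Exponents are shifted by one, since a semigroup has no zeroth power:
  \<open>spow S x n\<close> is a product of n + 1 factors, which accounts for the extra
  \<open>Suc\<close>.\<close>

lemma spow_add:
  "is_sgp S \<Longrightarrow> x \<in> carrier S \<Longrightarrow> spow S x m \<cdot>\<^bsub>S\<^esub> spow S x n = spow S x (Suc (m + n))"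
  by (induction n) (auto simp: is_sgpD(3)[symmetric] spow_closed)

lemma spow_carrier_update: "spow (S\<lparr>carrier := V\<rparr>) x n = spow S x n"
  by (induction n) auto

lemma is_sgp_subsgp: "is_sgp S \<Longrightarrow> subsgp V S \<Longrightarrow> is_sgp (S\<lparr>carrier := V\<rparr>)"
  unfolding is_sgp_def subsgp_def by (simp add: subset_iff)

lemma spow_shift: "spow S x (Suc i) = spow S x i \<Longrightarrow> spow S x (i + k) = spow S x i"
  by (induction k) auto

text \<open>Two equal consecutive powers of x can be cancelled in any subgroup containing x, so x is
  its identity.\<close>

lemma aperiodicI:
  assumes "\<And>x. x \<in> carrier S \<Longrightarrow> \<exists>n. spow S x (Suc n) = spow S x n"
  shows "aperiodic S"
  unfolding aperiodic_def
proof (intro allI impI)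
  fix K assume K: "sgp_subgroup K S"
  then obtain e where sub: "K \<subseteq> carrier S" and
    g: "Group.group \<lparr>carrier = K, mult = sprod S, one = e\<rparr>" by (auto simp: sgp_subgroup_def)
  interpret g: Group.group "\<lparr>carrier = K, mult = sprod S, one = e\<rparr>" by (fact g)
  have "x = e" if x: "x \<in> K" for x
  proof -
    obtain n where n: "spow S x (Suc n) = spow S x n" using assms x sub by blast
    have "spow S x k \<in> K" for k using g.m_closed x by (induction k) auto
    then show ?thesis using n g.l_cancel_one[of "spow S x n" x] x by auto
  qed
  moreover have "e \<in> K" using g.one_closed by simp
  ultimately show "\<exists>e. K = {e}" by blast
qed

text \<open>By finiteness two powers of x agree; i is then an index and p a period of x.\<close>

lemma spow_periodic:
  assumes S: "finite_sgp S" and x: "x \<in> carrier S"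
  obtains i p where "p > 0" "\<And>m k. m \<ge> i \<Longrightarrow> spow S x (m + k * p) = spow S x m"
proof -
  have s: "is_sgp S" using S by (simp add: finite_sgp_def)
  have "range (spow S x) \<subseteq> carrier S" using spow_closed[OF s x] by blast
  then have "finite (range (spow S x))" using S finite_subset unfolding finite_sgp_def by blast
  then have "\<not> inj (spow S x)" using finite_imageD infinite_UNIV_nat by blast
  then obtain i j where ij: "i < j" "spow S x i = spow S x j"
    by (metis linorder_injI)
  have st: "spow S x (i + d + (j - i)) = spow S x (i + d)" for d
  proof (induction d)
    case 0 then show ?case using ij by simp
  next
    case (Suc d) then show ?case by simp
  qed
  have "spow S x (m + k * (j - i)) = spow S x m" if "m \<ge> i" for m k
  proof (induction k)
    case (Suc k)
    have "spow S x (m + Suc k * (j - i)) = spow S x (i + (m - i + k * (j - i)) + (j - i))"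
      using that by (simp add: add.assoc add.commute[of "j - i"])
    also have "\<dots> = spow S x (i + (m - i + k * (j - i)))" by (rule st)
    finally show ?case using Suc that by simp
  qed simp
  with ij show thesis using that[of "j - i" i] by simp
qed

lemma ex_idempotent_spow:
  assumes S: "finite_sgp S" and x: "x \<in> carrier S"
  obtains n where "spow S x n \<cdot>\<^bsub>S\<^esub> spow S x n = spow S x n"
proof -
  have s: "is_sgp S" using S by (simp add: finite_sgp_def)
  obtain i p where p: "p > 0" "\<And>m k. m \<ge> i \<Longrightarrow> spow S x (m + k * p) = spow S x m"
    by (rule spow_periodic[OF S x]) blast
  \<comment> \<open>Because of the shift this is x^((i + 1) p): the exponent is a multiple of the
    period and lies beyond the index, so squaring changes nothing.\<close>
  define n where "n = Suc i * p - 1"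
  have n: "n \<ge> i" "Suc (n + n) = n + Suc i * p" using p(1) unfolding n_def
    by (cases p; simp_all)+
  have "spow S x n \<cdot>\<^bsub>S\<^esub> spow S x n = spow S x n"
    using spow_add[OF s x, of n n] n(2) p(2)[OF n(1), of "Suc i"] by metis
  then show thesis using that by blast
qed

text \<open>The periodic part of the powers of x is a group; if it is trivial, two consecutive
  powers coincide.\<close>

lemma aperiodicD:
  assumes S: "finite_sgp S" and ap: "aperiodic S" and x: "x \<in> carrier S"
  shows "\<exists>n. spow S x (Suc n) = spow S x n"
proof -
  have s: "is_sgp S" using S by (simp add: finite_sgp_def)
  obtain i p where p: "p > 0" "\<And>m k. m \<ge> i \<Longrightarrow> spow S x (m + k * p) = spow S x m"
    by (rule spow_periodic[OF S x]) blast
  define K where "K = {spow S x m | m. m \<ge> i}"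
  define e where "e = Suc i * p - 1"
  have e: "e \<ge> i" "Suc (m + e) = m + Suc i * p" for m using p(1) unfolding e_def
    by (cases p; simp)+
  have "Group.group \<lparr>carrier = K, mult = sprod S, one = spow S x e\<rparr>"
  proof (rule groupI; simp)
    show "spow S x e \<in> K" using e K_def by blast
    fix a assume "a \<in> K" then obtain m where m: "a = spow S x m" "m \<ge> i" by (auto simp: K_def)
    show "spow S x e \<cdot>\<^bsub>S\<^esub> a = a"
      using m spow_add[OF s x, of e m] e(2)[of m] p(2)[of m "Suc i"] by (metis add.commute)
    \<comment> \<open>Modulo the period (m + 1)(p - 1) is -(m + 1), so this power inverts a; the
      summand e keeps it beyond the index.\<close>
    define m' where "m' = e + Suc m * (p - 1)"
    have "Suc (m' + m) = e + Suc m * p" unfolding m'_def using p(1) by (cases p) auto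
    then have "spow S x m' \<cdot>\<^bsub>S\<^esub> a = spow S x e"
      using spow_add[OF s x, of m' m] p(2)[OF e(1), of "Suc m"] m by metis
    moreover have "spow S x m' \<in> K" using e(1) unfolding K_def m'_def by fastforce
    ultimately show "\<exists>y\<in>K. y \<cdot>\<^bsub>S\<^esub> a = spow S x e" by blast
    fix b assume "b \<in> K" then obtain n where n: "b = spow S x n" "n \<ge> i" by (auto simp: K_def)
    have "a \<cdot>\<^bsub>S\<^esub> b = spow S x (Suc (m + n))" using m n spow_add[OF s x] by simp
    moreover have "Suc (m + n) \<ge> i" using m by simp
    ultimately show "a \<cdot>\<^bsub>S\<^esub> b \<in> K" unfolding K_def by blast
    fix c assume "c \<in> K" then obtain l where l: "c = spow S x l" by (auto simp: K_def)
    show "a \<cdot>\<^bsub>S\<^esub> b \<cdot>\<^bsub>S\<^esub> c = a \<cdot>\<^bsub>S\<^esub> (b \<cdot>\<^bsub>S\<^esub> c)"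
      using m n l is_sgpD(3)[OF s] spow_closed[OF s x] by simp
  qed
  moreover have "K \<subseteq> carrier S" using spow_closed[OF s x] by (auto simp: K_def)
  ultimately have "sgp_subgroup K S" unfolding sgp_subgroup_def by blast
  then obtain c where c: "K = {c}" using ap unfolding aperiodic_def by blast
  have "spow S x i \<in> K" "spow S x (Suc i) \<in> K" unfolding K_def using le_refl le_SucI by blast+
  then have "spow S x (Suc i) = spow S x i" using c by auto
  then show ?thesis by blast
qed

text \<open>A single exponent for all elements is what lets aperiodicity pass to functions with
  values in S and to wreath products.\<close>

lemma aperiodic_uniform:
  assumes S: "finite_sgp S" and ap: "aperiodic S"
  obtains N where "\<And>x k. x \<in> carrier S \<Longrightarrow> spow S x (N + k) = spow S x N"
proof -
  obtain f where f: "\<And>x. x \<in> carrier S \<Longrightarrow> spow S x (Suc (f x)) = spow S x (f x)"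
    using aperiodicD[OF S ap] by metis
  have fin: "finite (f ` carrier S)" using S by (simp add: finite_sgp_def)
  define N where "N = Max (f ` carrier S)"
  have "spow S x (N + k) = spow S x N" if x: "x \<in> carrier S" for x k
  proof -
    have "f x \<le> N" using fin x unfolding N_def by simp
    then obtain d where "N = f x + d" using le_Suc_ex by blast
    then show ?thesis
      using spow_shift[OF f[OF x], of d] spow_shift[OF f[OF x], of "d + k"] by (simp add: add.assoc)
  qed
  then show thesis using that by blast
qed


section \<open>Division\<close>

text \<open>The divisions constructed below come from such a relation, read as: u covers s. An
  element may have many covers, but no u covers two elements, so covering is a homomorphism on the
  subsemigroup of all covering elements.\<close>

lemma divides_rel:
  assumes S: "is_sgp S"
    and U: "\<And>u v. u \<in> carrier U \<Longrightarrow> v \<in> carrier U \<Longrightarrow> u \<cdot>\<^bsub>U\<^esub> v \<in> carrier U"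
    and tot: "\<And>s. s \<in> carrier S \<Longrightarrow> \<exists>u\<in>carrier U. \<rho> u s"
    and mult: "\<And>u v s t. \<rho> u s \<Longrightarrow> \<rho> v t \<Longrightarrow> u \<in> carrier U \<Longrightarrow> v \<in> carrier U \<Longrightarrow> s \<in> carrier S \<Longrightarrow>
       t \<in> carrier S \<Longrightarrow> \<rho> (u \<cdot>\<^bsub>U\<^esub> v) (s \<cdot>\<^bsub>S\<^esub> t)"
    and func: "\<And>u s t. \<rho> u s \<Longrightarrow> \<rho> u t \<Longrightarrow> u \<in> carrier U \<Longrightarrow> s \<in> carrier S \<Longrightarrow> t \<in> carrier S \<Longrightarrow> s = t"
  shows "S \<prec>\<^sub>s U"
proof -
  define V where "V = {u \<in> carrier U. \<exists>s\<in>carrier S. \<rho> u s}"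
  define h where "h u = (SOME s. s \<in> carrier S \<and> \<rho> u s)" for u
  have hV: "h u \<in> carrier S \<and> \<rho> u (h u)" if "u \<in> V" for u
    unfolding h_def using that someI_ex[of "\<lambda>s. s \<in> carrier S \<and> \<rho> u s"] by (auto simp: V_def)
  have h: "h u = s" if "u \<in> carrier U" "s \<in> carrier S" "\<rho> u s" for u s
    using hV[of u] func that by (auto simp: V_def)
  have "subsgp V U" unfolding subsgp_def V_def using U mult tot is_sgpD(1,2)[OF S]
    by (auto; meson)
  moreover have "h ` V = carrier S"
  proof
    show "h ` V \<subseteq> carrier S" using hV by blast
    show "carrier S \<subseteq> h ` V"
    proof
      fix s assume "s \<in> carrier S"
      then obtain u where "u \<in> carrier U" "\<rho> u s" using tot by blast
      then show "s \<in> h ` V" using h[of u s] \<open>s \<in> _\<close> unfolding V_def by force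
    qed
  qed
  moreover have "h (u \<cdot>\<^bsub>U\<^esub> v) = h u \<cdot>\<^bsub>S\<^esub> h v" if "u \<in> V" "v \<in> V" for u v
    using that hV[of u] hV[of v] mult U is_sgpD(2)[OF S] by (intro h) (auto simp: V_def)
  ultimately show ?thesis unfolding divides_def by blast
qed

lemma dividesE:
  assumes "S \<prec>\<^sub>s U"
  obtains V h where "V \<subseteq> carrier U" "\<And>u v. u \<in> V \<Longrightarrow> v \<in> V \<Longrightarrow> u \<cdot>\<^bsub>U\<^esub> v \<in> V"
    "h ` V = carrier S" "\<And>u v. u \<in> V \<Longrightarrow> v \<in> V \<Longrightarrow> h (u \<cdot>\<^bsub>U\<^esub> v) = h u \<cdot>\<^bsub>S\<^esub> h v"
proof -
  obtain V h where "subsgp V U \<and> h ` V = carrier S \<and>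
     (\<forall>u\<in>V. \<forall>v\<in>V. h (u \<cdot>\<^bsub>U\<^esub> v) = h u \<cdot>\<^bsub>S\<^esub> h v)"
    using assms unfolding divides_def by (elim exE)
  then show thesis using that[of V h] by (simp add: subsgp_def)
qed

lemma divides_trans:
  assumes SU: "S \<prec>\<^sub>s U" and UW: "U \<prec>\<^sub>s W" and S: "is_sgp S"
  shows "S \<prec>\<^sub>s W"
proof -
  obtain V h where V: "V \<subseteq> carrier U" "\<And>u v. u \<in> V \<Longrightarrow> v \<in> V \<Longrightarrow> u \<cdot>\<^bsub>U\<^esub> v \<in> V"
    "h ` V = carrier S" "\<And>u v. u \<in> V \<Longrightarrow> v \<in> V \<Longrightarrow> h (u \<cdot>\<^bsub>U\<^esub> v) = h u \<cdot>\<^bsub>S\<^esub> h v"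
    using dividesE[OF SU] by metis
  obtain V' h' where V': "V' \<subseteq> carrier W" "\<And>u v. u \<in> V' \<Longrightarrow> v \<in> V' \<Longrightarrow> u \<cdot>\<^bsub>W\<^esub> v \<in> V'"
    "h' ` V' = carrier U" "\<And>u v. u \<in> V' \<Longrightarrow> v \<in> V' \<Longrightarrow> h' (u \<cdot>\<^bsub>W\<^esub> v) = h' u \<cdot>\<^bsub>U\<^esub> h' v"
    using dividesE[OF UW] by metis
  define V'' where "V'' = {w \<in> V'. h' w \<in> V}"
  have "(h \<circ> h') ` V'' = carrier S"
  proof
    show "(h \<circ> h') ` V'' \<subseteq> carrier S" using V(3) by (auto simp: V''_def)
    show "carrier S \<subseteq> (h \<circ> h') ` V''"
    proof
      fix s assume "s \<in> carrier S"
      then obtain v where v: "v \<in> V" "s = h v" using V(3) by blast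
      then obtain w where "w \<in> V'" "v = h' w" using V(1) V'(3) by blast
      with v show "s \<in> (h \<circ> h') ` V''" unfolding V''_def by force
    qed
  qed
  moreover from this have "V'' \<noteq> {}" using is_sgpD(1)[OF S] by force
  ultimately show ?thesis unfolding divides_def subsgp_def
    using V(2,4) V'(1,2,4) by (intro exI[of _ V''] exI[of _ "h \<circ> h'"]) (auto simp: V''_def)
qed

lemma complexity_mono:
  assumes "S \<prec>\<^sub>s U" "is_sgp S" "complexity U \<le> enat n"
  shows "complexity S \<le> enat n"
  using assms divides_trans unfolding complexity_le_iff kr_decomposition_def by blast


section \<open>Partial functions and wreath products\<close>

lemma pfun_sgp_simps [simp]:
  "carrier (pfun_sgp F) = F" "f \<cdot>\<^bsub>pfun_sgp F\<^esub> g = g \<circ>\<^sub>m f"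
  by (simp_all add: pfun_sgp_def)

lemma map_comp_assoc: "h \<circ>\<^sub>m (g \<circ>\<^sub>m f) = (h \<circ>\<^sub>m g) \<circ>\<^sub>m f"
  by (auto simp: map_comp_def fun_eq_iff split: option.split)

lemma is_sgp_pfun: "is_sgp (pfun_sgp F) \<longleftrightarrow> F \<noteq> {} \<and> (\<forall>f\<in>F. \<forall>g\<in>F. g \<circ>\<^sub>m f \<in> F)"
  unfolding is_sgp_def pfun_sgp_simps using map_comp_assoc by metis

lemma is_tsD:
  assumes "is_ts T"
  shows "finite (states T)" "is_sgp (sgp_of T)" "pfuns T \<noteq> {}"
    "f \<in> pfuns T \<Longrightarrow> g \<in> pfuns T \<Longrightarrow> g \<circ>\<^sub>m f \<in> pfuns T"
    "f \<in> pfuns T \<Longrightarrow> f x = Some y \<Longrightarrow> x \<in> states T"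
    "f \<in> pfuns T \<Longrightarrow> f x = Some y \<Longrightarrow> y \<in> states T"
proof -
  have "finite (states T) \<and> is_sgp (sgp_of T) \<and> pfuns T \<noteq> {} \<and>
    (\<forall>f\<in>pfuns T. \<forall>g\<in>pfuns T. g \<circ>\<^sub>m f \<in> pfuns T)"
    using assms is_sgp_pfun unfolding is_ts_def by blast
  then show "finite (states T)" "is_sgp (sgp_of T)" "pfuns T \<noteq> {}"
    "f \<in> pfuns T \<Longrightarrow> g \<in> pfuns T \<Longrightarrow> g \<circ>\<^sub>m f \<in> pfuns T" by auto
  show "f \<in> pfuns T \<Longrightarrow> f x = Some y \<Longrightarrow> x \<in> states T"
    using assms unfolding is_ts_def by blast
  show "f \<in> pfuns T \<Longrightarrow> f x = Some y \<Longrightarrow> y \<in> states T"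
    using assms unfolding is_ts_def by (auto dest: ranI)
qed

lemma finite_pfuns:
  assumes "is_ts T" shows "finite (pfuns T)"
proof -
  have "pfuns T \<subseteq> (\<Union>A\<in>Pow (states T). {m. dom m = A \<and> ran m \<subseteq> states T})"
    using assms by (auto simp: is_ts_def)
  moreover have "finite \<dots>"
    using is_tsD(1)[OF assms]
    by (intro finite_UN_I) (auto intro: finite_set_of_finite_maps rev_finite_subset)
  ultimately show ?thesis by (rule finite_subset)
qed

lemma finite_sgp_of: "is_ts T \<Longrightarrow> finite_sgp (sgp_of T)"
  using finite_pfuns is_tsD(2) by (auto simp: finite_sgp_def)

lemma wreath_act_simp:
  "wreath_act f s (p, q) = (case s q of None \<Rightarrow> None
     | Some q' \<Rightarrow> (case f q p of None \<Rightarrow> None | Some p' \<Rightarrow> Some (p', q')))"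
  by (simp add: wreath_act_def)

lemma wreath_act_Some:
  "wreath_act f s x = Some y \<longleftrightarrow> s (snd x) = Some (snd y) \<and> f (snd x) (fst x) = Some (fst y)"
  by (cases x; cases y) (auto simp: wreath_act_simp split: option.splits)

lemma wreath_act_comp:
  "wreath_act g t \<circ>\<^sub>m wreath_act f s = wreath_act (\<lambda>q. g (the (s q)) \<circ>\<^sub>m f q) (t \<circ>\<^sub>m s)"
  by (rule ext) (auto simp: wreath_act_def map_comp_def split: option.splits prod.splits)

lemma wreath_act_cong:
  "(\<And>q q'. s q = Some q' \<Longrightarrow> f q = g q) \<Longrightarrow> wreath_act f s = wreath_act g s"
  by (rule ext) (auto simp: wreath_act_def split: option.splits)

lemma wreath_pfuns:
  "w \<in> pfuns (P \<wr> Q) \<longleftrightarrow> (\<exists>f s. w = wreath_act f s \<and> s \<in> pfuns Q \<and> (\<forall>q\<in>dom s. f q \<in> pfuns P))"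
  by (auto simp: wreath_def)

lemma wreath_pfunsI:
  "s \<in> pfuns Q \<Longrightarrow> (\<And>q q'. s q = Some q' \<Longrightarrow> f q \<in> pfuns P) \<Longrightarrow> wreath_act f s \<in> pfuns (P \<wr> Q)"
  unfolding wreath_pfuns by blast

lemma states_wreath [simp]: "states (P \<wr> Q) = states P \<times> states Q"
  by (simp add: wreath_def)

lemma wreath_closed:
  assumes P: "\<And>f g. f \<in> pfuns P \<Longrightarrow> g \<in> pfuns P \<Longrightarrow> g \<circ>\<^sub>m f \<in> pfuns P"
    and Q: "\<And>f g. f \<in> pfuns Q \<Longrightarrow> g \<in> pfuns Q \<Longrightarrow> g \<circ>\<^sub>m f \<in> pfuns Q"
    and v: "v \<in> pfuns (P \<wr> Q)" and w: "w \<in> pfuns (P \<wr> Q)"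
  shows "w \<circ>\<^sub>m v \<in> pfuns (P \<wr> Q)"
proof -
  obtain f s where f: "v = wreath_act f s" "s \<in> pfuns Q" "\<And>q. q \<in> dom s \<Longrightarrow> f q \<in> pfuns P"
    using v unfolding wreath_pfuns by blast
  obtain g t where g: "w = wreath_act g t" "t \<in> pfuns Q" "\<And>q. q \<in> dom t \<Longrightarrow> g q \<in> pfuns P"
    using w unfolding wreath_pfuns by blast
  show ?thesis unfolding f(1) g(1) wreath_act_comp
    using f(2,3) g(2,3) Q by (intro wreath_pfunsI) (auto simp: map_comp_Some_iff dom_def intro!: P)
qed

lemma is_ts_wreath:
  assumes P: "is_ts P" and Q: "is_ts Q" shows "is_ts (P \<wr> Q)"
proof -
  obtain p q where "p \<in> pfuns P" "q \<in> pfuns Q" using is_tsD(3)[OF P] is_tsD(3)[OF Q] by blast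
  then have "wreath_act (\<lambda>_. p) q \<in> pfuns (P \<wr> Q)" by (intro wreath_pfunsI)
  moreover have "dom w \<subseteq> states P \<times> states Q \<and> ran w \<subseteq> states P \<times> states Q" if w: "w \<in> pfuns (P \<wr> Q)" for w
  proof -
    obtain f s where f: "w = wreath_act f s" "s \<in> pfuns Q" "\<And>q. q \<in> dom s \<Longrightarrow> f q \<in> pfuns P"
      using w unfolding wreath_pfuns by blast
    have "x \<in> states P \<times> states Q \<and> y \<in> states P \<times> states Q" if "w x = Some y" for x y
    proof -
      have h: "s (snd x) = Some (snd y)" "f (snd x) (fst x) = Some (fst y)"
        using that unfolding f wreath_act_Some by auto
      then have "f (snd x) \<in> pfuns P" using f(3) by blast
      then show ?thesis
        using h is_tsD(5,6)[OF P] is_tsD(5,6)[OF Q f(2)] by (cases x; cases y) auto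
    qed
    then show ?thesis by (auto simp: ran_def dom_def)
  qed
  ultimately show ?thesis unfolding is_ts_def is_sgp_pfun
    using wreath_closed[of P Q] is_tsD(1,4)[OF P] is_tsD(1,4)[OF Q] by auto
qed

section \<open>Powers in wreath products and aperiodicity\<close>

lemma spow_pfun_sgp: "spow (pfun_sgp F) x n = spow (pfun_sgp UNIV) x n"
  by (induction n) auto

abbreviation ppow :: "('q \<rightharpoonup> 'q) \<Rightarrow> nat \<Rightarrow> ('q \<rightharpoonup> 'q)" where
  "ppow \<equiv> spow (pfun_sgp UNIV)"

lemma ppow_add: "ppow f (Suc (m + n)) = ppow f n \<circ>\<^sub>m ppow f m"
  using spow_add[of "pfun_sgp UNIV" f m n] by (simp add: is_sgp_pfun)

lemma ppow_fixed_wreath: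
  "s q = Some q \<Longrightarrow> ppow (wreath_act f s) n (p, q) = map_option (\<lambda>p'. (p', q)) (ppow (f q) n p)"
  by (induction n) (auto simp: map_comp_def wreath_act_simp split: option.splits)

lemma ppow_wreath_proj:
  "\<exists>f'. ppow (wreath_act f s) n = wreath_act f' (ppow s n)"
proof (induction n)
  case (Suc n) then show ?case by (auto simp: wreath_act_comp)
qed auto

text \<open>If \<open>t ^ m = t ^ (m + 1)\<close>, then \<open>t\<close> fixes all points in the image of \<open>t ^ m\<close>, so that from there
  on \<open>(f, t)\<close> acts on the first coordinate by powers of a single element.\<close>

lemma wreath_power_stable:
  assumes P: "is_ts P" "aperiodic (sgp_of P)"
  shows "\<exists>N. \<forall>f s m. (\<forall>q\<in>dom s. f q \<in> pfuns P) \<longrightarrow> ppow s (Suc m) = ppow s m \<longrightarrow>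
     ppow (wreath_act f s) (Suc (Suc (m + N))) = ppow (wreath_act f s) (Suc (m + N))"
proof -
  obtain N where N: "\<And>x k. x \<in> pfuns P \<Longrightarrow> ppow x (N + k) = ppow x N"
    using aperiodic_uniform[OF finite_sgp_of[OF P(1)] P(2)] by (auto simp: spow_pfun_sgp[of "pfuns P"])
  have "ppow (wreath_act f s) (Suc (Suc (m + N))) = ppow (wreath_act f s) (Suc (m + N))"
    if f: "\<forall>q\<in>dom s. f q \<in> pfuns P" and s: "ppow s (Suc m) = ppow s m" for f s m
  proof
    fix x
    let ?w = "wreath_act f s"
    show "ppow ?w (Suc (Suc (m + N))) x = ppow ?w (Suc (m + N)) x"
    proof (cases "ppow ?w m x")
      case None
      then show ?thesis using ppow_add[of ?w m N] ppow_add[of ?w m "Suc N"] by (simp add: map_comp_def)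
    next
      case (Some y)
      obtain p q where y: "y = (p, q)" by (cases y)
      obtain f' where "ppow ?w m = wreath_act f' (ppow s m)" using ppow_wreath_proj by blast
      then have "ppow s m (snd x) = Some q" using Some y by (auto simp: wreath_act_Some)
      moreover from this have "ppow s (Suc m) (snd x) = s q" by simp
      ultimately have sq: "s q = Some q" using s by metis
      then have fq: "f q \<in> pfuns P" using f by blast
      have "ppow ?w (Suc N) y = ppow ?w N y"
        unfolding y ppow_fixed_wreath[of s q, OF sq] using N[OF fq, of "Suc 0"] by simp
      then show ?thesis
        using ppow_add[of ?w m N] ppow_add[of ?w m "Suc N"] Some by (simp add: map_comp_def del: spow.simps)
    qed
  qed
  then show ?thesis by blast
qed

lemma aperiodic_wreath:
  assumes P: "is_ts P" "aperiodic (sgp_of P)" and Q: "is_ts Q" "aperiodic (sgp_of Q)"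
  shows "aperiodic (sgp_of (P \<wr> Q))"
proof (rule aperiodicI)
  fix w assume "w \<in> carrier (sgp_of (P \<wr> Q))"
  then obtain f s where w: "w = wreath_act f s" "s \<in> pfuns Q" "\<And>q. q \<in> dom s \<Longrightarrow> f q \<in> pfuns P"
    by (auto simp: wreath_pfuns)
  obtain m where "ppow s (Suc m) = ppow s m"
    using aperiodicD[OF finite_sgp_of[OF Q(1)] Q(2)] w(2)
    by (auto simp: spow_pfun_sgp[of "pfuns Q"] simp del: spow.simps)
  then show "\<exists>n. spow (sgp_of (P \<wr> Q)) w (Suc n) = spow (sgp_of (P \<wr> Q)) w n"
    unfolding spow_pfun_sgp[of "pfuns _"] w(1) using wreath_power_stable[OF P] w(3) by metis
qed

section \<open>Covering the right regular representation\<close>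

text \<open>The right multiplication of \<open>S\<close> on \<open>S\<close> with a new identity \<^term>\<open>None\<close> adjoined.\<close>

definition ract :: "'a sgp \<Rightarrow> 'a option \<Rightarrow> 'a \<Rightarrow> 'a" where
  "ract S u s = (case u of None \<Rightarrow> s | Some a \<Rightarrow> a \<cdot>\<^bsub>S\<^esub> s)"

definition lifts :: "'a sgp \<Rightarrow> ('w \<rightharpoonup> 'a option) \<Rightarrow> 'a \<Rightarrow> ('w \<rightharpoonup> 'w) \<Rightarrow> bool" where
  "lifts S c s w \<longleftrightarrow>
     (\<forall>x u. c x = Some u \<longrightarrow> (\<exists>x'. w x = Some x' \<and> c x' = Some (Some (ract S u s))))"

text \<open>A partial map c from the states of W to S with an identity supplies the link between
  states and elements on which division is silent. The state x0 over the identity serves to read off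
  s from any of its lifts.\<close>

definition reg_cover :: "'w ts \<Rightarrow> 'a sgp \<Rightarrow> ('w \<rightharpoonup> 'a option) \<Rightarrow> 'w \<Rightarrow> bool" where
  "reg_cover W S c x0 \<longleftrightarrow> x0 \<in> states W \<and> c x0 = Some None \<and>
     (\<forall>x a. c x = Some (Some a) \<longrightarrow> a \<in> carrier S) \<and>
     (\<forall>s\<in>carrier S. \<exists>w\<in>pfuns W. lifts S c s w)"

lemma reg_coverD:
  assumes "reg_cover W S c x0"
  shows "x0 \<in> states W" "c x0 = Some None" "c x = Some (Some a) \<Longrightarrow> a \<in> carrier S"
    "s \<in> carrier S \<Longrightarrow> \<exists>w\<in>pfuns W. lifts S c s w"
  using assms by (auto simp: reg_cover_def)

lemma liftsD:
  assumes "lifts S c s w" "c x = Some u"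
  obtains x' where "w x = Some x'" "c x' = Some (Some (ract S u s))"
  using assms unfolding lifts_def by blast

lemma lifts_mult:
  assumes cov: "reg_cover W S c x0" and S: "is_sgp S"
    and "lifts S c s w" "lifts S c t v" "s \<in> carrier S" "t \<in> carrier S"
  shows "lifts S c (s \<cdot>\<^bsub>S\<^esub> t) (v \<circ>\<^sub>m w)"
  unfolding lifts_def
proof (intro allI impI)
  fix x u assume x: "c x = Some u"
  obtain x' where x': "w x = Some x'" "c x' = Some (Some (ract S u s))"
    using liftsD[OF assms(3) x] .
  obtain x'' where x'': "v x' = Some x''" "c x'' = Some (Some (ract S (Some (ract S u s)) t))"
    using liftsD[OF assms(4) x'(2)] .
  have "ract S (Some (ract S u s)) t = ract S u (s \<cdot>\<^bsub>S\<^esub> t)"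
    using x reg_coverD(3)[OF cov] assms(5,6) is_sgpD(3)[OF S] by (cases u) (auto simp: ract_def)
  then show "\<exists>x'. (v \<circ>\<^sub>m w) x = Some x' \<and> c x' = Some (Some (ract S u (s \<cdot>\<^bsub>S\<^esub> t)))"
    using x' x'' by (auto simp: map_comp_def)
qed

lemma lifts_unique:
  assumes "reg_cover W S c x0" "lifts S c s w" "lifts S c t w" shows "s = t"
proof -
  have c: "c x0 = Some None" by (rule reg_coverD(2)[OF assms(1)])
  obtain x' where "w x0 = Some x'" "c x' = Some (Some (ract S None s))" by (rule liftsD[OF assms(2) c])
  moreover obtain x'' where "w x0 = Some x''" "c x'' = Some (Some (ract S None t))"
    by (rule liftsD[OF assms(3) c])
  ultimately show ?thesis by (simp add: ract_def)
qed

lemma reg_cover_divides: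
  assumes cov: "reg_cover W S c x0" and S: "is_sgp S" and W: "is_sgp (sgp_of W)"
  shows "S \<prec>\<^sub>s sgp_of W"
  using reg_coverD(4)[OF cov] is_sgpD(2)[OF W] lifts_mult[OF cov S] lifts_unique[OF cov]
  by (intro divides_rel[OF S, where \<rho> = "\<lambda>w s. lifts S c s w"]) auto

lemma reg_cover_mono:
  assumes cov: "reg_cover W S c x0" and div: "S' \<prec>\<^sub>s S" and S: "is_sgp S"
  shows "\<exists>c'. reg_cover W S' c' x0"
proof -
  obtain V h where V: "V \<subseteq> carrier S" "\<And>u v. u \<in> V \<Longrightarrow> v \<in> V \<Longrightarrow> u \<cdot>\<^bsub>S\<^esub> v \<in> V"
    "h ` V = carrier S'" "\<And>u v. u \<in> V \<Longrightarrow> v \<in> V \<Longrightarrow> h (u \<cdot>\<^bsub>S\<^esub> v) = h u \<cdot>\<^bsub>S'\<^esub> h v"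
    using dividesE[OF div] by metis
  \<comment> \<open>States over elements outside V lose their label; those over V are relabelled
    through h.\<close>
  define c' where "c' x = (case c x of None \<Rightarrow> None | Some None \<Rightarrow> Some None
    | Some (Some a) \<Rightarrow> if a \<in> V then Some (Some (h a)) else None)" for x
  have c': "c' x = Some u \<longleftrightarrow> (c x = Some None \<and> u = None \<or>
      (\<exists>a\<in>V. c x = Some (Some a) \<and> u = Some (h a)))" for x u
    by (auto simp: c'_def split: option.splits)
  have "\<exists>w\<in>pfuns W. lifts S' c' s w" if s: "s \<in> carrier S'" for s
  proof -
    obtain a where a: "a \<in> V" "s = h a" using V(3) s by blast
    then obtain w where w: "w \<in> pfuns W" "lifts S c a w" using reg_coverD(4)[OF cov] V(1) by blast
    have "lifts S' c' s w" unfolding lifts_def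
    proof (intro allI impI)
      fix x u assume "c' x = Some u"
      then consider "c x = Some None" "u = None" | b where "b \<in> V" "c x = Some (Some b)" "u = Some (h b)"
        unfolding c' by blast
      then show "\<exists>x'. w x = Some x' \<and> c' x' = Some (Some (ract S' u s))"
      proof cases
        case 1
        obtain x' where "w x = Some x'" "c x' = Some (Some (ract S None a))"
          by (rule liftsD[OF w(2) 1(1)])
        then show ?thesis using a 1(2) by (auto simp: c' ract_def)
      next
        case 2
        obtain x' where "w x = Some x'" "c x' = Some (Some (ract S (Some b) a))"
          by (rule liftsD[OF w(2) 2(2)])
        then show ?thesis using a 2 V(2)[of b a] V(4)[of b a] by (auto simp: c' ract_def)
      qed
    qed
    with w show ?thesis by blast
  qed
  then have "reg_cover W S' c' x0" unfolding reg_cover_def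
    using reg_coverD(1,2)[OF cov] V(3) by (auto simp: c')
  then show ?thesis by blast
qed

section \<open>Covering a wreath product by a power of its left factor\<close>

abbreviation rtrans :: "'g monoid \<Rightarrow> 'g \<Rightarrow> 'g \<rightharpoonup> 'g" where
  "rtrans N h \<equiv> (\<lambda>g. if g \<in> carrier N then Some (g \<otimes>\<^bsub>N\<^esub> h) else None)"

lemma group_ts_simps [simp]:
  "states (group_ts N) = carrier N" "pfuns (group_ts N) = rtrans N ` carrier N"
  by (auto simp: group_ts_def)

lemma rtrans_comp:
  "monoid N \<Longrightarrow> h \<in> carrier N \<Longrightarrow> k \<in> carrier N \<Longrightarrow> rtrans N k \<circ>\<^sub>m rtrans N h = rtrans N (h \<otimes>\<^bsub>N\<^esub> k)"
  by (rule ext) (auto simp: map_comp_def monoid.m_assoc monoid.m_closed)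

lemma is_ts_group_ts:
  assumes N: "monoid N" "finite (carrier N)" shows "is_ts (group_ts N)"
proof -
  interpret monoid N by (fact N)
  have "rtrans N k \<circ>\<^sub>m rtrans N h \<in> rtrans N ` carrier N" if "h \<in> carrier N" "k \<in> carrier N" for h k
    unfolding rtrans_comp[OF N(1) that] using that by blast
  moreover have "dom t \<subseteq> carrier N \<and> ran t \<subseteq> carrier N" if "t \<in> rtrans N ` carrier N" for t
    using that by (auto simp: dom_def ran_def split: if_splits)
  ultimately show ?thesis
    using N(2) one_closed unfolding is_ts_def is_sgp_pfun group_ts_simps by blast
qed

text \<open>A state \<open>(n, x)\<close>, with \<open>x\<close> covering \<open>t\<close>, covers the transformation given by the
  pair \<open>(\<delta> n, t)\<close>.  So one factor suffices whose states are functions on the states of \<open>T\<close>.\<close>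

lemma reg_cover_wreath:
  assumes cov: "reg_cover W (sgp_of T) c x0" and T: "is_ts T" and N: "monoid N"
    and P: "\<And>f g. f \<in> pfuns P \<Longrightarrow> g \<in> pfuns P \<Longrightarrow> g \<circ>\<^sub>m f \<in> pfuns P"
    and e: "\<And>m. m \<in> pfuns P \<Longrightarrow> m \<circ>\<^sub>m e = m" "e \<in> M" "pfuns P \<subseteq> M"
    and d1: "\<And>q. q \<in> states T \<Longrightarrow> \<delta> \<one>\<^bsub>N\<^esub> q = e"
    and dm: "\<And>m n q. m \<in> carrier N \<Longrightarrow> n \<in> carrier N \<Longrightarrow> q \<in> states T \<Longrightarrow>
      \<delta> (m \<otimes>\<^bsub>N\<^esub> n) q = \<delta> n q \<circ>\<^sub>m \<delta> m q"
    and ds: "\<And>\<psi>. (\<And>q. q \<in> states T \<Longrightarrow> \<psi> q \<in> M) \<Longrightarrow> \<exists>n\<in>carrier N. \<forall>q\<in>states T. \<delta> n q = \<psi> q"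
  shows "\<exists>c' x0'. reg_cover (group_ts N \<wr> W) (sgp_of (P \<wr> T)) c' x0'"
proof -
  interpret monoid N by (fact N)
  define c' where "c' = (\<lambda>(n, x). if n \<notin> carrier N then None else case c x of None \<Rightarrow> None
     | Some None \<Rightarrow> if \<forall>q\<in>states T. \<delta> n q = e then Some None else None
     | Some (Some t) \<Rightarrow> if \<forall>q\<in>dom t. \<delta> n q \<in> pfuns P then Some (Some (wreath_act (\<delta> n) t)) else None)"
  have c'I: "c' (n, x) = Some (Some (wreath_act (\<delta> n) t))"
    if "n \<in> carrier N" "c x = Some (Some t)" "\<And>q q'. t q = Some q' \<Longrightarrow> \<delta> n q \<in> pfuns P" for n x t
    using that by (auto simp: c'_def)
  have c'E: "n \<in> carrier N \<and> (c x = Some None \<and> u = None \<and> (\<forall>q\<in>states T. \<delta> n q = e) \<or>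
     (\<exists>t. c x = Some (Some t) \<and> u = Some (wreath_act (\<delta> n) t) \<and> (\<forall>q\<in>dom t. \<delta> n q \<in> pfuns P)))"
    if "c' (n, x) = Some u" for n x u
    using that unfolding c'_def by (auto split: option.splits if_splits)
  have lift: "\<exists>v\<in>pfuns (group_ts N \<wr> W). lifts (sgp_of (P \<wr> T)) c' s v" if sP: "s \<in> pfuns (P \<wr> T)" for s
  proof -
    obtain f t where s: "s = wreath_act f t" "t \<in> pfuns T" "\<And>q. q \<in> dom t \<Longrightarrow> f q \<in> pfuns P"
      using sP unfolding wreath_pfuns by blast
    obtain w where w: "w \<in> pfuns W" "lifts (sgp_of T) c t w"
      using reg_coverD(4)[OF cov] s(2) by auto
    \<comment> \<open>The factor by which the first coordinate must be multiplied at x: if x covers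
      u, the point q has already moved to \<open>u q\<close>, so f is evaluated there; e fills the
      places outside the domains.\<close>
    define \<psi> where "\<psi> x q = (case c x of Some None \<Rightarrow> if q \<in> dom t then f q else e
      | Some (Some u) \<Rightarrow> (case u q of None \<Rightarrow> e | Some q' \<Rightarrow> if q' \<in> dom t then f q' else e)
      | None \<Rightarrow> e)" for x q
    have "\<psi> x q \<in> M" for x q
      using s(3) e(2,3) unfolding \<psi>_def by (auto split: option.splits)
    then have "\<forall>x. \<exists>n\<in>carrier N. \<forall>q\<in>states T. \<delta> n q = \<psi> x q" using ds by blast
    then obtain n where n: "\<And>x. n x \<in> carrier N" "\<And>x q. q \<in> states T \<Longrightarrow> \<delta> (n x) q = \<psi> x q"
      by metis
    define v where "v = wreath_act (\<lambda>x. rtrans N (n x)) w"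
    have "v \<in> pfuns (group_ts N \<wr> W)" unfolding v_def using w(1) n(1) by (intro wreath_pfunsI) auto
    moreover have "lifts (sgp_of (P \<wr> T)) c' s v" unfolding lifts_def
    proof (intro allI impI)
      fix y u assume y: "c' y = Some u"
      obtain m x where yx: "y = (m, x)" by (cases y)
      have m: "m \<in> carrier N" using c'E y yx by blast
      have \<delta>: "\<delta> (m \<otimes>\<^bsub>N\<^esub> n x) q = \<psi> x q \<circ>\<^sub>m \<delta> m q" if "q \<in> states T" for q
        using that dm m n by simp
      have vy: "v y = Some (m \<otimes>\<^bsub>N\<^esub> n x, x')" if "w x = Some x'" for x'
        using that m by (simp add: v_def yx wreath_act_simp)
      consider "c x = Some None" "u = None" "\<And>q. q \<in> states T \<Longrightarrow> \<delta> m q = e"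
        | t' where "c x = Some (Some t')" "u = Some (wreath_act (\<delta> m) t')" "\<And>q. q \<in> dom t' \<Longrightarrow> \<delta> m q \<in> pfuns P"
        using c'E y yx by blast
      then show "\<exists>x'. v y = Some x' \<and> c' x' = Some (Some (ract (sgp_of (P \<wr> T)) u s))"
      proof cases
        case 1
        obtain x' where x': "w x = Some x'" "c x' = Some (Some t)"
          using liftsD[OF w(2) 1(1)] by (auto simp: ract_def)
        have eq: "\<delta> (m \<otimes>\<^bsub>N\<^esub> n x) q = f q" if "t q = Some q'" for q q'
          using \<delta>[of q] that is_tsD(5)[OF T s(2) that] 1 s(3)[of q] e(1) by (auto simp: \<psi>_def)
        have cl: "\<delta> (m \<otimes>\<^bsub>N\<^esub> n x) q \<in> pfuns P" if "t q = Some q'" for q q'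
          using eq[OF that] s(3)[of q] that by auto
        have "wreath_act (\<delta> (m \<otimes>\<^bsub>N\<^esub> n x)) t = s" unfolding s(1) by (rule wreath_act_cong) (rule eq)
        then have "c' (m \<otimes>\<^bsub>N\<^esub> n x, x') = Some (Some s)"
          using c'I[OF _ x'(2), of "m \<otimes>\<^bsub>N\<^esub> n x"] m n(1) cl by auto
        then show ?thesis using vy[OF x'(1)] 1(2) by (simp add: ract_def)
      next
        case 2
        have t': "t' \<in> pfuns T" using reg_coverD(3)[OF cov 2(1)] by simp
        obtain x' where x': "w x = Some x'" "c x' = Some (Some (t \<circ>\<^sub>m t'))"
          using liftsD[OF w(2) 2(1)] by (auto simp: ract_def)
        have eq: "\<delta> (m \<otimes>\<^bsub>N\<^esub> n x) q = f (the (t' q)) \<circ>\<^sub>m \<delta> m q" if h: "(t \<circ>\<^sub>m t') q = Some q'" for q q'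
        proof -
          obtain p where p: "t' q = Some p" "t p = Some q'" using h by (auto simp: map_comp_Some_iff)
          have "q \<in> states T" using is_tsD(5)[OF T t' p(1)] .
          then show ?thesis using \<delta>[of q] p 2(1) by (simp add: \<psi>_def dom_def)
        qed
        have cl: "\<delta> (m \<otimes>\<^bsub>N\<^esub> n x) q \<in> pfuns P" if h: "(t \<circ>\<^sub>m t') q = Some q'" for q q'
        proof -
          obtain p where p: "t' q = Some p" "t p = Some q'" using h by (auto simp: map_comp_Some_iff)
          show ?thesis unfolding eq[OF h] using p by (intro P 2(3) s(3)) auto
        qed
        have "wreath_act (\<delta> (m \<otimes>\<^bsub>N\<^esub> n x)) (t \<circ>\<^sub>m t') = s \<circ>\<^sub>m wreath_act (\<delta> m) t'"
          unfolding s(1) wreath_act_comp by (rule wreath_act_cong) (rule eq)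
        then have "c' (m \<otimes>\<^bsub>N\<^esub> n x, x') = Some (Some (s \<circ>\<^sub>m wreath_act (\<delta> m) t'))"
          using c'I[OF _ x'(2), of "m \<otimes>\<^bsub>N\<^esub> n x"] m n(1) cl by auto
        then show ?thesis using vy[OF x'(1)] 2(2) by (simp add: ract_def)
      qed
    qed
    ultimately show ?thesis by blast
  qed
  have "c' (\<one>\<^bsub>N\<^esub>, x0) = Some None" using reg_coverD(2)[OF cov] d1 by (simp add: c'_def)
  moreover have "a \<in> pfuns (P \<wr> T)" if ya: "c' y = Some (Some a)" for y a
  proof -
    obtain m x where yx: "y = (m, x)" by (cases y)
    obtain t where t: "c x = Some (Some t)" "a = wreath_act (\<delta> m) t" "\<And>q. q \<in> dom t \<Longrightarrow> \<delta> m q \<in> pfuns P"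
      using c'E ya unfolding yx by blast
    show ?thesis using t(2,3) reg_coverD(3)[OF cov t(1)] by (auto intro: wreath_pfunsI)
  qed
  ultimately have "reg_cover (group_ts N \<wr> W) (sgp_of (P \<wr> T)) c' (\<one>\<^bsub>N\<^esub>, x0)"
    unfolding reg_cover_def using lift reg_coverD(1)[OF cov] by auto
  then show ?thesis by blast
qed

text \<open>Decompositions admit only factors on natural numbers, so monoids built from functions
  have to be transported there.\<close>

lemma monoid_nat_copy:
  assumes M: "monoid M" and fin: "finite (carrier M)"
  obtains N :: "nat monoid" and h where "monoid N" "finite (carrier N)" "bij_betw h (carrier N) (carrier M)"
    "h \<one>\<^bsub>N\<^esub> = \<one>\<^bsub>M\<^esub>"
    "\<And>x y. x \<in> carrier N \<Longrightarrow> y \<in> carrier N \<Longrightarrow> h (x \<otimes>\<^bsub>N\<^esub> y) = h x \<otimes>\<^bsub>M\<^esub> h y"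
    "Group.group M \<Longrightarrow> Group.group N"
proof -
  interpret M: monoid M by (fact M)
  obtain h where h: "bij_betw h {0..<card (carrier M)} (carrier M)"
    using ex_bij_betw_nat_finite[OF fin] by blast
  define C where "C = {0..<card (carrier M)}"
  define g where "g = inv_into C h"
  have g: "g y \<in> C" "h (g y) = y" if "y \<in> carrier M" for y
    using that h bij_betw_inv_into_right[OF h that] bij_betw_apply[OF bij_betw_inv_into[OF h] that]
    by (auto simp: C_def g_def)
  have hC: "h x \<in> carrier M" "g (h x) = x" if "x \<in> C" for x
    using that h bij_betw_apply bij_betw_inv_into_left by (fastforce simp: C_def g_def)+
  define N where "N = \<lparr>carrier = C, mult = (\<lambda>x y. g (h x \<otimes>\<^bsub>M\<^esub> h y)), one = g \<one>\<^bsub>M\<^esub>\<rparr>"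
  have N: "monoid N" unfolding N_def using g hC by (intro monoidI) (auto simp: M.m_assoc)
  moreover have "Group.group N" if "Group.group M"
  proof -
    interpret G: Group.group M by (fact that)
    show ?thesis
    proof (rule group.intro[OF N], unfold_locales)
      show "carrier N \<subseteq> Units N"
      proof
        fix x assume x: "x \<in> carrier N"
        then have x: "x \<in> C" by (simp add: N_def)
        then have i: "inv\<^bsub>M\<^esub> (h x) \<in> carrier M" using hC by simp
        show "x \<in> Units N" unfolding Units_def
          using x g[OF i] hC[OF x] by (auto simp: N_def intro!: bexI[of _ "g (inv\<^bsub>M\<^esub> (h x))"])
      qed
    qed
  qed
  ultimately show thesis using that[of N h] h g hC by (auto simp: N_def C_def)
qed

text \<open>The power of M with pointwise product, coded by numbers with decoding
  \<open>\<delta>\<close>. Inverses and a common exponent of aperiodicity are inherited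
  coordinatewise, which serves the group and the aperiodic case alike.\<close>

lemma function_monoid_copy:
  assumes Q: "finite Q" and M: "finite M" "\<And>f g. f \<in> M \<Longrightarrow> g \<in> M \<Longrightarrow> g \<circ>\<^sub>m f \<in> M"
    and e: "e \<in> M" "\<And>m. m \<in> M \<Longrightarrow> m \<circ>\<^sub>m e = m" "\<And>m. m \<in> M \<Longrightarrow> e \<circ>\<^sub>m m = m"
  obtains N :: "nat monoid" and \<delta> where "monoid N" "finite (carrier N)"
    "\<And>q. q \<in> Q \<Longrightarrow> \<delta> \<one>\<^bsub>N\<^esub> q = e"
    "\<And>m n q. m \<in> carrier N \<Longrightarrow> n \<in> carrier N \<Longrightarrow> q \<in> Q \<Longrightarrow> \<delta> (m \<otimes>\<^bsub>N\<^esub> n) q = \<delta> n q \<circ>\<^sub>m \<delta> m q"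
    "\<And>\<psi>. (\<And>q. q \<in> Q \<Longrightarrow> \<psi> q \<in> M) \<Longrightarrow> \<exists>n\<in>carrier N. \<forall>q\<in>Q. \<delta> n q = \<psi> q"
    "(\<And>m. m \<in> M \<Longrightarrow> \<exists>m'\<in>M. m' \<circ>\<^sub>m m = e \<and> m \<circ>\<^sub>m m' = e) \<Longrightarrow> Group.group N"
    "\<And>k. (\<And>m. m \<in> M \<Longrightarrow> ppow m (Suc k) = ppow m k) \<Longrightarrow> aperiodic (sgp_of (group_ts N))"
proof -
  define F where "F = \<lparr>carrier = Q \<rightarrow>\<^sub>E M, mult = (\<lambda>\<phi> \<psi>. \<lambda>q\<in>Q. \<psi> q \<circ>\<^sub>m \<phi> q), one = (\<lambda>q\<in>Q. e)\<rparr>"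
  have F: "monoid F" unfolding F_def
  proof (rule monoidI, unfold partial_object.simps monoid.simps)
    show "(\<lambda>q\<in>Q. e) \<in> Q \<rightarrow>\<^sub>E M" using e(1) by auto
    fix \<phi> \<psi> \<chi> assume h: "\<phi> \<in> Q \<rightarrow>\<^sub>E M"
    show "(\<lambda>q\<in>Q. \<phi> q \<circ>\<^sub>m (\<lambda>q\<in>Q. e) q) = \<phi>" "(\<lambda>q\<in>Q. (\<lambda>q\<in>Q. e) q \<circ>\<^sub>m \<phi> q) = \<phi>"
      using h e(2,3) by (auto simp: restrict_def PiE_def extensional_def Pi_def fun_eq_iff)
    assume h: "\<psi> \<in> Q \<rightarrow>\<^sub>E M"
    show "(\<lambda>q\<in>Q. \<psi> q \<circ>\<^sub>m \<phi> q) \<in> Q \<rightarrow>\<^sub>E M"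
      using h \<open>\<phi> \<in> _\<close> by (auto intro!: M(2))
    show "(\<lambda>q\<in>Q. \<chi> q \<circ>\<^sub>m (\<lambda>q\<in>Q. \<psi> q \<circ>\<^sub>m \<phi> q) q) = (\<lambda>q\<in>Q. (\<lambda>q\<in>Q. \<chi> q \<circ>\<^sub>m \<psi> q) q \<circ>\<^sub>m \<phi> q)"
      by (auto simp: map_comp_assoc restrict_def)
  qed
  have "finite (carrier F)" using Q M(1) by (auto simp: F_def intro: finite_PiE)
  then obtain N :: "nat monoid" and h where N: "monoid N" "finite (carrier N)"
    "bij_betw h (carrier N) (carrier F)" "h \<one>\<^bsub>N\<^esub> = \<one>\<^bsub>F\<^esub>"
    "\<And>x y. x \<in> carrier N \<Longrightarrow> y \<in> carrier N \<Longrightarrow> h (x \<otimes>\<^bsub>N\<^esub> y) = h x \<otimes>\<^bsub>F\<^esub> h y"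
    "Group.group F \<Longrightarrow> Group.group N"
    using monoid_nat_copy[OF F] by metis
  interpret N: monoid N by (fact N(1))
  have hM: "h n q \<in> M" if "n \<in> carrier N" "q \<in> Q" for n q
    using bij_betw_apply[OF N(3) that(1)] that(2) by (auto simp: F_def)
  show thesis
  proof (rule that[of N h])
    show "monoid N" "finite (carrier N)" by fact+
    show "h \<one>\<^bsub>N\<^esub> q = e" if "q \<in> Q" for q using N(4) that by (simp add: F_def)
    show mult: "h (m \<otimes>\<^bsub>N\<^esub> n) q = h n q \<circ>\<^sub>m h m q" if "m \<in> carrier N" "n \<in> carrier N" "q \<in> Q" for m n q
      using N(5)[OF that(1,2)] that(3) by (simp add: F_def)
    show "\<exists>n\<in>carrier N. \<forall>q\<in>Q. h n q = \<psi> q" if "\<And>q. q \<in> Q \<Longrightarrow> \<psi> q \<in> M" for \<psi>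
    proof -
      have "restrict \<psi> Q \<in> carrier F" using that by (auto simp: F_def)
      then obtain n where "n \<in> carrier N" "h n = restrict \<psi> Q"
        using N(3) unfolding bij_betw_def by (metis imageE)
      then show ?thesis by (intro bexI[of _ n]) auto
    qed
    show "Group.group N" if inv: "\<And>m. m \<in> M \<Longrightarrow> \<exists>m'\<in>M. m' \<circ>\<^sub>m m = e \<and> m \<circ>\<^sub>m m' = e"
    proof (rule N(6), rule group.intro[OF F], unfold_locales, rule subsetI)
      fix \<phi> assume \<phi>: "\<phi> \<in> carrier F"
      obtain i where i: "\<And>m. m \<in> M \<Longrightarrow> i m \<in> M \<and> i m \<circ>\<^sub>m m = e \<and> m \<circ>\<^sub>m i m = e"
        using inv by metis
      define \<psi> where "\<psi> = (\<lambda>q\<in>Q. i (\<phi> q))"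
      have m: "\<phi> q \<in> M" if "q \<in> Q" for q using \<phi> that by (auto simp: F_def)
      have "\<psi> \<in> carrier F" using m i by (auto simp: F_def \<psi>_def)
      moreover have "\<psi> \<otimes>\<^bsub>F\<^esub> \<phi> = \<one>\<^bsub>F\<^esub>" "\<phi> \<otimes>\<^bsub>F\<^esub> \<psi> = \<one>\<^bsub>F\<^esub>"
        using m i by (auto simp: F_def \<psi>_def restrict_def fun_eq_iff)
      ultimately show "\<phi> \<in> Units F" using \<phi> unfolding Units_def by blast
    qed
    show "aperiodic (sgp_of (group_ts N))" if k: "\<And>m. m \<in> M \<Longrightarrow> ppow m (Suc k) = ppow m k" for k
    proof (rule aperiodicI)
      fix x assume "x \<in> carrier (sgp_of (group_ts N))"
      then obtain n where n: "x = rtrans N n" "n \<in> carrier N" by auto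
      have pow: "ppow x j = rtrans N (n [^]\<^bsub>N\<^esub> Suc j)" for j
      proof (induction j)
        case (Suc j)
        have "n [^]\<^bsub>N\<^esub> Suc j \<otimes>\<^bsub>N\<^esub> n = n [^]\<^bsub>N\<^esub> Suc (Suc j)" by (rule nat_pow_Suc[symmetric])
        moreover have "ppow x (Suc j) = rtrans N n \<circ>\<^sub>m rtrans N (n [^]\<^bsub>N\<^esub> Suc j)" using Suc n by simp
        moreover have "\<dots> = rtrans N (n [^]\<^bsub>N\<^esub> Suc j \<otimes>\<^bsub>N\<^esub> n)" using n by (intro rtrans_comp[OF N(1)]) auto
        ultimately show ?case by metis
      next
        case 0
        have "n [^]\<^bsub>N\<^esub> Suc 0 = n" using n by simp
        then show ?case unfolding n(1) by (metis spow.simps(1))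
      qed
      have hp: "h (n [^]\<^bsub>N\<^esub> Suc j) q = ppow (h n q) j" if "q \<in> Q" for j q
      proof (induction j)
        case (Suc j)
        have "n [^]\<^bsub>N\<^esub> Suc j \<otimes>\<^bsub>N\<^esub> n = n [^]\<^bsub>N\<^esub> Suc (Suc j)" by (rule nat_pow_Suc[symmetric])
        then show ?case using Suc mult[OF _ n(2) that, of "n [^]\<^bsub>N\<^esub> Suc j"] n that by simp
      qed (use n in simp)
      have eq: "h (n [^]\<^bsub>N\<^esub> Suc (Suc k)) q = h (n [^]\<^bsub>N\<^esub> Suc k) q" if "q \<in> Q" for q
        unfolding hp[OF that] by (rule k) (rule hM[OF n(2) that])
      have mem: "h (n [^]\<^bsub>N\<^esub> j) \<in> Q \<rightarrow>\<^sub>E M" for j :: nat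
        using bij_betw_apply[OF N(3), of "n [^]\<^bsub>N\<^esub> j"] N.nat_pow_closed[OF n(2)]
        by (simp add: F_def)
      have "h (n [^]\<^bsub>N\<^esub> Suc (Suc k)) = h (n [^]\<^bsub>N\<^esub> Suc k)" by (rule PiE_ext[OF mem mem eq])
      then have "n [^]\<^bsub>N\<^esub> Suc (Suc k) = n [^]\<^bsub>N\<^esub> Suc k"
        using N(3) n(2) unfolding bij_betw_def inj_on_def by (meson N.nat_pow_closed)
      then have "ppow x (Suc k) = ppow x k" unfolding pow by metis
      then show "\<exists>n. spow (sgp_of (group_ts N)) x (Suc n) = spow (sgp_of (group_ts N)) x n"
        unfolding spow_pfun_sgp[of "pfuns _"] by blast
    qed
  qed
qed

lemma reg_cover_group:
  assumes cov: "reg_cover W (sgp_of T) c x0" and T: "is_ts T" and P: "is_ts P"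
    and e: "e \<in> pfuns P" "\<And>m. m \<in> pfuns P \<Longrightarrow> m \<circ>\<^sub>m e = m" "\<And>m. m \<in> pfuns P \<Longrightarrow> e \<circ>\<^sub>m m = m"
    and inv: "\<And>m. m \<in> pfuns P \<Longrightarrow> \<exists>m'\<in>pfuns P. m' \<circ>\<^sub>m m = e \<and> m \<circ>\<^sub>m m' = e"
  shows "\<exists>(H :: nat monoid) c' x0'. Group.group H \<and> finite (carrier H) \<and>
    reg_cover (group_ts H \<wr> W) (sgp_of (P \<wr> T)) c' x0'"
proof -
  obtain N :: "nat monoid" and \<delta> where N: "monoid N" "finite (carrier N)"
    "\<And>q. q \<in> states T \<Longrightarrow> \<delta> \<one>\<^bsub>N\<^esub> q = e"
    "\<And>m n q. m \<in> carrier N \<Longrightarrow> n \<in> carrier N \<Longrightarrow> q \<in> states T \<Longrightarrow> \<delta> (m \<otimes>\<^bsub>N\<^esub> n) q = \<delta> n q \<circ>\<^sub>m \<delta> m q"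
    "\<And>\<psi>. (\<And>q. q \<in> states T \<Longrightarrow> \<psi> q \<in> pfuns P) \<Longrightarrow> \<exists>n\<in>carrier N. \<forall>q\<in>states T. \<delta> n q = \<psi> q"
    "(\<And>m. m \<in> pfuns P \<Longrightarrow> \<exists>m'\<in>pfuns P. m' \<circ>\<^sub>m m = e \<and> m \<circ>\<^sub>m m' = e) \<Longrightarrow> Group.group N"
    by (rule function_monoid_copy[OF is_tsD(1)[OF T] finite_pfuns[OF P] is_tsD(4)[OF P] e]) blast+
  have "\<exists>c' x0'. reg_cover (group_ts N \<wr> W) (sgp_of (P \<wr> T)) c' x0'"
    by (rule reg_cover_wreath[OF cov T N(1) is_tsD(4)[OF P] e(2) e(1) _ N(3,4,5)]) auto
  then show ?thesis using N(2) N(6)[OF inv] by blast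
qed

lemma reg_cover_aperiodic:
  assumes cov: "reg_cover W (sgp_of T) c x0" and T: "is_ts T" and P: "is_ts P" "aperiodic (sgp_of P)"
  shows "\<exists>(A :: nat ts) c' x0'. is_ts A \<and> aperiodic (sgp_of A) \<and>
    reg_cover (A \<wr> W) (sgp_of (P \<wr> T)) c' x0'"
proof -
  obtain k where k: "\<And>x i. x \<in> pfuns P \<Longrightarrow> ppow x (k + i) = ppow x k"
    using aperiodic_uniform[OF finite_sgp_of[OF P(1)] P(2)] by (auto simp: spow_pfun_sgp[of "pfuns P"])
  \<comment> \<open>P may lack an identity, so \<open>Some\<close>, the identity on the whole type,
    is adjoined; powers still become stable at k.\<close>
  let ?M = "insert Some (pfuns P)"
  have one: "m \<circ>\<^sub>m Some = m" "Some \<circ>\<^sub>m m = m" for m :: "'c \<rightharpoonup> 'c"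
    by (auto simp: map_comp_def fun_eq_iff split: option.split)
  have cl: "g \<circ>\<^sub>m f \<in> ?M" if "f \<in> ?M" "g \<in> ?M" for f g
    using that is_tsD(4)[OF P(1)] one by auto
  have fin: "finite ?M" using finite_pfuns[OF P(1)] by simp
  have "ppow Some j = Some" for j by (induction j) (auto simp: one)
  then have kM: "ppow m (Suc k) = ppow m k" if "m \<in> ?M" for m
    using that k[of m "Suc 0"] one by auto
  obtain N :: "nat monoid" and \<delta> where N: "monoid N" "finite (carrier N)"
    "\<And>q. q \<in> states T \<Longrightarrow> \<delta> \<one>\<^bsub>N\<^esub> q = Some"
    "\<And>m n q. m \<in> carrier N \<Longrightarrow> n \<in> carrier N \<Longrightarrow> q \<in> states T \<Longrightarrow> \<delta> (m \<otimes>\<^bsub>N\<^esub> n) q = \<delta> n q \<circ>\<^sub>m \<delta> m q"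
    "\<And>\<psi>. (\<And>q. q \<in> states T \<Longrightarrow> \<psi> q \<in> ?M) \<Longrightarrow> \<exists>n\<in>carrier N. \<forall>q\<in>states T. \<delta> n q = \<psi> q"
    "\<And>k. (\<And>m. m \<in> ?M \<Longrightarrow> ppow m (Suc k) = ppow m k) \<Longrightarrow> aperiodic (sgp_of (group_ts N))"
    by (rule function_monoid_copy[OF is_tsD(1)[OF T] fin cl _ one]) (assumption | blast)+
  have "\<exists>c' x0'. reg_cover (group_ts N \<wr> W) (sgp_of (P \<wr> T)) c' x0'"
    by (rule reg_cover_wreath[where M = ?M, OF cov T N(1) is_tsD(4)[OF P(1)] one(1) _ _ N(3,4,5)]) blast+
  then show ?thesis using is_ts_group_ts[OF N(1,2)] N(6)[OF kM] by blast
qed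

section \<open>Simulation and relabelling of transformation semigroups\<close>

text \<open>A covering of W by V for partial actions: the surjection d is partial, and the lift of w
  has to follow w where w is defined and is free elsewhere.\<close>

definition simulates :: "'v ts \<Rightarrow> 'w ts \<Rightarrow> ('v \<rightharpoonup> 'w) \<Rightarrow> (('w \<rightharpoonup> 'w) \<Rightarrow> ('v \<rightharpoonup> 'v)) \<Rightarrow> bool" where
  "simulates V W d l \<longleftrightarrow> (\<forall>x\<in>states W. \<exists>z\<in>states V. d z = Some x) \<and>
     (\<forall>w\<in>pfuns W. l w \<in> pfuns V \<and> (\<forall>z x y. d z = Some x \<longrightarrow> w x = Some y \<longrightarrow>
        (\<exists>z'. l w z = Some z' \<and> d z' = Some y)))"

definition sim :: "'v ts \<Rightarrow> 'w ts \<Rightarrow> bool" where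
  "sim V W \<longleftrightarrow> (\<exists>d l. simulates V W d l)"

lemma simulatesD:
  assumes "simulates V W d l"
  shows "x \<in> states W \<Longrightarrow> \<exists>z\<in>states V. d z = Some x"
    "w \<in> pfuns W \<Longrightarrow> l w \<in> pfuns V"
    "w \<in> pfuns W \<Longrightarrow> d z = Some x \<Longrightarrow> w x = Some y \<Longrightarrow> \<exists>z'. l w z = Some z' \<and> d z' = Some y"
  using assms unfolding simulates_def by blast+

lemma simI:
  assumes "\<And>x. x \<in> states W \<Longrightarrow> \<exists>z\<in>states V. d z = Some x"
    and "\<And>w. w \<in> pfuns W \<Longrightarrow> \<exists>v\<in>pfuns V. \<forall>z x y. d z = Some x \<longrightarrow> w x = Some y \<longrightarrow>
        (\<exists>z'. v z = Some z' \<and> d z' = Some y)"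
  shows "sim V W"
proof -
  have "\<forall>w\<in>pfuns W. \<exists>v. v \<in> pfuns V \<and> (\<forall>z x y. d z = Some x \<longrightarrow> w x = Some y \<longrightarrow>
        (\<exists>z'. v z = Some z' \<and> d z' = Some y))" using assms(2) by blast
  from bchoice[OF this] show ?thesis unfolding sim_def simulates_def using assms(1) by blast
qed

lemma sim_trans:
  assumes "sim U V" "sim V W" shows "sim U W"
proof -
  obtain d l where "simulates U V d l" using assms(1) unfolding sim_def by blast
  note d = simulatesD[OF this]
  obtain e k where "simulates V W e k" using assms(2) unfolding sim_def by blast
  note e = simulatesD[OF this]
  show ?thesis
  proof (rule simI[where d = "e \<circ>\<^sub>m d"])
    show "\<exists>z\<in>states U. (e \<circ>\<^sub>m d) z = Some x" if x: "x \<in> states W" for x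
    proof -
      obtain y where "y \<in> states V" "e y = Some x" using e(1)[OF x] by blast
      moreover from this obtain z where "z \<in> states U" "d z = Some y" using d(1) by blast
      ultimately show ?thesis by (intro bexI[of _ z]) auto
    qed
    show "\<exists>v\<in>pfuns U. \<forall>z x y. (e \<circ>\<^sub>m d) z = Some x \<longrightarrow> w x = Some y \<longrightarrow>
        (\<exists>z'. v z = Some z' \<and> (e \<circ>\<^sub>m d) z' = Some y)" if w: "w \<in> pfuns W" for w
    proof (intro bexI[of _ "l (k w)"] allI impI)
      fix z x y assume "(e \<circ>\<^sub>m d) z = Some x" and y: "w x = Some y"
      then obtain m where m: "d z = Some m" "e m = Some x" by (auto simp: map_comp_Some_iff)
      obtain m' where m': "k w m = Some m'" "e m' = Some y" using e(3)[OF w m(2) y] by blast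
      obtain z' where "l (k w) z = Some z'" "d z' = Some m'" using d(3)[OF e(2)[OF w] m(1) m'(1)] by blast
      then show "\<exists>z'. l (k w) z = Some z' \<and> (e \<circ>\<^sub>m d) z' = Some y" using m' by auto
    qed (use d(2) e(2) w in blast)
  qed
qed

lemma reg_cover_sim:
  assumes cov: "reg_cover W S c x0" and "sim V W"
  shows "\<exists>c' x0'. reg_cover V S c' x0'"
proof -
  obtain d l where "simulates V W d l" using assms(2) unfolding sim_def by blast
  note d = simulatesD[OF this]
  obtain z0 where z0: "z0 \<in> states V" "d z0 = Some x0" using d(1) reg_coverD(1)[OF cov] by blast
  have "\<exists>v\<in>pfuns V. lifts S (c \<circ>\<^sub>m d) s v" if s: "s \<in> carrier S" for s
  proof -
    obtain w where w: "w \<in> pfuns W" "lifts S c s w" using reg_coverD(4)[OF cov s] by blast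
    have "lifts S (c \<circ>\<^sub>m d) s (l w)" unfolding lifts_def
    proof (intro allI impI)
      fix z u assume "(c \<circ>\<^sub>m d) z = Some u"
      then obtain x where x: "d z = Some x" "c x = Some u" by (auto simp: map_comp_Some_iff)
      obtain x' where x': "w x = Some x'" "c x' = Some (Some (ract S u s))" by (rule liftsD[OF w(2) x(2)])
      obtain z' where "l w z = Some z'" "d z' = Some x'" using d(3)[OF w(1) x(1) x'(1)] by blast
      then show "\<exists>x'. l w z = Some x' \<and> (c \<circ>\<^sub>m d) x' = Some (Some (ract S u s))" using x' by auto
    qed
    then show ?thesis using d(2)[OF w(1)] by blast
  qed
  moreover have "a \<in> carrier S" if "(c \<circ>\<^sub>m d) x = Some (Some a)" for x a
    using that reg_coverD(3)[OF cov] by (auto simp: map_comp_Some_iff)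
  ultimately have "reg_cover V S (c \<circ>\<^sub>m d) z0"
    unfolding reg_cover_def using z0 reg_coverD(2)[OF cov] by auto
  then show ?thesis by blast
qed

lemma sim_wreath:
  fixes P :: "'p ts"
  assumes "sim V W" and p0: "p0 \<in> pfuns P" shows "sim (P \<wr> V) (P \<wr> W)"
proof -
  obtain d l where "simulates V W d l" using assms(1) unfolding sim_def by blast
  note d = simulatesD[OF this]
  define d' where "d' = (\<lambda>(p :: 'p, z). map_option (Pair p) (d z))"
  show ?thesis
  proof (rule simI[where d = d'])
    show "\<exists>z\<in>states (P \<wr> V). d' z = Some x" if x: "x \<in> states (P \<wr> W)" for x
    proof -
      obtain z where "z \<in> states V" "d z = Some (snd x)" using d(1)[of "snd x"] x by auto
      then show ?thesis using x by (intro bexI[of _ "(fst x, z)"]) (auto simp: d'_def)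
    qed
    show "\<exists>v\<in>pfuns (P \<wr> V). \<forall>z x y. d' z = Some x \<longrightarrow> w x = Some y \<longrightarrow>
        (\<exists>z'. v z = Some z' \<and> d' z' = Some y)" if wP: "w \<in> pfuns (P \<wr> W)" for w
    proof -
      obtain f s where w: "w = wreath_act f s" "s \<in> pfuns W" "\<And>q. q \<in> dom s \<Longrightarrow> f q \<in> pfuns P"
        using wP unfolding wreath_pfuns by blast
      \<comment> \<open>The lift of s may be defined at states over points outside
        \<open>dom s\<close>; p0 is the value there.\<close>
      define g where "g z = (case d z of None \<Rightarrow> p0 | Some x \<Rightarrow> if x \<in> dom s then f x else p0)" for z
      have g: "g z \<in> pfuns P" for z using p0 w(3) by (auto simp: g_def split: option.split)
      show ?thesis
      proof (intro bexI[of _ "wreath_act g (l s)"] allI impI)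
        show "wreath_act g (l s) \<in> pfuns (P \<wr> V)" using d(2)[OF w(2)] g by (intro wreath_pfunsI)
        fix z x y assume z: "d' z = Some x" and y: "w x = Some y"
        obtain p m where [simp]: "z = (p, m)" by (cases z)
        obtain m' where m': "d m = Some m'" "x = (p, m')" using z by (auto simp: d'_def)
        have s: "s m' = Some (snd y)" "f m' p = Some (fst y)" using y m' w(1) by (auto simp: wreath_act_Some)
        obtain z' where "l s m = Some z'" "d z' = Some (snd y)" using d(3)[OF w(2) m'(1) s(1)] by blast
        then show "\<exists>z'. wreath_act g (l s) z = Some z' \<and> d' z' = Some y"
          using s m' by (intro exI[of _ "(fst y, z')"]) (auto simp: wreath_act_Some d'_def g_def)
      qed
    qed
  qed
qed

section \<open>Renaming the states of a transformation semigroup\<close>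

definition relabel :: "('p \<Rightarrow> 'q) \<Rightarrow> ('q \<rightharpoonup> 'p) \<Rightarrow> ('p \<rightharpoonup> 'p) \<Rightarrow> ('q \<rightharpoonup> 'q)" where
  "relabel e d w = (\<lambda>r. case d r of None \<Rightarrow> None | Some x \<Rightarrow> map_option e (w x))"

definition relabel_ts :: "('p \<Rightarrow> 'q) \<Rightarrow> ('q \<rightharpoonup> 'p) \<Rightarrow> 'p ts \<Rightarrow> 'q ts" where
  "relabel_ts e d T = \<lparr>states = e ` states T, pfuns = relabel e d ` pfuns T\<rparr>"

lemma relabel_ts_simps [simp]:
  "states (relabel_ts e d T) = e ` states T" "pfuns (relabel_ts e d T) = relabel e d ` pfuns T"
  by (simp_all add: relabel_ts_def)

text \<open>e is injective and d its inverse, defined exactly on the image of e; the image may be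
  proper, as for non-empty lists.\<close>

definition retr :: "('p \<Rightarrow> 'q) \<Rightarrow> ('q \<rightharpoonup> 'p) \<Rightarrow> bool" where
  "retr e d \<longleftrightarrow> (\<forall>x. d (e x) = Some x) \<and> (\<forall>r x. d r = Some x \<longrightarrow> r = e x)"

lemma relabel_Some:
  "relabel e d w r = Some r' \<longleftrightarrow> (\<exists>x y. d r = Some x \<and> w x = Some y \<and> r' = e y)"
  by (auto simp: relabel_def split: option.splits)

lemma relabel_comp: "retr e d \<Longrightarrow> relabel e d v \<circ>\<^sub>m relabel e d w = relabel e d (v \<circ>\<^sub>m w)"
  by (rule ext) (auto simp: relabel_def retr_def map_comp_def split: option.split)

lemma relabel_inj: "retr e d \<Longrightarrow> relabel e d v = relabel e d w \<Longrightarrow> v = w"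
proof
  fix x assume r: "retr e d" and "relabel e d v = relabel e d w"
  then have "relabel e d v (e x) = relabel e d w (e x)" by simp
  then have "map_option e (v x) = map_option e (w x)" using r by (simp add: relabel_def retr_def)
  moreover have "inj e" using r unfolding retr_def by (metis injI option.inject)
  ultimately show "v x = w x" using inj_map_eq_map option.inj_map by (metis injD)
qed

lemma is_ts_relabel:
  assumes r: "retr e d" and T: "is_ts T" shows "is_ts (relabel_ts e d T)"
proof -
  have "dom (relabel e d w) \<subseteq> e ` states T \<and> ran (relabel e d w) \<subseteq> e ` states T" if w: "w \<in> pfuns T" for w
  proof -
    have "r \<in> e ` states T \<and> r' \<in> e ` states T" if "relabel e d w r = Some r'" for r r'
      using that is_tsD(5,6)[OF T w] \<open>retr e d\<close> unfolding relabel_Some retr_def by blast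
    then show ?thesis by (auto simp: dom_def ran_def)
  qed
  then show ?thesis unfolding is_ts_def is_sgp_pfun
    using is_tsD(1,3,4)[OF T] relabel_comp[OF r] by auto
qed

lemma relabel_divides:
  assumes r: "retr e d" and T: "is_ts T"
  shows "sgp_of (relabel_ts e d T) \<prec>\<^sub>s sgp_of T" "sgp_of T \<prec>\<^sub>s sgp_of (relabel_ts e d T)"
  using is_tsD(4)[OF T] is_tsD(2)[OF is_ts_relabel[OF r T]] is_tsD(2)[OF T] relabel_comp[OF r] relabel_inj[OF r]
  by (auto intro!: divides_rel[where \<rho> = "\<lambda>u s. s = relabel e d u"] divides_rel[where \<rho> = "\<lambda>u s. u = relabel e d s"])

lemma sim_relabel:
  assumes r: "retr e d"
  shows "sim (relabel_ts e d T) T" "sim T (relabel_ts e d T)"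
proof -
  show "sim (relabel_ts e d T) T"
  proof (rule simI[where d = d])
    show "\<exists>z\<in>states (relabel_ts e d T). d z = Some x" if "x \<in> states T" for x
      using that r by (auto simp: retr_def)
    show "\<exists>v\<in>pfuns (relabel_ts e d T). \<forall>z x y. d z = Some x \<longrightarrow> w x = Some y \<longrightarrow>
        (\<exists>z'. v z = Some z' \<and> d z' = Some y)" if "w \<in> pfuns T" for w
      using that r by (intro bexI[of _ "relabel e d w"]) (auto simp: relabel_Some retr_def)
  qed
  show "sim T (relabel_ts e d T)"
  proof (rule simI[where d = "\<lambda>x. Some (e x)"])
    show "\<exists>v\<in>pfuns T. \<forall>z x y. Some (e z) = Some x \<longrightarrow> w x = Some y \<longrightarrow>
        (\<exists>z'. v z = Some z' \<and> Some (e z') = Some y)" if w: "w \<in> pfuns (relabel_ts e d T)" for w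
    proof -
      obtain v where v: "v \<in> pfuns T" "w = relabel e d v" using w by auto
      then show ?thesis using r by (intro bexI[of _ v]) (auto simp: relabel_Some retr_def)
    qed
  qed auto
qed

lemma sim_assoc: "sim ((P \<wr> Q) \<wr> W) (P \<wr> (Q \<wr> W))"
proof (rule simI[where d = "\<lambda>z. Some (fst (fst z), snd (fst z), snd z)"])
  fix x assume "x \<in> states (P \<wr> (Q \<wr> W))"
  then show "\<exists>z\<in>states ((P \<wr> Q) \<wr> W). Some (fst (fst z), snd (fst z), snd z) = Some x"
    by (intro bexI[of _ "((fst x, fst (snd x)), snd (snd x))"]) auto
next
  fix w assume "w \<in> pfuns (P \<wr> (Q \<wr> W))"
  then obtain f s where w: "w = wreath_act f s" "s \<in> pfuns (Q \<wr> W)" "\<And>q. q \<in> dom s \<Longrightarrow> f q \<in> pfuns P"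
    unfolding wreath_pfuns by blast
  obtain g u where s: "s = wreath_act g u" "u \<in> pfuns W" "\<And>q. q \<in> dom u \<Longrightarrow> g q \<in> pfuns Q"
    using w(2) unfolding wreath_pfuns by blast
  \<comment> \<open>f depends on both coordinates (q, z); for fixed z it becomes the function of q
    that the inner wreath product asks for.\<close>
  define v where "v = wreath_act (\<lambda>z. wreath_act (\<lambda>q. f (q, z)) (g z)) u"
  have "f (q, z) \<in> pfuns P" if "u z = Some z'" "g z q = Some q'" for q z q' z'
    using that by (intro w(3)) (auto simp: s wreath_act_simp dom_def)
  then have "v \<in> pfuns ((P \<wr> Q) \<wr> W)"
    unfolding v_def using s(2) by (intro wreath_pfunsI) (auto intro!: wreath_pfunsI s(3))
  moreover have "\<exists>z'. v z = Some z' \<and> Some (fst (fst z'), snd (fst z'), snd z') = Some y"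
    if "w (fst (fst z), snd (fst z), snd z) = Some y" for z y
    using that by (intro exI[of _ "((fst y, fst (snd y)), snd (snd y))"])
      (auto simp: v_def w(1) s(1) wreath_act_Some)
  ultimately show "\<exists>v\<in>pfuns ((P \<wr> Q) \<wr> W). \<forall>z x y. Some (fst (fst z), snd (fst z), snd z) = Some x \<longrightarrow>
      w x = Some y \<longrightarrow> (\<exists>z'. v z = Some z' \<and> Some (fst (fst z'), snd (fst z'), snd z') = Some y)"
    by blast
qed


section \<open>Complexity\<close>

abbreviation wl :: "kr_factor list \<Rightarrow> nat list ts" where
  "wl Fs \<equiv> wreath_list (map factor_ts Fs)"

abbreviation ngroups :: "kr_factor list \<Rightarrow> nat" where
  "ngroups Fs \<equiv> length (filter is_group_factor Fs)"

abbreviation cons_pair :: "'q \<times> 'q list \<Rightarrow> 'q list" where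
  "cons_pair \<equiv> (\<lambda>(q, qs). q # qs)"

abbreviation uncons :: "'q list \<rightharpoonup> 'q \<times> 'q list" where
  "uncons \<equiv> (\<lambda>r. case r of [] \<Rightarrow> None | q # qs \<Rightarrow> Some (q, qs))"

lemma retr_cons: "retr cons_pair uncons"
  by (auto simp: retr_def split: list.splits)

lemma retr_bij: "bij e \<Longrightarrow> retr e (\<lambda>r. Some (inv_into UNIV e r))"
  by (auto simp: retr_def bij_is_inj bij_is_surj surj_f_inv_f)

lemma wreath_list_Cons: "wreath_list (T # Ts) = relabel_ts cons_pair uncons (T \<wr> wreath_list Ts)"
proof -
  have "relabel cons_pair uncons w = (\<lambda>r. case r of [] \<Rightarrow> None
      | q # qs \<Rightarrow> map_option (\<lambda>(q', qs'). q' # qs') (w (q, qs)))" for w :: "'a \<times> 'a list \<rightharpoonup> 'a \<times> 'a list"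
    by (auto simp: relabel_def fun_eq_iff split: list.split)
  then show ?thesis by (auto simp: relabel_ts_def Let_def)
qed

declare wreath_list.simps(2) [simp del]

lemma is_ts_wreath_list: "(\<And>T. T \<in> set Ts \<Longrightarrow> is_ts T) \<Longrightarrow> is_ts (wreath_list Ts)"
proof (induction Ts)
  case Nil
  have "(\<lambda>qs. if qs = [] then Some [] else None) \<circ>\<^sub>m (\<lambda>qs. if qs = [] then Some [] else None) =
    (\<lambda>qs :: 'a list. if qs = [] then Some ([] :: 'a list) else None)" by (auto simp: map_comp_def)
  then show ?case by (auto simp: is_ts_def is_sgp_pfun dom_def ran_def split: if_splits)
next
  case (Cons T Ts)
  then show ?case unfolding wreath_list_Cons by (auto intro!: is_ts_relabel retr_cons is_ts_wreath)
qed

lemma factor_ok_ts: "factor_ok F \<Longrightarrow> is_ts (factor_ts F)"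
  by (cases F) (auto intro: is_ts_group_ts simp: Group.group_def)

lemma is_ts_wl: "(\<And>F. F \<in> set Fs \<Longrightarrow> factor_ok F) \<Longrightarrow> is_ts (wl Fs)"
  by (intro is_ts_wreath_list) (auto intro: factor_ok_ts)

lemma group_ts_group:
  assumes "Group.group H"
  defines "e \<equiv> rtrans H \<one>\<^bsub>H\<^esub>"
  shows "e \<in> pfuns (group_ts H)" "m \<in> pfuns (group_ts H) \<Longrightarrow> m \<circ>\<^sub>m e = m"
    "m \<in> pfuns (group_ts H) \<Longrightarrow> e \<circ>\<^sub>m m = m"
    "m \<in> pfuns (group_ts H) \<Longrightarrow> \<exists>m'\<in>pfuns (group_ts H). m' \<circ>\<^sub>m m = e \<and> m \<circ>\<^sub>m m' = e"
proof -
  interpret Group.group H by fact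
  have M: "monoid H" by unfold_locales
  show "e \<in> pfuns (group_ts H)" by (simp add: e_def)
  assume "m \<in> pfuns (group_ts H)"
  then obtain h where h: "m = rtrans H h" "h \<in> carrier H" by auto
  show "m \<circ>\<^sub>m e = m" "e \<circ>\<^sub>m m = m"
    unfolding e_def h(1) using rtrans_comp[OF M, of h "\<one>\<^bsub>H\<^esub>"] rtrans_comp[OF M, of "\<one>\<^bsub>H\<^esub>" h] h(2)
    by (simp_all cong: if_cong)
  show "\<exists>m'\<in>pfuns (group_ts H). m' \<circ>\<^sub>m m = e \<and> m \<circ>\<^sub>m m' = e"
    unfolding e_def h(1) using rtrans_comp[OF M, of h "inv\<^bsub>H\<^esub> h"] rtrans_comp[OF M, of "inv\<^bsub>H\<^esub> h" h] h(2)
    by (intro bexI[of _ "rtrans H (inv\<^bsub>H\<^esub> h)"]) (simp_all cong: if_cong)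
qed

lemma reg_cover_wl_Cons:
  assumes "reg_cover (factor_ts F \<wr> wl Fs) S c x0"
  shows "\<exists>c x0. reg_cover (wl (F # Fs)) S c x0"
  using reg_cover_sim[OF assms sim_relabel(1)[OF retr_cons]] by (simp add: wreath_list_Cons)

text \<open>Factor by factor from the right, a group is replaced by one of its powers and an
  aperiodic factor by an aperiodic monoid, so the number of groups is unchanged.\<close>

lemma reg_cover_wl:
  assumes "\<And>F. F \<in> set Fs \<Longrightarrow> factor_ok F"
  shows "\<exists>Fs'. (\<forall>F\<in>set Fs'. factor_ok F) \<and> ngroups Fs' = ngroups Fs \<and>
    (\<exists>c x0. reg_cover (wl Fs') (sgp_of (wl Fs)) c x0)"
  using assms
proof (induction Fs)
  case Nil
  \<comment> \<open>The empty product has a one-element semigroup, but its regular representation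
    has two states: 0 is the adjoined identity, sent to 1 by the only element.\<close>
  define A :: "nat ts" where "A = \<lparr>states = {0, 1}, pfuns = {\<lambda>x. if x \<in> {0, 1} then Some 1 else None}\<rparr>"
  define w where "w = (\<lambda>x. if x \<in> {0, 1 :: nat} then Some (1 :: nat) else None)"
  have ww: "w \<circ>\<^sub>m w = w" by (auto simp: w_def map_comp_def)
  have "is_ts A" using ww
    by (auto simp: A_def is_ts_def is_sgp_pfun w_def dom_def ran_def split: if_splits)
  moreover have "aperiodic (sgp_of A)"
    by (rule aperiodicI) (use ww in \<open>auto simp: A_def w_def intro!: exI[of _ 0]\<close>)
  ultimately have ok: "factor_ok (Aperiodic_Factor A)" by simp
  define t where "t = (\<lambda>qs :: nat list. if qs = [] then Some ([] :: nat list) else None)"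
  define c where "c x = (if x = (0, []) then Some None else if x = (1, []) then Some (Some t) else None)"
    for x :: "nat \<times> nat list"
  have tt: "t \<circ>\<^sub>m t = t" by (auto simp: t_def map_comp_def)
  have wl0: "wl [] = \<lparr>states = {[]}, pfuns = {t}\<rparr>" by (simp add: t_def)
  have wA: "wreath_act (\<lambda>_. w) t \<in> pfuns (A \<wr> wl [])"
    unfolding wl0 by (intro wreath_pfunsI) (auto simp: A_def w_def)
  have "lifts (sgp_of (wl [])) c t (wreath_act (\<lambda>_. w) t)" unfolding lifts_def
  proof (intro allI impI)
    fix x u assume "c x = Some u"
    then have "x = (0, []) \<and> u = None \<or> x = (1, []) \<and> u = Some t" by (auto simp: c_def split: if_splits)
    then show "\<exists>x'. wreath_act (\<lambda>_. w) t x = Some x' \<and> c x' = Some (Some (ract (sgp_of (wl [])) u t))"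
      using tt by (intro exI[of _ "(1, [])"]) (auto simp: wreath_act_Some t_def w_def c_def ract_def)
  qed
  then have "reg_cover (A \<wr> wl []) (sgp_of (wl [])) c (0, [])"
    unfolding reg_cover_def using wA by (auto simp: c_def A_def t_def split: if_splits)
  then have "\<exists>c x0. reg_cover (wl [Aperiodic_Factor A]) (sgp_of (wl [])) c x0"
    by (intro reg_cover_wl_Cons[of "Aperiodic_Factor A"]) auto
  then show ?case using ok by (intro exI[of _ "[Aperiodic_Factor A]"]) auto
next
  case (Cons F Fs)
  then obtain Fs' c x0 where Fs': "\<forall>F\<in>set Fs'. factor_ok F" "ngroups Fs' = ngroups Fs"
    "reg_cover (wl Fs') (sgp_of (wl Fs)) c x0" by auto
  have T: "is_ts (wl Fs)" using Cons.prems by (intro is_ts_wl) auto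
  have F: "factor_ok F" using Cons.prems by simp
  have "\<exists>F' c x0. factor_ok F' \<and> is_group_factor F' = is_group_factor F \<and>
    reg_cover (factor_ts F' \<wr> wl Fs') (sgp_of (factor_ts F \<wr> wl Fs)) c x0"
  proof (cases F)
    case (Group_Factor H)
    then have H: "Group.group H" using F by simp
    obtain H' c' x0' where "Group.group (H' :: nat monoid)" "finite (carrier H')"
       "reg_cover (group_ts H' \<wr> wl Fs') (sgp_of (group_ts H \<wr> wl Fs)) c' x0'"
      using reg_cover_group[OF Fs'(3) T _ group_ts_group[OF H]] factor_ok_ts[OF F] Group_Factor by auto
    then show ?thesis using Group_Factor
      by (intro exI[of _ "Group_Factor H'"] exI[of _ c'] exI[of _ x0']) auto
  next
    case (Aperiodic_Factor A)
    obtain A' c' x0' where "is_ts (A' :: nat ts)" "aperiodic (sgp_of A')"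
       "reg_cover (A' \<wr> wl Fs') (sgp_of (A \<wr> wl Fs)) c' x0'"
      using reg_cover_aperiodic[OF Fs'(3) T, of A] F Aperiodic_Factor by auto
    then show ?thesis using Aperiodic_Factor
      by (intro exI[of _ "Aperiodic_Factor A'"] exI[of _ c'] exI[of _ x0']) auto
  qed
  then obtain F' c' x0' where F': "factor_ok F'" "is_group_factor F' = is_group_factor F"
    "reg_cover (factor_ts F' \<wr> wl Fs') (sgp_of (factor_ts F \<wr> wl Fs)) c' x0'" by blast
  obtain c'' x0'' where cov: "reg_cover (wl (F' # Fs')) (sgp_of (factor_ts F \<wr> wl Fs)) c'' x0''"
    using reg_cover_wl_Cons[OF F'(3)] by blast
  have W: "is_ts (factor_ts F \<wr> wl Fs)" using T F factor_ok_ts is_ts_wreath by blast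
  have "sgp_of (wl (F # Fs)) \<prec>\<^sub>s sgp_of (factor_ts F \<wr> wl Fs)"
    using relabel_divides(1)[OF retr_cons W] by (simp add: wreath_list_Cons)
  then have "\<exists>c. reg_cover (wl (F' # Fs')) (sgp_of (wl (F # Fs))) c x0''"
    by (rule reg_cover_mono[OF cov _ is_tsD(2)[OF W]])
  then show ?case using F'(1,2) Fs'(1,2) by (intro exI[of _ "F' # Fs'"]) auto
qed

text \<open>The form in which complexity is used from here on: covering the regular representation
  instead of dividing costs no additional group.\<close>

lemma complexity_le_cover:
  assumes S: "is_sgp S"
  shows "complexity S \<le> enat n \<longleftrightarrow> (\<exists>Fs. (\<forall>F\<in>set Fs. factor_ok F) \<and> ngroups Fs \<le> n \<and>
    (\<exists>c x0. reg_cover (wl Fs) S c x0))"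
proof
  assume "complexity S \<le> enat n"
  then obtain Fs where Fs: "\<And>F. F \<in> set Fs \<Longrightarrow> factor_ok F" "S \<prec>\<^sub>s sgp_of (wl Fs)" "ngroups Fs \<le> n"
    unfolding complexity_le_iff kr_decomposition_def by blast
  obtain Fs' c x0 where Fs': "\<forall>F\<in>set Fs'. factor_ok F" "ngroups Fs' = ngroups Fs"
    "reg_cover (wl Fs') (sgp_of (wl Fs)) c x0"
    using reg_cover_wl[of Fs] Fs(1) by blast
  obtain c' where "reg_cover (wl Fs') S c' x0"
    using reg_cover_mono[OF Fs'(3) Fs(2) is_tsD(2)[OF is_ts_wl[OF Fs(1)]]] by blast
  then show "\<exists>Fs. (\<forall>F\<in>set Fs. factor_ok F) \<and> ngroups Fs \<le> n \<and> (\<exists>c x0. reg_cover (wl Fs) S c x0)"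
    using Fs' Fs(3) by (intro exI[of _ Fs']) auto
next
  assume "\<exists>Fs. (\<forall>F\<in>set Fs. factor_ok F) \<and> ngroups Fs \<le> n \<and> (\<exists>c x0. reg_cover (wl Fs) S c x0)"
  then obtain Fs c x0 where Fs: "\<forall>F\<in>set Fs. factor_ok F" "ngroups Fs \<le> n" "reg_cover (wl Fs) S c x0"
    by blast
  have "is_ts (wl Fs)" using Fs(1) by (intro is_ts_wl) auto
  then have "S \<prec>\<^sub>s sgp_of (wl Fs)" using reg_cover_divides[OF Fs(3) S] is_tsD(2) by blast
  then show "complexity S \<le> enat n" unfolding complexity_le_iff kr_decomposition_def using Fs by blast
qed

text \<open>P is any transformation semigroup whose semigroup is a group, such as a symmetric group.
  The functions from the states of T to this group form one group, hence a single further
  factor.\<close>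

lemma complexity_group_wreath:
  assumes T: "is_ts T" and P: "is_ts P"
    and e: "e \<in> pfuns P" "\<And>m. m \<in> pfuns P \<Longrightarrow> m \<circ>\<^sub>m e = m" "\<And>m. m \<in> pfuns P \<Longrightarrow> e \<circ>\<^sub>m m = m"
    and inv: "\<And>m. m \<in> pfuns P \<Longrightarrow> \<exists>m'\<in>pfuns P. m' \<circ>\<^sub>m m = e \<and> m \<circ>\<^sub>m m' = e"
    and n: "complexity (sgp_of T) \<le> enat n"
  shows "complexity (sgp_of (P \<wr> T)) \<le> enat (Suc n)"
proof -
  obtain Fs c x0 where Fs: "\<forall>F\<in>set Fs. factor_ok F" "ngroups Fs \<le> n" "reg_cover (wl Fs) (sgp_of T) c x0"
    using n unfolding complexity_le_cover[OF is_tsD(2)[OF T]] by blast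
  obtain H c' x0' where H: "Group.group (H :: nat monoid)" "finite (carrier H)"
    "reg_cover (group_ts H \<wr> wl Fs) (sgp_of (P \<wr> T)) c' x0'"
    using reg_cover_group[OF Fs(3) T P e inv] by auto
  then have "\<exists>c x0. reg_cover (wl (Group_Factor H # Fs)) (sgp_of (P \<wr> T)) c x0"
    by (intro reg_cover_wl_Cons) auto
  then show ?thesis unfolding complexity_le_cover[OF is_tsD(2)[OF is_ts_wreath[OF P T]]]
    using Fs H by (intro exI[of _ "Group_Factor H # Fs"]) auto
qed

section \<open>Direct products: two wreath products run in parallel\<close>

definition psim :: "'v ts \<Rightarrow> 'w ts \<Rightarrow> 'u ts \<Rightarrow> bool" where
  "psim V W W' \<longleftrightarrow> (\<exists>d l. (\<forall>x\<in>states W. \<forall>x'\<in>states W'. \<exists>z\<in>states V. d z = Some (x, x')) \<and>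
     (\<forall>w\<in>pfuns W. \<forall>w'\<in>pfuns W'. l w w' \<in> pfuns V \<and>
        (\<forall>z x x' y y'. d z = Some (x, x') \<longrightarrow> w x = Some y \<longrightarrow> w' x' = Some y' \<longrightarrow>
           (\<exists>z'. l w w' z = Some z' \<and> d z' = Some (y, y')))))"

lemma psimE:
  assumes "psim V W W'"
  obtains d l where "\<forall>x\<in>states W. \<forall>x'\<in>states W'. \<exists>z\<in>states V. d z = Some (x, x')"
    "\<forall>w\<in>pfuns W. \<forall>w'\<in>pfuns W'. l w w' \<in> pfuns V"
    "\<forall>w\<in>pfuns W. \<forall>w'\<in>pfuns W'. \<forall>z x x' y y'. d z = Some (x, x') \<longrightarrow> w x = Some y \<longrightarrow> w' x' = Some y' \<longrightarrow>
           (\<exists>z'. l w w' z = Some z' \<and> d z' = Some (y, y'))"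
proof -
  obtain d l where "(\<forall>x\<in>states W. \<forall>x'\<in>states W'. \<exists>z\<in>states V. d z = Some (x, x')) \<and>
     (\<forall>w\<in>pfuns W. \<forall>w'\<in>pfuns W'. l w w' \<in> pfuns V \<and>
        (\<forall>z x x' y y'. d z = Some (x, x') \<longrightarrow> w x = Some y \<longrightarrow> w' x' = Some y' \<longrightarrow>
           (\<exists>z'. l w w' z = Some z' \<and> d z' = Some (y, y'))))"
    using assms unfolding psim_def by (elim exE)
  then show thesis using that[of d l] by simp
qed

lemma psimI:
  assumes "\<And>x x'. x \<in> states W \<Longrightarrow> x' \<in> states W' \<Longrightarrow> \<exists>z\<in>states V. d z = Some (x, x')"
    and "\<And>w w'. w \<in> pfuns W \<Longrightarrow> w' \<in> pfuns W' \<Longrightarrow> \<exists>v\<in>pfuns V.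
      \<forall>z x x' y y'. d z = Some (x, x') \<longrightarrow> w x = Some y \<longrightarrow> w' x' = Some y' \<longrightarrow>
           (\<exists>z'. v z = Some z' \<and> d z' = Some (y, y'))"
  shows "psim V W W'"
proof -
  define l where "l w w' = (SOME v. v \<in> pfuns V \<and>
      (\<forall>z x x' y y'. d z = Some (x, x') \<longrightarrow> w x = Some y \<longrightarrow> w' x' = Some y' \<longrightarrow>
           (\<exists>z'. v z = Some z' \<and> d z' = Some (y, y'))))" for w w'
  have "l w w' \<in> pfuns V \<and>
      (\<forall>z x x' y y'. d z = Some (x, x') \<longrightarrow> w x = Some y \<longrightarrow> w' x' = Some y' \<longrightarrow>
           (\<exists>z'. l w w' z = Some z' \<and> d z' = Some (y, y')))"
    if h: "w \<in> pfuns W" "w' \<in> pfuns W'" for w w'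
    unfolding l_def by (rule someI_ex[where P = "\<lambda>v. v \<in> pfuns V \<and> (\<forall>z x x' y y'. d z = Some (x, x') \<longrightarrow>
      w x = Some y \<longrightarrow> w' x' = Some y' \<longrightarrow> (\<exists>z'. v z = Some z' \<and> d z' = Some (y, y')))"])
      (use assms(2)[OF h] in blast)
  then show ?thesis unfolding psim_def using assms(1) by (intro exI[of _ d] exI[of _ l]) simp
qed

lemma psim_sym: assumes "psim V W W'" shows "psim V W' W"
proof -
  obtain d l where d: "\<forall>x\<in>states W. \<forall>x'\<in>states W'. \<exists>z\<in>states V. d z = Some (x, x')"
    "\<forall>w\<in>pfuns W. \<forall>w'\<in>pfuns W'. l w w' \<in> pfuns V"
    "\<forall>w\<in>pfuns W. \<forall>w'\<in>pfuns W'. \<forall>z x x' y y'. d z = Some (x, x') \<longrightarrow> w x = Some y \<longrightarrow> w' x' = Some y' \<longrightarrow>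
           (\<exists>z'. l w w' z = Some z' \<and> d z' = Some (y, y'))"
    by (rule psimE[OF assms])
  show ?thesis
  proof (rule psimI[where d = "\<lambda>z. map_option (\<lambda>(x, y). (y, x)) (d z)"])
    fix x x' assume "x \<in> states W'" "x' \<in> states W"
    then obtain z where "z \<in> states V" "d z = Some (x', x)" using d(1) by blast
    then show "\<exists>z\<in>states V. map_option (\<lambda>(x, y). (y, x)) (d z) = Some (x, x')" by force
  next
    fix w w' assume h: "w \<in> pfuns W'" "w' \<in> pfuns W"
    then have l: "\<forall>z x x' y y'. d z = Some (x, x') \<longrightarrow> w' x = Some y \<longrightarrow> w x' = Some y' \<longrightarrow>
           (\<exists>z'. l w' w z = Some z' \<and> d z' = Some (y, y'))" using d(3) by blast
    show "\<exists>v\<in>pfuns V. \<forall>z x x' y y'. map_option (\<lambda>(x, y). (y, x)) (d z) = Some (x, x') \<longrightarrow>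
      w x = Some y \<longrightarrow> w' x' = Some y' \<longrightarrow>
      (\<exists>z'. v z = Some z' \<and> map_option (\<lambda>(x, y). (y, x)) (d z') = Some (y, y'))"
    proof (intro bexI[of _ "l w' w"] allI impI)
      fix z x x' y y' assume "map_option (\<lambda>(x, y). (y, x)) (d z) = Some (x, x')" "w x = Some y" "w' x' = Some y'"
      then obtain z' where "l w' w z = Some z'" "d z' = Some (y', y)" using l by fast
      then show "\<exists>z'. l w' w z = Some z' \<and> map_option (\<lambda>(x, y). (y, x)) (d z') = Some (y, y')" by auto
    qed (use h d(2) in blast)
  qed
qed

lemma psim_sim:
  assumes p: "psim V W W'" and s: "sim U V" and t: "sim W X"
  shows "psim U X W'"
proof -
  obtain d l where d: "\<forall>x\<in>states W. \<forall>x'\<in>states W'. \<exists>z\<in>states V. d z = Some (x, x')"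
    "\<forall>w\<in>pfuns W. \<forall>w'\<in>pfuns W'. l w w' \<in> pfuns V"
    "\<forall>w\<in>pfuns W. \<forall>w'\<in>pfuns W'. \<forall>z x x' y y'. d z = Some (x, x') \<longrightarrow> w x = Some y \<longrightarrow> w' x' = Some y' \<longrightarrow>
           (\<exists>z'. l w w' z = Some z' \<and> d z' = Some (y, y'))"
    by (rule psimE[OF p])
  obtain e k where "simulates U V e k" using s unfolding sim_def by blast
  note e = simulatesD[OF this]
  obtain c m where "simulates W X c m" using t unfolding sim_def by blast
  note c = simulatesD[OF this]
  define d' where "d' z = (case e z of None \<Rightarrow> None | Some v \<Rightarrow> (case d v of None \<Rightarrow> None
    | Some (w, w') \<Rightarrow> (case c w of None \<Rightarrow> None | Some x \<Rightarrow> Some (x, w'))))" for z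
  have d': "d' z = Some (x, w') \<longleftrightarrow> (\<exists>v w. e z = Some v \<and> d v = Some (w, w') \<and> c w = Some x)" for z x w'
    unfolding d'_def by (auto split: option.splits)
  show ?thesis
  proof (rule psimI[where d = d'])
    fix x x' assume "x \<in> states X" "x' \<in> states W'"
    then obtain w where w: "w \<in> states W" "c w = Some x" using c(1) by blast
    then obtain v where v: "v \<in> states V" "d v = Some (w, x')" using d(1) \<open>x' \<in> _\<close> by blast
    then obtain z where "z \<in> states U" "e z = Some v" using e(1) by blast
    then show "\<exists>z\<in>states U. d' z = Some (x, x')" using v w by (auto simp: d')
  next
    fix w w' assume h: "w \<in> pfuns X" "w' \<in> pfuns W'"
    have mw: "m w \<in> pfuns W" using c(2) h by blast
    have lw: "l (m w) w' \<in> pfuns V" using d(2) mw h by blast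
    show "\<exists>v\<in>pfuns U. \<forall>z x x' y y'. d' z = Some (x, x') \<longrightarrow> w x = Some y \<longrightarrow> w' x' = Some y' \<longrightarrow>
           (\<exists>z'. v z = Some z' \<and> d' z' = Some (y, y'))"
    proof (intro bexI[of _ "k (l (m w) w')"] allI impI)
      fix z x x' y y' assume z: "d' z = Some (x, x')" and y: "w x = Some y" and y': "w' x' = Some y'"
      obtain v u where v: "e z = Some v" "d v = Some (u, x')" "c u = Some x" using z unfolding d' by blast
      obtain u' where u': "m w u = Some u'" "c u' = Some y" using c(3)[OF h(1) v(3) y] by blast
      obtain v' where v': "l (m w) w' v = Some v'" "d v' = Some (u', y')"
        using d(3) mw h(2) v(2) u'(1) y' by blast
      obtain z' where "k (l (m w) w') z = Some z'" "e z' = Some v'" using e(3)[OF lw v(1) v'(1)] by blast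
      then show "\<exists>z'. k (l (m w) w') z = Some z' \<and> d' z' = Some (y, y')" using v' u' by (auto simp: d')
    qed (use e(2) lw in blast)
  qed
qed

text \<open>The new factor looks only at the W-coordinate of a simulated pair, so one of the two
  chains can be lengthened alone.\<close>

lemma psim_wreath:
  fixes P :: "'p ts"
  assumes p: "psim V W W'" and p0: "p0 \<in> pfuns P"
  shows "psim (P \<wr> V) (P \<wr> W) W'"
proof -
  obtain d l where d: "\<forall>x\<in>states W. \<forall>x'\<in>states W'. \<exists>z\<in>states V. d z = Some (x, x')"
    "\<forall>w\<in>pfuns W. \<forall>w'\<in>pfuns W'. l w w' \<in> pfuns V"
    "\<forall>w\<in>pfuns W. \<forall>w'\<in>pfuns W'. \<forall>z x x' y y'. d z = Some (x, x') \<longrightarrow> w x = Some y \<longrightarrow> w' x' = Some y' \<longrightarrow>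
           (\<exists>z'. l w w' z = Some z' \<and> d z' = Some (y, y'))"
    by (rule psimE[OF p])
  define d' where "d' = (\<lambda>(p :: 'p, z). map_option (\<lambda>(x, x'). ((p, x), x')) (d z))"
  have d': "d' z = Some (x, x') \<longleftrightarrow> d (snd z) = Some (snd x, x') \<and> fst z = fst x" for z x x'
    by (cases z; cases x) (auto simp: d'_def)
  show ?thesis
  proof (rule psimI[where d = d'])
    fix x x' assume h: "x \<in> states (P \<wr> W)" "x' \<in> states W'"
    then have "snd x \<in> states W" by auto
    then obtain z where "z \<in> states V" "d z = Some (snd x, x')" using d(1) h by blast
    then show "\<exists>z\<in>states (P \<wr> V). d' z = Some (x, x')"
      using h by (intro bexI[of _ "(fst x, z)"]) (auto simp: d')
  next
    fix w w' assume wP: "w \<in> pfuns (P \<wr> W)" and w': "w' \<in> pfuns W'"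
    obtain f s where w: "w = wreath_act f s" "s \<in> pfuns W" "\<And>q. q \<in> dom s \<Longrightarrow> f q \<in> pfuns P"
      using wP unfolding wreath_pfuns by blast
    define g where "g z = (case d z of None \<Rightarrow> p0 | Some (x, _) \<Rightarrow> if x \<in> dom s then f x else p0)" for z
    have g: "g z \<in> pfuns P" for z using p0 w(3) by (auto simp: g_def split: option.split)
    have "l s w' \<in> pfuns V" using d(2) w(2) w' by blast
    then have v: "wreath_act g (l s w') \<in> pfuns (P \<wr> V)" using g by (intro wreath_pfunsI)
    show "\<exists>v\<in>pfuns (P \<wr> V). \<forall>z x x' y y'. d' z = Some (x, x') \<longrightarrow> w x = Some y \<longrightarrow> w' x' = Some y' \<longrightarrow>
           (\<exists>z'. v z = Some z' \<and> d' z' = Some (y, y'))"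
    proof (intro bexI[OF _ v] allI impI)
      fix z x x' y y' assume z: "d' z = Some (x, x')" and y: "w x = Some y" and y': "w' x' = Some y'"
      have s: "s (snd x) = Some (snd y)" "f (snd x) (fst x) = Some (fst y)"
        using y w(1) by (auto simp: wreath_act_Some)
      have dz: "d (snd z) = Some (snd x, x')" "fst z = fst x" using z d' by auto
      obtain z' where "l s w' (snd z) = Some z'" "d z' = Some (snd y, y')"
        using d(3) w(2) w' dz(1) s(1) y' by blast
      then show "\<exists>z'. wreath_act g (l s w') z = Some z' \<and> d' z' = Some (y, y')"
        using s dz by (intro exI[of _ "(fst y, z')"]) (auto simp: wreath_act_Some d' g_def dom_def)
    qed
  qed
qed

definition nat_times :: "nat monoid \<Rightarrow> nat monoid \<Rightarrow> nat monoid" where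
  "nat_times H K = \<lparr>carrier = prod_encode ` (carrier H \<times> carrier K),
     mult = (\<lambda>m n. prod_encode (fst (prod_decode m) \<otimes>\<^bsub>H\<^esub> fst (prod_decode n),
                                snd (prod_decode m) \<otimes>\<^bsub>K\<^esub> snd (prod_decode n))),
     one = prod_encode (\<one>\<^bsub>H\<^esub>, \<one>\<^bsub>K\<^esub>)\<rparr>"

lemma group_nat_times:
  assumes "Group.group H" "Group.group K" shows "Group.group (nat_times H K)"
proof -
  interpret H: Group.group H by fact
  interpret K: Group.group K by fact
  show ?thesis
  proof (rule groupI)
    fix x assume "x \<in> carrier (nat_times H K)"
    then obtain h k where x: "x = prod_encode (h, k)" "h \<in> carrier H" "k \<in> carrier K"
      by (auto simp: nat_times_def)
    then show "\<exists>y\<in>carrier (nat_times H K). y \<otimes>\<^bsub>nat_times H K\<^esub> x = \<one>\<^bsub>nat_times H K\<^esub>"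
      by (intro bexI[of _ "prod_encode (inv\<^bsub>H\<^esub> h, inv\<^bsub>K\<^esub> k)"]) (auto simp: nat_times_def)
  qed (auto simp: nat_times_def H.m_assoc K.m_assoc)
qed

text \<open>Two groups at the head of the two chains act independently on the two coordinates, so
  their direct product serves both; this bounds a product by the maximum of the counts instead of
  their sum.\<close>

lemma psim_groups:
  assumes p: "psim V W W'" and H: "Group.group H" and K: "Group.group K"
  shows "psim (group_ts (nat_times H K) \<wr> V) (group_ts H \<wr> W) (group_ts K \<wr> W')"
proof -
  obtain d l where d: "\<forall>x\<in>states W. \<forall>x'\<in>states W'. \<exists>z\<in>states V. d z = Some (x, x')"
    "\<forall>w\<in>pfuns W. \<forall>w'\<in>pfuns W'. l w w' \<in> pfuns V"
    "\<forall>w\<in>pfuns W. \<forall>w'\<in>pfuns W'. \<forall>z x x' y y'. d z = Some (x, x') \<longrightarrow> w x = Some y \<longrightarrow> w' x' = Some y' \<longrightarrow>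
           (\<exists>z'. l w w' z = Some z' \<and> d z' = Some (y, y'))"
    by (rule psimE[OF p])
  let ?HK = "nat_times H K"
  define d' where "d' = (\<lambda>(n, z). map_option
     (\<lambda>(x, x'). ((fst (prod_decode n), x), (snd (prod_decode n), x'))) (d z))"
  have d': "d' z = Some (x, x') \<longleftrightarrow>
     d (snd z) = Some (snd x, snd x') \<and> fst z = prod_encode (fst x, fst x')" for z x x'
    by (cases z; cases x; cases x') (auto simp: d'_def)
  show ?thesis
  proof (rule psimI[where d = d'])
    fix x x' assume h: "x \<in> states (group_ts H \<wr> W)" "x' \<in> states (group_ts K \<wr> W')"
    then have "snd x \<in> states W" "snd x' \<in> states W'" by auto
    then obtain z where "z \<in> states V" "d z = Some (snd x, snd x')" using d(1) h by blast
    then show "\<exists>z\<in>states (group_ts ?HK \<wr> V). d' z = Some (x, x')"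
      using h by (intro bexI[of _ "(prod_encode (fst x, fst x'), z)"]) (auto simp: d' nat_times_def)
  next
    fix w w' assume wP: "w \<in> pfuns (group_ts H \<wr> W)" and wP': "w' \<in> pfuns (group_ts K \<wr> W')"
    obtain f s where w: "w = wreath_act f s" "s \<in> pfuns W" "\<forall>q\<in>dom s. f q \<in> rtrans H ` carrier H"
      using wP unfolding wreath_pfuns by auto
    obtain f' s' where w': "w' = wreath_act f' s'" "s' \<in> pfuns W'" "\<forall>q\<in>dom s'. f' q \<in> rtrans K ` carrier K"
      using wP' unfolding wreath_pfuns by auto
    have "\<forall>q\<in>dom s. \<exists>h. h \<in> carrier H \<and> f q = rtrans H h" using w(3) by blast
    from bchoice[OF this] obtain h where h: "\<forall>q\<in>dom s. h q \<in> carrier H \<and> f q = rtrans H (h q)" by blast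
    have "\<forall>q\<in>dom s'. \<exists>h. h \<in> carrier K \<and> f' q = rtrans K h" using w'(3) by blast
    from bchoice[OF this] obtain h' where h': "\<forall>q\<in>dom s'. h' q \<in> carrier K \<and> f' q = rtrans K (h' q)" by blast
    define g where "g z = (case d z of None \<Rightarrow> \<one>\<^bsub>?HK\<^esub>
      | Some (x, x') \<Rightarrow> if x \<in> dom s \<and> x' \<in> dom s' then prod_encode (h x, h' x') else \<one>\<^bsub>?HK\<^esub>)" for z
    have "g z \<in> carrier ?HK" for z
      using h h' monoid.one_closed[OF group.is_monoid[OF group_nat_times[OF H K]]]
      by (auto simp: g_def nat_times_def split: option.split)
    moreover have "l s s' \<in> pfuns V" using d(2) w(2) w'(2) by blast
    ultimately have v: "wreath_act (\<lambda>z. rtrans ?HK (g z)) (l s s') \<in> pfuns (group_ts ?HK \<wr> V)"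
      by (intro wreath_pfunsI) auto
    show "\<exists>v\<in>pfuns (group_ts ?HK \<wr> V). \<forall>z x x' y y'. d' z = Some (x, x') \<longrightarrow> w x = Some y \<longrightarrow> w' x' = Some y' \<longrightarrow>
           (\<exists>z'. v z = Some z' \<and> d' z' = Some (y, y'))"
    proof (intro bexI[OF _ v] allI impI)
      fix z x x' y y' assume z: "d' z = Some (x, x')" and y: "w x = Some y" and y': "w' x' = Some y'"
      have s: "s (snd x) = Some (snd y)" "f (snd x) (fst x) = Some (fst y)"
        "s' (snd x') = Some (snd y')" "f' (snd x') (fst x') = Some (fst y')"
        using y y' w(1) w'(1) by (auto simp: wreath_act_Some)
      have dz: "d (snd z) = Some (snd x, snd x')" "fst z = prod_encode (fst x, fst x')" using z d' by auto
      have hh: "h (snd x) \<in> carrier H" "fst x \<in> carrier H" "fst y = fst x \<otimes>\<^bsub>H\<^esub> h (snd x)"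
        "h' (snd x') \<in> carrier K" "fst x' \<in> carrier K" "fst y' = fst x' \<otimes>\<^bsub>K\<^esub> h' (snd x')"
        using s h h' by (auto simp: dom_def split: if_splits)
      obtain z' where z': "l s s' (snd z) = Some z'" "d z' = Some (snd y, snd y')"
        using d(3) w(2) w'(2) dz(1) s(1,3) by blast
      have "g (snd z) = prod_encode (h (snd x), h' (snd x'))" using dz(1) s(1,3) by (auto simp: g_def)
      then have "rtrans ?HK (g (snd z)) (fst z) = Some (prod_encode (fst y, fst y'))"
        using hh dz(2) by (auto simp: nat_times_def)
      then show "\<exists>z'. wreath_act (\<lambda>z. rtrans ?HK (g z)) (l s s') z = Some z' \<and> d' z' = Some (y, y')"
        using z' by (intro exI[of _ "(prod_encode (fst y, fst y'), z')"]) (auto simp: wreath_act_Some d')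
    qed
  qed
qed

lemma sim_wl_Cons: "sim (wl (F # Fs)) (factor_ts F \<wr> wl Fs)" "sim (factor_ts F \<wr> wl Fs) (wl (F # Fs))"
  using sim_relabel[OF retr_cons] by (simp_all add: wreath_list_Cons)

lemma sim_refl: "sim W W"
  by (rule simI[where d = Some]) auto

text \<open>Recursion on both lists: an aperiodic head is taken off alone, which does not count, and
  two group heads are taken off together and count once.\<close>

lemma psim_wl:
  assumes "\<forall>F\<in>set Fs. factor_ok F" "\<forall>F\<in>set Fs'. factor_ok F"
  shows "\<exists>Fs''. (\<forall>F\<in>set Fs''. factor_ok F) \<and> ngroups Fs'' \<le> max (ngroups Fs) (ngroups Fs') \<and>
    psim (wl Fs'') (wl Fs) (wl Fs')"
  using assms
proof (induction "length Fs + length Fs'" arbitrary: Fs Fs' rule: less_induct)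
  case less
  have nil: "psim W (wl []) W" for W :: "nat list ts"
    by (rule psimI[where d = "\<lambda>z. Some ([], z)"]) (auto split: if_splits)
  have aper: "\<exists>Fs''. (\<forall>F\<in>set Fs''. factor_ok F) \<and> ngroups Fs'' \<le> max (ngroups (Aperiodic_Factor A # Gs)) (ngroups Gs') \<and>
    psim (wl Fs'') (wl (Aperiodic_Factor A # Gs)) (wl Gs')"
    if len: "length Gs + length Gs' < length Fs + length Fs'"
      and ok: "\<forall>F\<in>set (Aperiodic_Factor A # Gs). factor_ok F" "\<forall>F\<in>set Gs'. factor_ok F" for A Gs Gs'
  proof -
    have ok': "\<forall>F\<in>set Gs. factor_ok F" using ok by simp
    obtain Gs'' where Gs'': "\<forall>F\<in>set Gs''. factor_ok F" "ngroups Gs'' \<le> max (ngroups Gs) (ngroups Gs')"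
      "psim (wl Gs'') (wl Gs) (wl Gs')"
      using less.hyps[OF len ok' ok(2)] by blast
    have A: "is_ts A" using ok by simp
    obtain a where "a \<in> pfuns A" using is_tsD(3)[OF A] by blast
    then have "psim (A \<wr> wl Gs'') (A \<wr> wl Gs) (wl Gs')" by (rule psim_wreath[OF Gs''(3)])
    then have "psim (wl (Aperiodic_Factor A # Gs'')) (wl (Aperiodic_Factor A # Gs)) (wl Gs')"
      by (rule psim_sim) (use sim_wl_Cons[of "Aperiodic_Factor A"] in simp_all)
    then show ?thesis using Gs'' ok by (intro exI[of _ "Aperiodic_Factor A # Gs''"]) auto
  qed
  show ?case
  proof (cases Fs)
    case Nil
    then show ?thesis using nil[of "wl Fs'"] less.prems by (intro exI[of _ Fs']) auto
  next
    case (Cons F Gs)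
    show ?thesis
    proof (cases Fs')
      case Nil
      then show ?thesis using psim_sym[OF nil[of "wl Fs"]] less.prems by (intro exI[of _ Fs]) auto
    next
      case C': (Cons F' Gs')
      consider A where "F = Aperiodic_Factor A" | A where "F' = Aperiodic_Factor A"
        | H K where "F = Group_Factor H" "F' = Group_Factor K" by (cases F; cases F'; blast)
      then show ?thesis
      proof cases
        case 1
        then show ?thesis using aper[of Gs Fs' A] less.prems Cons by simp
      next
        case 2
        then obtain Fs'' where "\<forall>F\<in>set Fs''. factor_ok F" "ngroups Fs'' \<le> max (ngroups Fs') (ngroups Fs)"
          "psim (wl Fs'') (wl Fs') (wl Fs)"
          using aper[of Gs' Fs A] less.prems C' by auto
        then show ?thesis using psim_sym by (intro exI[of _ Fs'']) (auto simp: max.commute)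
      next
        case 3
        have len: "length Gs + length Gs' < length Fs + length Fs'" using Cons C' by simp
        have ok: "\<forall>F\<in>set Gs. factor_ok F" "\<forall>F\<in>set Gs'. factor_ok F" using Cons C' less.prems by auto
        obtain Gs'' where Gs'': "\<forall>F\<in>set Gs''. factor_ok F" "ngroups Gs'' \<le> max (ngroups Gs) (ngroups Gs')"
          "psim (wl Gs'') (wl Gs) (wl Gs')"
          using less.hyps[OF len ok] by blast
        have HK: "Group.group H" "Group.group K" "finite (carrier H)" "finite (carrier K)"
          using less.prems Cons C' 3 by auto
        let ?F = "Group_Factor (nat_times H K)"
        have "factor_ok ?F" using HK group_nat_times by (simp add: nat_times_def)
        have "psim (group_ts (nat_times H K) \<wr> wl Gs'') (group_ts H \<wr> wl Gs) (group_ts K \<wr> wl Gs')"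
          by (rule psim_groups[OF Gs''(3) HK(1,2)])
        then have "psim (wl (?F # Gs'')) (wl Fs) (group_ts K \<wr> wl Gs')"
          by (rule psim_sim) (use sim_wl_Cons[of ?F] sim_wl_Cons[of F Gs] 3 Cons in simp_all)
        then have "psim (wl (?F # Gs'')) (wl Fs) (wl Fs')"
          using psim_sym psim_sim[OF _ sim_refl] sim_wl_Cons[of F' Gs'] 3 C' by (metis factor_ts.simps(1))
        then show ?thesis using Gs'' \<open>factor_ok ?F\<close> 3 Cons C'
          by (intro exI[of _ "?F # Gs''"]) auto
      qed
    qed
  qed
qed

lemma is_sgp_times: "is_sgp S \<Longrightarrow> is_sgp U \<Longrightarrow> is_sgp (sgp_times S U)"
  by (auto simp: is_sgp_def sgp_times_def)

lemma reg_cover_times: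
  assumes p: "psim V W W'" and S: "reg_cover W S c x0" and U: "reg_cover W' U c' x0'"
  shows "\<exists>c x0. reg_cover V (sgp_times S U) c x0"
proof -
  obtain d l where d: "\<forall>x\<in>states W. \<forall>x'\<in>states W'. \<exists>z\<in>states V. d z = Some (x, x')"
    "\<forall>w\<in>pfuns W. \<forall>w'\<in>pfuns W'. l w w' \<in> pfuns V"
    "\<forall>w\<in>pfuns W. \<forall>w'\<in>pfuns W'. \<forall>z x x' y y'. d z = Some (x, x') \<longrightarrow> w x = Some y \<longrightarrow> w' x' = Some y' \<longrightarrow>
           (\<exists>z'. l w w' z = Some z' \<and> d z' = Some (y, y'))"
    by (rule psimE[OF p])
  obtain z0 where z0: "z0 \<in> states V" "d z0 = Some (x0, x0')"
    using d(1) reg_coverD(1)[OF S] reg_coverD(1)[OF U] by blast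
  define e where "e z = (case d z of None \<Rightarrow> None | Some (x, x') \<Rightarrow> (case (c x, c' x') of
     (Some None, Some None) \<Rightarrow> Some None
   | (Some (Some s), Some (Some u)) \<Rightarrow> Some (Some (s, u)) | _ \<Rightarrow> None))" for z
  have e: "e z = Some v \<longleftrightarrow> (\<exists>x x' s u. d z = Some (x, x') \<and> c x = Some s \<and> c' x' = Some u \<and>
     (s = None \<and> u = None \<and> v = None \<or> (\<exists>a b. s = Some a \<and> u = Some b \<and> v = Some (a, b))))" for z v
    unfolding e_def by (auto split: option.splits)
  have "\<exists>v\<in>pfuns V. lifts (sgp_times S U) e y v" if y: "y \<in> carrier (sgp_times S U)" for y
  proof -
    obtain s u where su: "y = (s, u)" "s \<in> carrier S" "u \<in> carrier U" using y by (auto simp: sgp_times_def)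
    obtain w where w: "w \<in> pfuns W" "lifts S c s w" using reg_coverD(4)[OF S su(2)] by blast
    obtain w' where w': "w' \<in> pfuns W'" "lifts U c' u w'" using reg_coverD(4)[OF U su(3)] by blast
    have "lifts (sgp_times S U) e y (l w w')" unfolding lifts_def
    proof (intro allI impI)
      fix z v assume "e z = Some v"
      then obtain x x' a b where h: "d z = Some (x, x')" "c x = Some a" "c' x' = Some b"
        "a = None \<and> b = None \<and> v = None \<or> (\<exists>a' b'. a = Some a' \<and> b = Some b' \<and> v = Some (a', b'))"
        unfolding e by blast
      obtain x1 where x1: "w x = Some x1" "c x1 = Some (Some (ract S a s))" by (rule liftsD[OF w(2) h(2)])
      obtain x2 where x2: "w' x' = Some x2" "c' x2 = Some (Some (ract U b u))" by (rule liftsD[OF w'(2) h(3)])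
      obtain z' where z': "l w w' z = Some z'" "d z' = Some (x1, x2)"
        using d(3) w(1) w'(1) h(1) x1(1) x2(1) by blast
      have "ract (sgp_times S U) v y = (ract S a s, ract U b u)"
        using h(4) su(1) by (auto simp: ract_def sgp_times_def)
      then have "e z' = Some (Some (ract (sgp_times S U) v y))" using z'(2) x1 x2 by (auto simp: e)
      then show "\<exists>x'. l w w' z = Some x' \<and> e x' = Some (Some (ract (sgp_times S U) v y))" using z' by blast
    qed
    then show ?thesis using d(2) w(1) w'(1) by blast
  qed
  moreover have "e z0 = Some None" using z0 reg_coverD(2)[OF S] reg_coverD(2)[OF U] by (auto simp: e)
  moreover have "a \<in> carrier (sgp_times S U)" if "e z = Some (Some a)" for z a
    using that reg_coverD(3)[OF S] reg_coverD(3)[OF U] by (auto simp: e sgp_times_def)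
  ultimately have "reg_cover V (sgp_times S U) e z0" unfolding reg_cover_def using z0(1) by blast
  then show ?thesis by blast
qed

lemma complexity_times:
  assumes "is_sgp S" "is_sgp U" "complexity S \<le> enat n" "complexity U \<le> enat n"
  shows "complexity (sgp_times S U) \<le> enat n"
proof -
  obtain Fs c x0 where Fs: "\<forall>F\<in>set Fs. factor_ok F" "ngroups Fs \<le> n" "reg_cover (wl Fs) S c x0"
    using assms(3) unfolding complexity_le_cover[OF assms(1)] by blast
  obtain Fs' c' x0' where Fs': "\<forall>F\<in>set Fs'. factor_ok F" "ngroups Fs' \<le> n" "reg_cover (wl Fs') U c' x0'"
    using assms(4) unfolding complexity_le_cover[OF assms(2)] by blast
  obtain Fs'' where Fs'': "\<forall>F\<in>set Fs''. factor_ok F" "ngroups Fs'' \<le> max (ngroups Fs) (ngroups Fs')"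
    "psim (wl Fs'') (wl Fs) (wl Fs')" using psim_wl[OF Fs(1) Fs'(1)] by blast
  show ?thesis unfolding complexity_le_cover[OF is_sgp_times[OF assms(1,2)]]
    using Fs'' Fs(2) Fs'(2) reg_cover_times[OF Fs''(3) Fs(3) Fs'(3)]
    by (intro exI[of _ Fs'']) auto
qed

section \<open>Isolating the leftmost group factor\<close>

lemma hom_spow:
  assumes "\<And>u v. u \<in> V \<Longrightarrow> v \<in> V \<Longrightarrow> u \<cdot>\<^bsub>U\<^esub> v \<in> V"
    "\<And>u v. u \<in> V \<Longrightarrow> v \<in> V \<Longrightarrow> h (u \<cdot>\<^bsub>U\<^esub> v) = h u \<cdot>\<^bsub>S\<^esub> h v" "u \<in> V"
  shows "spow U u n \<in> V \<and> h (spow U u n) = spow S (h u) n"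
  by (induction n) (use assms in auto)

lemma aperiodic_divides:
  assumes "S \<prec>\<^sub>s U" "finite_sgp U" "aperiodic U" shows "aperiodic S"
proof (rule aperiodicI)
  fix x assume x: "x \<in> carrier S"
  obtain V h where V: "V \<subseteq> carrier U" "\<And>u v. u \<in> V \<Longrightarrow> v \<in> V \<Longrightarrow> u \<cdot>\<^bsub>U\<^esub> v \<in> V"
    "h ` V = carrier S" "\<And>u v. u \<in> V \<Longrightarrow> v \<in> V \<Longrightarrow> h (u \<cdot>\<^bsub>U\<^esub> v) = h u \<cdot>\<^bsub>S\<^esub> h v"
    using dividesE[OF assms(1)] by metis
  obtain u where u: "u \<in> V" "x = h u" using x V(3) by blast
  obtain n where "spow U u (Suc n) = spow U u n" using aperiodicD[OF assms(2,3)] u V(1) by blast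
  then have "spow S x (Suc n) = spow S x n"
    using hom_spow[of V U h S, OF V(2,4) u(1)] u(2) by metis
  then show "\<exists>n. spow S x (Suc n) = spow S x n" ..
qed

lemma aperiodic_wl:
  assumes "\<forall>F\<in>set Fs. factor_ok F \<and> \<not> is_group_factor F"
  shows "aperiodic (sgp_of (wl Fs))"
  using assms
proof (induction Fs)
  case Nil
  have "(\<lambda>qs. if qs = [] then Some [] else None) \<circ>\<^sub>m (\<lambda>qs. if qs = [] then Some [] else None) =
    (\<lambda>qs :: nat list. if qs = [] then Some ([] :: nat list) else None)" by (auto simp: map_comp_def)
  then show ?case by (intro aperiodicI) (auto intro!: exI[of _ 0])
next
  case (Cons F Fs)
  obtain A where A: "F = Aperiodic_Factor A" "is_ts A" "aperiodic (sgp_of A)"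
    using Cons.prems by (cases F) auto
  have W: "is_ts (wl Fs)" using Cons.prems by (intro is_ts_wl) auto
  have "aperiodic (sgp_of (A \<wr> wl Fs))" using aperiodic_wreath[OF A(2,3) W] Cons by simp
  moreover have "sgp_of (wl (F # Fs)) \<prec>\<^sub>s sgp_of (A \<wr> wl Fs)"
    using relabel_divides(1)[OF retr_cons is_ts_wreath[OF A(2) W]] A(1) by (simp add: wreath_list_Cons)
  ultimately show ?case using aperiodic_divides finite_sgp_of[OF is_ts_wreath[OF A(2) W]] by blast
qed

text \<open>Reassociation merges the run As into one wreath product, aperiodic by
  \<open>aperiodic_wreath\<close> and recoded on numbers by the pairing function; an empty run
  becomes a one-point factor.\<close>

lemma sim_aperiodic_prefix:
  assumes "\<forall>F\<in>set As. factor_ok F \<and> \<not> is_group_factor F"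
  shows "\<exists>A :: nat ts. is_ts A \<and> aperiodic (sgp_of A) \<and> sim (A \<wr> wl Fs) (wl (As @ Fs))"
  using assms
proof (induction As)
  case Nil
  define A :: "nat ts" where "A = \<lparr>states = {0}, pfuns = {\<lambda>x. if x = 0 then Some 0 else None}\<rparr>"
  have ww: "(\<lambda>x. if x = 0 then Some 0 else None) \<circ>\<^sub>m (\<lambda>x. if x = 0 then Some 0 else None) =
    (\<lambda>x :: nat. if x = 0 then Some (0 :: nat) else None)" by (auto simp: map_comp_def)
  have "is_ts A" using ww by (auto simp: A_def is_ts_def is_sgp_pfun dom_def ran_def split: if_splits)
  moreover have "aperiodic (sgp_of A)"
    by (rule aperiodicI) (use ww in \<open>auto simp: A_def intro!: exI[of _ 0]\<close>)
  moreover have "sim (A \<wr> wl Fs) (wl Fs)"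
  proof (rule simI[where d = "\<lambda>(a, x). if a = 0 then Some x else None"])
    fix w assume "w \<in> pfuns (wl Fs)"
    then have "wreath_act (\<lambda>_ x. if x = 0 then Some 0 else None) w \<in> pfuns (A \<wr> wl Fs)"
      by (intro wreath_pfunsI) (auto simp: A_def)
    then show "\<exists>v\<in>pfuns (A \<wr> wl Fs). \<forall>z x y. (case z of (a, x) \<Rightarrow> if a = 0 then Some x else None) = Some x \<longrightarrow>
      w x = Some y \<longrightarrow> (\<exists>z'. v z = Some z' \<and> (case z' of (a, x) \<Rightarrow> if a = 0 then Some x else None) = Some y)"
      by (rule bexI[rotated]) (auto simp: wreath_act_Some split: if_splits)
  qed (auto simp: A_def)
  ultimately show ?case by auto
next
  case (Cons F As)
  then obtain A :: "nat ts" where A: "is_ts A" "aperiodic (sgp_of A)" "sim (A \<wr> wl Fs) (wl (As @ Fs))"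
    by auto
  obtain P where P: "F = Aperiodic_Factor P" "is_ts P" "aperiodic (sgp_of P)"
    using Cons.prems by (cases F) auto
  obtain p where p: "p \<in> pfuns P" using is_tsD(3)[OF P(2)] by blast
  note r = retr_bij[OF bij_prod_encode]
  let ?B = "relabel_ts prod_encode (\<lambda>r. Some (inv_into UNIV prod_encode r)) (P \<wr> A)"
  have PA: "is_ts (P \<wr> A)" using P(2) A(1) by (rule is_ts_wreath)
  have B: "is_ts ?B" by (rule is_ts_relabel[OF r PA])
  have "aperiodic (sgp_of ?B)"
    by (rule aperiodic_divides[OF relabel_divides(1)[OF r PA] finite_sgp_of[OF PA]
        aperiodic_wreath[OF P(2,3) A(1,2)]])
  moreover have "sim (?B \<wr> wl Fs) ((P \<wr> A) \<wr> wl Fs)"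
  proof (rule simI[where d = "\<lambda>(n, x). Some (prod_decode n, x)"])
    fix x assume "x \<in> states ((P \<wr> A) \<wr> wl Fs)"
    then show "\<exists>z\<in>states (?B \<wr> wl Fs). (case z of (n, x) \<Rightarrow> Some (prod_decode n, x)) = Some x"
      by (intro bexI[of _ "(prod_encode (fst x), snd x)"]) auto
  next
    fix w assume "w \<in> pfuns ((P \<wr> A) \<wr> wl Fs)"
    then obtain f s where w: "w = wreath_act f s" "s \<in> pfuns (wl Fs)" "\<And>q. q \<in> dom s \<Longrightarrow> f q \<in> pfuns (P \<wr> A)"
      unfolding wreath_pfuns by blast
    let ?f = "\<lambda>q. relabel prod_encode (\<lambda>r. Some (inv_into UNIV prod_encode r)) (f q)"
    have v: "wreath_act ?f s \<in> pfuns (?B \<wr> wl Fs)"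
      using w(2) by (intro wreath_pfunsI) (auto intro!: w(3))
    have i: "inv_into UNIV prod_encode r = prod_decode r" for r
      by (metis inj_prod_encode inv_f_eq prod_decode_inverse)
    show "\<exists>v\<in>pfuns (?B \<wr> wl Fs). \<forall>z x y. (case z of (n, x) \<Rightarrow> Some (prod_decode n, x)) = Some x \<longrightarrow>
      w x = Some y \<longrightarrow> (\<exists>z'. v z = Some z' \<and> (case z' of (n, x) \<Rightarrow> Some (prod_decode n, x)) = Some y)"
    proof (intro bexI[OF _ v] allI impI)
      fix z x y assume z: "(case z of (n, x) \<Rightarrow> Some (prod_decode n, x)) = Some x" and y: "w x = Some y"
      have "x = (prod_decode (fst z), snd z)" using z by (cases z) auto
      then show "\<exists>z'. wreath_act ?f s z = Some z' \<and> (case z' of (n, x) \<Rightarrow> Some (prod_decode n, x)) = Some y"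
        using y by (intro exI[of _ "(prod_encode (fst y), snd y)"])
          (auto simp: w(1) wreath_act_Some relabel_Some i)
    qed
  qed
  moreover have "sim ((P \<wr> A) \<wr> wl Fs) (P \<wr> (A \<wr> wl Fs))" by (rule sim_assoc)
  moreover have "sim (P \<wr> (A \<wr> wl Fs)) (P \<wr> wl (As @ Fs))" by (rule sim_wreath[OF A(3) p])
  moreover have "sim (P \<wr> wl (As @ Fs)) (wl ((F # As) @ Fs))"
    using sim_wl_Cons(2)[of F "As @ Fs"] P(1) by simp
  ultimately show ?case using B by (intro exI[of _ ?B]) (blast intro: sim_trans)
qed

text \<open>The list is split at its leftmost group factor H: the run before it becomes A, and the
  rest T has one group fewer.\<close>

lemma complexity_decompose:
  assumes S: "is_sgp S" "\<not> aperiodic S" and n: "complexity S \<le> enat n"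
  obtains A T :: "nat ts" and H :: "nat monoid" and c x0 where
    "is_ts A" "aperiodic (sgp_of A)" "is_ts T" "Group.group H" "finite (carrier H)"
    "complexity (sgp_of T) + 1 \<le> enat n" "reg_cover (A \<wr> (group_ts H \<wr> T)) S c x0"
proof -
  obtain Fs c x0 where Fs: "\<forall>F\<in>set Fs. factor_ok F" "ngroups Fs \<le> n" "reg_cover (wl Fs) S c x0"
    using n unfolding complexity_le_cover[OF S(1)] by blast
  have W: "is_ts (wl Fs)" using Fs(1) by (intro is_ts_wl) auto
  \<comment> \<open>Without a group factor the whole product is aperiodic, and with it the divisor
    S.\<close>
  have "\<exists>F\<in>set Fs. is_group_factor F"
  proof (rule ccontr)
    assume "\<not> ?thesis"
    then have "aperiodic (sgp_of (wl Fs))" using Fs(1) by (intro aperiodic_wl) auto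
    then show False
      using aperiodic_divides reg_cover_divides[OF Fs(3) S(1) is_tsD(2)[OF W]] finite_sgp_of[OF W] S(2) by blast
  qed
  from split_list_first_prop[OF this] obtain As F Gs where sp: "Fs = As @ F # Gs" "is_group_factor F"
    "\<forall>F\<in>set As. \<not> is_group_factor F" by blast
  obtain H where H: "F = Group_Factor H" using sp(2) by (cases F) auto
  have ok: "\<forall>F\<in>set As. factor_ok F \<and> \<not> is_group_factor F" "Group.group H" "finite (carrier H)"
    "\<And>F. F \<in> set Gs \<Longrightarrow> factor_ok F" using Fs(1) sp H by auto
  obtain A :: "nat ts" where A: "is_ts A" "aperiodic (sgp_of A)" "sim (A \<wr> wl (F # Gs)) (wl Fs)"
    using sim_aperiodic_prefix[OF ok(1)] sp(1) by blast
  note r = retr_bij[OF bij_list_encode]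
  define T where "T = relabel_ts list_encode (\<lambda>r. Some (inv_into UNIV list_encode r)) (wl Gs)"
  have G: "is_ts (wl Gs)" using ok(4) by (rule is_ts_wl)
  have T: "is_ts T" unfolding T_def by (rule is_ts_relabel[OF r G])
  obtain a where a: "a \<in> pfuns A" using is_tsD(3)[OF A(1)] by blast
  have one: "rtrans H \<one>\<^bsub>H\<^esub> \<in> pfuns (group_ts H)" using group_ts_group(1)[OF ok(2)] .
  have "sim (group_ts H \<wr> T) (group_ts H \<wr> wl Gs)"
    unfolding T_def by (rule sim_wreath[OF sim_relabel(1)[OF r] one])
  moreover have "sim (group_ts H \<wr> wl Gs) (wl (F # Gs))" using sim_wl_Cons(2)[of F Gs] H by simp
  ultimately have "sim (A \<wr> (group_ts H \<wr> T)) (A \<wr> wl (F # Gs))"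
    using sim_wreath[OF _ a] sim_trans by blast
  then have "sim (A \<wr> (group_ts H \<wr> T)) (wl Fs)" using A(3) sim_trans by blast
  from reg_cover_sim[OF Fs(3) this] obtain c' x0' where
    cov: "reg_cover (A \<wr> (group_ts H \<wr> T)) S c' x0'" by blast
  have "kr_decomposition (sgp_of T) Gs" unfolding kr_decomposition_def
    using ok(4) relabel_divides(1)[OF r G] by (simp add: T_def)
  then have "complexity (sgp_of T) \<le> enat (ngroups Gs)" unfolding complexity_le_iff by blast
  moreover have "Suc (ngroups Gs) \<le> n" using Fs(2) sp H by simp
  ultimately have "complexity (sgp_of T) + 1 \<le> enat n"
    by (metis add_right_mono enat_ord_simps(1) eSuc_enat order_trans plus_1_eSuc(2))
  then show thesis using that[OF A(1,2) T ok(2,3) _ cov] by blast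
qed

section \<open>Coordinates on a GM semigroup\<close>

lemma option_eqI: "(\<And>w. u = Some w \<longleftrightarrow> v = Some w) \<Longrightarrow> u = v"
  by (cases u; cases v) auto

locale gm =
  fixes S :: "'s sgp" and I :: "'s set" and G :: "'g monoid" and A :: "'a set" and B :: "'b set"
    and C :: "'b \<Rightarrow> 'a \<Rightarrow> 'g option" and \<phi> :: "'s \<Rightarrow> ('a \<times> 'g \<times> 'b) option" and a0 :: 'a
  assumes gm: "GM S I G A B C \<phi>" and a0: "a0 \<in> A"
begin

lemma S: "is_sgp S" and finS: "finite (carrier S)"
  using gm by (auto simp: GM_def finite_sgp_def)

sublocale G: Group.group G
  using gm by (simp add: GM_def)

lemma ideal: "I \<subseteq> carrier S" "x \<in> I \<Longrightarrow> s \<in> carrier S \<Longrightarrow> s \<cdot>\<^bsub>S\<^esub> x \<in> I" "x \<in> I \<Longrightarrow> s \<in> carrier S \<Longrightarrow> x \<cdot>\<^bsub>S\<^esub> s \<in> I"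
proof -
  have "is_ideal S I" using gm by (simp add: GM_def zero_minimal_ideal_def nonzero_ideal_def)
  then show "I \<subseteq> carrier S" "x \<in> I \<Longrightarrow> s \<in> carrier S \<Longrightarrow> s \<cdot>\<^bsub>S\<^esub> x \<in> I"
    "x \<in> I \<Longrightarrow> s \<in> carrier S \<Longrightarrow> x \<cdot>\<^bsub>S\<^esub> s \<in> I" by (auto simp: is_ideal_def)
qed

lemma regular: "x \<in> I \<Longrightarrow> \<exists>y\<in>carrier S. x \<cdot>\<^bsub>S\<^esub> y \<cdot>\<^bsub>S\<^esub> x = x"
  using gm by (auto simp: GM_def)

text \<open>Treats semigroups with and without zero at once: it is left open whether
  \<open>None\<close> is a value of \<open>\<phi>\<close>.\<close>

lemma phi: "inj_on \<phi> I" "Some ` (A \<times> carrier G \<times> B) \<subseteq> \<phi> ` I"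
  "\<phi> ` I \<subseteq> insert None (Some ` (A \<times> carrier G \<times> B))"
  "x \<in> I \<Longrightarrow> y \<in> I \<Longrightarrow> \<phi> (x \<cdot>\<^bsub>S\<^esub> y) = rees_mult G C (\<phi> x) (\<phi> y)"
proof -
  have "sgp_iso (S\<lparr>carrier := I\<rparr>) (rees0 G A B C) \<phi> \<or> sgp_iso (S\<lparr>carrier := I\<rparr>) (rees G A B C) \<phi>"
    using gm unfolding GM_def by (auto split: if_splits)
  then have "inj_on \<phi> I \<and> (\<phi> ` I = insert None (Some ` (A \<times> carrier G \<times> B)) \<or> \<phi> ` I = Some ` (A \<times> carrier G \<times> B))
    \<and> (\<forall>x\<in>I. \<forall>y\<in>I. \<phi> (x \<cdot>\<^bsub>S\<^esub> y) = rees_mult G C (\<phi> x) (\<phi> y))"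
    by (auto simp: sgp_iso_def bij_betw_def rees0_def rees_def)
  then show "inj_on \<phi> I" "Some ` (A \<times> carrier G \<times> B) \<subseteq> \<phi> ` I"
    "\<phi> ` I \<subseteq> insert None (Some ` (A \<times> carrier G \<times> B))"
    "x \<in> I \<Longrightarrow> y \<in> I \<Longrightarrow> \<phi> (x \<cdot>\<^bsub>S\<^esub> y) = rees_mult G C (\<phi> x) (\<phi> y)" by auto
qed

lemma C_closed: "b \<in> B \<Longrightarrow> a \<in> A \<Longrightarrow> C b a = Some c \<Longrightarrow> c \<in> carrier G"
  using gm by (auto simp: GM_def)

definition el :: "'a \<Rightarrow> 'g \<Rightarrow> 'b \<Rightarrow> 's" where
  "el a g b = inv_into I \<phi> (Some (a, g, b))"

lemma el:
  assumes "a \<in> A" "g \<in> carrier G" "b \<in> B"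
  shows "el a g b \<in> I" "\<phi> (el a g b) = Some (a, g, b)"
proof -
  have "Some (a, g, b) \<in> \<phi> ` I" using phi(2) assms by blast
  then show "el a g b \<in> I" "\<phi> (el a g b) = Some (a, g, b)"
    unfolding el_def by (auto intro: inv_into_into f_inv_into_f)
qed

lemma el_eq: "x \<in> I \<Longrightarrow> \<phi> x = Some (a, g, b) \<Longrightarrow> x = el a g b"
  unfolding el_def using phi(1) by (metis inv_into_f_f)

lemma phi_cases:
  assumes "x \<in> I"
  obtains "\<phi> x = None" | a g b where "a \<in> A" "g \<in> carrier G" "b \<in> B" "x = el a g b"
proof (cases "\<phi> x")
  case (Some u)
  obtain a g b where u: "u = (a, g, b)" by (metis prod.exhaust)
  have "\<phi> x \<in> insert None (Some ` (A \<times> carrier G \<times> B))" using phi(3) assms by blast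
  then have "a \<in> A" "g \<in> carrier G" "b \<in> B" using Some u by auto
  moreover have "x = el a g b" using el_eq[OF assms] Some u by simp
  ultimately show thesis by (rule that(2))
qed (rule that(1))

lemma el_mult:
  assumes "a \<in> A" "g \<in> carrier G" "b \<in> B" "a' \<in> A" "h \<in> carrier G" "b' \<in> B" "C b a' = Some c"
  shows "el a g b \<cdot>\<^bsub>S\<^esub> el a' h b' = el a (g \<otimes>\<^bsub>G\<^esub> c \<otimes>\<^bsub>G\<^esub> h) b'"
proof -
  have "\<phi> (el a g b \<cdot>\<^bsub>S\<^esub> el a' h b') = Some (a, g \<otimes>\<^bsub>G\<^esub> c \<otimes>\<^bsub>G\<^esub> h, b')"
    using phi(4) el assms by (simp add: rees_mult_def)
  then show ?thesis using el_eq ideal el assms by (meson subset_iff)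
qed

lemma rees_None: "rees_mult G C None v = None" "rees_mult G C u None = None"
  by (auto simp: rees_mult_def split: option.split)

lemma rees_Some: "rees_mult G C (Some (a, g, b)) (Some (a', h, b')) =
   (case C b a' of None \<Rightarrow> None | Some c \<Rightarrow> Some (a, g \<otimes>\<^bsub>G\<^esub> c \<otimes>\<^bsub>G\<^esub> h, b'))"
  by (auto simp: rees_mult_def)

text \<open>Regularity gives x = x (y x) with y x in I; in Rees coordinates this product is non-zero
  only through a non-zero entry in row b.\<close>

lemma row_nonzero:
  assumes b: "b \<in> B" shows "\<exists>a\<in>A. \<exists>c. C b a = Some c"
proof -
  let ?x = "el a0 \<one>\<^bsub>G\<^esub> b"
  have x: "?x \<in> I" "\<phi> ?x = Some (a0, \<one>\<^bsub>G\<^esub>, b)" using el a0 b by auto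
  obtain y where y: "y \<in> carrier S" "?x \<cdot>\<^bsub>S\<^esub> y \<cdot>\<^bsub>S\<^esub> ?x = ?x" using regular[OF x(1)] by blast
  have yx: "y \<cdot>\<^bsub>S\<^esub> ?x \<in> I" using ideal x y by blast
  have "?x \<cdot>\<^bsub>S\<^esub> (y \<cdot>\<^bsub>S\<^esub> ?x) = ?x" using y is_sgpD(3)[OF S] x(1) ideal(1) by (metis subset_iff)
  then have "rees_mult G C (\<phi> ?x) (\<phi> (y \<cdot>\<^bsub>S\<^esub> ?x)) = \<phi> ?x" using phi(4)[OF x(1) yx] by simp
  then have e: "rees_mult G C (Some (a0, \<one>\<^bsub>G\<^esub>, b)) (\<phi> (y \<cdot>\<^bsub>S\<^esub> ?x)) = Some (a0, \<one>\<^bsub>G\<^esub>, b)" using x by simp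
  show ?thesis
  proof (rule phi_cases[OF yx])
    assume "\<phi> (y \<cdot>\<^bsub>S\<^esub> ?x) = None" then show ?thesis using e by (simp add: rees_None)
  next
    fix a g b' assume h: "a \<in> A" "g \<in> carrier G" "b' \<in> B" "y \<cdot>\<^bsub>S\<^esub> ?x = el a g b'"
    then show ?thesis using e el(2)[OF h(1-3)] h(1) by (auto simp: rees_Some split: option.splits)
  qed
qed

lemma column_nonzero: "\<exists>b\<in>B. \<exists>c. C b a0 = Some c"
proof -
  obtain b where b: "b \<in> B" using gm by (auto simp: GM_def)
  let ?x = "el a0 \<one>\<^bsub>G\<^esub> b"
  have x: "?x \<in> I" "\<phi> ?x = Some (a0, \<one>\<^bsub>G\<^esub>, b)" using el a0 b by auto
  obtain y where y: "y \<in> carrier S" "?x \<cdot>\<^bsub>S\<^esub> y \<cdot>\<^bsub>S\<^esub> ?x = ?x" using regular[OF x(1)] by blast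
  have xy: "?x \<cdot>\<^bsub>S\<^esub> y \<in> I" using ideal x y by blast
  then have "rees_mult G C (\<phi> (?x \<cdot>\<^bsub>S\<^esub> y)) (\<phi> ?x) = \<phi> ?x" using phi(4)[OF xy x(1)] y by simp
  then have e: "rees_mult G C (\<phi> (?x \<cdot>\<^bsub>S\<^esub> y)) (Some (a0, \<one>\<^bsub>G\<^esub>, b)) = Some (a0, \<one>\<^bsub>G\<^esub>, b)" using x by simp
  show ?thesis
  proof (rule phi_cases[OF xy])
    assume "\<phi> (?x \<cdot>\<^bsub>S\<^esub> y) = None" then show ?thesis using e by (simp add: rees_None)
  next
    fix a g b' assume h: "a \<in> A" "g \<in> carrier G" "b' \<in> B" "?x \<cdot>\<^bsub>S\<^esub> y = el a g b'"
    then show ?thesis using e el(2)[OF h(1-3)] h(3) by (auto simp: rees_Some split: option.splits)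
  qed
qed

text \<open>The chosen \<open>\<R>\<close>-class is \<open>\<iota> ` (G \<times> B)\<close>.  It contains the maximal subgroup
  \<open>{lm g | g. g \<in> G}\<close>, through which \<open>G\<close> acts on the left.\<close>

definition \<iota> :: "'g \<times> 'b \<Rightarrow> 's" where "\<iota> y = el a0 (fst y) (snd y)"

definition row :: 'b where "row = (SOME b. b \<in> B \<and> C b a0 \<noteq> None)"

text \<open>The entry at (\<open>row\<close>, a0) is non-zero, so these elements form a group; the
  inverse of that entry normalizes the coordinates so that \<open>lm\<close> becomes
  multiplicative.\<close>

definition lm :: "'g \<Rightarrow> 's" where "lm g = el a0 (g \<otimes>\<^bsub>G\<^esub> inv\<^bsub>G\<^esub> (the (C row a0))) row"

abbreviation act :: "'s \<Rightarrow> 'g \<times> 'b \<rightharpoonup> 'g \<times> 'b" where "act \<equiv> GM_act S I G B \<phi> a0"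

abbreviation rlm :: "'s \<Rightarrow> 'b \<rightharpoonup> 'b" where "rlm \<equiv> RLM_act S I G B \<phi> a0"

abbreviation Y :: "('g \<times> 'b) set" where "Y \<equiv> carrier G \<times> B"

lemma row: "row \<in> B" "C row a0 = Some (the (C row a0))" "the (C row a0) \<in> carrier G"
proof -
  have "\<exists>b. b \<in> B \<and> C b a0 \<noteq> None" using column_nonzero by auto
  from someI_ex[OF this] have h: "row \<in> B \<and> C row a0 \<noteq> None" unfolding row_def .
  then show "row \<in> B" "C row a0 = Some (the (C row a0))" by auto
  then show "the (C row a0) \<in> carrier G" using C_closed a0 by blast
qed

lemma iota_I: "y \<in> Y \<Longrightarrow> \<iota> y \<in> I" and phi_iota: "y \<in> Y \<Longrightarrow> \<phi> (\<iota> y) = Some (a0, y)"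
  using el a0 by (auto simp: \<iota>_def)

lemma iota_S: "y \<in> Y \<Longrightarrow> \<iota> y \<in> carrier S"
  using iota_I ideal(1) by blast

lemma iota_inj: "y \<in> Y \<Longrightarrow> y' \<in> Y \<Longrightarrow> \<iota> y = \<iota> y' \<Longrightarrow> y = y'"
  using phi_iota by (metis option.inject prod.inject)

lemma lm_closed: "g \<in> carrier G \<Longrightarrow> lm g \<in> carrier S"
  unfolding lm_def using el(1) a0 row ideal(1) by (meson G.inv_closed G.m_closed subset_iff)

lemma cancel: "g \<in> carrier G \<Longrightarrow> h \<in> carrier G \<Longrightarrow>
    g \<otimes>\<^bsub>G\<^esub> inv\<^bsub>G\<^esub> (the (C row a0)) \<otimes>\<^bsub>G\<^esub> (the (C row a0)) \<otimes>\<^bsub>G\<^esub> h = g \<otimes>\<^bsub>G\<^esub> h"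
  using row(3) by (simp add: G.m_assoc)

lemma lm_iota: "g \<in> carrier G \<Longrightarrow> y \<in> Y \<Longrightarrow> lm g \<cdot>\<^bsub>S\<^esub> \<iota> y = \<iota> (g \<otimes>\<^bsub>G\<^esub> fst y, snd y)"
  unfolding lm_def \<iota>_def using el_mult[of a0 _ row a0 "fst y" "snd y", OF a0 _ row(1) a0 _ _ row(2)] row(3)
  by (auto simp: cancel)

lemma lm_mult: "g \<in> carrier G \<Longrightarrow> h \<in> carrier G \<Longrightarrow> lm g \<cdot>\<^bsub>S\<^esub> lm h = lm (g \<otimes>\<^bsub>G\<^esub> h)"
  using lm_iota[of g "(h \<otimes>\<^bsub>G\<^esub> inv\<^bsub>G\<^esub> (the (C row a0)), row)"] row
  by (simp add: lm_def \<iota>_def G.m_assoc)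

lemma lm_inj: "g \<in> carrier G \<Longrightarrow> h \<in> carrier G \<Longrightarrow> lm g = lm h \<Longrightarrow> g = h"
  using iota_inj[of "(g \<otimes>\<^bsub>G\<^esub> inv\<^bsub>G\<^esub> (the (C row a0)), row)" "(h \<otimes>\<^bsub>G\<^esub> inv\<^bsub>G\<^esub> (the (C row a0)), row)"] row
  by (auto simp: lm_def \<iota>_def)

text \<open>Every element of the class can be returned to the left identity
  \<open>lm \<one>\<close>; this transfers questions about points of the class to elements over
  \<open>lm \<one>\<close>.\<close>

lemma iota_right_inverse:
  assumes y: "y \<in> Y" shows "\<exists>r\<in>carrier S. \<iota> y \<cdot>\<^bsub>S\<^esub> r = lm \<one>\<^bsub>G\<^esub>"
proof -
  obtain g b where gb: "y = (g, b)" "g \<in> carrier G" "b \<in> B" using y by auto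
  obtain a c where ac: "a \<in> A" "C b a = Some c" using row_nonzero gb by blast
  have c: "c \<in> carrier G" using C_closed gb ac by blast
  \<comment> \<open>Chosen to solve g c k = d, where d is the inverse of the entry at
    (\<open>row\<close>, a0).\<close>
  define k where "k = inv\<^bsub>G\<^esub> (g \<otimes>\<^bsub>G\<^esub> c) \<otimes>\<^bsub>G\<^esub> inv\<^bsub>G\<^esub> (the (C row a0))"
  have k: "k \<in> carrier G" unfolding k_def using gb c row by simp
  have "g \<otimes>\<^bsub>G\<^esub> c \<otimes>\<^bsub>G\<^esub> k = \<one>\<^bsub>G\<^esub> \<otimes>\<^bsub>G\<^esub> inv\<^bsub>G\<^esub> (the (C row a0))"
    unfolding k_def using gb c row(3) by (simp add: G.m_assoc[symmetric])
  then have "\<iota> y \<cdot>\<^bsub>S\<^esub> el a k row = lm \<one>\<^bsub>G\<^esub>"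
    using el_mult[OF a0 gb(2,3) ac(1) k row(1) ac(2)] by (simp add: \<iota>_def lm_def gb)
  moreover have "el a k row \<in> carrier S" using el(1)[OF ac(1) k row(1)] ideal(1) by blast
  ultimately show ?thesis by blast
qed

lemma lm_one_iota: "y \<in> Y \<Longrightarrow> lm \<one>\<^bsub>G\<^esub> \<cdot>\<^bsub>S\<^esub> \<iota> y = \<iota> y"
  by (subst lm_iota) auto

text \<open>The left identity \<open>lm \<one>\<close> fixes the product, so its first Rees
  coordinate is a0 unless it is zero.\<close>

lemma iota_mult_cases:
  assumes y: "y \<in> Y" and s: "s \<in> carrier S"
  shows "\<phi> (\<iota> y \<cdot>\<^bsub>S\<^esub> s) = None \<or> (\<exists>y'\<in>Y. \<iota> y \<cdot>\<^bsub>S\<^esub> s = \<iota> y')"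
proof -
  let ?z = "\<iota> y \<cdot>\<^bsub>S\<^esub> s"
  have z: "?z \<in> I" using ideal iota_I y s by blast
  have l: "lm \<one>\<^bsub>G\<^esub> \<in> I" "\<phi> (lm \<one>\<^bsub>G\<^esub>) = Some (a0, inv\<^bsub>G\<^esub> (the (C row a0)), row)"
    using el a0 row by (auto simp: lm_def)
  have "lm \<one>\<^bsub>G\<^esub> \<cdot>\<^bsub>S\<^esub> ?z = ?z"
    using lm_one_iota[OF y] is_sgpD(3)[OF S] iota_S[OF y] s lm_closed by (metis G.one_closed)
  then have e: "\<phi> ?z = rees_mult G C (Some (a0, inv\<^bsub>G\<^esub> (the (C row a0)), row)) (\<phi> ?z)"
    using phi(4)[OF l(1) z] l(2) by simp
  show ?thesis
  proof (rule phi_cases[OF z])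
    fix a g b assume h: "a \<in> A" "g \<in> carrier G" "b \<in> B" "?z = el a g b"
    have "a = a0" using e el(2)[OF h(1-3)] unfolding h(4) by (auto simp: rees_Some split: option.splits)
    then show ?thesis using h by (intro disjI2 bexI[of _ "(g, b)"]) (auto simp: \<iota>_def)
  qed simp
qed

text \<open>Replaces coordinates by equations in S, the form in which the action is used from here
  on.\<close>

lemma act_Some:
  assumes s: "s \<in> carrier S"
  shows "act s y = Some y' \<longleftrightarrow> y \<in> Y \<and> y' \<in> Y \<and> \<iota> y \<cdot>\<^bsub>S\<^esub> s = \<iota> y'"
proof (cases "y \<in> Y")
  case True
  have eq: "act s y = (case \<phi> (\<iota> y \<cdot>\<^bsub>S\<^esub> s) of None \<Rightarrow> None
     | Some (a, g', b') \<Rightarrow> if a = a0 then Some (g', b') else None)"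
    using True by (auto simp: GM_act_def \<iota>_def el_def split: prod.split)
  from iota_mult_cases[OF True s] show ?thesis
  proof
    assume "\<phi> (\<iota> y \<cdot>\<^bsub>S\<^esub> s) = None"
    then show ?thesis using eq phi_iota by auto
  next
    assume "\<exists>y'\<in>Y. \<iota> y \<cdot>\<^bsub>S\<^esub> s = \<iota> y'"
    then obtain z where z: "z \<in> Y" "\<iota> y \<cdot>\<^bsub>S\<^esub> s = \<iota> z" by blast
    then have "act s y = Some z" using eq phi_iota by auto
    then show ?thesis using z True iota_inj by auto
  qed
qed (auto simp: GM_act_def split: prod.splits if_splits)

lemma act_comp:
  assumes s: "s \<in> carrier S" and t: "t \<in> carrier S"
  shows "act (s \<cdot>\<^bsub>S\<^esub> t) = act t \<circ>\<^sub>m act s"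
proof
  fix y
  have st: "s \<cdot>\<^bsub>S\<^esub> t \<in> carrier S" using is_sgpD(2)[OF S s t] .
  show "act (s \<cdot>\<^bsub>S\<^esub> t) y = (act t \<circ>\<^sub>m act s) y"
  proof (cases "y \<in> Y")
    case False
    then have "act s y = None" "act (s \<cdot>\<^bsub>S\<^esub> t) y = None" using act_Some[OF s] act_Some[OF st] by (metis not_Some_eq)+
    then show ?thesis by simp
  next
    case y: True
    have as: "\<iota> y \<cdot>\<^bsub>S\<^esub> (s \<cdot>\<^bsub>S\<^esub> t) = \<iota> y \<cdot>\<^bsub>S\<^esub> s \<cdot>\<^bsub>S\<^esub> t" using is_sgpD(3)[OF S] iota_S[OF y] s t by simp
    show ?thesis
    proof (cases "act s y")
      case (Some z)
      then have z: "z \<in> Y" "\<iota> y \<cdot>\<^bsub>S\<^esub> s = \<iota> z" using act_Some[OF s] by auto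
      have "act (s \<cdot>\<^bsub>S\<^esub> t) y = Some w \<longleftrightarrow> act t z = Some w" for w
        using act_Some[OF st] act_Some[OF t] as z y by auto
      then have "act (s \<cdot>\<^bsub>S\<^esub> t) y = act t z" by (rule option_eqI)
      then show ?thesis using Some by simp
    next
      case None
      let ?u = "\<iota> y \<cdot>\<^bsub>S\<^esub> s"
      have uI: "?u \<in> I" using ideal iota_I y s by blast
      have u0: "\<phi> ?u = None" using iota_mult_cases[OF y s] None act_Some[OF s] y by (metis option.distinct(1))
      have "act (s \<cdot>\<^bsub>S\<^esub> t) y = None"
      proof (rule ccontr)
        assume "act (s \<cdot>\<^bsub>S\<^esub> t) y \<noteq> None"
        then obtain w where w: "act (s \<cdot>\<^bsub>S\<^esub> t) y = Some w" by blast
        then have wY: "w \<in> Y" "?u \<cdot>\<^bsub>S\<^esub> t = \<iota> w" using act_Some[OF st] as by auto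
        \<comment> \<open>A product that has left the class cannot return: regularity supplies a
          right factor in I, and \<open>\<iota> w\<close> becomes a product of two elements of I,
          the first of which is zero in coordinates.\<close>
        obtain v where v: "v \<in> carrier S" "\<iota> w \<cdot>\<^bsub>S\<^esub> v \<cdot>\<^bsub>S\<^esub> \<iota> w = \<iota> w" using regular[OF iota_I[OF wY(1)]] by blast
        have uS: "?u \<in> carrier S" using uI ideal by blast
        have vw: "v \<cdot>\<^bsub>S\<^esub> \<iota> w \<in> I" using ideal iota_I wY v by blast
        then have tvw: "t \<cdot>\<^bsub>S\<^esub> (v \<cdot>\<^bsub>S\<^esub> \<iota> w) \<in> I" using ideal t by blast
        have "?u \<cdot>\<^bsub>S\<^esub> (t \<cdot>\<^bsub>S\<^esub> (v \<cdot>\<^bsub>S\<^esub> \<iota> w)) = ?u \<cdot>\<^bsub>S\<^esub> t \<cdot>\<^bsub>S\<^esub> (v \<cdot>\<^bsub>S\<^esub> \<iota> w)"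
          using is_sgpD(3)[OF S uS t] vw ideal by (metis subset_iff)
        also have "\<dots> = \<iota> w" unfolding wY(2) using v is_sgpD(3)[OF S iota_S[OF wY(1)] v(1) iota_S[OF wY(1)]] by simp
        finally have "\<phi> (\<iota> w) = None" using phi(4)[OF uI tvw] u0 by (simp add: rees_None)
        then show False using phi_iota[OF wY(1)] by simp
      qed
      then show ?thesis using None by simp
    qed
  qed
qed

lemma act_left:
  assumes s: "s \<in> carrier S" and h: "h \<in> carrier G" and a: "act s (g, b) = Some (k, b')"
  shows "act s (h \<otimes>\<^bsub>G\<^esub> g, b) = Some (h \<otimes>\<^bsub>G\<^esub> k, b')"
proof -
  have e: "(g, b) \<in> Y" "(k, b') \<in> Y" "\<iota> (g, b) \<cdot>\<^bsub>S\<^esub> s = \<iota> (k, b')" using a act_Some[OF s] by auto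
  have "\<iota> (h \<otimes>\<^bsub>G\<^esub> g, b) \<cdot>\<^bsub>S\<^esub> s = lm h \<cdot>\<^bsub>S\<^esub> (\<iota> (g, b) \<cdot>\<^bsub>S\<^esub> s)"
    using lm_iota[OF h e(1)] is_sgpD(3)[OF S lm_closed[OF h] iota_S[OF e(1)] s] by simp
  also have "\<dots> = \<iota> (h \<otimes>\<^bsub>G\<^esub> k, b')" using lm_iota[OF h e(2)] e(3) by simp
  finally show ?thesis using act_Some[OF s] e h by auto
qed

lemma G_nontrivial: "\<exists>g\<in>carrier G. g \<noteq> \<one>\<^bsub>G\<^esub>"
proof -
  have "carrier G \<noteq> {\<one>\<^bsub>G\<^esub>}" using gm unfolding GM_def by blast
  then show ?thesis using G.one_closed by blast
qed

text \<open>Identifies the class on which S is assumed to act faithfully with the one in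
  coordinates. Any two of its points reach each other through \<open>lm \<one>\<close>; conversely,
  a product that can be undone stays in the class.\<close>

lemma R_class_iota:
  assumes x: "x \<in> Y" shows "R_class S (\<iota> x) = \<iota> ` Y"
proof -
  have cov1: "\<iota> y \<in> insert (\<iota> z) ((\<lambda>s. \<iota> z \<cdot>\<^bsub>S\<^esub> s) ` carrier S)"
    and cov2: "(\<iota> y \<cdot>\<^bsub>S\<^esub> s) \<in> (\<lambda>s. \<iota> z \<cdot>\<^bsub>S\<^esub> s) ` carrier S" if h: "y \<in> Y" "z \<in> Y" "s \<in> carrier S" for y z s
  proof -
    obtain r where r: "r \<in> carrier S" "\<iota> z \<cdot>\<^bsub>S\<^esub> r = lm \<one>\<^bsub>G\<^esub>" using iota_right_inverse h by blast
    have e: "\<iota> z \<cdot>\<^bsub>S\<^esub> (r \<cdot>\<^bsub>S\<^esub> \<iota> y) = \<iota> y"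
      using r lm_one_iota[OF h(1)] is_sgpD(3)[OF S iota_S[OF h(2)] r(1) iota_S[OF h(1)]] by simp
    have ry: "r \<cdot>\<^bsub>S\<^esub> \<iota> y \<in> carrier S" using is_sgpD(2)[OF S r(1) iota_S[OF h(1)]] .
    show "\<iota> y \<in> insert (\<iota> z) ((\<lambda>s. \<iota> z \<cdot>\<^bsub>S\<^esub> s) ` carrier S)" using e ry by force
    have "\<iota> z \<cdot>\<^bsub>S\<^esub> (r \<cdot>\<^bsub>S\<^esub> \<iota> y \<cdot>\<^bsub>S\<^esub> s) = \<iota> y \<cdot>\<^bsub>S\<^esub> s"
      using is_sgpD(3)[OF S iota_S[OF h(2)] ry h(3)] e by simp
    moreover have "r \<cdot>\<^bsub>S\<^esub> \<iota> y \<cdot>\<^bsub>S\<^esub> s \<in> carrier S" using is_sgpD(2)[OF S ry h(3)] .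
    ultimately show "(\<iota> y \<cdot>\<^bsub>S\<^esub> s) \<in> (\<lambda>s. \<iota> z \<cdot>\<^bsub>S\<^esub> s) ` carrier S" by force
  qed
  have sub: "insert (\<iota> y) ((\<lambda>s. \<iota> y \<cdot>\<^bsub>S\<^esub> s) ` carrier S) \<subseteq> insert (\<iota> z) ((\<lambda>s. \<iota> z \<cdot>\<^bsub>S\<^esub> s) ` carrier S)"
    if h: "y \<in> Y" "z \<in> Y" for y z
  proof -
    obtain s where "s \<in> carrier S" using is_sgpD(1)[OF S] by blast
    then show ?thesis using cov1[OF h] cov2[OF h] by blast
  qed
  have "\<iota> y \<in> R_class S (\<iota> x)" if "y \<in> Y" for y
    unfolding R_class_def using sub[OF x that] sub[OF that x] iota_S[OF that] by blast
  moreover have "z \<in> \<iota> ` Y" if z: "z \<in> R_class S (\<iota> x)" for z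
  proof -
    have zS: "z \<in> carrier S" and zx: "z = \<iota> x \<or> (\<exists>s\<in>carrier S. z = \<iota> x \<cdot>\<^bsub>S\<^esub> s)"
      and xz: "\<iota> x = z \<or> (\<exists>s\<in>carrier S. \<iota> x = z \<cdot>\<^bsub>S\<^esub> s)" using z unfolding R_class_def by blast+
    show ?thesis
    proof (cases "z = \<iota> x")
      case False
      obtain s where s: "s \<in> carrier S" "z = \<iota> x \<cdot>\<^bsub>S\<^esub> s" using False zx by blast
      obtain t where t: "t \<in> carrier S" "\<iota> x = z \<cdot>\<^bsub>S\<^esub> t" using False xz by blast
      have "\<iota> x \<cdot>\<^bsub>S\<^esub> (s \<cdot>\<^bsub>S\<^esub> t) = \<iota> x" using s t is_sgpD(3)[OF S iota_S[OF x] s(1) t(1)] by simp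
      then have "act (s \<cdot>\<^bsub>S\<^esub> t) x = Some x" using act_Some[OF is_sgpD(2)[OF S s(1) t(1)]] x by blast
      then obtain y where "act s x = Some y" unfolding act_comp[OF s(1) t(1)] by (auto simp: map_comp_Some_iff)
      then show ?thesis using act_Some[OF s(1)] s(2) by auto
    qed (use x in blast)
  qed
  ultimately show ?thesis by blast
qed

text \<open>Non-triviality of G enters here: a zero would be fixed by every \<open>lm g\<close>,
  which moves all points for g \<noteq> \<one>.\<close>

lemma iota_nonzero: assumes y: "y \<in> Y" shows "\<not> is_zero S (\<iota> y)"
proof
  assume z: "is_zero S (\<iota> y)"
  obtain g where g: "g \<in> carrier G" "g \<noteq> \<one>\<^bsub>G\<^esub>" using G_nontrivial by blast
  have "lm g \<cdot>\<^bsub>S\<^esub> \<iota> y = \<iota> y" using z lm_closed[OF g(1)] by (simp add: is_zero_def)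
  then have "(g \<otimes>\<^bsub>G\<^esub> fst y, snd y) = y" using lm_iota[OF g(1) y] iota_inj[OF _ y] g(1) y by auto
  then have "g \<otimes>\<^bsub>G\<^esub> fst y = fst y" by (metis fst_conv)
  then show False using g y by auto
qed

lemma Y_nonempty: "Y \<noteq> {}"
proof -
  have "B \<noteq> {}" using gm unfolding GM_def by blast
  then show ?thesis using G.one_closed by blast
qed

lemma act_inj: "inj_on act (carrier S)"
proof (rule inj_onI)
  fix s t assume s: "s \<in> carrier S" and t: "t \<in> carrier S" and e: "act s = act t"
  obtain x where x: "x \<in> Y" using Y_nonempty by blast
  have "inj_on (right_schutz S (R_class S (\<iota> x))) (carrier S)"
    using gm iota_I[OF x] iota_nonzero[OF x] unfolding GM_def by blast
  then have inj: "inj_on (right_schutz S (\<iota> ` Y)) (carrier S)" unfolding R_class_iota[OF x] .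
  have "right_schutz S (\<iota> ` Y) s r = right_schutz S (\<iota> ` Y) t r" for r
  proof (cases "r \<in> \<iota> ` Y")
    case True
    then obtain y where y: "y \<in> Y" "r = \<iota> y" by blast
    have "right_schutz S (\<iota> ` Y) u r = map_option \<iota> (act u y)" if u: "u \<in> carrier S" for u
    proof (cases "act u y")
      case None
      then have "r \<cdot>\<^bsub>S\<^esub> u \<notin> \<iota> ` Y" using act_Some[OF u, of y] y by auto
      then show ?thesis using None by (simp add: right_schutz_def)
    next
      case (Some z)
      then show ?thesis using act_Some[OF u, of y z] y by (auto simp: right_schutz_def)
    qed
    then show ?thesis using e s t by simp
  qed (simp add: right_schutz_def)
  then show "s = t" using inj s t by (meson ext inj_onD)
qed

lemma finite_Y: "finite (carrier G)" "finite B"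
proof -
  have "inj_on \<iota> Y" using iota_inj by (rule inj_onI)
  then have "finite Y" using iota_S finS by (meson finite_subset finite_imageD image_subsetI)
  then show "finite (carrier G)" "finite B"
    using Y_nonempty by (auto simp: finite_cartesian_product_iff)
qed

lemma spow_lm: "g \<in> carrier G \<Longrightarrow> spow S (lm g) n = lm (g [^]\<^bsub>G\<^esub> Suc n)"
proof (induction n)
  case (Suc n)
  then have "spow S (lm g) (Suc n) = lm (g [^]\<^bsub>G\<^esub> Suc n \<otimes>\<^bsub>G\<^esub> g)" using lm_mult[of "g [^]\<^bsub>G\<^esub> Suc n" g] by simp
  then show ?case by simp
qed simp

lemma lm_stable:
  assumes g: "g \<in> carrier G" and e: "spow S (lm g) (Suc n) = spow S (lm g) n" shows "g = \<one>\<^bsub>G\<^esub>"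
proof -
  have "lm (g [^]\<^bsub>G\<^esub> Suc (Suc n)) = lm (g [^]\<^bsub>G\<^esub> Suc n)" using e unfolding spow_lm[OF g] .
  then have "g [^]\<^bsub>G\<^esub> Suc (Suc n) = g [^]\<^bsub>G\<^esub> Suc n" using lm_inj g by blast
  then have "g [^]\<^bsub>G\<^esub> Suc n \<otimes>\<^bsub>G\<^esub> g = g [^]\<^bsub>G\<^esub> Suc n" by simp
  then show ?thesis using G.l_cancel_one[of "g [^]\<^bsub>G\<^esub> Suc n" g] g by blast
qed

text \<open>S contains the non-trivial group of all \<open>lm g\<close>; this makes
  \<open>complexity_decompose\<close> applicable.\<close>

lemma not_aperiodic: "\<not> aperiodic S"
proof
  assume ap: "aperiodic S"
  have fin: "finite_sgp S" using S finS by (simp add: finite_sgp_def)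
  have "\<exists>n. spow S x (Suc n) = spow S x n" if "x \<in> carrier S" for x
    by (rule aperiodicD[OF fin ap that])
  then have "g = \<one>\<^bsub>G\<^esub>" if "g \<in> carrier G" for g
    using lm_closed[OF that] lm_stable[OF that] by blast
  then show False using G_nontrivial by blast
qed

text \<open>Left translation carries the representative (\<one>, b) to (g, b), so any g may be used
  to read off the action on B.\<close>

lemma rlm_Some:
  assumes s: "s \<in> carrier S" and g: "g \<in> carrier G"
  shows "rlm s b = Some b' \<longleftrightarrow> (\<exists>k. act s (g, b) = Some (k, b'))"
proof
  assume "rlm s b = Some b'"
  then obtain k where "act s (\<one>\<^bsub>G\<^esub>, b) = Some (k, b')" by (auto simp: RLM_act_def)
  from act_left[OF s g this] show "\<exists>k. act s (g, b) = Some (k, b')" using g by auto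
next
  assume "\<exists>k. act s (g, b) = Some (k, b')"
  then obtain k where "act s (g, b) = Some (k, b')" ..
  from act_left[OF s _ this, of "inv\<^bsub>G\<^esub> g"] show "rlm s b = Some b'" using g by (auto simp: RLM_act_def)
qed

lemma rlm_comp:
  assumes s: "s \<in> carrier S" and t: "t \<in> carrier S"
  shows "rlm (s \<cdot>\<^bsub>S\<^esub> t) = rlm t \<circ>\<^sub>m rlm s"
proof
  fix b
  have "rlm (s \<cdot>\<^bsub>S\<^esub> t) b = Some b' \<longleftrightarrow> (rlm t \<circ>\<^sub>m rlm s) b = Some b'" for b'
  proof -
    have "rlm (s \<cdot>\<^bsub>S\<^esub> t) b = Some b' \<longleftrightarrow> (\<exists>k. act (s \<cdot>\<^bsub>S\<^esub> t) (\<one>\<^bsub>G\<^esub>, b) = Some (k, b'))"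
      by (rule rlm_Some[OF is_sgpD(2)[OF S s t]]) simp
    also have "\<dots> \<longleftrightarrow> (\<exists>k g b1. act s (\<one>\<^bsub>G\<^esub>, b) = Some (g, b1) \<and> act t (g, b1) = Some (k, b'))"
      unfolding act_comp[OF s t] by (auto simp: map_comp_Some_iff)
    also have "\<dots> \<longleftrightarrow> (\<exists>b1. rlm s b = Some b1 \<and> rlm t b1 = Some b')"
    proof -
      have "g \<in> carrier G" if "act s (\<one>\<^bsub>G\<^esub>, b) = Some (g, b1)" for g b1 using act_Some[OF s] that by auto
      then show ?thesis using rlm_Some[OF s G.one_closed] rlm_Some[OF t] by metis
    qed
    finally show ?thesis by (auto simp: map_comp_Some_iff)
  qed
  then show "rlm (s \<cdot>\<^bsub>S\<^esub> t) b = (rlm t \<circ>\<^sub>m rlm s) b" by (rule option_eqI)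
qed

abbreviation P where "P \<equiv> GM_ts S I G B \<phi> a0"
abbreviation RL where "RL \<equiv> RLM S I G B \<phi> a0"

lemma P_simps [simp]: "states P = Y" "pfuns P = act ` carrier S"
  by (simp_all add: GM_ts_def)

lemma RL_simps [simp]: "states RL = B" "pfuns RL = rlm ` carrier S"
  by (simp_all add: RLM_def)

lemma is_sgp_RL: "is_sgp (sgp_of RL)"
proof -
  have "rlm t \<circ>\<^sub>m rlm s \<in> rlm ` carrier S" if "s \<in> carrier S" "t \<in> carrier S" for s t
    using rlm_comp[OF that] is_sgpD(2)[OF S that] by (metis imageI)
  then show ?thesis using is_sgpD(1)[OF S] unfolding is_sgp_pfun by auto
qed

end

section \<open>Permutations\<close>

lemma sym_tsI:
  assumes D: "finite D" and m: "\<And>x. x \<in> D \<Longrightarrow> \<exists>y\<in>D. m x = Some y" "\<And>x. x \<notin> D \<Longrightarrow> m x = None"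
    "\<And>x x' y. m x = Some y \<Longrightarrow> m x' = Some y \<Longrightarrow> x = x'"
  shows "m \<in> pfuns (sym_ts D)"
proof -
  define \<pi> where "\<pi> x = the (m x)" for x
  have e: "m x = Some (\<pi> x) \<and> \<pi> x \<in> D" if "x \<in> D" for x using m(1)[OF that] by (auto simp: \<pi>_def)
  have "inj_on \<pi> D" using e m(3) by (metis inj_onI)
  moreover have "\<pi> ` D \<subseteq> D" using e by blast
  ultimately have "bij_betw \<pi> D D" using D by (simp add: bij_betw_def endo_inj_surj)
  moreover have "m = (\<lambda>b. if b \<in> D then Some (\<pi> b) else None)" using e m(2) by (auto simp: fun_eq_iff)
  ultimately show ?thesis by (auto simp: sym_ts_def)
qed

lemma sym_ts_simps [simp]: "states (sym_ts D) = D"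
  by (simp add: sym_ts_def)

lemma sym_ts_bijI: "bij_betw \<pi> D D \<Longrightarrow> (\<lambda>b. if b \<in> D then Some (\<pi> b) else None) \<in> pfuns (sym_ts D)"
  by (auto simp: sym_ts_def)

lemma sym_tsE:
  assumes "m \<in> pfuns (sym_ts D)"
  obtains \<pi> where "bij_betw \<pi> D D" "m = (\<lambda>b. if b \<in> D then Some (\<pi> b) else None)"
  using assms by (auto simp: sym_ts_def)

lemma sym_ts_group:
  fixes D :: "'d set"
  defines "e \<equiv> (\<lambda>b. if b \<in> D then Some b else None)"
  shows "e \<in> pfuns (sym_ts D)" "m \<in> pfuns (sym_ts D) \<Longrightarrow> m \<circ>\<^sub>m e = m"
    "m \<in> pfuns (sym_ts D) \<Longrightarrow> e \<circ>\<^sub>m m = m"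
    "m \<in> pfuns (sym_ts D) \<Longrightarrow> \<exists>m'\<in>pfuns (sym_ts D). m' \<circ>\<^sub>m m = e \<and> m \<circ>\<^sub>m m' = e"
    "m \<in> pfuns (sym_ts D) \<Longrightarrow> m' \<in> pfuns (sym_ts D) \<Longrightarrow> m' \<circ>\<^sub>m m \<in> pfuns (sym_ts D)"
proof -
  have "bij_betw (\<lambda>b. b) D D" by (simp add: bij_betw_def)
  then show "e \<in> pfuns (sym_ts D)" unfolding e_def by (rule sym_ts_bijI)
  assume m: "m \<in> pfuns (sym_ts D)"
  obtain \<pi> where p: "bij_betw \<pi> D D" "m = (\<lambda>b. if b \<in> D then Some (\<pi> b) else None)"
    by (rule sym_tsE[OF m])
  have pD: "\<pi> x \<in> D" if "x \<in> D" for x using p(1) that by (rule bij_betwE[rule_format])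
  show "m \<circ>\<^sub>m e = m" "e \<circ>\<^sub>m m = m" using pD by (auto simp: p(2) e_def map_comp_def)
  let ?i = "inv_into D \<pi>"
  have i: "bij_betw ?i D D" using p(1) by (rule bij_betw_inv_into)
  have iD: "?i x \<in> D" if "x \<in> D" for x using i that by (rule bij_betwE[rule_format])
  let ?m = "\<lambda>b. if b \<in> D then Some (?i b) else None"
  have "?m \<in> pfuns (sym_ts D)" using i by (rule sym_ts_bijI)
  moreover have "?m \<circ>\<^sub>m m = e" "m \<circ>\<^sub>m ?m = e"
    using pD iD bij_betw_inv_into_left[OF p(1)] bij_betw_inv_into_right[OF p(1)]
    by (auto simp: p(2) e_def map_comp_def)
  ultimately show "\<exists>m'\<in>pfuns (sym_ts D). m' \<circ>\<^sub>m m = e \<and> m \<circ>\<^sub>m m' = e" by blast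
  assume m': "m' \<in> pfuns (sym_ts D)"
  obtain \<sigma> where s: "bij_betw \<sigma> D D" "m' = (\<lambda>b. if b \<in> D then Some (\<sigma> b) else None)"
    by (rule sym_tsE[OF m'])
  have "m' \<circ>\<^sub>m m = (\<lambda>b. if b \<in> D then Some ((\<sigma> \<circ> \<pi>) b) else None)"
    using pD by (auto simp: s p map_comp_def)
  moreover have "bij_betw (\<sigma> \<circ> \<pi>) D D" using p(1) s(1) by (rule bij_betw_trans)
  ultimately show "m' \<circ>\<^sub>m m \<in> pfuns (sym_ts D)" using sym_ts_bijI by metis
qed

lemma is_ts_sym_ts: assumes "finite D" shows "is_ts (sym_ts D)"
proof -
  have "dom m \<subseteq> D \<and> ran m \<subseteq> D" if h: "m \<in> pfuns (sym_ts D)" for m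
  proof -
    obtain \<pi> where p: "bij_betw \<pi> D D" "m = (\<lambda>b. if b \<in> D then Some (\<pi> b) else None)"
      by (rule sym_tsE[OF h])
    then show ?thesis using bij_betwE[OF p(1)] by (auto simp: dom_def ran_def split: if_splits)
  qed
  then show ?thesis using assms sym_ts_group(1,5)[where D = D] unfolding is_ts_def is_sgp_pfun by auto
qed

text \<open>Domain and image of m have the same size, hence so do their complements in the finite
  set D, and any bijection between the complements completes m.\<close>

lemma extend_partial_injection:
  assumes D: "finite D" and m: "\<And>x y. m x = Some y \<Longrightarrow> x \<in> D \<and> y \<in> D"
    "\<And>x x' y. m x = Some y \<Longrightarrow> m x' = Some y \<Longrightarrow> x = x'"
  shows "\<exists>p\<in>pfuns (sym_ts D). \<forall>x y. m x = Some y \<longrightarrow> p x = Some y"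
proof -
  have sub: "dom m \<subseteq> D" "ran m \<subseteq> D" using m(1) by (auto simp: dom_def ran_def)
  have "inj_on (the \<circ> m) (dom m)" using m(2) by (auto simp: inj_on_def dom_def)
  moreover have "(the \<circ> m) ` dom m = ran m" by (force simp: dom_def ran_def image_def)
  ultimately have "card (ran m) = card (dom m)" by (metis card_image)
  then have "card (D - dom m) = card (D - ran m)"
    using sub D by (simp add: card_Diff_subset finite_subset)
  then obtain h where h: "bij_betw h (D - dom m) (D - ran m)"
    using finite_same_card_bij[of "D - dom m" "D - ran m"] D by auto
  define p where "p x = (if x \<in> D then (case m x of Some y \<Rightarrow> Some y | None \<Rightarrow> Some (h x)) else None)" for x
  have hx: "h x \<in> D - ran m" if "x \<in> D" "m x = None" for x
    using bij_betwE[OF h] that by (auto simp: dom_def)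
  have "p \<in> pfuns (sym_ts D)"
  proof (rule sym_tsI[OF D])
    show "\<exists>y\<in>D. p x = Some y" if "x \<in> D" for x
      using that m(1) hx[OF that] by (auto simp: p_def split: option.split)
    show "x = x'" if e: "p x = Some y" "p x' = Some y" for x x' y
    proof (cases "m x"; cases "m x'")
      assume "m x = None" "m x' = None"
      then show ?thesis using e bij_betw_imp_inj_on[OF h] by (auto simp: p_def inj_on_def dom_def split: if_splits)
    next
      fix z assume "m x = None" "m x' = Some z"
      then show ?thesis using e hx[of x] by (auto simp: p_def ran_def split: if_splits)
    next
      fix z assume "m x = Some z" "m x' = None"
      then show ?thesis using e hx[of x'] by (auto simp: p_def ran_def split: if_splits)
    next
      fix z z' assume "m x = Some z" "m x' = Some z'"
      then show ?thesis using e m(2) by (auto simp: p_def split: if_splits)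
    qed
  qed (simp add: p_def)
  moreover have "p x = Some y" if "m x = Some y" for x y using that m(1) by (auto simp: p_def)
  ultimately show ?thesis by blast
qed

text \<open>The bound n - 1 is written as c + 1 \<le> n, so that it fails for n = 0.\<close>

lemma enat_Suc_le:
  assumes "c + 1 \<le> enat n" obtains m where "n = Suc m" "c \<le> enat m"
proof (cases n)
  case 0 then show thesis using assms by (simp add: enat_0)
next
  case (Suc m)
  then show thesis using assms that[of m] by (simp flip: eSuc_enat plus_1_eSuc(2))
qed

text \<open>For each state q of T the two upper components together permute G \<times> B, so they
  merge into one symmetric group and cost one group instead of two.\<close>

lemma group_sym_divides:
  fixes G :: "'g monoid" and B :: "'b set" and T :: "'q ts"
  assumes G: "Group.group G" "finite (carrier G)" and B: "finite B" and T: "is_ts T"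
  shows "sgp_of (group_ts G \<wr> sym_ts B \<wr> T) \<prec>\<^sub>s sgp_of (sym_ts (carrier G \<times> B) \<wr> T)"
proof -
  interpret Group.group G by (fact G(1))
  have ts: "is_ts (group_ts G \<wr> sym_ts B \<wr> T)" "is_ts (sym_ts (carrier G \<times> B) \<wr> T)"
    using is_ts_wreath[OF is_ts_group_ts[OF is_monoid G(2)] is_ts_wreath[OF is_ts_sym_ts[OF B] T]]
      is_ts_wreath[OF is_ts_sym_ts[of "carrier G \<times> B"] T] G(2) B by auto
  define e where "e = (\<lambda>((g :: 'g, b :: 'b), q :: 'q). (g, b, q))"
  define \<rho> where "\<rho> w v \<longleftrightarrow> (\<forall>x. v (e x) = map_option e (w x))" for w v
  show ?thesis
  proof (rule divides_rel[where \<rho> = \<rho>])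
    show "is_sgp (sgp_of (group_ts G \<wr> sym_ts B \<wr> T))" using is_tsD(2)[OF ts(1)] .
    show "u \<cdot>\<^bsub>sgp_of (sym_ts (carrier G \<times> B) \<wr> T)\<^esub> v \<in> carrier (sgp_of (sym_ts (carrier G \<times> B) \<wr> T))"
      if "u \<in> carrier (sgp_of (sym_ts (carrier G \<times> B) \<wr> T))" "v \<in> carrier (sgp_of (sym_ts (carrier G \<times> B) \<wr> T))"
      for u v using is_sgpD(2)[OF is_tsD(2)[OF ts(2)] that] .
    show "s = t" if h: "\<rho> u s" "\<rho> u t" for u s t
    proof
      fix y :: "'g \<times> 'b \<times> 'q"
      obtain x where "y = e x" by (cases y) (auto simp: e_def)
      then show "s y = t y" using h unfolding \<rho>_def by metis
    qed
    show "\<rho> (u \<cdot>\<^bsub>sgp_of (sym_ts (carrier G \<times> B) \<wr> T)\<^esub> v) (s \<cdot>\<^bsub>sgp_of (group_ts G \<wr> sym_ts B \<wr> T)\<^esub> t)"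
      if h: "\<rho> u s" "\<rho> v t" for u v s t
      using h by (auto simp: \<rho>_def map_comp_def split: option.split)
    show "\<exists>u\<in>carrier (sgp_of (sym_ts (carrier G \<times> B) \<wr> T)). \<rho> u v"
      if vP: "v \<in> carrier (sgp_of (group_ts G \<wr> sym_ts B \<wr> T))" for v
    proof -
      have vP': "v \<in> pfuns (group_ts G \<wr> sym_ts B \<wr> T)" using vP by simp
      obtain f s where v: "v = wreath_act f s" "s \<in> pfuns (sym_ts B \<wr> T)"
        "\<And>q. q \<in> dom s \<Longrightarrow> f q \<in> rtrans G ` carrier G"
        using vP' unfolding wreath_pfuns[of v] group_ts_simps by blast
      obtain g t where s: "s = wreath_act g t" "t \<in> pfuns T" "\<And>q. q \<in> dom t \<Longrightarrow> g q \<in> pfuns (sym_ts B)"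
        using v(2) unfolding wreath_pfuns by blast
      define k where "k q = (\<lambda>(h, b). case wreath_act (\<lambda>b. f (b, q)) (g q) (h, b) of None \<Rightarrow> None | Some y \<Rightarrow> Some y)" for q
      have "k q \<in> pfuns (sym_ts (carrier G \<times> B))" if q: "t q = Some q'" for q q'
      proof (rule sym_tsI)
        show "finite (carrier G \<times> B)" using G(2) B by simp
        have "g q \<in> pfuns (sym_ts B)" using s(3) q by blast
        then obtain \<pi> where p: "bij_betw \<pi> B B" "g q = (\<lambda>b. if b \<in> B then Some (\<pi> b) else None)"
          by (rule sym_tsE)
        have f: "\<exists>h\<in>carrier G. f (b, q) = rtrans G h" if "b \<in> B" for b
        proof -
          have "(b, q) \<in> dom s" using p(2) q that by (simp add: s(1) wreath_act_simp dom_def)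
          then show ?thesis using v(3) by blast
        qed
        show "\<exists>y\<in>carrier G \<times> B. k q x = Some y" if x: "x \<in> carrier G \<times> B" for x
        proof -
          obtain h b where hb: "x = (h, b)" "h \<in> carrier G" "b \<in> B" using x by blast
          obtain h' where h': "h' \<in> carrier G" "f (b, q) = rtrans G h'" using f hb by blast
          have "\<pi> b \<in> B" using p(1) hb(3) bij_betwE by blast
          then show ?thesis using hb h' p(2)
            by (intro bexI[of _ "(h \<otimes>\<^bsub>G\<^esub> h', \<pi> b)"]) (auto simp: k_def wreath_act_simp)
        qed
        show "k q x = None" if x: "x \<notin> carrier G \<times> B" for x
        proof -
          obtain h b where hb: "x = (h, b)" by (cases x)
          show ?thesis
          proof (cases "b \<in> B")
            case True
            then obtain h' where "f (b, q) = rtrans G h'" using f by blast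
            then show ?thesis using x hb True by (auto simp: k_def wreath_act_simp p(2))
          qed (simp add: k_def wreath_act_simp p(2) hb)
        qed
        show "x = x'" if kq: "k q x = Some y" "k q x' = Some y" for x x' y
        proof -
          obtain h b where hb: "x = (h, b)" by (cases x)
          obtain h' b' where hb': "x' = (h', b')" by (cases x')
          have w: "wreath_act (\<lambda>b. f (b, q)) (g q) (h, b) = Some y" "wreath_act (\<lambda>b. f (b, q)) (g q) (h', b') = Some y"
            using kq by (auto simp: k_def hb hb' split: option.splits)
          then have 1: "b \<in> B" "b' \<in> B" "\<pi> b = snd y" "\<pi> b' = snd y"
            unfolding wreath_act_Some p(2) by (auto split: if_splits)
          then have bb: "b = b'" using bij_betw_imp_inj_on[OF p(1)] by (simp add: inj_on_def)
          obtain j where j: "j \<in> carrier G" "f (b, q) = rtrans G j" using f 1(1) by blast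
          have "h \<in> carrier G" "h' \<in> carrier G" "h \<otimes>\<^bsub>G\<^esub> j = h' \<otimes>\<^bsub>G\<^esub> j"
            using w j unfolding wreath_act_Some bb by (auto split: if_splits)
          then show ?thesis using j(1) bb hb hb' by simp
        qed
      qed
      then have "wreath_act k t \<in> pfuns (sym_ts (carrier G \<times> B) \<wr> T)" using s(2) by (intro wreath_pfunsI)
      moreover have "\<rho> (wreath_act k t) v"
        by (auto simp: \<rho>_def e_def v(1) s(1) k_def wreath_act_simp split: option.split)
      ultimately show ?thesis by (intro bexI[of _ "wreath_act k t"]) simp_all
    qed
  qed
qed

lemma sgp_generated_closed: "sgp_generated S X \<subseteq> V"
  if "X \<subseteq> V" "\<And>x y. x \<in> V \<Longrightarrow> y \<in> V \<Longrightarrow> x \<cdot>\<^bsub>S\<^esub> y \<in> V"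
proof
  fix x assume "x \<in> sgp_generated S X"
  then show "x \<in> V" by induction (use that in auto)
qed

section \<open>Bounding the complexity by permutations and RLM(S)\<close>

context gm
begin

text \<open>The common end of 4-1 and 6-1: permutations of a finite set add one group to T, and the
  factor RLM(S) is absorbed because a direct product costs only the maximum.\<close>

lemma complexity_le_sym:
  assumes T: "is_ts T" "complexity (sgp_of T) + 1 \<le> enat n" and D: "finite D"
    and RL: "complexity (sgp_of RL) \<le> enat n"
    and div: "S \<prec>\<^sub>s sgp_times U (sgp_of RL)" and U: "U \<prec>\<^sub>s sgp_of (sym_ts D \<wr> T)" "is_sgp U"
  shows "complexity S \<le> enat n"
proof -
  obtain m where m: "n = Suc m" "complexity (sgp_of T) \<le> enat m" by (rule enat_Suc_le[OF T(2)])
  have "complexity (sgp_of (sym_ts D \<wr> T)) \<le> enat (Suc m)"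
    by (rule complexity_group_wreath[OF T(1) is_ts_sym_ts[OF D] sym_ts_group(1,2,3,4) m(2)])
  then have "complexity U \<le> enat n" using complexity_mono[OF U] m(1) by simp
  then have "complexity (sgp_times U (sgp_of RL)) \<le> enat n"
    using complexity_times[OF U(2) is_sgp_RL _ RL] by simp
  then show ?thesis by (rule complexity_mono[OF div S])
qed

lemma complexity_le_of_division:
  assumes T: "is_ts T" "complexity (sgp_of T) + 1 \<le> enat n" and RL: "complexity (sgp_of RL) \<le> enat n"
    and div: "S \<prec>\<^sub>s sgp_times (sgp_of (group_ts G \<wr> sym_ts B \<wr> T)) (sgp_of RL)"
  shows "complexity S \<le> enat n"
proof (rule complexity_le_sym[OF T _ RL div])
  show "finite (carrier G \<times> B)" using finite_Y by simp
  show "sgp_of (group_ts G \<wr> sym_ts B \<wr> T) \<prec>\<^sub>s sgp_of (sym_ts (carrier G \<times> B) \<wr> T)"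
    by (rule group_sym_divides[OF G.is_group finite_Y T(1)])
  show "is_sgp (sgp_of (group_ts G \<wr> sym_ts B \<wr> T))"
    using is_ts_group_ts[OF G.is_monoid finite_Y(1)] is_ts_sym_ts[OF finite_Y(2)] T(1)
    by (intro is_tsD(2) is_ts_wreath)
qed

text \<open>Returning to \<open>lm \<one>\<close> and multiplying by \<open>\<iota> y\<close> again
  fixes the point. Among other things this makes the derived semigroup non-empty.\<close>

lemma right_identity: assumes "y \<in> Y" shows "\<exists>s\<in>carrier S. act s y = Some y"
proof -
  obtain r where r: "r \<in> carrier S" "\<iota> y \<cdot>\<^bsub>S\<^esub> r = lm \<one>\<^bsub>G\<^esub>" using iota_right_inverse assms by blast
  have s: "r \<cdot>\<^bsub>S\<^esub> \<iota> y \<in> carrier S" using is_sgpD(2)[OF S r(1) iota_S[OF assms]] .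
  have "\<iota> y \<cdot>\<^bsub>S\<^esub> (r \<cdot>\<^bsub>S\<^esub> \<iota> y) = \<iota> y"
    using r lm_one_iota[OF assms] is_sgpD(3)[OF S iota_S[OF assms] r(1) iota_S[OF assms]] by simp
  then show ?thesis using act_Some[OF s] assms s by blast
qed

section \<open>The derived transformation semigroup\<close>

lemma ts_morphD:
  assumes "ts_rel_morphism P T \<Phi>Q \<Phi>T"
  shows "s \<in> carrier S \<Longrightarrow> \<Phi>T (act s) \<noteq> {}" "s \<in> carrier S \<Longrightarrow> \<Phi>T (act s) \<subseteq> pfuns T"
    "s \<in> carrier S \<Longrightarrow> s' \<in> carrier S \<Longrightarrow> t \<in> \<Phi>T (act s) \<Longrightarrow> t' \<in> \<Phi>T (act s') \<Longrightarrow> t' \<circ>\<^sub>m t \<in> \<Phi>T (act (s \<cdot>\<^bsub>S\<^esub> s'))"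
    "y \<in> Y \<Longrightarrow> \<Phi>Q y \<noteq> {}" "y \<in> Y \<Longrightarrow> \<Phi>Q y \<subseteq> states T"
    "q \<in> \<Phi>Q y \<Longrightarrow> s \<in> carrier S \<Longrightarrow> t \<in> \<Phi>T (act s) \<Longrightarrow> act s y = Some y' \<Longrightarrow>
       \<exists>q'. t q = Some q' \<and> q' \<in> \<Phi>Q y'"
proof -
  have a: "rel_morphism (sgp_of P) (sgp_of T) \<Phi>T"
    and b: "\<forall>p\<in>Y. \<Phi>Q p \<noteq> {} \<and> \<Phi>Q p \<subseteq> states T"
    and c: "\<forall>p\<in>Y. \<forall>s\<in>act ` carrier S. \<forall>q\<in>\<Phi>Q p. \<forall>t\<in>\<Phi>T s. \<forall>p'.
        s p = Some p' \<longrightarrow> (\<exists>q'. t q = Some q' \<and> q' \<in> \<Phi>Q p')"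
    using assms unfolding ts_rel_morphism_def by auto
  show "s \<in> carrier S \<Longrightarrow> \<Phi>T (act s) \<noteq> {}" "s \<in> carrier S \<Longrightarrow> \<Phi>T (act s) \<subseteq> pfuns T"
    using a unfolding rel_morphism_def by auto
  show "t' \<circ>\<^sub>m t \<in> \<Phi>T (act (s \<cdot>\<^bsub>S\<^esub> s'))"
    if "s \<in> carrier S" "s' \<in> carrier S" "t \<in> \<Phi>T (act s)" "t' \<in> \<Phi>T (act s')"
    using a that unfolding rel_morphism_def act_comp[OF that(1,2)] by auto
  show "y \<in> Y \<Longrightarrow> \<Phi>Q y \<noteq> {}" "y \<in> Y \<Longrightarrow> \<Phi>Q y \<subseteq> states T" using b by auto
  show "\<exists>q'. t q = Some q' \<and> q' \<in> \<Phi>Q y'"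
    if "q \<in> \<Phi>Q y" "s \<in> carrier S" "t \<in> \<Phi>T (act s)" "act s y = Some y'"
  proof -
    have "y \<in> Y" using act_Some[OF that(2)] that(4) by blast
    then show ?thesis using c that by blast
  qed
qed

lemma derived_gen_Some:
  "derived_gen P \<Phi>Q q p t x = Some z \<longleftrightarrow> fst x \<in> Y \<and> q \<in> \<Phi>Q (fst x) \<and> snd x = q \<and>
     p (fst x) = Some (fst z) \<and> t q = Some (snd z)"
  by (cases x; cases z; auto simp: derived_gen_def derived_states_def split: option.splits)

abbreviation Der where "Der T \<Phi>Q \<Phi>T \<equiv> derived_ts P T \<Phi>Q \<Phi>T"

lemma Der_simps: "states (Der T \<Phi>Q \<Phi>T) = derived_states P \<Phi>Q"
  "pfuns (Der T \<Phi>Q \<Phi>T) = sgp_generated (pfun_sgp UNIV)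
     {derived_gen P \<Phi>Q q s t | q s t. q \<in> states T \<and> s \<in> pfuns P \<and> t \<in> \<Phi>T s \<and> t q \<noteq> None}"
  by (simp_all add: derived_ts_def)

lemma Der_induct [consumes 1, case_names gen prod]:
  assumes "d \<in> pfuns (Der T \<Phi>Q \<Phi>T)"
    and "\<And>q s t. q \<in> states T \<Longrightarrow> s \<in> carrier S \<Longrightarrow> t \<in> \<Phi>T (act s) \<Longrightarrow> t q \<noteq> None \<Longrightarrow>
       R (derived_gen P \<Phi>Q q (act s) t)"
    and "\<And>d e. d \<in> pfuns (Der T \<Phi>Q \<Phi>T) \<Longrightarrow> e \<in> pfuns (Der T \<Phi>Q \<Phi>T) \<Longrightarrow> R d \<Longrightarrow> R e \<Longrightarrow> R (e \<circ>\<^sub>m d)"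
  shows "R d"
proof -
  have "d \<in> sgp_generated (pfun_sgp UNIV)
     {derived_gen P \<Phi>Q q s t | q s t. q \<in> states T \<and> s \<in> pfuns P \<and> t \<in> \<Phi>T s \<and> t q \<noteq> None}"
    using assms(1) unfolding Der_simps .
  then show ?thesis
  proof induction
    case (gen x)
    then obtain q s t where h: "x = derived_gen P \<Phi>Q q (act s) t" "q \<in> states T" "s \<in> carrier S" "t \<in> \<Phi>T (act s)" "t q \<noteq> None"
      by auto
    show ?case unfolding h(1) by (rule assms(2)[OF h(2-5)])
  next
    case (prod x y)
    then show ?case using assms(3)[of x y] unfolding Der_simps by simp
  qed
qed

lemma Der_gen:
  "q \<in> states T \<Longrightarrow> s \<in> carrier S \<Longrightarrow> t \<in> \<Phi>T (act s) \<Longrightarrow> t q \<noteq> None \<Longrightarrow>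
    derived_gen P \<Phi>Q q (act s) t \<in> pfuns (Der T \<Phi>Q \<Phi>T)"
  unfolding Der_simps by (rule sgp_generated.gen) auto

lemma Der_mult: "d \<in> pfuns (Der T \<Phi>Q \<Phi>T) \<Longrightarrow> e \<in> pfuns (Der T \<Phi>Q \<Phi>T) \<Longrightarrow> e \<circ>\<^sub>m d \<in> pfuns (Der T \<Phi>Q \<Phi>T)"
  unfolding Der_simps using sgp_generated.prod[of d "pfun_sgp UNIV" _ e] by simp

lemma is_ts_Der:
  assumes T: "is_ts T" and \<Phi>: "ts_rel_morphism P T \<Phi>Q \<Phi>T"
  shows "is_ts (Der T \<Phi>Q \<Phi>T)"
proof -
  note m = ts_morphD[OF \<Phi>]
  have "derived_states P \<Phi>Q \<subseteq> Y \<times> states T" using m(5) by (auto simp: derived_states_def)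
  then have fin: "finite (states (Der T \<Phi>Q \<Phi>T))"
    unfolding Der_simps using finite_Y is_tsD(1)[OF T] by (meson finite_SigmaI finite_subset)
  obtain y where y: "y \<in> Y" using Y_nonempty by blast
  obtain s where s: "s \<in> carrier S" "act s y = Some y" using right_identity[OF y] by blast
  obtain q where q: "q \<in> \<Phi>Q y" using m(4)[OF y] by blast
  obtain t where t: "t \<in> \<Phi>T (act s)" using m(1)[OF s(1)] by blast
  have "t q \<noteq> None" using m(6)[OF q s(1) t s(2)] by blast
  moreover have "q \<in> states T" using m(5)[OF y] q by blast
  ultimately have ne: "pfuns (Der T \<Phi>Q \<Phi>T) \<noteq> {}" using Der_gen[OF _ s(1), of q T t \<Phi>T \<Phi>Q] t by blast
  have "\<forall>x z. d x = Some z \<longrightarrow> x \<in> derived_states P \<Phi>Q \<and> z \<in> derived_states P \<Phi>Q"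
    if "d \<in> pfuns (Der T \<Phi>Q \<Phi>T)" for d
    using that
  proof (induction rule: Der_induct)
    case (gen q s t)
    show ?case
    proof (intro allI impI)
      fix x z assume "derived_gen P \<Phi>Q q (act s) t x = Some z"
      then have h: "fst x \<in> Y" "q \<in> \<Phi>Q (fst x)" "snd x = q" "act s (fst x) = Some (fst z)" "t q = Some (snd z)"
        unfolding derived_gen_Some by auto
      have "fst z \<in> Y" using act_Some[OF gen(2)] h(4) by blast
      moreover have "snd z \<in> \<Phi>Q (fst z)" using m(6)[OF h(2) gen(2,3) h(4)] h(5) by auto
      ultimately show "x \<in> derived_states P \<Phi>Q \<and> z \<in> derived_states P \<Phi>Q"
        using h by (cases x; cases z) (auto simp: derived_states_def)
    qed
  next
    case (prod d e)
    then show ?case by (auto simp: map_comp_Some_iff)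
  qed
  then have "dom d \<subseteq> derived_states P \<Phi>Q \<and> ran d \<subseteq> derived_states P \<Phi>Q" if "d \<in> pfuns (Der T \<Phi>Q \<Phi>T)" for d
    using that by (fastforce simp: dom_def ran_def)
  then show ?thesis unfolding is_ts_def is_sgp_pfun using fin ne Der_mult by (metis Der_simps(1))
qed

lemma eq_from_rlm:
  assumes s: "s \<in> carrier S" and t: "t \<in> carrier S" and r: "rlm s = rlm t"
    and e: "\<And>g b b' k k'. act s (g, b) = Some (k, b') \<Longrightarrow> act t (g, b) = Some (k', b') \<Longrightarrow> k = k'"
  shows "s = t"
proof -
  have "act s y = act t y" for y
  proof (rule option_eqI)
    fix z :: "'g \<times> 'b"
    obtain g b where y: "y = (g, b)" by (cases y)
    obtain k b' where z: "z = (k, b')" by (cases z)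
    have "\<exists>k'. act u' (g, b) = Some (k', b')" if "act u (g, b) = Some (k, b')" "rlm u = rlm u'"
      "u \<in> carrier S" "u' \<in> carrier S" for u u'
    proof -
      have g: "g \<in> carrier G" using that(1) act_Some[OF that(3)] by auto
      have "rlm u b = Some b'" using rlm_Some[OF that(3) g] that(1) by blast
      then show ?thesis using rlm_Some[OF that(4) g] that(2) by auto
    qed
    then show "act s y = Some z \<longleftrightarrow> act t y = Some z" using y z s t r e by (metis (no_types))
  qed
  then show ?thesis using act_inj s t by (meson ext inj_onD)
qed

text \<open>Since \<open>\<tau>\<close> is injective, each generator [q, s, t] is a partial
  injection on the finite set of classes and extends to a permutation; together with t these
  permutations simulate s on pairs of a class and a state of T. Equal classes over the same b and q
  have the same g, so this simulation and \<open>rlm s\<close> together determine s.\<close>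

lemma complexity_le_of_cross_section:
  assumes T: "is_ts T" "complexity (sgp_of T) + 1 \<le> enat n" and RL: "complexity (sgp_of RL) \<le> enat n"
    and \<Phi>: "ts_rel_morphism P T \<Phi>Q \<Phi>T"
    and cs: "is_cross_section G B (states T) (tilson_congruence (Der T \<Phi>Q \<Phi>T))"
  shows "complexity S \<le> enat n"
proof -
  note m = ts_morphD[OF \<Phi>]
  let ?D = "Der T \<Phi>Q \<Phi>T"
  have D: "is_ts ?D" by (rule is_ts_Der[OF T(1) \<Phi>])
  define \<tau> where "\<tau> = tilson_congruence ?D"
  have inj: "injective_congruence ?D \<tau>"
    unfolding \<tau>_def tilson_congruence_eq[OF D] by (rule injective_congruence_Inter[OF D])
  then have con: "ts_congruence ?D \<tau>" by (simp add: injective_congruence_def)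
  then have eq: "equiv (states ?D) \<tau>" by (simp add: ts_congruence_def)
  define cl where "cl y q = \<tau> `` {(y, q)}" for y q
  define \<Delta> where "\<Delta> = states ?D // \<tau>"
  have fin: "finite \<Delta>" unfolding \<Delta>_def using is_tsD(1)[OF D] eq
    by (meson equiv_type finite_quotient)
  have st: "(y, q) \<in> states ?D" if "y \<in> Y" "q \<in> \<Phi>Q y" for y q
    using that by (simp add: Der_simps derived_states_def)
  \<comment> \<open>Only points at which s acts are constrained, so one w may simulate several
    elements; these are told apart by \<open>rlm\<close>.\<close>
  define \<rho> where "\<rho> w s \<longleftrightarrow> (\<forall>y q z. q \<in> \<Phi>Q y \<and> act s y = Some z \<longrightarrow>
     (\<exists>q'. q' \<in> \<Phi>Q z \<and> w (cl y q, q) = Some (cl z q', q')))" for w s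
  have W: "is_ts (sym_ts \<Delta> \<wr> T)" using is_ts_sym_ts[OF fin] T(1) by (rule is_ts_wreath)
  have total: "\<exists>w\<in>pfuns (sym_ts \<Delta> \<wr> T). \<rho> w s" if s: "s \<in> carrier S" for s
  proof -
    obtain t where t: "t \<in> \<Phi>T (act s)" using m(1)[OF s] by blast
    have tT: "t \<in> pfuns T" using m(2)[OF s] t by blast
    let ?d = "\<lambda>q. derived_gen P \<Phi>Q q (act s) t"
    have "\<exists>p\<in>pfuns (sym_ts \<Delta>). \<forall>x y. class_act ?D \<tau> (?d q) x = Some y \<longrightarrow> p x = Some y" if q: "q \<in> dom t" for q
    proof (rule extend_partial_injection[OF fin])
      have "q \<in> states T" using is_tsD(5)[OF T(1) tT] q by blast
      then have d: "?d q \<in> pfuns ?D" using Der_gen[of q T s t \<Phi>T \<Phi>Q] s t q by auto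
      show "x \<in> \<Delta> \<and> y \<in> \<Delta>" if xy: "class_act ?D \<tau> (?d q) x = Some y" for x y
      proof -
        have x: "x \<in> \<Delta>" "\<exists>q'\<in>x. ?d q q' \<noteq> None"
          using xy unfolding class_act_def \<Delta>_def by (auto split: if_splits)
        then obtain u v where u: "u \<in> x" "?d q u = Some v" by blast
        have "x = \<tau> `` {u}" using x(1) u(1) eq unfolding \<Delta>_def
          by (metis quotientE Image_singleton_iff equiv_class_eq)
        then have "y = \<tau> `` {v}" using class_act_class[OF con D d u(2)] xy by simp
        moreover have "v \<in> states ?D" using is_tsD(6)[OF D d u(2)] .
        ultimately show ?thesis using x(1) unfolding \<Delta>_def by (simp add: quotientI)
      qed
      show "x = x'" if xy: "class_act ?D \<tau> (?d q) x = Some y" "class_act ?D \<tau> (?d q) x' = Some y" for x x' y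
        using inj d xy unfolding injective_congruence_def inj_on_def by (metis domI)
    qed
    then have "\<forall>q\<in>dom t. \<exists>p. p \<in> pfuns (sym_ts \<Delta>) \<and> (\<forall>x y. class_act ?D \<tau> (?d q) x = Some y \<longrightarrow> p x = Some y)"
      by blast
    from bchoice[OF this] obtain f where
      f: "\<forall>q\<in>dom t. f q \<in> pfuns (sym_ts \<Delta>) \<and> (\<forall>x y. class_act ?D \<tau> (?d q) x = Some y \<longrightarrow> f q x = Some y)" by blast
    have "\<rho> (wreath_act f t) s" unfolding \<rho>_def
    proof (intro allI impI, elim conjE)
      fix y q z assume q: "q \<in> \<Phi>Q y" and z: "act s y = Some z"
      obtain q' where q': "t q = Some q'" "q' \<in> \<Phi>Q z" using m(6)[OF q s t z] by blast
      have y: "y \<in> Y" using act_Some[OF s] z by blast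
      have "q \<in> states T" using m(5)[OF y] q by blast
      then have d: "?d q \<in> pfuns ?D" using Der_gen[of q T s t \<Phi>T \<Phi>Q] s t q' by auto
      have "?d q (y, q) = Some (z, q')" unfolding derived_gen_Some using y q z q' by simp
      from class_act_class[OF con D d this] have "f q (cl y q) = Some (cl z q')"
        using f q' unfolding cl_def by blast
      then show "\<exists>q'. q' \<in> \<Phi>Q z \<and> wreath_act f t (cl y q, q) = Some (cl z q', q')"
        using q' by (auto simp: wreath_act_Some)
    qed
    moreover have "wreath_act f t \<in> pfuns (sym_ts \<Delta> \<wr> T)" using tT f by (intro wreath_pfunsI) auto
    ultimately show ?thesis by blast
  qed
  have "S \<prec>\<^sub>s sgp_times (sgp_of (sym_ts \<Delta> \<wr> T)) (sgp_of RL)"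
  proof (rule divides_rel[OF S, where \<rho> = "\<lambda>u s. \<rho> (fst u) s \<and> snd u = rlm s"])
    show "u \<cdot>\<^bsub>sgp_times (sgp_of (sym_ts \<Delta> \<wr> T)) (sgp_of RL)\<^esub> v \<in> carrier (sgp_times (sgp_of (sym_ts \<Delta> \<wr> T)) (sgp_of RL))"
      if "u \<in> carrier (sgp_times (sgp_of (sym_ts \<Delta> \<wr> T)) (sgp_of RL))"
        "v \<in> carrier (sgp_times (sgp_of (sym_ts \<Delta> \<wr> T)) (sgp_of RL))" for u v
      using is_sgpD(2)[OF is_sgp_times[OF is_tsD(2)[OF W] is_sgp_RL] that] .
    show "\<exists>u\<in>carrier (sgp_times (sgp_of (sym_ts \<Delta> \<wr> T)) (sgp_of RL)). \<rho> (fst u) s \<and> snd u = rlm s"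
      if s: "s \<in> carrier S" for s
    proof -
      obtain w where "w \<in> pfuns (sym_ts \<Delta> \<wr> T)" "\<rho> w s" using total[OF s] by blast
      then show ?thesis using s by (intro bexI[of _ "(w, rlm s)"]) (auto simp: sgp_times_def)
    qed
    show "\<rho> (fst (u \<cdot>\<^bsub>sgp_times (sgp_of (sym_ts \<Delta> \<wr> T)) (sgp_of RL)\<^esub> v)) (s \<cdot>\<^bsub>S\<^esub> t) \<and>
      snd (u \<cdot>\<^bsub>sgp_times (sgp_of (sym_ts \<Delta> \<wr> T)) (sgp_of RL)\<^esub> v) = rlm (s \<cdot>\<^bsub>S\<^esub> t)"
      if h: "\<rho> (fst u) s \<and> snd u = rlm s" "\<rho> (fst v) t \<and> snd v = rlm t" "s \<in> carrier S" "t \<in> carrier S" for u v s t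
    proof
      have "\<rho> (fst v \<circ>\<^sub>m fst u) (s \<cdot>\<^bsub>S\<^esub> t)" unfolding \<rho>_def
      proof (intro allI impI, elim conjE)
        fix y q z assume q: "q \<in> \<Phi>Q y" and z: "act (s \<cdot>\<^bsub>S\<^esub> t) y = Some z"
        obtain x where x: "act s y = Some x" "act t x = Some z"
          using z unfolding act_comp[OF h(3,4)] by (auto simp: map_comp_Some_iff)
        obtain q1 where q1: "q1 \<in> \<Phi>Q x" "fst u (cl y q, q) = Some (cl x q1, q1)"
          using h(1) q x(1) unfolding \<rho>_def by blast
        obtain q2 where q2: "q2 \<in> \<Phi>Q z" "fst v (cl x q1, q1) = Some (cl z q2, q2)"
          using h(2) q1(1) x(2) unfolding \<rho>_def by blast
        then show "\<exists>q'. q' \<in> \<Phi>Q z \<and> (fst v \<circ>\<^sub>m fst u) (cl y q, q) = Some (cl z q', q')"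
          using q1 by (auto simp: map_comp_def)
      qed
      then show "\<rho> (fst (u \<cdot>\<^bsub>sgp_times (sgp_of (sym_ts \<Delta> \<wr> T)) (sgp_of RL)\<^esub> v)) (s \<cdot>\<^bsub>S\<^esub> t)"
        by (simp add: sgp_times_def case_prod_unfold)
      show "snd (u \<cdot>\<^bsub>sgp_times (sgp_of (sym_ts \<Delta> \<wr> T)) (sgp_of RL)\<^esub> v) = rlm (s \<cdot>\<^bsub>S\<^esub> t)"
        using h rlm_comp[OF h(3,4)] by (simp add: sgp_times_def case_prod_unfold)
    qed
    show "s = t" if h: "\<rho> (fst u) s \<and> snd u = rlm s" "\<rho> (fst u) t \<and> snd u = rlm t" "s \<in> carrier S" "t \<in> carrier S"
      for u s t
    proof (rule eq_from_rlm[OF h(3,4)])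
      show "rlm s = rlm t" using h by simp
      fix g b b' k k' assume a: "act s (g, b) = Some (k, b')" and a': "act t (g, b) = Some (k', b')"
      have Y: "(g, b) \<in> Y" "(k, b') \<in> Y" "(k', b') \<in> Y" using act_Some[OF h(3)] act_Some[OF h(4)] a a' by blast+
      obtain q where q: "q \<in> \<Phi>Q (g, b)" using m(4)[OF Y(1)] by blast
      obtain q1 where q1: "q1 \<in> \<Phi>Q (k, b')" "fst u (cl (g, b) q, q) = Some (cl (k, b') q1, q1)"
        using h(1) q a unfolding \<rho>_def by blast
      obtain q2 where q2: "q2 \<in> \<Phi>Q (k', b')" "fst u (cl (g, b) q, q) = Some (cl (k', b') q2, q2)"
        using h(2) q a' unfolding \<rho>_def by blast
      have e: "q2 = q1" "cl (k, b') q1 = cl (k', b') q1" using q1 q2 by auto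
      then have "(((k, b'), q1), ((k', b'), q1)) \<in> \<tau>"
        using eq_equiv_class[OF _ eq st[OF Y(3)]] q2 unfolding cl_def by blast
      moreover have "q1 \<in> states T" using m(5)[OF Y(2)] q1(1) by blast
      ultimately show "k = k'" using cs Y unfolding is_cross_section_def \<tau>_def by blast
    qed
  qed
  moreover have "sgp_of (sym_ts \<Delta> \<wr> T) \<prec>\<^sub>s sgp_of (sym_ts \<Delta> \<wr> T)"
    by (rule divides_rel[where \<rho> = "(=)"]) (use is_tsD(2,4)[OF W] in auto)
  ultimately show ?thesis
    using complexity_le_sym[OF T fin RL] is_tsD(2)[OF W] by blast
qed

end

section \<open>Flows\<close>

context gm
begin

text \<open>A flow along all of \<open>S\<close>: \<open>R\<close> relates the value in \<open>S\<close> of a word to its value in \<open>T\<close>.\<close>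

definition flow_rel ::
  "'q ts \<Rightarrow> ('q \<Rightarrow> ('g \<times> 'b) set \<times> ('g \<times> 'b) set set) \<Rightarrow> ('s \<times> ('q \<rightharpoonup> 'q)) set \<Rightarrow> bool" where
  "flow_rel T f R \<longleftrightarrow>
     (\<forall>q\<in>states T. f q \<in> invariant_cross_sections G B) \<and>
     (\<forall>y\<in>Y. \<exists>q\<in>states T. y \<in> fst (f q)) \<and>
     (\<forall>s\<in>carrier S. \<exists>t. (s, t) \<in> R) \<and>
     (\<forall>s t. (s, t) \<in> R \<longrightarrow> s \<in> carrier S \<and> t \<in> pfuns T) \<and>
     (\<forall>s t s' t'. (s, t) \<in> R \<longrightarrow> (s', t') \<in> R \<longrightarrow> (s \<cdot>\<^bsub>S\<^esub> s', t' \<circ>\<^sub>m t) \<in> R) \<and>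
     (\<forall>s t q y z. (s, t) \<in> R \<longrightarrow> q \<in> states T \<longrightarrow> y \<in> fst (f q) \<longrightarrow> act s y = Some z \<longrightarrow>
        (\<exists>q'. t q = Some q' \<and> z \<in> fst (f q'))) \<and>
     (\<forall>s t q q' y y' z z'. (s, t) \<in> R \<longrightarrow> q \<in> states T \<longrightarrow> t q = Some q' \<longrightarrow>
        y \<in> fst (f q) \<longrightarrow> y' \<in> fst (f q) \<longrightarrow> act s y = Some z \<longrightarrow> act s y' = Some z' \<longrightarrow>
        (same_block (snd (f q)) y y' \<longleftrightarrow> same_block (snd (f q')) z z'))"

lemma flow_relD:
  assumes "flow_rel T f R"
  shows "q \<in> states T \<Longrightarrow> f q \<in> invariant_cross_sections G B"
    "y \<in> Y \<Longrightarrow> \<exists>q\<in>states T. y \<in> fst (f q)"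
    "s \<in> carrier S \<Longrightarrow> \<exists>t. (s, t) \<in> R"
    "(s, t) \<in> R \<Longrightarrow> s \<in> carrier S" "(s, t) \<in> R \<Longrightarrow> t \<in> pfuns T"
    "(s, t) \<in> R \<Longrightarrow> (s', t') \<in> R \<Longrightarrow> (s \<cdot>\<^bsub>S\<^esub> s', t' \<circ>\<^sub>m t) \<in> R"
    "(s, t) \<in> R \<Longrightarrow> q \<in> states T \<Longrightarrow> y \<in> fst (f q) \<Longrightarrow> act s y = Some z \<Longrightarrow>
        \<exists>q'. t q = Some q' \<and> z \<in> fst (f q')"
    "(s, t) \<in> R \<Longrightarrow> q \<in> states T \<Longrightarrow> t q = Some q' \<Longrightarrow>
        y \<in> fst (f q) \<Longrightarrow> y' \<in> fst (f q) \<Longrightarrow> act s y = Some z \<Longrightarrow> act s y' = Some z' \<Longrightarrow>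
        same_block (snd (f q)) y y' \<longleftrightarrow> same_block (snd (f q')) z z'"
proof -
  note a = assms[unfolded flow_rel_def]
  note a2 = conjunct2[OF a] note a3 = conjunct2[OF a2] note a4 = conjunct2[OF a3]
  note a5 = conjunct2[OF a4] note a6 = conjunct2[OF a5] note a7 = conjunct2[OF a6]
  show "q \<in> states T \<Longrightarrow> f q \<in> invariant_cross_sections G B" using conjunct1[OF a] by blast
  show "y \<in> Y \<Longrightarrow> \<exists>q\<in>states T. y \<in> fst (f q)" using conjunct1[OF a2] by blast
  show "s \<in> carrier S \<Longrightarrow> \<exists>t. (s, t) \<in> R" using conjunct1[OF a3] by blast
  show "(s, t) \<in> R \<Longrightarrow> s \<in> carrier S" "(s, t) \<in> R \<Longrightarrow> t \<in> pfuns T" using conjunct1[OF a4] by blast+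
  show "(s, t) \<in> R \<Longrightarrow> (s', t') \<in> R \<Longrightarrow> (s \<cdot>\<^bsub>S\<^esub> s', t' \<circ>\<^sub>m t) \<in> R" using conjunct1[OF a5] by blast
  show "(s, t) \<in> R \<Longrightarrow> q \<in> states T \<Longrightarrow> y \<in> fst (f q) \<Longrightarrow> act s y = Some z \<Longrightarrow>
        \<exists>q'. t q = Some q' \<and> z \<in> fst (f q')" using conjunct1[OF a6] by blast
  show "(s, t) \<in> R \<Longrightarrow> q \<in> states T \<Longrightarrow> t q = Some q' \<Longrightarrow>
        y \<in> fst (f q) \<Longrightarrow> y' \<in> fst (f q) \<Longrightarrow> act s y = Some z \<Longrightarrow> act s y' = Some z' \<Longrightarrow>
        same_block (snd (f q)) y y' \<longleftrightarrow> same_block (snd (f q')) z z'" using a7 by blast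
qed

text \<open>A flow is given on letters. Its conditions survive concatenation, because the state
  reached by the first word again contains the point reached; one element of S may thereby acquire
  several partners in T, one for each word.\<close>

lemma flow_rel_exists:
  assumes T: "is_ts T" and X: "X \<subseteq> carrier S" "sgp_generated S X = carrier S"
    and flow: "admits_flow_from G B act X T"
  shows "\<exists>f R. flow_rel T f R"
proof -
  obtain \<delta> f where au: "automaton X (states T) \<delta>" and tr: "transition_sgp X \<delta> = pfuns T"
    and fl: "automaton_flow G B act X (states T) \<delta> f"
    using flow unfolding admits_flow_from_def by blast
  define R where "R = sgp_generated (sgp_times S (pfun_sgp UNIV)) ((\<lambda>x. (x, \<delta> x)) ` X)"
  have f1: "\<forall>q\<in>states T. f q \<in> invariant_cross_sections G B"
    and f2: "\<forall>y\<in>Y. \<exists>q\<in>states T. y \<in> fst (f q)"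
    and F: "\<forall>q\<in>states T. \<forall>x\<in>X. \<forall>U \<P> V \<Theta>.
        f q = (U, \<P>) \<and> (V, \<Theta>) = (case \<delta> x q of None \<Rightarrow> ({}, {}) | Some q' \<Rightarrow> f q') \<longrightarrow>
        (\<forall>y\<in>U. \<forall>z. act x y = Some z \<longrightarrow> z \<in> V) \<and>
        (\<forall>y\<in>U. \<forall>y'\<in>U. \<forall>z z'. act x y = Some z \<and> act x y' = Some z' \<longrightarrow>
           (same_block \<P> y y' \<longleftrightarrow> same_block \<Theta> z z'))"
    by (fact conjunct1[OF fl[unfolded automaton_flow_def]],
        fact conjunct1[OF conjunct2[OF fl[unfolded automaton_flow_def]]],
        fact conjunct2[OF conjunct2[OF fl[unfolded automaton_flow_def]]])
  have f3: "(\<forall>y\<in>U. \<forall>z. act x y = Some z \<longrightarrow> z \<in> V) \<and>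
        (\<forall>y\<in>U. \<forall>y'\<in>U. \<forall>z z'. act x y = Some z \<and> act x y' = Some z' \<longrightarrow>
           (same_block \<P> y y' \<longleftrightarrow> same_block \<Theta> z z'))"
    if "q \<in> states T" "x \<in> X" "f q = (U, \<P>)"
      "(V, \<Theta>) = (case \<delta> x q of None \<Rightarrow> ({}, {}) | Some q' \<Rightarrow> f q')" for q x U \<P> V \<Theta>
    using F[THEN bspec, OF that(1), THEN bspec, OF that(2), THEN spec, THEN spec, THEN spec, THEN spec,
      THEN mp, OF conjI, OF that(3,4)] .
  define good where "good s t \<longleftrightarrow> s \<in> carrier S \<and> t \<in> pfuns T \<and>
     (\<forall>q y z. q \<in> states T \<longrightarrow> y \<in> fst (f q) \<longrightarrow> act s y = Some z \<longrightarrow>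
        (\<exists>q'. t q = Some q' \<and> z \<in> fst (f q'))) \<and>
     (\<forall>q q' y y' z z'. q \<in> states T \<longrightarrow> t q = Some q' \<longrightarrow>
        y \<in> fst (f q) \<longrightarrow> y' \<in> fst (f q) \<longrightarrow> act s y = Some z \<longrightarrow> act s y' = Some z' \<longrightarrow>
        (same_block (snd (f q)) y y' \<longleftrightarrow> same_block (snd (f q')) z z'))" for s t
  have good: "good (fst p) (snd p)" if "p \<in> R" for p
    using that unfolding R_def
  proof induction
    case (gen p)
    then obtain x where x: "x \<in> X" "p = (x, \<delta> x)" by blast
    have "\<delta> x \<in> pfuns T" unfolding tr[symmetric] transition_sgp_def using x by (blast intro: sgp_generated.gen)
    moreover have "\<exists>q'. \<delta> x q = Some q' \<and> z \<in> fst (f q')"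
      if h: "q \<in> states T" "y \<in> fst (f q)" "act x y = Some z" for q y z
    proof (cases "\<delta> x q")
      case None
      \<comment> \<open>By convention an undefined transition leads to empty sets, so x acts at no
        point contained at q.\<close>
      then have "\<forall>y\<in>fst (f q). \<forall>z. act x y = Some z \<longrightarrow> z \<in> {}"
        by (intro f3[of q x "fst (f q)" "snd (f q)" "{}" "{}", OF h(1) x(1) prod.collapse[symmetric], THEN conjunct1]) simp
      then show ?thesis using h by blast
    next
      case (Some q')
      then have "\<forall>y\<in>fst (f q). \<forall>z. act x y = Some z \<longrightarrow> z \<in> fst (f q')"
        by (intro f3[of q x "fst (f q)" "snd (f q)" "fst (f q')" "snd (f q')", OF h(1) x(1) prod.collapse[symmetric], THEN conjunct1]) simp
      then show ?thesis using h Some by blast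
    qed
    moreover have "same_block (snd (f q)) y y' \<longleftrightarrow> same_block (snd (f q')) z z'"
      if h: "q \<in> states T" "\<delta> x q = Some q'" "y \<in> fst (f q)" "y' \<in> fst (f q)" "act x y = Some z" "act x y' = Some z'"
      for q q' y y' z z'
    proof -
      have "\<forall>y\<in>fst (f q). \<forall>y'\<in>fst (f q). \<forall>z z'. act x y = Some z \<and> act x y' = Some z' \<longrightarrow>
           (same_block (snd (f q)) y y' \<longleftrightarrow> same_block (snd (f q')) z z')"
        using h(2) by (intro f3[of q x "fst (f q)" "snd (f q)" "fst (f q')" "snd (f q')",
          OF h(1) x(1) prod.collapse[symmetric], THEN conjunct2]) simp
      then show ?thesis using h by blast
    qed
    ultimately show ?case unfolding good_def x(2) using x(1) X(1) by auto
  next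
    case (prod p p')
    let ?s = "fst p" and ?t = "snd p" and ?s' = "fst p'" and ?t' = "snd p'"
    have sS: "?s \<in> carrier S" "?s' \<in> carrier S" and tT: "?t \<in> pfuns T" "?t' \<in> pfuns T"
      using prod unfolding good_def by auto
    have ac: "act (?s \<cdot>\<^bsub>S\<^esub> ?s') = act ?s' \<circ>\<^sub>m act ?s" by (rule act_comp[OF sS])
    have st1: "\<exists>q'. ?t q = Some q' \<and> q' \<in> states T \<and> z \<in> fst (f q')"
      if "q \<in> states T" "y \<in> fst (f q)" "act ?s y = Some z" for q y z
      using prod(3) that is_tsD(6)[OF T tT(1)] unfolding good_def by blast
    have "good (?s \<cdot>\<^bsub>S\<^esub> ?s') (?t' \<circ>\<^sub>m ?t)" unfolding good_def
    proof (intro conjI allI impI)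
      show "?s \<cdot>\<^bsub>S\<^esub> ?s' \<in> carrier S" using is_sgpD(2)[OF S sS] .
      show "?t' \<circ>\<^sub>m ?t \<in> pfuns T" using is_tsD(4)[OF T tT] .
    next
      fix q y z assume h: "q \<in> states T" "y \<in> fst (f q)" "act (?s \<cdot>\<^bsub>S\<^esub> ?s') y = Some z"
      obtain x where x: "act ?s y = Some x" "act ?s' x = Some z" using h(3) unfolding ac by (auto simp: map_comp_Some_iff)
      obtain q1 where q1: "?t q = Some q1" "q1 \<in> states T" "x \<in> fst (f q1)" using st1[OF h(1,2) x(1)] by blast
      obtain q2 where "?t' q1 = Some q2" "z \<in> fst (f q2)" using prod(4) q1 x unfolding good_def by blast
      then show "\<exists>q'. (?t' \<circ>\<^sub>m ?t) q = Some q' \<and> z \<in> fst (f q')" using q1 by auto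
    next
      fix q q' y y' z z' assume h: "q \<in> states T" "(?t' \<circ>\<^sub>m ?t) q = Some q'" "y \<in> fst (f q)" "y' \<in> fst (f q)"
        "act (?s \<cdot>\<^bsub>S\<^esub> ?s') y = Some z" "act (?s \<cdot>\<^bsub>S\<^esub> ?s') y' = Some z'"
      obtain x where x: "act ?s y = Some x" "act ?s' x = Some z" using h(5) unfolding ac by (auto simp: map_comp_Some_iff)
      obtain x' where x': "act ?s y' = Some x'" "act ?s' x' = Some z'" using h(6) unfolding ac by (auto simp: map_comp_Some_iff)
      obtain q1 where q1: "?t q = Some q1" "q1 \<in> states T" "x \<in> fst (f q1)" using st1[OF h(1,3) x(1)] by blast
      have x'1: "x' \<in> fst (f q1)" using st1[OF h(1,4) x'(1)] q1(1) by auto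
      have "?t' q1 = Some q'" using h(2) q1(1) by simp
      then have "same_block (snd (f q1)) x x' \<longleftrightarrow> same_block (snd (f q')) z z'"
        using prod(4) q1 x'1 x(2) x'(2) unfolding good_def by blast
      moreover have "same_block (snd (f q)) y y' \<longleftrightarrow> same_block (snd (f q1)) x x'"
        using prod(3) h(1,3,4) q1(1) x(1) x'(1) unfolding good_def by blast
      ultimately show "same_block (snd (f q)) y y' \<longleftrightarrow> same_block (snd (f q')) z z'" by simp
    qed
    then show ?case by (simp add: sgp_times_def case_prod_unfold)
  qed
  have mult: "(s \<cdot>\<^bsub>S\<^esub> s', t' \<circ>\<^sub>m t) \<in> R" if "(s, t) \<in> R" "(s', t') \<in> R" for s t s' t'
    using sgp_generated.prod[OF that[unfolded R_def]] unfolding R_def by (simp add: sgp_times_def)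
  have ex: "\<exists>t. (s, t) \<in> R" if "s \<in> carrier S" for s
  proof -
    have "s \<in> sgp_generated S X" using that X(2) by simp
    then show ?thesis
    proof induction
      case (gen x) then show ?case unfolding R_def by (intro exI[of _ "\<delta> x"] sgp_generated.gen) blast
    next
      case (prod x y) then show ?case using mult by blast
    qed
  qed
  have good': "good s t" if "(s, t) \<in> R" for s t using good[OF that] by simp
  have "flow_rel T f R" unfolding flow_rel_def
    apply (intro conjI)
    subgoal by (rule f1)
    subgoal by (rule f2)
    subgoal using ex by blast
    subgoal using good' unfolding good_def by blast
    subgoal using mult by blast
    subgoal using good' unfolding good_def by blast
    subgoal using good' unfolding good_def by blast
    done
  then show ?thesis by blast
qed

lemma invariant_cross_sectionsD:
  assumes "(U, \<Theta>) \<in> invariant_cross_sections G B"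
  shows "U \<subseteq> Y" "y \<in> U \<Longrightarrow> same_block \<Theta> y y" "same_block \<Theta> y z \<Longrightarrow> same_block \<Theta> z y"
    "same_block \<Theta> x y \<Longrightarrow> same_block \<Theta> y z \<Longrightarrow> same_block \<Theta> x z"
    "same_block \<Theta> y z \<Longrightarrow> y \<in> U \<and> z \<in> U"
    "same_block \<Theta> (g, b) (h, b) \<Longrightarrow> g = h"
    "k \<in> carrier G \<Longrightarrow> same_block \<Theta> (g, b) (h, c) \<Longrightarrow> same_block \<Theta> (k \<otimes>\<^bsub>G\<^esub> g, b) (k \<otimes>\<^bsub>G\<^esub> h, c)"
proof -
  have 1: "U \<subseteq> Y" "\<Union>\<Theta> = U" "disjoint \<Theta>"
    "\<forall>P\<in>\<Theta>. \<forall>g h b. (g, b) \<in> P \<and> (h, b) \<in> P \<longrightarrow> g = h"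
    "\<forall>g\<in>carrier G. left_translate G g ` \<Theta> = \<Theta>"
    using assms by (auto simp: invariant_cross_sections_def partition_on_def)
  show "U \<subseteq> Y" by fact
  show "y \<in> U \<Longrightarrow> same_block \<Theta> y y" using 1(2) by (auto simp: same_block_def)
  show "same_block \<Theta> y z \<Longrightarrow> same_block \<Theta> z y" by (auto simp: same_block_def)
  show "same_block \<Theta> x y \<Longrightarrow> same_block \<Theta> y z \<Longrightarrow> same_block \<Theta> x z"
    using 1(3) unfolding same_block_def disjoint_def by blast
  show "same_block \<Theta> y z \<Longrightarrow> y \<in> U \<and> z \<in> U" using 1(2) by (auto simp: same_block_def)
  show "same_block \<Theta> (g, b) (h, b) \<Longrightarrow> g = h" using 1(4) unfolding same_block_def by blast
  show "same_block \<Theta> (k \<otimes>\<^bsub>G\<^esub> g, b) (k \<otimes>\<^bsub>G\<^esub> h, c)" if k: "k \<in> carrier G" and sb: "same_block \<Theta> (g, b) (h, c)"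
  proof -
    obtain P where P: "P \<in> \<Theta>" "(g, b) \<in> P" "(h, c) \<in> P" using sb unfolding same_block_def by blast
    have "left_translate G k P \<in> \<Theta>" using 1(5) k P(1) by blast
    moreover have "(k \<otimes>\<^bsub>G\<^esub> g, b) \<in> left_translate G k P" "(k \<otimes>\<^bsub>G\<^esub> h, c) \<in> left_translate G k P"
      using P(2,3) unfolding left_translate_def by force+
    ultimately show ?thesis unfolding same_block_def by blast
  qed
qed

lemma flow_imp_cross_section:
  assumes T: "is_ts T" and flow: "flow_rel T f R"
  shows "\<exists>\<Phi>Q \<Phi>T. ts_rel_morphism P T \<Phi>Q \<Phi>T \<and>
    is_cross_section G B (states T) (tilson_congruence (Der T \<Phi>Q \<Phi>T))"
proof -
  note fl = flow_relD[OF flow]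
  have ic: "(fst (f q), snd (f q)) \<in> invariant_cross_sections G B" if "q \<in> states T" for q using fl(1)[OF that] by simp
  define \<Phi>Q where "\<Phi>Q y = {q \<in> states T. y \<in> fst (f q)}" for y
  define \<Phi>T where "\<Phi>T p = {t. \<exists>s. act s = p \<and> (s, t) \<in> R}" for p
  have \<Phi>T: "t \<in> \<Phi>T (act s) \<longleftrightarrow> (s, t) \<in> R" if "s \<in> carrier S" for s t
    unfolding \<Phi>T_def using that act_inj fl(4) by (auto dest: inj_onD)
  have m: "ts_rel_morphism P T \<Phi>Q \<Phi>T" unfolding ts_rel_morphism_def
  proof (intro conjI)
    show "rel_morphism (sgp_of P) (sgp_of T) \<Phi>T" unfolding rel_morphism_def
    proof (intro conjI ballI)
      show "\<Phi>T s \<noteq> {}" if s: "s \<in> carrier (sgp_of P)" for s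
      proof -
        obtain s' where "s' \<in> carrier S" "s = act s'" using s by auto
        then show ?thesis using fl(3)[of s'] \<Phi>T by blast
      qed
      show "\<Phi>T s \<subseteq> carrier (sgp_of T)" if "s \<in> carrier (sgp_of P)" for s
        using fl(5) unfolding \<Phi>T_def by auto
      fix s s' t t' assume h: "s \<in> carrier (sgp_of P)" "s' \<in> carrier (sgp_of P)" "t \<in> \<Phi>T s" "t' \<in> \<Phi>T s'"
      obtain a a' where a: "s = act a" "(a, t) \<in> R" "s' = act a'" "(a', t') \<in> R" using h(3,4) unfolding \<Phi>T_def by blast
      then have "act (a \<cdot>\<^bsub>S\<^esub> a') = s' \<circ>\<^sub>m s" using act_comp fl(4) by blast
      then show "t \<cdot>\<^bsub>sgp_of T\<^esub> t' \<in> \<Phi>T (s \<cdot>\<^bsub>sgp_of P\<^esub> s')"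
        using fl(6)[OF a(2,4)] unfolding \<Phi>T_def by auto
    qed
    show "\<forall>p\<in>states P. \<Phi>Q p \<noteq> {} \<and> \<Phi>Q p \<subseteq> states T" using fl(2) unfolding \<Phi>Q_def by auto
    show "\<forall>p\<in>states P. \<forall>s\<in>pfuns P. \<forall>q\<in>\<Phi>Q p. \<forall>t\<in>\<Phi>T s. \<forall>p'. s p = Some p' \<longrightarrow> (\<exists>q'. t q = Some q' \<and> q' \<in> \<Phi>Q p')"
    proof (intro ballI allI impI)
      fix p s q t p' assume h: "s \<in> pfuns P" "q \<in> \<Phi>Q p" "t \<in> \<Phi>T s" "s p = Some p'"
      obtain a where a: "s = act a" "(a, t) \<in> R" using h(3) unfolding \<Phi>T_def by blast
      obtain q' where "t q = Some q'" "p' \<in> fst (f q')" using fl(7)[OF a(2)] h a unfolding \<Phi>Q_def by blast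
      then show "\<exists>q'. t q = Some q' \<and> q' \<in> \<Phi>Q p'"
        using is_tsD(6)[OF T fl(5)[OF a(2)]] unfolding \<Phi>Q_def by blast
    qed
  qed
  let ?D = "Der T \<Phi>Q \<Phi>T"
  have D: "is_ts ?D" by (rule is_ts_Der[OF T m])
  define r where "r = {((y, q), (y', q)) | y y' q. q \<in> states T \<and> same_block (snd (f q)) y y'}"
  have rI: "(x, x') \<in> r \<longleftrightarrow> snd x = snd x' \<and> snd x \<in> states T \<and> same_block (snd (f (snd x))) (fst x) (fst x')" for x x'
    unfolding r_def by (cases x; cases x') auto
  have sD: "x \<in> states ?D \<longleftrightarrow> snd x \<in> states T \<and> fst x \<in> fst (f (snd x))" for x
    using invariant_cross_sectionsD(1)[OF ic] unfolding Der_simps derived_states_def \<Phi>Q_def by (cases x) auto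
  have resp: "\<forall>x x' z z'. d x = Some z \<and> d x' = Some z' \<longrightarrow> ((x, x') \<in> r \<longleftrightarrow> (z, z') \<in> r)" if "d \<in> pfuns ?D" for d
    using that
  proof (induction rule: Der_induct)
    case (gen q s t)
    have st: "(s, t) \<in> R" using gen \<Phi>T by blast
    show ?case
    proof (intro allI impI, elim conjE)
      fix x x' z z' assume "derived_gen P \<Phi>Q q (act s) t x = Some z" "derived_gen P \<Phi>Q q (act s) t x' = Some z'"
      then have h: "snd x = q" "snd x' = q" "act s (fst x) = Some (fst z)" "act s (fst x') = Some (fst z')"
        "t q = Some (snd z)" "t q = Some (snd z')" "fst x \<in> fst (f q)" "fst x' \<in> fst (f q)"
        unfolding derived_gen_Some \<Phi>Q_def by auto
      have "snd z \<in> states T" using is_tsD(6)[OF T fl(5)[OF st] h(5)] .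
      then show "(x, x') \<in> r \<longleftrightarrow> (z, z') \<in> r" unfolding rI
        using fl(8)[OF st gen(1) h(5,7,8,3,4)] h gen(1) by auto
    qed
  next
    case (prod d e)
    show ?case
    proof (intro allI impI, elim conjE)
      fix x x' z z' assume "(e \<circ>\<^sub>m d) x = Some z" "(e \<circ>\<^sub>m d) x' = Some z'"
      then obtain w w' where "d x = Some w" "e w = Some z" "d x' = Some w'" "e w' = Some z'"
        by (auto simp: map_comp_Some_iff)
      then show "(x, x') \<in> r \<longleftrightarrow> (z, z') \<in> r" using prod(3,4) by blast
    qed
  qed
  have "equiv (states ?D) r"
  proof (rule equivI)
    show "r \<subseteq> states ?D \<times> states ?D" using invariant_cross_sectionsD(5)[OF ic] by (auto simp: rI sD)
    show "refl_on (states ?D) r" unfolding refl_on_def using invariant_cross_sectionsD(2)[OF ic] invariant_cross_sectionsD(5)[OF ic] by (auto simp: rI sD)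
    show "sym r" unfolding sym_def using invariant_cross_sectionsD(3)[OF ic] by (auto simp: rI)
    show "Relation.trans r" unfolding Relation.trans_def using invariant_cross_sectionsD(4)[OF ic] by (auto simp: rI)
  qed
  then have "injective_congruence ?D r"
    unfolding injective_congruence_iff[OF D] ts_congruence_def using resp by blast
  \<comment> \<open>The Tilson congruence is the least injective one, and being a cross-section
    passes to smaller relations.\<close>
  then have "tilson_congruence ?D \<subseteq> r" unfolding tilson_congruence_eq[OF D] by blast
  moreover have "g = h" if "(((g, b), q), ((h, b), q)) \<in> r" for g h b q
    using that invariant_cross_sectionsD(6)[OF ic] by (auto simp: rI)
  ultimately have "is_cross_section G B (states T) (tilson_congruence ?D)"
    unfolding is_cross_section_def by blast
  with m show ?thesis by blast
qed

text \<open>An equivariant partial injection of G \<times> B is determined by its values at the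
  points (\<one>, b): they give a partial injection of B, which extends to a permutation, and for
  each b the factor in G by which it multiplies on the right. Together these form an element of the
  wreath product of G with Sym(B).\<close>

lemma extend_equivariant:
  assumes M: "M \<subseteq> Y \<times> Y"
    and sv: "\<And>x y z. (x, y) \<in> M \<Longrightarrow> (x, z) \<in> M \<Longrightarrow> y = z"
    and inj: "\<And>x y z. (x, z) \<in> M \<Longrightarrow> (y, z) \<in> M \<Longrightarrow> x = y"
    and G: "\<And>g h b h' b'. g \<in> carrier G \<Longrightarrow> ((h, b), (h', b')) \<in> M \<Longrightarrow> ((g \<otimes>\<^bsub>G\<^esub> h, b), (g \<otimes>\<^bsub>G\<^esub> h', b')) \<in> M"
  shows "\<exists>\<gamma> \<pi>. (\<forall>b. \<gamma> b \<in> carrier G) \<and> \<pi> \<in> pfuns (sym_ts B) \<and>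
    (\<forall>h b h' b'. ((h, b), (h', b')) \<in> M \<longrightarrow> \<pi> b = Some b' \<and> h \<otimes>\<^bsub>G\<^esub> \<gamma> b = h')"
proof -
  define m where "m b = (if \<exists>k b'. ((\<one>\<^bsub>G\<^esub>, b), (k, b')) \<in> M
     then Some (SOME y. ((\<one>\<^bsub>G\<^esub>, b), y) \<in> M) else None)" for b
  have norm: "((\<one>\<^bsub>G\<^esub>, b), (inv\<^bsub>G\<^esub> h \<otimes>\<^bsub>G\<^esub> h', b')) \<in> M" if "((h, b), (h', b')) \<in> M" for h b h' b'
  proof -
    have "h \<in> carrier G" using that M by blast
    then show ?thesis using G[of "inv\<^bsub>G\<^esub> h" h b h' b'] that by simp
  qed
  have m: "m b = Some y \<longleftrightarrow> ((\<one>\<^bsub>G\<^esub>, b), y) \<in> M" for b y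
  proof
    assume e: "m b = Some y"
    then have "\<exists>y. ((\<one>\<^bsub>G\<^esub>, b), y) \<in> M" unfolding m_def by (auto split: if_splits)
    from someI_ex[OF this] show "((\<one>\<^bsub>G\<^esub>, b), y) \<in> M" using e by (auto simp: m_def split: if_splits)
  next
    assume e: "((\<one>\<^bsub>G\<^esub>, b), y) \<in> M"
    then have "(SOME y. ((\<one>\<^bsub>G\<^esub>, b), y) \<in> M) = y" using sv by blast
    moreover have "\<exists>k b'. ((\<one>\<^bsub>G\<^esub>, b), (k, b')) \<in> M" using e by (metis prod.collapse)
    ultimately show "m b = Some y" by (simp add: m_def)
  qed
  define p where "p b = map_option snd (m b)" for b
  have p: "p b = Some b' \<longleftrightarrow> (\<exists>k. ((\<one>\<^bsub>G\<^esub>, b), (k, b')) \<in> M)" for b b'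
    unfolding p_def map_option_eq_Some using m by force
  have "\<exists>\<pi>\<in>pfuns (sym_ts B). \<forall>x y. p x = Some y \<longrightarrow> \<pi> x = Some y"
  proof (rule extend_partial_injection[OF finite_Y(2)])
    show "b \<in> B \<and> b' \<in> B" if "p b = Some b'" for b b' using that M unfolding p by blast
    show "b = c" if h: "p b = Some b'" "p c = Some b'" for b c b'
    proof -
      obtain k l where kl: "((\<one>\<^bsub>G\<^esub>, b), (k, b')) \<in> M" "((\<one>\<^bsub>G\<^esub>, c), (l, b')) \<in> M" using h p by blast
      then have c: "k \<in> carrier G" "l \<in> carrier G" using M by blast+
      \<comment> \<open>Translating the pair at c by k times the inverse of l gives both pairs the
        same image, so injectivity of M applies.\<close>
      have "((k \<otimes>\<^bsub>G\<^esub> inv\<^bsub>G\<^esub> l \<otimes>\<^bsub>G\<^esub> \<one>\<^bsub>G\<^esub>, c), (k \<otimes>\<^bsub>G\<^esub> inv\<^bsub>G\<^esub> l \<otimes>\<^bsub>G\<^esub> l, b')) \<in> M"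
        by (rule G[OF _ kl(2)]) (use c in simp)
      moreover have "k \<otimes>\<^bsub>G\<^esub> inv\<^bsub>G\<^esub> l \<otimes>\<^bsub>G\<^esub> l = k" using c by (simp add: G.m_assoc)
      ultimately have "(\<one>\<^bsub>G\<^esub>, b) = (k \<otimes>\<^bsub>G\<^esub> inv\<^bsub>G\<^esub> l \<otimes>\<^bsub>G\<^esub> \<one>\<^bsub>G\<^esub>, c)" using inj kl(1) by metis
      then show ?thesis by simp
    qed
  qed
  then obtain \<pi> where \<pi>: "\<pi> \<in> pfuns (sym_ts B)" "\<And>x y. p x = Some y \<Longrightarrow> \<pi> x = Some y" by blast
  define \<gamma> where "\<gamma> b = (case m b of None \<Rightarrow> \<one>\<^bsub>G\<^esub> | Some y \<Rightarrow> fst y)" for b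
  have "\<gamma> b \<in> carrier G" for b
  proof (cases "m b")
    case (Some y)
    then have "y \<in> Y" using m M by blast
    then show ?thesis using Some by (auto simp: \<gamma>_def)
  qed (simp add: \<gamma>_def)
  moreover have "\<pi> b = Some b' \<and> h \<otimes>\<^bsub>G\<^esub> \<gamma> b = h'" if h: "((h, b), (h', b')) \<in> M" for h b h' b'
  proof
    have c: "h \<in> carrier G" "h' \<in> carrier G" using h M by blast+
    show "\<pi> b = Some b'" using norm[OF h] p \<pi>(2) by blast
    have "m b = Some (inv\<^bsub>G\<^esub> h \<otimes>\<^bsub>G\<^esub> h', b')" using norm[OF h] m by simp
    then show "h \<otimes>\<^bsub>G\<^esub> \<gamma> b = h'" using c by (simp add: \<gamma>_def G.m_assoc[symmetric])
  qed
  ultimately show ?thesis using \<pi>(1) by blast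
qed

text \<open>A block meets the fibre over each b in at most one point, so a representative is fixed
  by its coordinate in B. Choosing only this coordinate, from the set of coordinates of the block,
  makes the choice equivariant, as translates of a block have the same set.\<close>

lemma block_representatives:
  assumes ic: "(U, \<Theta>) \<in> invariant_cross_sections G B"
  obtains \<kappa> where "\<And>y. y \<in> U \<Longrightarrow> \<kappa> y \<in> Y"
    "\<And>y z. y \<in> U \<Longrightarrow> z \<in> U \<Longrightarrow> same_block \<Theta> y z \<longleftrightarrow> \<kappa> y = \<kappa> z"
    "\<And>k g b. k \<in> carrier G \<Longrightarrow> (g, b) \<in> U \<Longrightarrow> \<kappa> (k \<otimes>\<^bsub>G\<^esub> g, b) = (k \<otimes>\<^bsub>G\<^esub> fst (\<kappa> (g, b)), snd (\<kappa> (g, b)))"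
    "\<And>k g b. k \<in> carrier G \<Longrightarrow> (g, b) \<in> U \<Longrightarrow> (k \<otimes>\<^bsub>G\<^esub> g, b) \<in> U"
proof -
  note i = invariant_cross_sectionsD[OF ic]
  define \<beta> where "\<beta> y = (SOME b. \<exists>g. same_block \<Theta> y (g, b))" for y
  define \<kappa> where "\<kappa> y = (SOME z. same_block \<Theta> y z \<and> snd z = \<beta> y)" for y
  have \<kappa>: "same_block \<Theta> y (\<kappa> y) \<and> snd (\<kappa> y) = \<beta> y" if "y \<in> U" for y
  proof -
    have "same_block \<Theta> y (fst y, snd y)" using i(2)[OF that] by simp
    then have "\<exists>b g. same_block \<Theta> y (g, b)" by blast
    from someI_ex[OF this] have "\<exists>g. same_block \<Theta> y (g, \<beta> y)" unfolding \<beta>_def .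
    then have "\<exists>z. same_block \<Theta> y z \<and> snd z = \<beta> y" by auto
    from someI_ex[OF this] show ?thesis unfolding \<kappa>_def .
  qed
  have uniq: "z = \<kappa> y" if "y \<in> U" "same_block \<Theta> y z" "snd z = \<beta> y" for y z
  proof -
    have "same_block \<Theta> z (\<kappa> y)" using \<kappa>[OF that(1)] that(2) i(3,4) by blast
    then have "fst z = fst (\<kappa> y)" using i(6)[of "fst z" "snd z" "fst (\<kappa> y)"] \<kappa>[OF that(1)] that(3)
      by (metis prod.collapse)
    then show ?thesis using \<kappa>[OF that(1)] that(3) by (simp add: prod_eq_iff)
  qed
  have trans: "(k \<otimes>\<^bsub>G\<^esub> g, b) \<in> U" if "k \<in> carrier G" "(g, b) \<in> U" for k g b
    using i(7)[OF that(1) i(2)[OF that(2)]] i(5) by blast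
  show thesis
  proof (rule that[of \<kappa>])
    show "\<kappa> y \<in> Y" if "y \<in> U" for y using \<kappa>[OF that] i(1,5) by blast
    show "same_block \<Theta> y z \<longleftrightarrow> \<kappa> y = \<kappa> z" if yz: "y \<in> U" "z \<in> U" for y z
    proof
      assume sb: "same_block \<Theta> y z"
      then have "(\<exists>g. same_block \<Theta> y (g, b)) \<longleftrightarrow> (\<exists>g. same_block \<Theta> z (g, b))" for b using i(3,4) by blast
      then have "\<beta> y = \<beta> z" by (simp add: \<beta>_def)
      then show "\<kappa> y = \<kappa> z" using uniq[OF yz(2), of "\<kappa> y"] \<kappa>[OF yz(1)] sb i(3,4) by metis
    next
      assume "\<kappa> y = \<kappa> z"
      then show "same_block \<Theta> y z" using \<kappa>[OF yz(1)] \<kappa>[OF yz(2)] i(3,4) by metis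
    qed
    show "\<kappa> (k \<otimes>\<^bsub>G\<^esub> g, b) = (k \<otimes>\<^bsub>G\<^esub> fst (\<kappa> (g, b)), snd (\<kappa> (g, b)))"
      if k: "k \<in> carrier G" and gb: "(g, b) \<in> U" for k g b
    proof -
      have gG: "g \<in> carrier G" using gb i(1) by blast
      have bk: "same_block \<Theta> (g, b) (inv\<^bsub>G\<^esub> k \<otimes>\<^bsub>G\<^esub> h, c)" if "same_block \<Theta> (k \<otimes>\<^bsub>G\<^esub> g, b) (h, c)" for h c
        using i(7)[OF G.inv_closed[OF k] that] k gG by (simp add: G.m_assoc[symmetric])
      have "(\<exists>h. same_block \<Theta> (k \<otimes>\<^bsub>G\<^esub> g, b) (h, c)) \<longleftrightarrow> (\<exists>h. same_block \<Theta> (g, b) (h, c))" for c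
        using bk i(7)[OF k] by blast
      then have b: "\<beta> (k \<otimes>\<^bsub>G\<^esub> g, b) = \<beta> (g, b)" by (simp add: \<beta>_def)
      have "same_block \<Theta> (g, b) (fst (\<kappa> (g, b)), snd (\<kappa> (g, b)))" using \<kappa>[OF gb] unfolding prod.collapse by blast
      from i(7)[OF k this] show ?thesis
        using uniq[OF trans[OF k gb]] b \<kappa>[OF gb] by (metis snd_conv)
    qed
  qed (rule trans)
qed

lemma flow_imp_division:
  assumes T: "is_ts T" and flow: "flow_rel T f R"
  shows "S \<prec>\<^sub>s sgp_times (sgp_of (group_ts G \<wr> sym_ts B \<wr> T)) (sgp_of RL)"
proof -
  note fl = flow_relD[OF flow]
  have ic: "(fst (f q), snd (f q)) \<in> invariant_cross_sections G B" if "q \<in> states T" for q using fl(1)[OF that] by simp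
  have "\<forall>q. \<exists>\<kappa>. q \<in> states T \<longrightarrow> (\<forall>y. y \<in> fst (f q) \<longrightarrow> \<kappa> y \<in> Y) \<and>
    (\<forall>y z. y \<in> fst (f q) \<longrightarrow> z \<in> fst (f q) \<longrightarrow> same_block (snd (f q)) y z = (\<kappa> y = \<kappa> z)) \<and>
    (\<forall>k g b. k \<in> carrier G \<longrightarrow> (g, b) \<in> fst (f q) \<longrightarrow> \<kappa> (k \<otimes>\<^bsub>G\<^esub> g, b) = (k \<otimes>\<^bsub>G\<^esub> fst (\<kappa> (g, b)), snd (\<kappa> (g, b)))) \<and>
    (\<forall>k g b. k \<in> carrier G \<longrightarrow> (g, b) \<in> fst (f q) \<longrightarrow> (k \<otimes>\<^bsub>G\<^esub> g, b) \<in> fst (f q))"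
  proof
    fix q show "\<exists>\<kappa>. q \<in> states T \<longrightarrow> (\<forall>y. y \<in> fst (f q) \<longrightarrow> \<kappa> y \<in> Y) \<and>
    (\<forall>y z. y \<in> fst (f q) \<longrightarrow> z \<in> fst (f q) \<longrightarrow> same_block (snd (f q)) y z = (\<kappa> y = \<kappa> z)) \<and>
    (\<forall>k g b. k \<in> carrier G \<longrightarrow> (g, b) \<in> fst (f q) \<longrightarrow> \<kappa> (k \<otimes>\<^bsub>G\<^esub> g, b) = (k \<otimes>\<^bsub>G\<^esub> fst (\<kappa> (g, b)), snd (\<kappa> (g, b)))) \<and>
    (\<forall>k g b. k \<in> carrier G \<longrightarrow> (g, b) \<in> fst (f q) \<longrightarrow> (k \<otimes>\<^bsub>G\<^esub> g, b) \<in> fst (f q))"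
    proof (cases "q \<in> states T")
      case True
      show ?thesis by (rule block_representatives[OF ic[OF True]]) blast
    qed blast
  qed
  from choice[OF this] obtain \<kappa> where \<kappa>: "\<forall>q. q \<in> states T \<longrightarrow> (\<forall>y. y \<in> fst (f q) \<longrightarrow> \<kappa> q y \<in> Y) \<and>
    (\<forall>y z. y \<in> fst (f q) \<longrightarrow> z \<in> fst (f q) \<longrightarrow> same_block (snd (f q)) y z = (\<kappa> q y = \<kappa> q z)) \<and>
    (\<forall>k g b. k \<in> carrier G \<longrightarrow> (g, b) \<in> fst (f q) \<longrightarrow> \<kappa> q (k \<otimes>\<^bsub>G\<^esub> g, b) = (k \<otimes>\<^bsub>G\<^esub> fst (\<kappa> q (g, b)), snd (\<kappa> q (g, b)))) \<and>
    (\<forall>k g b. k \<in> carrier G \<longrightarrow> (g, b) \<in> fst (f q) \<longrightarrow> (k \<otimes>\<^bsub>G\<^esub> g, b) \<in> fst (f q))" ..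
  have kY: "\<kappa> q y \<in> Y" if "q \<in> states T" "y \<in> fst (f q)" for q y using \<kappa> that by blast
  have ksb: "same_block (snd (f q)) y z = (\<kappa> q y = \<kappa> q z)" if "q \<in> states T" "y \<in> fst (f q)" "z \<in> fst (f q)" for q y z
    using \<kappa> that by blast
  have keq: "\<kappa> q (k \<otimes>\<^bsub>G\<^esub> g, b) = (k \<otimes>\<^bsub>G\<^esub> fst (\<kappa> q (g, b)), snd (\<kappa> q (g, b)))"
    if "q \<in> states T" "k \<in> carrier G" "(g, b) \<in> fst (f q)" for q k g b using \<kappa> that by blast
  have kcl: "(k \<otimes>\<^bsub>G\<^esub> g, b) \<in> fst (f q)" if "q \<in> states T" "k \<in> carrier G" "(g, b) \<in> fst (f q)" for q k g b
    using \<kappa> that by blast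
  \<comment> \<open>The state of the wreath product that stands for the block of y at q: the
    representative of the block, followed by q.\<close>
  define pos where "pos q y = (fst (\<kappa> q y), snd (\<kappa> q y), q)" for q y
  define \<rho> where "\<rho> w s \<longleftrightarrow> (\<forall>q y z. q \<in> states T \<and> y \<in> fst (f q) \<and> act s y = Some z \<longrightarrow>
     (\<exists>q'. q' \<in> states T \<and> z \<in> fst (f q') \<and> w (pos q y) = Some (pos q' z)))" for w s
  have W: "is_ts (group_ts G \<wr> sym_ts B \<wr> T)"
    using is_ts_wreath[OF is_ts_group_ts[OF G.is_monoid finite_Y(1)] is_ts_wreath[OF is_ts_sym_ts[OF finite_Y(2)] T]] .
  have total: "\<exists>w\<in>pfuns (group_ts G \<wr> sym_ts B \<wr> T). \<rho> w s" if s: "s \<in> carrier S" for s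
  proof -
    obtain t where st: "(s, t) \<in> R" using fl(3)[OF s] by blast
    have tT: "t \<in> pfuns T" using fl(5)[OF st] .
    have ex: "\<exists>\<gamma> \<pi>. (\<forall>b. \<gamma> b \<in> carrier G) \<and> \<pi> \<in> pfuns (sym_ts B) \<and>
      (\<forall>y z. y \<in> fst (f q) \<longrightarrow> act s y = Some z \<longrightarrow> \<pi> (snd (\<kappa> q y)) = Some (snd (\<kappa> q' z)) \<and>
         fst (\<kappa> q y) \<otimes>\<^bsub>G\<^esub> \<gamma> (snd (\<kappa> q y)) = fst (\<kappa> q' z))" if q: "t q = Some q'" for q q'
    proof -
      have qT: "q \<in> states T" "q' \<in> states T" using is_tsD(5,6)[OF T tT q] .
      \<comment> \<open>The moves of s from representatives of blocks at q to representatives at q'.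
        The equivalence in the flow condition makes M single-valued and injective.\<close>
      define M where "M = {(\<kappa> q y, \<kappa> q' z) | y z. y \<in> fst (f q) \<and> act s y = Some z}"
      have z: "z \<in> fst (f q')" if "y \<in> fst (f q)" "act s y = Some z" for y z
        using fl(7)[OF st qT(1) that] q by auto
      have "\<exists>\<gamma> \<pi>. (\<forall>b. \<gamma> b \<in> carrier G) \<and> \<pi> \<in> pfuns (sym_ts B) \<and>
        (\<forall>h b h' b'. ((h, b), (h', b')) \<in> M \<longrightarrow> \<pi> b = Some b' \<and> h \<otimes>\<^bsub>G\<^esub> \<gamma> b = h')"
      proof (rule extend_equivariant)
        show "M \<subseteq> Y \<times> Y" using kY qT z unfolding M_def by blast
        have iff: "\<kappa> q y = \<kappa> q y' \<longleftrightarrow> \<kappa> q' x = \<kappa> q' x'" if "y \<in> fst (f q)" "act s y = Some x"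
          "y' \<in> fst (f q)" "act s y' = Some x'" for y x y' x'
          using fl(8)[OF st qT(1) q that(1,3,2,4)] ksb qT that z by simp
        show "y = z" if h: "(x, y) \<in> M" "(x, z) \<in> M" for x y z
          using h iff unfolding M_def by blast
        show "x = y" if h: "(x, z) \<in> M" "(y, z) \<in> M" for x y z
          using h iff unfolding M_def by blast
        show "((g \<otimes>\<^bsub>G\<^esub> h, b), (g \<otimes>\<^bsub>G\<^esub> h', b')) \<in> M" if g: "g \<in> carrier G" and h: "((h, b), (h', b')) \<in> M" for g h b h' b'
        proof -
          obtain y x where yx: "(h, b) = \<kappa> q y" "(h', b') = \<kappa> q' x" "y \<in> fst (f q)" "act s y = Some x"
            using h unfolding M_def by blast
          obtain k c where y: "y = (k, c)" by (cases y)
          obtain l d where x: "x = (l, d)" by (cases x)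
          have "act s (g \<otimes>\<^bsub>G\<^esub> k, c) = Some (g \<otimes>\<^bsub>G\<^esub> l, d)" using act_left[OF s g] yx(4) y x by simp
          moreover have "(g \<otimes>\<^bsub>G\<^esub> k, c) \<in> fst (f q)" using kcl[OF qT(1) g] yx(3) y by simp
          moreover have "\<kappa> q (g \<otimes>\<^bsub>G\<^esub> k, c) = (g \<otimes>\<^bsub>G\<^esub> h, b)" using keq[OF qT(1) g] yx(1,3) y by (metis fst_conv snd_conv)
          moreover have "\<kappa> q' (g \<otimes>\<^bsub>G\<^esub> l, d) = (g \<otimes>\<^bsub>G\<^esub> h', b')"
            using keq[OF qT(2) g] yx(2) x z[OF yx(3,4)] by (metis fst_conv snd_conv)
          ultimately show ?thesis unfolding M_def
            by (intro CollectI exI[of _ "(g \<otimes>\<^bsub>G\<^esub> k, c)"] exI[of _ "(g \<otimes>\<^bsub>G\<^esub> l, d)"]) simp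
        qed
      qed
      then obtain \<gamma> \<pi> where gp: "\<forall>b. \<gamma> b \<in> carrier G" "\<pi> \<in> pfuns (sym_ts B)"
        "\<forall>h b h' b'. ((h, b), (h', b')) \<in> M \<longrightarrow> \<pi> b = Some b' \<and> h \<otimes>\<^bsub>G\<^esub> \<gamma> b = h'" by blast
      have "\<pi> (snd (\<kappa> q y)) = Some (snd (\<kappa> q' z)) \<and> fst (\<kappa> q y) \<otimes>\<^bsub>G\<^esub> \<gamma> (snd (\<kappa> q y)) = fst (\<kappa> q' z)"
        if h: "y \<in> fst (f q)" "act s y = Some z" for y z
      proof -
        have "(\<kappa> q y, \<kappa> q' z) \<in> M" using h unfolding M_def by blast
        then have "((fst (\<kappa> q y), snd (\<kappa> q y)), (fst (\<kappa> q' z), snd (\<kappa> q' z))) \<in> M" by simp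
        then show ?thesis using gp(3) by blast
      qed
      then show ?thesis using gp(1,2) by blast
    qed
    have "\<forall>q. \<exists>\<gamma>\<pi>. q \<in> dom t \<longrightarrow> (\<forall>b. fst \<gamma>\<pi> b \<in> carrier G) \<and> snd \<gamma>\<pi> \<in> pfuns (sym_ts B) \<and>
      (\<forall>y z. y \<in> fst (f q) \<longrightarrow> act s y = Some z \<longrightarrow> snd \<gamma>\<pi> (snd (\<kappa> q y)) = Some (snd (\<kappa> (the (t q)) z)) \<and>
         fst (\<kappa> q y) \<otimes>\<^bsub>G\<^esub> fst \<gamma>\<pi> (snd (\<kappa> q y)) = fst (\<kappa> (the (t q)) z))"
    proof
      fix q
      show "\<exists>\<gamma>\<pi>. q \<in> dom t \<longrightarrow> (\<forall>b. fst \<gamma>\<pi> b \<in> carrier G) \<and> snd \<gamma>\<pi> \<in> pfuns (sym_ts B) \<and>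
      (\<forall>y z. y \<in> fst (f q) \<longrightarrow> act s y = Some z \<longrightarrow> snd \<gamma>\<pi> (snd (\<kappa> q y)) = Some (snd (\<kappa> (the (t q)) z)) \<and>
         fst (\<kappa> q y) \<otimes>\<^bsub>G\<^esub> fst \<gamma>\<pi> (snd (\<kappa> q y)) = fst (\<kappa> (the (t q)) z))"
      proof (cases "q \<in> dom t")
        case True
        then obtain q' where q': "t q = Some q'" by blast
        obtain \<gamma> \<pi> where "\<forall>b. \<gamma> b \<in> carrier G" "\<pi> \<in> pfuns (sym_ts B)"
          "\<forall>y z. y \<in> fst (f q) \<longrightarrow> act s y = Some z \<longrightarrow> \<pi> (snd (\<kappa> q y)) = Some (snd (\<kappa> q' z)) \<and>
             fst (\<kappa> q y) \<otimes>\<^bsub>G\<^esub> \<gamma> (snd (\<kappa> q y)) = fst (\<kappa> q' z)"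
          using ex[OF q'] by blast
        then show ?thesis using q' by (intro exI[of _ "(\<gamma>, \<pi>)"]) simp
      qed blast
    qed
    from choice[OF this] obtain \<gamma>\<pi> where
      gp: "\<And>q. q \<in> dom t \<Longrightarrow> (\<forall>b. fst (\<gamma>\<pi> q) b \<in> carrier G) \<and> snd (\<gamma>\<pi> q) \<in> pfuns (sym_ts B) \<and>
      (\<forall>y z. y \<in> fst (f q) \<longrightarrow> act s y = Some z \<longrightarrow> snd (\<gamma>\<pi> q) (snd (\<kappa> q y)) = Some (snd (\<kappa> (the (t q)) z)) \<and>
         fst (\<kappa> q y) \<otimes>\<^bsub>G\<^esub> fst (\<gamma>\<pi> q) (snd (\<kappa> q y)) = fst (\<kappa> (the (t q)) z))" by blast
    define w where "w = wreath_act (\<lambda>(b, q). rtrans G (fst (\<gamma>\<pi> q) b)) (wreath_act (\<lambda>q. snd (\<gamma>\<pi> q)) t)"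
    have "w \<in> pfuns (group_ts G \<wr> sym_ts B \<wr> T)" unfolding w_def
    proof (intro wreath_pfunsI)
      show "t \<in> pfuns T" by fact
      show "snd (\<gamma>\<pi> q) \<in> pfuns (sym_ts B)" if "t q = Some q'" for q q' using gp that by blast
      show "(case x of (b, q) \<Rightarrow> rtrans G (fst (\<gamma>\<pi> q) b)) \<in> pfuns (group_ts G)"
        if "wreath_act (\<lambda>q. snd (\<gamma>\<pi> q)) t x = Some y" for x y
      proof -
        have "snd x \<in> dom t" using that by (auto simp: wreath_act_Some)
        then show ?thesis using gp by (cases x) auto
      qed
    qed
    moreover have "\<rho> w s" unfolding \<rho>_def
    proof (intro allI impI, elim conjE)
      fix q y z assume h: "q \<in> states T" "y \<in> fst (f q)" "act s y = Some z"
      obtain q' where q': "t q = Some q'" "z \<in> fst (f q')" using fl(7)[OF st h] by blast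
      have qT: "q' \<in> states T" using is_tsD(6)[OF T tT q'(1)] .
      have g: "snd (\<gamma>\<pi> q) (snd (\<kappa> q y)) = Some (snd (\<kappa> q' z))"
         "fst (\<kappa> q y) \<otimes>\<^bsub>G\<^esub> fst (\<gamma>\<pi> q) (snd (\<kappa> q y)) = fst (\<kappa> q' z)"
        using gp[of q] h q'(1) by (auto simp del: split_paired_All)
      have "fst (\<kappa> q y) \<in> carrier G" using kY[OF h(1,2)] by auto
      then have "w (pos q y) = Some (pos q' z)" using g q'(1) by (simp add: w_def pos_def wreath_act_Some)
      then show "\<exists>q'. q' \<in> states T \<and> z \<in> fst (f q') \<and> w (pos q y) = Some (pos q' z)" using q'(2) qT by blast
    qed
    ultimately show ?thesis by blast
  qed
  let ?U = "sgp_times (sgp_of (group_ts G \<wr> sym_ts B \<wr> T)) (sgp_of RL)"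
  show ?thesis
  proof (rule divides_rel[OF S, where \<rho> = "\<lambda>u s. \<rho> (fst u) s \<and> snd u = rlm s"])
    show "u \<cdot>\<^bsub>?U\<^esub> v \<in> carrier ?U" if "u \<in> carrier ?U" "v \<in> carrier ?U" for u v
      using is_sgpD(2)[OF is_sgp_times[OF is_tsD(2)[OF W] is_sgp_RL] that] .
    show "\<exists>u\<in>carrier ?U. \<rho> (fst u) s \<and> snd u = rlm s" if s: "s \<in> carrier S" for s
    proof -
      obtain w where "w \<in> pfuns (group_ts G \<wr> sym_ts B \<wr> T)" "\<rho> w s" using total[OF s] by blast
      then show ?thesis using s by (intro bexI[of _ "(w, rlm s)"]) (auto simp: sgp_times_def)
    qed
    show "\<rho> (fst (u \<cdot>\<^bsub>?U\<^esub> v)) (s \<cdot>\<^bsub>S\<^esub> t) \<and> snd (u \<cdot>\<^bsub>?U\<^esub> v) = rlm (s \<cdot>\<^bsub>S\<^esub> t)"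
      if h: "\<rho> (fst u) s \<and> snd u = rlm s" "\<rho> (fst v) t \<and> snd v = rlm t" "s \<in> carrier S" "t \<in> carrier S" for u v s t
    proof
      have "\<rho> (fst v \<circ>\<^sub>m fst u) (s \<cdot>\<^bsub>S\<^esub> t)" unfolding \<rho>_def
      proof (intro allI impI, elim conjE)
        fix q y z assume q: "q \<in> states T" "y \<in> fst (f q)" and z: "act (s \<cdot>\<^bsub>S\<^esub> t) y = Some z"
        obtain x where x: "act s y = Some x" "act t x = Some z"
          using z unfolding act_comp[OF h(3,4)] by (auto simp: map_comp_Some_iff)
        obtain q1 where q1: "q1 \<in> states T" "x \<in> fst (f q1)" "fst u (pos q y) = Some (pos q1 x)"
          using h(1) q x(1) unfolding \<rho>_def by blast
        obtain q2 where q2: "q2 \<in> states T" "z \<in> fst (f q2)" "fst v (pos q1 x) = Some (pos q2 z)"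
          using h(2) q1(1,2) x(2) unfolding \<rho>_def by blast
        then show "\<exists>q'. q' \<in> states T \<and> z \<in> fst (f q') \<and> (fst v \<circ>\<^sub>m fst u) (pos q y) = Some (pos q' z)"
          using q1 by (intro exI[of _ q2]) (simp add: map_comp_def)
      qed
      then show "\<rho> (fst (u \<cdot>\<^bsub>?U\<^esub> v)) (s \<cdot>\<^bsub>S\<^esub> t)"
        by (simp add: sgp_times_def case_prod_unfold)
      show "snd (u \<cdot>\<^bsub>?U\<^esub> v) = rlm (s \<cdot>\<^bsub>S\<^esub> t)"
        using h rlm_comp[OF h(3,4)] by (simp add: sgp_times_def case_prod_unfold)
    qed
    show "s = t" if h: "\<rho> (fst u) s \<and> snd u = rlm s" "\<rho> (fst u) t \<and> snd u = rlm t" "s \<in> carrier S" "t \<in> carrier S"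
      for u s t
    proof (rule eq_from_rlm[OF h(3,4)])
      show "rlm s = rlm t" using h by simp
      fix g b b' k k' assume a: "act s (g, b) = Some (k, b')" and a': "act t (g, b) = Some (k', b')"
      have y: "(g, b) \<in> Y" using act_Some[OF h(3)] a by blast
      obtain q where q: "q \<in> states T" "(g, b) \<in> fst (f q)" using fl(2)[OF y] by blast
      obtain q1 where q1: "q1 \<in> states T" "(k, b') \<in> fst (f q1)" "fst u (pos q (g, b)) = Some (pos q1 (k, b'))"
        using h(1) q a unfolding \<rho>_def by blast
      obtain q2 where q2: "(k', b') \<in> fst (f q2)" "fst u (pos q (g, b)) = Some (pos q2 (k', b'))"
        using h(2) q a' unfolding \<rho>_def by blast
      have "pos q1 (k, b') = pos q2 (k', b')" using q1(3) q2(2) by simp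
      then have "q2 = q1" "\<kappa> q1 (k, b') = \<kappa> q1 (k', b')" by (auto simp: pos_def prod_eq_iff)
      then have "same_block (snd (f q1)) (k, b') (k', b')" using ksb[OF q1(1,2)] q2(1) by simp
      then show "k = k'" using invariant_cross_sectionsD(6)[OF ic[OF q1(1)]] by blast
    qed
  qed
qed

end

section \<open>Relational morphisms with aperiodic kernel\<close>

lemma lifts_spow:
  assumes cov: "reg_cover W S c x0" and S: "is_sgp S" and s: "s \<in> carrier S" and w: "lifts S c s w"
  shows "lifts S c (spow S s n) (ppow w n)"
proof (induction n)
  case (Suc n)
  then show ?case using lifts_mult[OF cov S Suc w spow_closed[OF S s] s] by simp
qed (use w in simp)

text \<open>An element related to a member of an aperiodic subsemigroup is related to one with
  stable powers, so it is enough to look at single elements.\<close>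

lemma aperiodic_rel_morphismI:
  assumes r: "rel_morphism S U \<Theta>" and U: "finite_sgp U"
    and ap: "\<And>s u m. s \<in> carrier S \<Longrightarrow> u \<in> \<Theta> s \<Longrightarrow> spow U u (Suc m) = spow U u m \<Longrightarrow>
      \<exists>n. spow S s (Suc n) = spow S s n"
  shows "aperiodic_rel_morphism S U \<Theta>"
  unfolding aperiodic_rel_morphism_def
proof (intro conjI allI impI)
  show "rel_morphism S U \<Theta>" by fact
  fix V assume V: "subsgp V U \<and> aperiodic (U\<lparr>carrier := V\<rparr>)"
  have fin: "finite_sgp (U\<lparr>carrier := V\<rparr>)"
    using U V is_sgp_subsgp[of U V] unfolding finite_sgp_def subsgp_def by (auto intro: finite_subset)
  show "aperiodic (S\<lparr>carrier := {s \<in> carrier S. \<Theta> s \<inter> V \<noteq> {}}\<rparr>)"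
  proof (rule aperiodicI)
    fix s assume "s \<in> carrier (S\<lparr>carrier := {s \<in> carrier S. \<Theta> s \<inter> V \<noteq> {}}\<rparr>)"
    then obtain u where s: "s \<in> carrier S" "u \<in> \<Theta> s" "u \<in> V" by auto
    obtain m where "spow (U\<lparr>carrier := V\<rparr>) u (Suc m) = spow (U\<lparr>carrier := V\<rparr>) u m"
      using aperiodicD[OF fin] V s(3) by auto
    then show "\<exists>n. spow (S\<lparr>carrier := {s \<in> carrier S. \<Theta> s \<inter> V \<noteq> {}}\<rparr>) s (Suc n) =
        spow (S\<lparr>carrier := {s \<in> carrier S. \<Theta> s \<inter> V \<noteq> {}}\<rparr>) s n"
      using ap[OF s(1,2)] unfolding spow_carrier_update by blast
  qed
qed

text \<open>The A-component of lifts is dropped. If the projection u has stable powers, so has every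
  lift (f, u), as A is aperiodic; and an element is determined by any of its lifts.\<close>

lemma reg_cover_aperiodic_morphism:
  fixes A :: "'p ts" and U :: "'q ts"
  assumes cov: "reg_cover (A \<wr> U) S c x0" and S: "is_sgp S"
    and A: "is_ts A" "aperiodic (sgp_of A)" and U: "is_ts U"
  defines "\<Theta> \<equiv> \<lambda>s. {v \<in> pfuns U. \<exists>f. (\<forall>q\<in>dom v. f q \<in> pfuns A) \<and> lifts S c s (wreath_act f v)}"
  shows "aperiodic_rel_morphism S (sgp_of U) \<Theta>"
proof (rule aperiodic_rel_morphismI)
  show "finite_sgp (sgp_of U)" by (rule finite_sgp_of[OF U])
  show "rel_morphism S (sgp_of U) \<Theta>" unfolding rel_morphism_def
  proof (intro conjI ballI)
    show "\<Theta> s \<noteq> {}" if s: "s \<in> carrier S" for s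
    proof -
      obtain w where "w \<in> pfuns (A \<wr> U)" "lifts S c s w" using reg_coverD(4)[OF cov s] by blast
      then show ?thesis unfolding wreath_pfuns \<Theta>_def by blast
    qed
    show "\<Theta> s \<subseteq> carrier (sgp_of U)" for s by (auto simp: \<Theta>_def)
    fix s s' u u' assume h: "s \<in> carrier S" "s' \<in> carrier S" "u \<in> \<Theta> s" "u' \<in> \<Theta> s'"
    obtain f where f: "u \<in> pfuns U" "\<forall>q\<in>dom u. f q \<in> pfuns A" "lifts S c s (wreath_act f u)"
      using h(3) unfolding \<Theta>_def by blast
    obtain f' where f': "u' \<in> pfuns U" "\<forall>q\<in>dom u'. f' q \<in> pfuns A" "lifts S c s' (wreath_act f' u')"
      using h(4) unfolding \<Theta>_def by blast
    have "lifts S c (s \<cdot>\<^bsub>S\<^esub> s') (wreath_act (\<lambda>q. f' (the (u q)) \<circ>\<^sub>m f q) (u' \<circ>\<^sub>m u))"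
      using lifts_mult[OF cov S f(3) f'(3) h(1,2)] unfolding wreath_act_comp .
    moreover have "f' (the (u q)) \<circ>\<^sub>m f q \<in> pfuns A" if "q \<in> dom (u' \<circ>\<^sub>m u)" for q
    proof -
      obtain q' q'' where "u q = Some q'" "u' q' = Some q''" using \<open>q \<in> _\<close>
        by (auto simp: map_comp_Some_iff)
      then have "f q \<in> pfuns A" "f' (the (u q)) \<in> pfuns A" using f(2) f'(2) by auto
      then show ?thesis by (rule is_tsD(4)[OF A(1)])
    qed
    moreover have "u' \<circ>\<^sub>m u \<in> pfuns U" using is_tsD(4)[OF U f(1) f'(1)] .
    ultimately show "u \<cdot>\<^bsub>sgp_of U\<^esub> u' \<in> \<Theta> (s \<cdot>\<^bsub>S\<^esub> s')" unfolding \<Theta>_def pfun_sgp_simps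
      by (intro CollectI conjI exI[of _ "\<lambda>q. f' (the (u q)) \<circ>\<^sub>m f q"]) auto
  qed
  obtain N where N: "\<forall>(f :: 'q \<Rightarrow> 'p \<rightharpoonup> 'p) s m. (\<forall>q\<in>dom s. f q \<in> pfuns A) \<longrightarrow> ppow s (Suc m) = ppow s m \<longrightarrow>
     ppow (wreath_act f s) (Suc (Suc (m + N))) = ppow (wreath_act f s) (Suc (m + N))"
    using wreath_power_stable[OF A] ..
  fix s u m assume s: "s \<in> carrier S" and u: "u \<in> \<Theta> s"
    and e: "spow (sgp_of U) u (Suc m) = spow (sgp_of U) u m"
  obtain f where f: "\<And>q. q \<in> dom u \<Longrightarrow> f q \<in> pfuns A" "lifts S c s (wreath_act f u)"
    using u unfolding \<Theta>_def by blast
  have "ppow (wreath_act f u) (Suc (Suc (m + N))) = ppow (wreath_act f u) (Suc (m + N))"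
    using e N f(1) unfolding spow_pfun_sgp[of "pfuns U"] by blast
  then have "spow S s (Suc (Suc (m + N))) = spow S s (Suc (m + N))"
    using lifts_spow[OF cov S s f(2)] lifts_unique[OF cov] by metis
  then show "\<exists>n. spow S s (Suc n) = spow S s n" by blast
qed

text \<open>The elements \<open>(\<alpha>, q, q')\<close> form an aperiodic semigroup, as \<open>\<alpha>\<close> ranges over the aperiodic
  semigroup of \<open>A\<close> and \<open>q \<mapsto> q'\<close> has rank one.\<close>

definition rank_one :: "(nat \<rightharpoonup> nat) \<Rightarrow> nat \<Rightarrow> nat \<Rightarrow> (nat \<times> nat \<rightharpoonup> nat \<times> nat)" where
  "rank_one \<alpha> q q' = (\<lambda>(a, r). if r = q then map_option (\<lambda>a'. (a', q')) (\<alpha> a) else None)"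

lemma rank_one_Some: "rank_one \<alpha> q q' x = Some y \<longleftrightarrow> snd x = q \<and> snd y = q' \<and> \<alpha> (fst x) = Some (fst y)"
  by (cases x; cases y) (auto simp: rank_one_def)

lemma rank_one_comp: "rank_one \<beta> r r' \<circ>\<^sub>m rank_one \<alpha> q q' =
    (if q' = r then rank_one (\<beta> \<circ>\<^sub>m \<alpha>) q r' else Map.empty)"
proof (rule ext, rule option_eqI)
  fix x y
  show "(rank_one \<beta> r r' \<circ>\<^sub>m rank_one \<alpha> q q') x = Some y \<longleftrightarrow>
    (if q' = r then rank_one (\<beta> \<circ>\<^sub>m \<alpha>) q r' else Map.empty) x = Some y"
    by (auto simp: map_comp_Some_iff rank_one_Some)
qed

definition rank_one_ts :: "nat ts \<Rightarrow> nat set \<Rightarrow> (nat \<times> nat) ts" where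
  "rank_one_ts A Q = \<lparr>states = states A \<times> Q,
     pfuns = insert Map.empty {rank_one \<alpha> q q' | \<alpha> q q'. \<alpha> \<in> pfuns A \<and> q \<in> Q \<and> q' \<in> Q}\<rparr>"

lemma rank_one_ts_ok:
  assumes A: "is_ts A" "aperiodic (sgp_of A)" and Q: "finite Q"
  shows "is_ts (rank_one_ts A Q)" "aperiodic (sgp_of (rank_one_ts A Q))"
proof -
  have cl: "v \<circ>\<^sub>m u \<in> pfuns (rank_one_ts A Q)"
    if "u \<in> pfuns (rank_one_ts A Q)" "v \<in> pfuns (rank_one_ts A Q)" for u v
  proof -
    have "v \<circ>\<^sub>m Map.empty = Map.empty" by (simp add: map_comp_def)
    then show ?thesis using that is_tsD(4)[OF A(1)] by (auto simp: rank_one_ts_def rank_one_comp; blast)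
  qed
  have dr: "dom u \<subseteq> states A \<times> Q \<and> ran u \<subseteq> states A \<times> Q" if u: "u \<in> pfuns (rank_one_ts A Q)" for u
  proof -
    have "x \<in> states A \<times> Q \<and> y \<in> states A \<times> Q" if "u x = Some y" for x y
      using u that is_tsD(5,6)[OF A(1)] by (cases x; cases y) (auto simp: rank_one_ts_def rank_one_Some)
    then show ?thesis by (auto simp: dom_def ran_def)
  qed
  show "is_ts (rank_one_ts A Q)" unfolding is_ts_def is_sgp_pfun
    using is_tsD(1)[OF A(1)] Q cl dr by (auto simp: rank_one_ts_def)
  show "aperiodic (sgp_of (rank_one_ts A Q))"
  proof (rule aperiodicI)
    fix u assume "u \<in> carrier (sgp_of (rank_one_ts A Q))"
    then consider "u = Map.empty" | \<alpha> q q' where "u = rank_one \<alpha> q q'" "\<alpha> \<in> pfuns A" by (auto simp: rank_one_ts_def)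
    then have "\<exists>n. ppow u (Suc n) = ppow u n"
    proof cases
      case 1 then show ?thesis by (intro exI[of _ 0]) simp
    next
      case 2
      show ?thesis
      proof (cases "q = q'")
        case True
        have pw: "ppow u n = rank_one (ppow \<alpha> n) q q" for n
          by (induction n) (use 2 True in \<open>auto simp: rank_one_comp\<close>)
        obtain n where "ppow \<alpha> (Suc n) = ppow \<alpha> n"
          using aperiodicD[OF finite_sgp_of[OF A(1)] A(2)] 2(2)
          by (auto simp: spow_pfun_sgp[of "pfuns A"] simp del: spow.simps)
        then show ?thesis unfolding pw by (intro exI[of _ n]) simp
      next
        case False
        then have "u \<circ>\<^sub>m u = Map.empty" using 2 by (simp add: rank_one_comp)
        then show ?thesis by (intro exI[of _ "Suc 0"]) (simp add: map_comp_assoc[symmetric])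
      qed
    qed
    then show "\<exists>n. spow (sgp_of (rank_one_ts A Q)) u (Suc n) = spow (sgp_of (rank_one_ts A Q)) u n"
      unfolding spow_pfun_sgp[of "pfuns _"] .
  qed
qed

section \<open>Condition 1 implies conditions 2 and 3\<close>

context gm
begin

lemma complexity_imp_aperiodic_morphism:
  assumes "complexity S \<le> enat n"
  shows "\<exists>(H :: nat monoid) (T :: nat ts) \<Theta>.
          Group.group H \<and> finite (carrier H) \<and> is_ts T \<and> complexity (sgp_of T) + 1 \<le> enat n \<and>
          aperiodic_rel_morphism S (sgp_of (group_ts H \<wr> T)) \<Theta>"
proof -
  obtain A T :: "nat ts" and H :: "nat monoid" and c x0 where
    h: "is_ts A" "aperiodic (sgp_of A)" "is_ts T" "Group.group H" "finite (carrier H)"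
    "complexity (sgp_of T) + 1 \<le> enat n" "reg_cover (A \<wr> (group_ts H \<wr> T)) S c x0"
    by (rule complexity_decompose[OF S not_aperiodic assms])
  have "is_ts (group_ts H \<wr> T)"
    using is_ts_wreath[OF is_ts_group_ts[OF group.is_monoid[OF h(4)] h(5)] h(3)] .
  from reg_cover_aperiodic_morphism[OF h(7) S h(1,2) this] show ?thesis using h(3-6) by blast
qed

text \<open>States \<open>(a, h, q)\<close> covering an element \<open>\<iota> y\<close> cover the state \<open>(y, q)\<close> of the derived
  transformation semigroup; those covering an element of \<open>\<iota> y \<cdot> S\<close> outside the \<open>\<R>\<close>-class
  record that the action has become undefined.\<close>

lemma complexity_imp_derived_Ap_Gp:
  assumes "complexity S \<le> enat n"
  shows "\<exists>(T :: nat ts) \<Phi>Q \<Phi>T. is_ts T \<and> complexity (sgp_of T) + 1 \<le> enat n \<and>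
          ts_rel_morphism P T \<Phi>Q \<Phi>T \<and> in_Ap_Gp (sgp_of (Der T \<Phi>Q \<Phi>T))"
proof -
  obtain A T :: "nat ts" and H :: "nat monoid" and c x0 where
    A: "is_ts A" "aperiodic (sgp_of A)" and T: "is_ts T" and H: "Group.group H" "finite (carrier H)" and
    n: "complexity (sgp_of T) + 1 \<le> enat n" and cov: "reg_cover (A \<wr> (group_ts H \<wr> T)) S c x0"
    by (rule complexity_decompose[OF S not_aperiodic assms])
  have Hts: "is_ts (group_ts H)" by (rule is_ts_group_ts[OF group.is_monoid[OF H(1)] H(2)])
  have U: "is_ts (group_ts H \<wr> T)" using is_ts_wreath[OF Hts T] .
  have W: "is_ts (A \<wr> (group_ts H \<wr> T))" using is_ts_wreath[OF A(1) U] .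
  define \<Phi>Q where "\<Phi>Q y = {q \<in> states T. \<exists>a h. c (a, h, q) = Some (Some (\<iota> y))}" for y
  \<comment> \<open>A lift of s, split into its components \<open>\<phi>\<close> over A, f over H
    and t over T.\<close>
  define L where "L s t f \<phi> \<longleftrightarrow> t \<in> pfuns T \<and> (\<forall>q\<in>dom t. f q \<in> pfuns (group_ts H)) \<and>
     (\<forall>z\<in>dom (wreath_act f t). \<phi> z \<in> pfuns A) \<and> lifts S c s (wreath_act \<phi> (wreath_act f t))" for s t f \<phi>
  define \<Phi>T where "\<Phi>T p = {t. \<exists>s\<in>carrier S. act s = p \<and> (\<exists>f \<phi>. L s t f \<phi>)}" for p
  have \<Phi>T: "t \<in> \<Phi>T (act s) \<longleftrightarrow> (\<exists>f \<phi>. L s t f \<phi>)" if "s \<in> carrier S" for s t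
    unfolding \<Phi>T_def using that act_inj by (auto dest: inj_onD)
  have Lmult: "\<exists>f \<phi>. L (s \<cdot>\<^bsub>S\<^esub> s') (t' \<circ>\<^sub>m t) f \<phi>" if "L s t f \<phi>" "L s' t' f' \<phi>'" "s \<in> carrier S" "s' \<in> carrier S"
    for s s' t t' f f' \<phi> \<phi>'
  proof -
    let ?u = "wreath_act f t" and ?u' = "wreath_act f' t'"
    have "lifts S c (s \<cdot>\<^bsub>S\<^esub> s') (wreath_act (\<lambda>q. \<phi>' (the (?u q)) \<circ>\<^sub>m \<phi> q) (?u' \<circ>\<^sub>m ?u))"
      using lifts_mult[OF cov S _ _ that(3,4)] that(1,2) unfolding L_def wreath_act_comp[symmetric] by blast
    then have l: "lifts S c (s \<cdot>\<^bsub>S\<^esub> s') (wreath_act (\<lambda>q. \<phi>' (the (?u q)) \<circ>\<^sub>m \<phi> q)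
        (wreath_act (\<lambda>q. f' (the (t q)) \<circ>\<^sub>m f q) (t' \<circ>\<^sub>m t)))" unfolding wreath_act_comp[of f' t' f t] .
    have "f' (the (t q)) \<circ>\<^sub>m f q \<in> pfuns (group_ts H)" if q: "q \<in> dom (t' \<circ>\<^sub>m t)" for q
    proof -
      obtain q' q'' where "t q = Some q'" "t' q' = Some q''" using q by (auto simp: map_comp_Some_iff)
      then have "f q \<in> pfuns (group_ts H)" "f' (the (t q)) \<in> pfuns (group_ts H)"
        using \<open>L s t f \<phi>\<close> \<open>L s' t' f' \<phi>'\<close> unfolding L_def by auto
      then show ?thesis by (rule is_tsD(4)[OF Hts])
    qed
    moreover have "\<phi>' (the (?u z)) \<circ>\<^sub>m \<phi> z \<in> pfuns A"
      if z: "z \<in> dom (wreath_act (\<lambda>q. f' (the (t q)) \<circ>\<^sub>m f q) (t' \<circ>\<^sub>m t))" for z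
    proof -
      have "z \<in> dom (?u' \<circ>\<^sub>m ?u)" using z unfolding wreath_act_comp .
      then obtain p where "(?u' \<circ>\<^sub>m ?u) z = Some p" by blast
      then obtain z' where "?u z = Some z'" "?u' z' = Some p" unfolding map_comp_Some_iff by blast
      then have "\<phi> z \<in> pfuns A" "\<phi>' (the (?u z)) \<in> pfuns A"
        using \<open>L s t f \<phi>\<close> \<open>L s' t' f' \<phi>'\<close> unfolding L_def by auto
      then show ?thesis by (rule is_tsD(4)[OF A(1)])
    qed
    moreover have "t' \<circ>\<^sub>m t \<in> pfuns T" using is_tsD(4)[OF T] that unfolding L_def by blast
    ultimately show ?thesis using l unfolding L_def
      by (intro exI[of _ "\<lambda>q. f' (the (t q)) \<circ>\<^sub>m f q"] exI[of _ "\<lambda>q. \<phi>' (the (?u q)) \<circ>\<^sub>m \<phi> q"]) blast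
  qed
  have Lex: "\<exists>t f \<phi>. L s t f \<phi>" if s: "s \<in> carrier S" for s
  proof -
    obtain w where w: "w \<in> pfuns (A \<wr> (group_ts H \<wr> T))" "lifts S c s w" using reg_coverD(4)[OF cov s] by blast
    obtain \<phi> u where u: "w = wreath_act \<phi> u" "u \<in> pfuns (group_ts H \<wr> T)" "\<forall>z\<in>dom u. \<phi> z \<in> pfuns A"
      using w(1) unfolding wreath_pfuns[of w] by blast
    obtain f t where t: "u = wreath_act f t" "t \<in> pfuns T" "\<forall>q\<in>dom t. f q \<in> pfuns (group_ts H)"
      using u(2) unfolding wreath_pfuns[of u] by blast
    have "L s t f \<phi>" unfolding L_def using u(3) t w(2) unfolding u(1) by simp
    then show ?thesis by blast
  qed
  have step: "\<exists>a' h' q'. t q = Some q' \<and> f q h = Some h' \<and> \<phi> (h, q) a = Some a' \<and> q \<in> states T \<and> q' \<in> states T \<and>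
      c (a', h', q') = Some (Some (u \<cdot>\<^bsub>S\<^esub> s))"
    if l: "L s t f \<phi>" and cu: "c (a, h, q) = Some (Some u)" for s t f \<phi> a h q u
  proof -
    have l': "lifts S c s (wreath_act \<phi> (wreath_act f t))" and tT: "t \<in> pfuns T" using l unfolding L_def by auto
    obtain x' where x': "wreath_act \<phi> (wreath_act f t) (a, h, q) = Some x'" "c x' = Some (Some (ract S (Some u) s))"
      by (rule liftsD[OF l' cu])
    obtain a' h' q' where e: "x' = (a', h', q')" by (metis prod.exhaust)
    have "t q = Some q'" using x'(1) unfolding e by (simp add: wreath_act_Some)
    then show ?thesis using x' is_tsD(5,6)[OF T tT, of q q'] unfolding e by (auto simp: wreath_act_Some ract_def)
  qed
  have m: "ts_rel_morphism P T \<Phi>Q \<Phi>T" unfolding ts_rel_morphism_def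
  proof (intro conjI)
    show "rel_morphism (sgp_of P) (sgp_of T) \<Phi>T" unfolding rel_morphism_def
    proof (intro conjI ballI)
      show "\<Phi>T p \<noteq> {}" if p: "p \<in> carrier (sgp_of P)" for p
      proof -
        obtain s where "s \<in> carrier S" "p = act s" using p by auto
        then show ?thesis using Lex[of s] \<Phi>T by blast
      qed
      show "\<Phi>T p \<subseteq> carrier (sgp_of T)" for p unfolding \<Phi>T_def L_def by auto
      fix p p' t t' assume h: "p \<in> carrier (sgp_of P)" "p' \<in> carrier (sgp_of P)" "t \<in> \<Phi>T p" "t' \<in> \<Phi>T p'"
      obtain s f \<phi> where s: "s \<in> carrier S" "act s = p" "L s t f \<phi>" using h(3) unfolding \<Phi>T_def by blast
      obtain s' f' \<phi>' where s': "s' \<in> carrier S" "act s' = p'" "L s' t' f' \<phi>'" using h(4) unfolding \<Phi>T_def by blast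
      have "act (s \<cdot>\<^bsub>S\<^esub> s') = p' \<circ>\<^sub>m p" using act_comp s s' by blast
      moreover have "s \<cdot>\<^bsub>S\<^esub> s' \<in> carrier S" using is_sgpD(2)[OF S] s s' by blast
      ultimately show "t \<cdot>\<^bsub>sgp_of T\<^esub> t' \<in> \<Phi>T (p \<cdot>\<^bsub>sgp_of P\<^esub> p')"
        using Lmult[OF s(3) s'(3) s(1) s'(1)] unfolding \<Phi>T_def pfun_sgp_simps by blast
    qed
    show "\<forall>p\<in>states P. \<Phi>Q p \<noteq> {} \<and> \<Phi>Q p \<subseteq> states T"
    proof
      fix y assume "y \<in> states P"
      then have i: "\<iota> y \<in> carrier S" using iota_S by simp
      obtain w where w: "w \<in> pfuns (A \<wr> (group_ts H \<wr> T))" "lifts S c (\<iota> y) w" using reg_coverD(4)[OF cov i] by blast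
      obtain x' where x': "w x0 = Some x'" "c x' = Some (Some (ract S None (\<iota> y)))"
        by (rule liftsD[OF w(2) reg_coverD(2)[OF cov]])
      obtain a h q where "x' = (a, h, q)" by (metis prod.exhaust)
      then have "q \<in> \<Phi>Q y" using x' is_tsD(6)[OF W w(1) x'(1)] unfolding \<Phi>Q_def by (auto simp: ract_def)
      then show "\<Phi>Q y \<noteq> {} \<and> \<Phi>Q y \<subseteq> states T" unfolding \<Phi>Q_def by blast
    qed
    show "\<forall>p\<in>states P. \<forall>s\<in>pfuns P. \<forall>q\<in>\<Phi>Q p. \<forall>t\<in>\<Phi>T s. \<forall>p'. s p = Some p' \<longrightarrow> (\<exists>q'. t q = Some q' \<and> q' \<in> \<Phi>Q p')"
    proof (intro ballI allI impI)
      fix y p q t y' assume h: "q \<in> \<Phi>Q y" "t \<in> \<Phi>T p" "p y = Some y'"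
      obtain s f \<phi> where s: "s \<in> carrier S" "act s = p" "L s t f \<phi>" using h(2) unfolding \<Phi>T_def by blast
      obtain a hh where cq: "c (a, hh, q) = Some (Some (\<iota> y))" using h(1) unfolding \<Phi>Q_def by blast
      have "\<iota> y \<cdot>\<^bsub>S\<^esub> s = \<iota> y'" using act_Some[OF s(1)] s(2) h(3) by blast
      then show "\<exists>q'. t q = Some q' \<and> q' \<in> \<Phi>Q y'" using step[OF s(3) cq] unfolding \<Phi>Q_def by auto
    qed
  qed
  let ?D = "Der T \<Phi>Q \<Phi>T"
  have D: "is_ts ?D" by (rule is_ts_Der[OF T m])
  define E where "E = rank_one_ts A (states T)"
  have E: "is_ts E" "aperiodic (sgp_of E)" unfolding E_def using rank_one_ts_ok[OF A is_tsD(1)[OF T]] by auto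
  note r = retr_bij[OF bij_prod_encode]
  define code where "code = relabel prod_encode (\<lambda>r. Some (inv_into UNIV prod_encode r))"
  define A' where "A' = relabel_ts prod_encode (\<lambda>r. Some (inv_into UNIV prod_encode r)) E"
  have i: "inv_into UNIV prod_encode r = prod_decode r" for r
    by (metis inj_prod_encode inv_f_eq prod_decode_inverse)
  have code: "code v (prod_encode x) = Some k \<longleftrightarrow> (\<exists>y. k = prod_encode y \<and> v x = Some y)" for v x k
    unfolding code_def relabel_Some i by auto
  have A': "is_ts A'" unfolding A'_def by (rule is_ts_relabel[OF r E(1)])
  have A'ap: "aperiodic (sgp_of A')" unfolding A'_def
    by (rule aperiodic_divides[OF relabel_divides(1)[OF r E(1)] finite_sgp_of[OF E(1)] E(2)])
  have A'P: "code v \<in> pfuns A'" if "v \<in> pfuns E" for v using that unfolding A'_def code_def by simp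
  have V: "is_ts (A' \<wr> group_ts H)" using is_ts_wreath[OF A' Hts] .
  define good where "good u \<longleftrightarrow> (\<exists>y\<in>Y. \<exists>s\<in>carrier S. u = \<iota> y \<cdot>\<^bsub>S\<^esub> s)" for u
  have good_iota: "good (\<iota> y)" if y: "y \<in> Y" for y
  proof -
    obtain s where "s \<in> carrier S" "act s y = Some y" using right_identity[OF y] by blast
    then show ?thesis using act_Some[of s y y] y unfolding good_def by metis
  qed
  have good_mult: "good (u \<cdot>\<^bsub>S\<^esub> s)" if u: "good u" and s: "s \<in> carrier S" for u s
  proof -
    obtain y s0 where y: "y \<in> Y" "s0 \<in> carrier S" "u = \<iota> y \<cdot>\<^bsub>S\<^esub> s0" using u unfolding good_def by blast
    have "u \<cdot>\<^bsub>S\<^esub> s = \<iota> y \<cdot>\<^bsub>S\<^esub> (s0 \<cdot>\<^bsub>S\<^esub> s)" using is_sgpD(3)[OF S iota_S[OF y(1)] y(2) s] y(3) by simp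
    then show ?thesis using y(1) is_sgpD(2)[OF S y(2) s] unfolding good_def by blast
  qed
  \<comment> \<open>By \<open>act_comp\<close> a product that ends in the class has never left
    it.\<close>
  have good_return: "\<exists>y\<in>Y. u = \<iota> y \<and> act s y = Some y'"
    if u: "good u" and s: "s \<in> carrier S" and e: "u \<cdot>\<^bsub>S\<^esub> s = \<iota> y'" and y': "y' \<in> Y" for u s y'
  proof -
    obtain y s0 where y: "y \<in> Y" "s0 \<in> carrier S" "u = \<iota> y \<cdot>\<^bsub>S\<^esub> s0" using u unfolding good_def by blast
    have "\<iota> y \<cdot>\<^bsub>S\<^esub> (s0 \<cdot>\<^bsub>S\<^esub> s) = \<iota> y'" using is_sgpD(3)[OF S iota_S[OF y(1)] y(2) s] y(3) e by simp
    then have "act (s0 \<cdot>\<^bsub>S\<^esub> s) y = Some y'" using act_Some[OF is_sgpD(2)[OF S y(2) s]] y(1) y' by blast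
    then obtain y1 where "act s0 y = Some y1" "act s y1 = Some y'"
      unfolding act_comp[OF y(2) s] by (auto simp: map_comp_Some_iff)
    then show ?thesis using act_Some[OF y(2)] y(3) by auto
  qed
  \<comment> \<open>Two conditions: every move of d is followed by w, and every move of w that ends
    over a point of the class comes from a move of d. The second one lets w determine where d is
    undefined.\<close>
  define \<rho> where "\<rho> w d \<longleftrightarrow> (\<forall>a r h u. good u \<and> c (a, h, r) = Some (Some u) \<longrightarrow>
     (\<forall>y z. y \<in> Y \<and> u = \<iota> y \<and> d (y, r) = Some z \<longrightarrow>
        (\<exists>a' h'. w (prod_encode (a, r), h) = Some (prod_encode (a', snd z), h') \<and>
           c (a', h', snd z) = Some (Some (\<iota> (fst z))))) \<and>
     (\<forall>k h'. w (prod_encode (a, r), h) = Some (k, h') \<longrightarrow>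
        (\<exists>a' r' u'. k = prod_encode (a', r') \<and> c (a', h', r') = Some (Some u') \<and> good u' \<and>
           (\<forall>y'\<in>Y. u' = \<iota> y' \<longrightarrow> (\<exists>y\<in>Y. u = \<iota> y \<and> d (y, r) = Some (y', r'))))))" for w d
  have \<rho>1: "\<exists>a' h'. w (prod_encode (a, r), h) = Some (prod_encode (a', snd z), h') \<and>
           c (a', h', snd z) = Some (Some (\<iota> (fst z)))"
    if "\<rho> w d" "c (a, h, r) = Some (Some (\<iota> y))" "y \<in> Y" "d (y, r) = Some z" for w d a h r y z
    using that good_iota unfolding \<rho>_def by blast
  have \<rho>2: "\<exists>a' r' u'. k = prod_encode (a', r') \<and> c (a', h', r') = Some (Some u') \<and> good u' \<and>
           (\<forall>y'\<in>Y. u' = \<iota> y' \<longrightarrow> (\<exists>y\<in>Y. u = \<iota> y \<and> d (y, r) = Some (y', r')))"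
    if "\<rho> w d" "c (a, h, r) = Some (Some u)" "good u" "w (prod_encode (a, r), h) = Some (k, h')" for w d a h r u k h'
    using that unfolding \<rho>_def by blast
  have DY: "fst x \<in> Y \<and> snd x \<in> \<Phi>Q (fst x) \<and> fst z \<in> Y" if d: "d \<in> pfuns ?D" and e: "d x = Some z" for d x z
    using is_tsD(5,6)[OF D d e] unfolding Der_simps derived_states_def by auto
  have \<rho>mult: "\<rho> (w' \<circ>\<^sub>m w) (d' \<circ>\<^sub>m d)" if h: "\<rho> w d" "\<rho> w' d'" "d \<in> pfuns ?D" "d' \<in> pfuns ?D" for w w' d d'
    unfolding \<rho>_def
  proof (intro allI impI conjI)
    fix a r hh u y z assume u: "good u \<and> c (a, hh, r) = Some (Some u)" and y: "y \<in> Y \<and> u = \<iota> y \<and> (d' \<circ>\<^sub>m d) (y, r) = Some z"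
    obtain x where x: "d (y, r) = Some x" "d' x = Some z" using y by (auto simp: map_comp_Some_iff)
    obtain a1 h1 where 1: "w (prod_encode (a, r), hh) = Some (prod_encode (a1, snd x), h1)"
      "c (a1, h1, snd x) = Some (Some (\<iota> (fst x)))" using \<rho>1[OF h(1) _ _ x(1)] u y by blast
    have "fst x \<in> Y" using DY[OF h(3) x(1)] by blast
    moreover have "d' (fst x, snd x) = Some z" using x(2) by simp
    ultimately obtain a2 h2 where "w' (prod_encode (a1, snd x), h1) = Some (prod_encode (a2, snd z), h2)"
      "c (a2, h2, snd z) = Some (Some (\<iota> (fst z)))" using \<rho>1[OF h(2) 1(2), of z] by metis
    then show "\<exists>a' h'. (w' \<circ>\<^sub>m w) (prod_encode (a, r), hh) = Some (prod_encode (a', snd z), h') \<and>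
           c (a', h', snd z) = Some (Some (\<iota> (fst z)))" using 1(1) by (intro exI[of _ a2] exI[of _ h2]) simp
  next
    fix a r hh u k h' assume u: "good u \<and> c (a, hh, r) = Some (Some u)"
      and k: "(w' \<circ>\<^sub>m w) (prod_encode (a, r), hh) = Some (k, h')"
    obtain k1 h1 where k1: "w (prod_encode (a, r), hh) = Some (k1, h1)" "w' (k1, h1) = Some (k, h')"
      using k by (auto simp: map_comp_Some_iff)
    obtain a1 r1 u1 where 1: "k1 = prod_encode (a1, r1)" "c (a1, h1, r1) = Some (Some u1)" "good u1"
      "\<forall>y'\<in>Y. u1 = \<iota> y' \<longrightarrow> (\<exists>y\<in>Y. u = \<iota> y \<and> d (y, r) = Some (y', r1))"
      using \<rho>2[OF h(1) _ _ k1(1)] u by blast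
    obtain a2 r2 u2 where 2: "k = prod_encode (a2, r2)" "c (a2, h', r2) = Some (Some u2)" "good u2"
      "\<forall>y'\<in>Y. u2 = \<iota> y' \<longrightarrow> (\<exists>y\<in>Y. u1 = \<iota> y \<and> d' (y, r1) = Some (y', r2))"
      using \<rho>2[OF h(2) 1(2,3) k1(2)[unfolded 1(1)]] by blast
    have "\<exists>y\<in>Y. u = \<iota> y \<and> (d' \<circ>\<^sub>m d) (y, r) = Some (y', r2)" if y': "y' \<in> Y" "u2 = \<iota> y'" for y'
    proof -
      obtain y1 where y1: "y1 \<in> Y" "u1 = \<iota> y1" "d' (y1, r1) = Some (y', r2)" using 2(4) y' by blast
      obtain y where "y \<in> Y" "u = \<iota> y" "d (y, r) = Some (y1, r1)" using 1(4) y1 by blast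
      then show ?thesis using y1(3) by (intro bexI[of _ y]) auto
    qed
    then show "\<exists>a' r' u'. k = prod_encode (a', r') \<and> c (a', h', r') = Some (Some u') \<and> good u' \<and>
           (\<forall>y'\<in>Y. u' = \<iota> y' \<longrightarrow> (\<exists>y\<in>Y. u = \<iota> y \<and> (d' \<circ>\<^sub>m d) (y, r) = Some (y', r')))" using 2(1-3) by blast
  qed
  \<comment> \<open>The first condition for d and the second for d', on the same w, include d in d';
    equality follows by symmetry.\<close>
  have \<rho>sub: "d' x = Some z" if h: "\<rho> w d" "\<rho> w d'" "d \<in> pfuns ?D" and e: "d x = Some z" for w d d' x z
  proof -
    have x: "fst x \<in> Y" "snd x \<in> \<Phi>Q (fst x)" "fst z \<in> Y" using DY[OF h(3) e] by auto
    obtain a hh where ca: "c (a, hh, snd x) = Some (Some (\<iota> (fst x)))" using x(2) unfolding \<Phi>Q_def by blast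
    have e': "d (fst x, snd x) = Some z" using e by simp
    obtain a1 h1 where 1: "w (prod_encode (a, snd x), hh) = Some (prod_encode (a1, snd z), h1)"
      "c (a1, h1, snd z) = Some (Some (\<iota> (fst z)))" using \<rho>1[OF h(1) ca x(1) e'] by blast
    obtain a2 r2 u2 where 2: "prod_encode (a1, snd z) = prod_encode (a2, r2)" "c (a2, h1, r2) = Some (Some u2)"
      "\<forall>y'\<in>Y. u2 = \<iota> y' \<longrightarrow> (\<exists>y\<in>Y. \<iota> (fst x) = \<iota> y \<and> d' (y, snd x) = Some (y', r2))"
      using \<rho>2[OF h(2) ca good_iota[OF x(1)] 1(1)] by blast
    have "a2 = a1" "r2 = snd z" using 2(1) by auto
    then have "u2 = \<iota> (fst z)" using 2(2) 1(2) by simp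
    then obtain y where "y \<in> Y" "\<iota> (fst x) = \<iota> y" "d' (y, snd x) = Some (fst z, r2)"
      using mp[OF bspec[OF 2(3) x(3)]] by blast
    moreover from this have "y = fst x" using iota_inj[OF x(1)] by metis
    ultimately show ?thesis using \<open>r2 = snd z\<close> by simp
  qed
  have gen: "\<exists>w\<in>pfuns (A' \<wr> group_ts H). \<rho> w (derived_gen P \<Phi>Q q (act s) t)"
    if h: "q \<in> states T" "s \<in> carrier S" "t \<in> \<Phi>T (act s)" "t q \<noteq> None" for q s t
  proof -
    obtain f \<phi> where l: "L s t f \<phi>" using \<Phi>T h by blast
    obtain q' where q': "t q = Some q'" using h(4) by blast
    have tT: "t \<in> pfuns T" and fq: "f q \<in> pfuns (group_ts H)" using l q' unfolding L_def by auto
    have q'T: "q' \<in> states T" using is_tsD(6)[OF T tT q'] .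
    \<comment> \<open>The T-coordinate is kept next to a in the aperiodic factor: as the generator
      starts only at q, it changes by the rank-one map from q to q', while the group coordinate
      moves by \<open>f q\<close>.\<close>
    define w where "w = wreath_act (\<lambda>h. code (rank_one (\<phi> (h, q)) q q')) (f q)"
    have "w \<in> pfuns (A' \<wr> group_ts H)" unfolding w_def
    proof (rule wreath_pfunsI[OF fq])
      fix h1 h2 assume "f q h1 = Some h2"
      then have "(h1, q) \<in> dom (wreath_act f t)" using q' by (simp add: wreath_act_simp dom_def)
      then have "\<phi> (h1, q) \<in> pfuns A" using l unfolding L_def by blast
      then show "code (rank_one (\<phi> (h1, q)) q q') \<in> pfuns A'"
        using h(1) q'T by (intro A'P) (auto simp: E_def rank_one_ts_def)
    qed
    moreover have "\<rho> w (derived_gen P \<Phi>Q q (act s) t)" unfolding \<rho>_def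
    proof (intro allI impI conjI)
      fix a r hh u y z assume u: "good u \<and> c (a, hh, r) = Some (Some u)"
        and y: "y \<in> Y \<and> u = \<iota> y \<and> derived_gen P \<Phi>Q q (act s) t (y, r) = Some z"
      then have d: "r = q" "act s y = Some (fst z)" "snd z = q'"
        using q' by (auto simp: derived_gen_Some)
      obtain a' h' where s1: "f q hh = Some h'" "\<phi> (hh, q) a = Some a'"
        "c (a', h', q') = Some (Some (u \<cdot>\<^bsub>S\<^esub> s))"
        using step[OF l, of a hh q u] u d(1) q' by auto
      have "u \<cdot>\<^bsub>S\<^esub> s = \<iota> (fst z)" using y d(2) act_Some[OF h(2)] by blast
      moreover have "w (prod_encode (a, r), hh) = Some (prod_encode (a', snd z), h')"
        using s1 d unfolding w_def by (simp add: wreath_act_Some code rank_one_Some)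
      ultimately show "\<exists>a' h'. w (prod_encode (a, r), hh) = Some (prod_encode (a', snd z), h') \<and>
           c (a', h', snd z) = Some (Some (\<iota> (fst z)))" using s1(3) d(3) by auto
    next
      fix a r hh u k h' assume u: "good u \<and> c (a, hh, r) = Some (Some u)" and k: "w (prod_encode (a, r), hh) = Some (k, h')"
      obtain a' where k': "f q hh = Some h'" "k = prod_encode (a', q')" "r = q" "\<phi> (hh, q) a = Some a'"
        using k unfolding w_def by (auto simp: wreath_act_Some code rank_one_Some)
      have c': "c (a', h', q') = Some (Some (u \<cdot>\<^bsub>S\<^esub> s))" using step[OF l, of a hh q u] u k' q' by auto
      have "\<exists>y\<in>Y. u = \<iota> y \<and> derived_gen P \<Phi>Q q (act s) t (y, r) = Some (y', q')"
        if y': "y' \<in> Y" "u \<cdot>\<^bsub>S\<^esub> s = \<iota> y'" for y'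
      proof -
        obtain y where y: "y \<in> Y" "u = \<iota> y" "act s y = Some y'" using good_return[OF _ h(2) y'(2,1)] u by blast
        have "q \<in> \<Phi>Q y" using u y(2) k'(3) h(1) unfolding \<Phi>Q_def by blast
        then show ?thesis using y k'(3) q' by (intro bexI[of _ y]) (auto simp: derived_gen_Some)
      qed
      then show "\<exists>a' r' u'. k = prod_encode (a', r') \<and> c (a', h', r') = Some (Some u') \<and> good u' \<and>
           (\<forall>y'\<in>Y. u' = \<iota> y' \<longrightarrow> (\<exists>y\<in>Y. u = \<iota> y \<and> derived_gen P \<Phi>Q q (act s) t (y, r) = Some (y', r')))"
        using k'(2) c' good_mult[OF _ h(2)] u by blast
    qed
    ultimately show ?thesis by blast
  qed
  have tot: "\<exists>w\<in>pfuns (A' \<wr> group_ts H). \<rho> w d" if "d \<in> pfuns ?D" for d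
    using that
  proof (induction rule: Der_induct)
    case (gen q s t)
    then show ?case by (rule \<open>\<And>q s t. _ \<Longrightarrow> _ \<Longrightarrow> _ \<Longrightarrow> _ \<Longrightarrow> \<exists>w\<in>pfuns (A' \<wr> group_ts H). \<rho> w (derived_gen P \<Phi>Q q (act s) t)\<close>)
  next
    case (prod d e)
    then show ?case using \<rho>mult is_tsD(4)[OF V] by blast
  qed
  have "sgp_of ?D \<prec>\<^sub>s sgp_of (A' \<wr> group_ts H)"
  proof (rule divides_rel[where \<rho> = \<rho>])
    show "is_sgp (sgp_of ?D)" using is_tsD(2)[OF D] .
    show "u = v" if hh: "\<rho> w u" "\<rho> w v" "u \<in> carrier (sgp_of ?D)" "v \<in> carrier (sgp_of ?D)" for w u v
    proof (rule ext, rule option_eqI)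
      have uv: "u \<in> pfuns ?D" "v \<in> pfuns ?D" using hh(3,4) by simp_all
      fix x z show "u x = Some z \<longleftrightarrow> v x = Some z"
        using \<rho>sub[OF hh(1,2) uv(1), of x z] \<rho>sub[OF hh(2,1) uv(2), of x z] by (rule iffI)
    qed
  qed (use tot \<rho>mult is_tsD(4)[OF V] in auto)
  then have "in_Ap_Gp (sgp_of ?D)" unfolding in_Ap_Gp_def using A' A'ap H by blast
  then show ?thesis using T n m by blast
qed

end

section \<open>Condition 3 implies condition 2\<close>

context gm
begin

text \<open>To each generator [q, s, t] the group component of one of its covers is attached; as
  generators multiply along paths, the pairs (k, t) give a relational morphism. If the powers of (k,
  t) become stable, the states q reached over points where s still acts are fixed by t and have
  trivial k q; there [q, s, t] repeats the action of s and has a cover whose powers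
  stabilize.\<close>

lemma derived_Ap_Gp_imp_aperiodic_morphism:
  fixes T :: "nat ts"
  assumes T: "is_ts T" and \<Phi>: "ts_rel_morphism P T \<Phi>Q \<Phi>T"
    and ap: "in_Ap_Gp (sgp_of (Der T \<Phi>Q \<Phi>T))"
  shows "\<exists>(H :: nat monoid) \<Theta>. Group.group H \<and> finite (carrier H) \<and>
    aperiodic_rel_morphism S (sgp_of (group_ts H \<wr> T)) \<Theta>"
proof -
  note m = ts_morphD[OF \<Phi>]
  let ?D = "Der T \<Phi>Q \<Phi>T"
  have D: "is_ts ?D" by (rule is_ts_Der[OF T \<Phi>])
  obtain A :: "nat ts" and K :: "nat monoid" where A: "is_ts A" "aperiodic (sgp_of A)"
    and K: "Group.group K" "finite (carrier K)" and div: "sgp_of ?D \<prec>\<^sub>s sgp_of (A \<wr> group_ts K)"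
    using ap unfolding in_Ap_Gp_def by blast
  interpret K: Group.group K by (fact K(1))
  obtain V \<eta> where V: "V \<subseteq> carrier (sgp_of (A \<wr> group_ts K))"
    "\<And>u v. u \<in> V \<Longrightarrow> v \<in> V \<Longrightarrow> u \<cdot>\<^bsub>sgp_of (A \<wr> group_ts K)\<^esub> v \<in> V"
    "\<eta> ` V = carrier (sgp_of ?D)"
    "\<And>u v. u \<in> V \<Longrightarrow> v \<in> V \<Longrightarrow> \<eta> (u \<cdot>\<^bsub>sgp_of (A \<wr> group_ts K)\<^esub> v) = \<eta> u \<cdot>\<^bsub>sgp_of ?D\<^esub> \<eta> v"
    by (rule dividesE[OF div]) (rule that, assumption+)
  define \<mu> where "\<mu> d k \<longleftrightarrow> k \<in> carrier K \<and> (\<exists>f. (\<forall>q\<in>carrier K. f q \<in> pfuns A) \<and>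
     wreath_act f (rtrans K k) \<in> V \<and> \<eta> (wreath_act f (rtrans K k)) = d)" for d k
  have \<mu>ex: "\<exists>k. \<mu> d k" if d: "d \<in> pfuns ?D" for d
  proof -
    have "d \<in> \<eta> ` V" using V(3) d by simp
    then obtain w where w: "w \<in> V" "\<eta> w = d" by blast
    then have "w \<in> pfuns (A \<wr> group_ts K)" using V(1) by auto
    then obtain f t where f: "w = wreath_act f t" "t \<in> pfuns (group_ts K)" "\<And>q. q \<in> dom t \<Longrightarrow> f q \<in> pfuns A"
      unfolding wreath_pfuns by blast
    obtain k where k: "k \<in> carrier K" "t = rtrans K k" using f(2) by auto
    then have "\<forall>q\<in>carrier K. f q \<in> pfuns A" using f(3) by (auto simp: dom_def)
    then show ?thesis unfolding \<mu>_def using k w f(1) by blast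
  qed
  have \<mu>mult: "\<mu> (e \<circ>\<^sub>m d) (k \<otimes>\<^bsub>K\<^esub> l)" if "\<mu> d k" "\<mu> e l" for d e k l
  proof -
    obtain f where f: "\<forall>q\<in>carrier K. f q \<in> pfuns A" "wreath_act f (rtrans K k) \<in> V" "\<eta> (wreath_act f (rtrans K k)) = d"
      and k: "k \<in> carrier K" using \<open>\<mu> d k\<close> unfolding \<mu>_def by blast
    obtain g where g: "\<forall>q\<in>carrier K. g q \<in> pfuns A" "wreath_act g (rtrans K l) \<in> V" "\<eta> (wreath_act g (rtrans K l)) = e"
      and l: "l \<in> carrier K" using \<open>\<mu> e l\<close> unfolding \<mu>_def by blast
    let ?h = "\<lambda>q. g (the (rtrans K k q)) \<circ>\<^sub>m f q"
    have h: "wreath_act g (rtrans K l) \<circ>\<^sub>m wreath_act f (rtrans K k) = wreath_act ?h (rtrans K (k \<otimes>\<^bsub>K\<^esub> l))"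
      unfolding wreath_act_comp rtrans_comp[OF K.is_monoid k l] ..
    have "wreath_act ?h (rtrans K (k \<otimes>\<^bsub>K\<^esub> l)) \<in> V" "\<eta> (wreath_act ?h (rtrans K (k \<otimes>\<^bsub>K\<^esub> l))) = e \<circ>\<^sub>m d"
      using V(2)[OF f(2) g(2)] V(4)[OF f(2) g(2)] f(3) g(3) unfolding pfun_sgp_simps h by auto
    moreover have "?h q \<in> pfuns A" if "q \<in> carrier K" for q
    proof -
      have "f q \<in> pfuns A" "g (the (rtrans K k q)) \<in> pfuns A" using f(1) g(1) that k by auto
      then show ?thesis by (rule is_tsD(4)[OF A(1)])
    qed
    ultimately show ?thesis unfolding \<mu>_def using k l by (intro conjI exI[of _ ?h]) auto
  qed
  define v where "v t k = wreath_act (\<lambda>q. rtrans K (k q)) t" for t :: "nat \<rightharpoonup> nat" and k :: "nat \<Rightarrow> nat"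
  define \<theta> where "\<theta> s t k \<longleftrightarrow> t \<in> \<Phi>T (act s) \<and> (\<forall>q\<in>dom t. \<mu> (derived_gen P \<Phi>Q q (act s) t) (k q))" for s t k
  define \<Theta> where "\<Theta> s = {v t k | t k. \<theta> s t k}" for s
  have Hts: "is_ts (group_ts K)" by (rule is_ts_group_ts[OF K.is_monoid K(2)])
  have U: "is_ts (group_ts K \<wr> T)" using is_ts_wreath[OF Hts T] .
  have kK: "k q \<in> carrier K" if "\<theta> s t k" "t q = Some q'" for s t k q q'
    using that unfolding \<theta>_def \<mu>_def by blast
  have "rel_morphism S (sgp_of (group_ts K \<wr> T)) \<Theta>" unfolding rel_morphism_def
  proof (intro conjI ballI)
    show "\<Theta> s \<noteq> {}" if s: "s \<in> carrier S" for s
    proof -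
      obtain t where t: "t \<in> \<Phi>T (act s)" using m(1)[OF s] by blast
      have tT: "t \<in> pfuns T" using m(2)[OF s] t by blast
      have "\<forall>q\<in>dom t. \<exists>k. \<mu> (derived_gen P \<Phi>Q q (act s) t) k"
      proof
        fix q assume "q \<in> dom t"
        then have "q \<in> states T" "t q \<noteq> None" using is_tsD(5)[OF T tT] by auto
        then show "\<exists>k. \<mu> (derived_gen P \<Phi>Q q (act s) t) k" using s t by (intro \<mu>ex Der_gen)
      qed
      from bchoice[OF this] obtain k where "\<forall>q\<in>dom t. \<mu> (derived_gen P \<Phi>Q q (act s) t) (k q)" ..
      then show ?thesis unfolding \<Theta>_def \<theta>_def using t by blast
    qed
    show "\<Theta> s \<subseteq> carrier (sgp_of (group_ts K \<wr> T))" if s: "s \<in> carrier S" for s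
    proof
      fix u assume "u \<in> \<Theta> s"
      then obtain t k where u: "u = v t k" "\<theta> s t k" unfolding \<Theta>_def by blast
      have "t \<in> pfuns T" using u(2) m(2)[OF s] unfolding \<theta>_def by blast
      then show "u \<in> carrier (sgp_of (group_ts K \<wr> T))" unfolding u(1) v_def pfun_sgp_simps
        using kK[OF u(2)] by (intro wreath_pfunsI) auto
    qed
    fix s s' u u' assume s: "s \<in> carrier S" "s' \<in> carrier S" and "u \<in> \<Theta> s" "u' \<in> \<Theta> s'"
    then obtain t k t' k' where u: "u = v t k" "\<theta> s t k" "u' = v t' k'" "\<theta> s' t' k'" unfolding \<Theta>_def by blast
    have t: "t \<in> \<Phi>T (act s)" "t' \<in> \<Phi>T (act s')" using u unfolding \<theta>_def by auto
    let ?k = "\<lambda>q. k q \<otimes>\<^bsub>K\<^esub> k' (the (t q))"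
    have "u' \<circ>\<^sub>m u = v (t' \<circ>\<^sub>m t) ?k" unfolding u(1,3) v_def wreath_act_comp
    proof (rule wreath_act_cong)
      fix q q' assume "(t' \<circ>\<^sub>m t) q = Some q'"
      then obtain p where p: "t q = Some p" "t' p = Some q'" by (auto simp: map_comp_Some_iff)
      show "rtrans K (k' (the (t q))) \<circ>\<^sub>m rtrans K (k q) = rtrans K (?k q)"
        using rtrans_comp[OF K.is_monoid kK[OF u(2) p(1)] kK[OF u(4) p(2)]] unfolding p(1) option.sel .
    qed
    moreover have "\<theta> (s \<cdot>\<^bsub>S\<^esub> s') (t' \<circ>\<^sub>m t) ?k" unfolding \<theta>_def
    proof (intro conjI ballI)
      show "t' \<circ>\<^sub>m t \<in> \<Phi>T (act (s \<cdot>\<^bsub>S\<^esub> s'))" by (rule m(3)[OF s t])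
      fix q assume "q \<in> dom (t' \<circ>\<^sub>m t)"
      then obtain q' where "(t' \<circ>\<^sub>m t) q = Some q'" by blast
      then obtain p where p: "t q = Some p" "t' p = Some q'" by (auto simp: map_comp_Some_iff)
      have "derived_gen P \<Phi>Q p (act s') t' \<circ>\<^sub>m derived_gen P \<Phi>Q q (act s) t =
        derived_gen P \<Phi>Q q (act (s \<cdot>\<^bsub>S\<^esub> s')) (t' \<circ>\<^sub>m t)"
      proof (rule ext, rule option_eqI)
        fix x z :: "('g \<times> 'b) \<times> nat"
        have *: "act s (fst x) = Some y \<Longrightarrow> q \<in> \<Phi>Q (fst x) \<Longrightarrow> y \<in> Y \<and> p \<in> \<Phi>Q y" for y
          using m(6)[OF _ s(1) t(1)] p(1) act_Some[OF s(1)] by fastforce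
        have "(derived_gen P \<Phi>Q p (act s') t' \<circ>\<^sub>m derived_gen P \<Phi>Q q (act s) t) x = Some z \<longleftrightarrow>
          (\<exists>y. derived_gen P \<Phi>Q q (act s) t x = Some (y, p) \<and> derived_gen P \<Phi>Q p (act s') t' (y, p) = Some z)"
          unfolding map_comp_Some_iff
        proof
          assume "\<exists>k. derived_gen P \<Phi>Q q (act s) t x = Some k \<and> derived_gen P \<Phi>Q p (act s') t' k = Some z"
          then obtain y where y: "derived_gen P \<Phi>Q q (act s) t x = Some y" "derived_gen P \<Phi>Q p (act s') t' y = Some z" by blast
          then have "y = (fst y, p)" unfolding derived_gen_Some by (simp add: prod_eq_iff)
          then show "\<exists>y. derived_gen P \<Phi>Q q (act s) t x = Some (y, p) \<and> derived_gen P \<Phi>Q p (act s') t' (y, p) = Some z"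
            using y by metis
        qed blast
        also have "\<dots> \<longleftrightarrow> derived_gen P \<Phi>Q q (act (s \<cdot>\<^bsub>S\<^esub> s')) (t' \<circ>\<^sub>m t) x = Some z"
          unfolding derived_gen_Some act_comp[OF s] using p * by (auto simp: map_comp_Some_iff)
        finally show "(derived_gen P \<Phi>Q p (act s') t' \<circ>\<^sub>m derived_gen P \<Phi>Q q (act s) t) x = Some z \<longleftrightarrow>
          derived_gen P \<Phi>Q q (act (s \<cdot>\<^bsub>S\<^esub> s')) (t' \<circ>\<^sub>m t) x = Some z" .
      qed
      moreover have "\<mu> (derived_gen P \<Phi>Q q (act s) t) (k q)" "\<mu> (derived_gen P \<Phi>Q p (act s') t') (k' p)"
        using u(2,4) p unfolding \<theta>_def by blast+
      ultimately show "\<mu> (derived_gen P \<Phi>Q q (act (s \<cdot>\<^bsub>S\<^esub> s')) (t' \<circ>\<^sub>m t)) (k q \<otimes>\<^bsub>K\<^esub> k' (the (t q)))"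
        using \<mu>mult p(1) by fastforce
    qed
    ultimately show "u \<cdot>\<^bsub>sgp_of (group_ts K \<wr> T)\<^esub> u' \<in> \<Theta> (s \<cdot>\<^bsub>S\<^esub> s')" unfolding \<Theta>_def pfun_sgp_simps by blast
  qed
  moreover have "\<exists>n. spow S s (Suc n) = spow S s n"
    if s: "s \<in> carrier S" and us: "u \<in> \<Theta> s"
      and stable: "spow (sgp_of (group_ts K \<wr> T)) u (Suc M) = spow (sgp_of (group_ts K \<wr> T)) u M" for s u M
  proof -
    obtain t k where u: "u = v t k" "\<theta> s t k" using us unfolding \<Theta>_def by blast
    have t: "t \<in> \<Phi>T (act s)" using u(2) unfolding \<theta>_def by blast
    obtain N where N: "\<forall>(f :: nat \<Rightarrow> nat \<rightharpoonup> nat) s m. (\<forall>q\<in>dom s. f q \<in> pfuns A) \<longrightarrow> ppow s (Suc m) = ppow s m \<longrightarrow>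
       ppow (wreath_act f s) (Suc (Suc (m + N))) = ppow (wreath_act f s) (Suc (m + N))"
      using wreath_power_stable[OF A] ..
    have uM: "ppow u (Suc M) = ppow u M" using stable unfolding spow_pfun_sgp[of "pfuns _"] .
    have sp: "act (spow S s j) = ppow (act s) j" for j
      by (induction j) (use act_comp[OF spow_closed[OF S s] s] in auto)
    \<comment> \<open>Along a run of s the action of u stays defined, and its T-coordinate stays
      related to the current point.\<close>
    have track: "\<exists>g q. ppow u j (\<one>\<^bsub>K\<^esub>, q0) = Some (g, q) \<and> q \<in> \<Phi>Q z \<and> g \<in> carrier K"
      if q0: "q0 \<in> \<Phi>Q y" and z: "ppow (act s) j y = Some z" for j y z q0
      using z
    proof (induction j arbitrary: z)
      case 0
      obtain q where q: "t q0 = Some q" "q \<in> \<Phi>Q z" using m(6)[OF q0 s t] 0 by auto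
      then show ?case using kK[OF u(2) q(1)] by (simp add: u(1) v_def wreath_act_simp)
    next
      case (Suc j)
      obtain x where x: "ppow (act s) j y = Some x" "act s x = Some z" using Suc.prems by (auto simp: map_comp_Some_iff)
      obtain g q where g: "ppow u j (\<one>\<^bsub>K\<^esub>, q0) = Some (g, q)" "q \<in> \<Phi>Q x" "g \<in> carrier K" using Suc.IH[OF x(1)] by blast
      obtain q' where q': "t q = Some q'" "q' \<in> \<Phi>Q z" using m(6)[OF g(2) s t x(2)] by blast
      have "u (g, q) = Some (g \<otimes>\<^bsub>K\<^esub> k q, q')" using q' g(3) by (simp add: u(1) v_def wreath_act_simp)
      then show ?case using g q' kK[OF u(2) q'(1)] by simp
    qed
    have key: "ppow (act s) (Suc (Suc N)) z = ppow (act s) (Suc N) z" if z: "ppow (act s) M y = Some z" for y z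
    proof (cases "act s z")
      case None
      have "ppow (act s) j z = None" for j by (induction j) (use None in auto)
      then show ?thesis by simp
    next
      case (Some z')
      have yY: "y \<in> Y" "z \<in> Y"
        using z act_Some[OF spow_closed[OF S s]] unfolding sp[symmetric] by blast+
      obtain q0 where q0: "q0 \<in> \<Phi>Q y" using m(4)[OF yY(1)] by blast
      obtain g q where g: "ppow u M (\<one>\<^bsub>K\<^esub>, q0) = Some (g, q)" "q \<in> \<Phi>Q z" "g \<in> carrier K" using track[OF q0 z] by blast
      obtain q' where q': "t q = Some q'" "q' \<in> \<Phi>Q z'" using m(6)[OF g(2) s t Some] by blast
      have "u (g, q) = Some (g \<otimes>\<^bsub>K\<^esub> k q, q')" using q' g(3) by (simp add: u(1) v_def wreath_act_simp)
      moreover have "ppow u (Suc M) (\<one>\<^bsub>K\<^esub>, q0) = u (g, q)" using g(1) by simp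
      \<comment> \<open>Stability of u fixes both coordinates: t fixes q and, by cancellation in K,
        \<open>k q\<close> is trivial.\<close>
      ultimately have "Some (g \<otimes>\<^bsub>K\<^esub> k q, q') = Some (g, q)" using uM g(1) by metis
      then have e: "g \<otimes>\<^bsub>K\<^esub> k q = g" "q' = q" by simp_all
      have tq: "t q = Some q" using q'(1) e(2) by simp
      have "k q = \<one>\<^bsub>K\<^esub>" using e(1) g(3) kK[OF u(2) tq] by simp
      moreover have "\<mu> (derived_gen P \<Phi>Q q (act s) t) (k q)" using u(2) tq unfolding \<theta>_def by blast
      ultimately have "\<mu> (derived_gen P \<Phi>Q q (act s) t) \<one>\<^bsub>K\<^esub>" by metis
      then obtain f where f: "\<forall>q\<in>carrier K. f q \<in> pfuns A" "wreath_act f (rtrans K \<one>\<^bsub>K\<^esub>) \<in> V"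
        "\<eta> (wreath_act f (rtrans K \<one>\<^bsub>K\<^esub>)) = derived_gen P \<Phi>Q q (act s) t" unfolding \<mu>_def by blast
      let ?d = "derived_gen P \<Phi>Q q (act s) t" and ?w = "wreath_act f (rtrans K \<one>\<^bsub>K\<^esub>)"
      \<comment> \<open>The group component is idempotent, so the bound for wreath products applies
        with m = 0.\<close>
      have "ppow (rtrans K \<one>\<^bsub>K\<^esub>) (Suc 0) = ppow (rtrans K \<one>\<^bsub>K\<^esub>) 0"
        using rtrans_comp[OF K.is_monoid K.one_closed K.one_closed] by (simp cong: if_cong)
      moreover have "\<forall>q\<in>dom (rtrans K \<one>\<^bsub>K\<^esub>). f q \<in> pfuns A" using f(1) by (auto simp: dom_def split: if_splits)
      ultimately have w: "ppow ?w (Suc (Suc (0 + N))) = ppow ?w (Suc (0 + N))" using N by blast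
      have hp: "\<eta> (ppow ?w j) = ppow ?d j" for j
        using hom_spow[of V "sgp_of (A \<wr> group_ts K)" \<eta> "sgp_of ?D" ?w j, OF V(2,4) f(2)] f(3)
        unfolding spow_pfun_sgp[of "pfuns _"] by simp
      have d: "ppow ?d (Suc (Suc N)) = ppow ?d (Suc N)"
        using w unfolding add_0 hp[of "Suc (Suc N)", symmetric] hp[of "Suc N", symmetric] by (rule arg_cong)
      have dp: "ppow ?d j (x, q) = map_option (\<lambda>x. (x, q)) (ppow (act s) j x)" if xq: "q \<in> \<Phi>Q x" "x \<in> Y" for j x
      proof (induction j)
        case 0
        show ?case
        proof (rule option_eqI)
          fix y show "ppow ?d 0 (x, q) = Some y \<longleftrightarrow> map_option (\<lambda>x. (x, q)) (ppow (act s) 0 x) = Some y"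
            using xq tq by (cases y) (auto simp: derived_gen_Some)
        qed
      next
        case (Suc j)
        show ?case
        proof (cases "ppow (act s) j x")
          case None
          then show ?thesis using Suc by simp
        next
          case (Some x')
          have x'Y: "x' \<in> Y" using Some act_Some[OF spow_closed[OF S s]] unfolding sp[symmetric] by blast
          have x'q: "q \<in> \<Phi>Q x'"
          proof -
            obtain g1 q1 where "ppow u j (\<one>\<^bsub>K\<^esub>, q) = Some (g1, q1)" "q1 \<in> \<Phi>Q x'" using track[OF xq(1) Some] by blast
            moreover have "q1 = q" if "ppow u j (\<one>\<^bsub>K\<^esub>, q) = Some (g1, q1)" for g1 q1
              using that ppow_fixed_wreath[of t q "\<lambda>q. rtrans K (k q)" j "\<one>\<^bsub>K\<^esub>", OF tq] unfolding u(1) v_def by auto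
            ultimately show ?thesis by blast
          qed
          have "ppow ?d (Suc j) (x, q) = ?d (x', q)" using Suc Some by simp
          also have "\<dots> = map_option (\<lambda>x. (x, q)) (act s x')"
          proof (rule option_eqI)
            fix y show "?d (x', q) = Some y \<longleftrightarrow> map_option (\<lambda>x. (x, q)) (act s x') = Some y"
              using x'q x'Y tq by (cases y) (auto simp: derived_gen_Some)
          qed
          finally show ?thesis using Some by simp
        qed
      qed
      have "map_option (\<lambda>x. (x, q)) (ppow (act s) (Suc (Suc N)) z) = map_option (\<lambda>x. (x, q)) (ppow (act s) (Suc N) z)"
        using d dp[OF g(2) yY(2)] by metis
      moreover have "inj (\<lambda>x :: 'g \<times> 'b. (x, q))" by (simp add: inj_on_def)
      ultimately show ?thesis using option.inj_map by (metis (no_types, lifting) injD)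
    qed
    have "ppow (act s) (Suc (M + Suc (Suc N))) = ppow (act s) (Suc (M + Suc N))"
    proof
      fix y
      show "ppow (act s) (Suc (M + Suc (Suc N))) y = ppow (act s) (Suc (M + Suc N)) y"
      proof (cases "ppow (act s) M y")
        case None
        then show ?thesis unfolding ppow_add by (simp add: map_comp_def)
      next
        case (Some z)
        then show ?thesis unfolding ppow_add using key[OF Some] by (simp add: map_comp_def del: spow.simps)
      qed
    qed
    then have "act (spow S s (Suc (M + Suc (Suc N)))) = act (spow S s (Suc (M + Suc N)))" unfolding sp .
    then have "spow S s (Suc (M + Suc (Suc N))) = spow S s (Suc (M + Suc N))"
      by (rule inj_onD[OF act_inj _ spow_closed[OF S s] spow_closed[OF S s]])
    then show ?thesis by (intro exI[of _ "Suc (M + Suc N)"]) simp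
  qed
  ultimately have "aperiodic_rel_morphism S (sgp_of (group_ts K \<wr> T)) \<Theta>"
    by (intro aperiodic_rel_morphismI finite_sgp_of[OF U]) blast+
  then show ?thesis using K by blast
qed

end

text \<open>An idempotent y with the fewest elements in y U y will do: for w in y U y some power f
  of w is idempotent, and f U f lies in y U y, so both agree by minimality. Then y belongs to f U f,
  which forces f = y, and w has an inverse among its own powers.\<close>

lemma ex_local_group:
  assumes U: "finite_sgp U"
  shows "\<exists>y\<in>carrier U. y \<cdot>\<^bsub>U\<^esub> y = y \<and> (\<forall>x\<in>carrier U. \<exists>x'\<in>carrier U.
    (y \<cdot>\<^bsub>U\<^esub> x \<cdot>\<^bsub>U\<^esub> y) \<cdot>\<^bsub>U\<^esub> (y \<cdot>\<^bsub>U\<^esub> x' \<cdot>\<^bsub>U\<^esub> y) = y)"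
proof -
  have S: "is_sgp U" and fin: "finite (carrier U)" using U by (auto simp: finite_sgp_def)
  note cl = is_sgpD(2)[OF S] and as = is_sgpD(3)[OF S]
  define loc where "loc y = (\<lambda>x. y \<cdot>\<^bsub>U\<^esub> x \<cdot>\<^bsub>U\<^esub> y) ` carrier U" for y
  define idem where "idem y \<longleftrightarrow> y \<in> carrier U \<and> y \<cdot>\<^bsub>U\<^esub> y = y" for y
  have "\<exists>y. idem y"
  proof -
    obtain x where x: "x \<in> carrier U" using is_sgpD(1)[OF S] by blast
    obtain n where "spow U x n \<cdot>\<^bsub>U\<^esub> spow U x n = spow U x n" by (rule ex_idempotent_spow[OF U x])
    then show ?thesis using spow_closed[OF S x] unfolding idem_def by blast
  qed
  then obtain y where y: "idem y" "\<And>y'. idem y' \<Longrightarrow> card (loc y) \<le> card (loc y')"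
    using ex_has_least_nat[of idem _ "\<lambda>y. card (loc y)"] by blast
  have yU: "y \<in> carrier U" "y \<cdot>\<^bsub>U\<^esub> y = y" using y(1) by (auto simp: idem_def)
  have "\<exists>x'\<in>carrier U. (y \<cdot>\<^bsub>U\<^esub> x \<cdot>\<^bsub>U\<^esub> y) \<cdot>\<^bsub>U\<^esub> (y \<cdot>\<^bsub>U\<^esub> x' \<cdot>\<^bsub>U\<^esub> y) = y" if x: "x \<in> carrier U" for x
  proof -
    let ?w = "y \<cdot>\<^bsub>U\<^esub> x \<cdot>\<^bsub>U\<^esub> y"
    have w: "?w \<in> carrier U" using cl x yU by blast
    have wy: "y \<cdot>\<^bsub>U\<^esub> ?w = ?w" "?w \<cdot>\<^bsub>U\<^esub> y = ?w" using as cl x yU by metis+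
    have py: "y \<cdot>\<^bsub>U\<^esub> spow U ?w n = spow U ?w n \<and> spow U ?w n \<cdot>\<^bsub>U\<^esub> y = spow U ?w n" for n
    proof (induction n)
      case (Suc n)
      have p: "spow U ?w n \<in> carrier U" by (rule spow_closed[OF S w])
      show ?case using Suc wy as[OF yU(1) p w] as[OF p w yU(1)] by simp
    qed (use wy in simp)
    obtain n where n: "spow U ?w n \<cdot>\<^bsub>U\<^esub> spow U ?w n = spow U ?w n" by (rule ex_idempotent_spow[OF U w])
    let ?f = "spow U ?w n"
    have f: "?f \<in> carrier U" by (rule spow_closed[OF S w])
    have "loc ?f \<subseteq> loc y"
    proof
      fix v assume "v \<in> loc ?f"
      then obtain u where u: "u \<in> carrier U" "v = ?f \<cdot>\<^bsub>U\<^esub> u \<cdot>\<^bsub>U\<^esub> ?f" by (auto simp: loc_def)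
      have fu: "?f \<cdot>\<^bsub>U\<^esub> u \<in> carrier U" "?f \<cdot>\<^bsub>U\<^esub> u \<cdot>\<^bsub>U\<^esub> ?f \<in> carrier U" using cl f u by blast+
      have "y \<cdot>\<^bsub>U\<^esub> (?f \<cdot>\<^bsub>U\<^esub> u \<cdot>\<^bsub>U\<^esub> ?f) \<cdot>\<^bsub>U\<^esub> y = ?f \<cdot>\<^bsub>U\<^esub> u \<cdot>\<^bsub>U\<^esub> ?f"
        using as[OF yU(1) fu(1) f] as[OF yU(1) f u(1)] as[OF fu(1) f yU(1)] py[of n] by metis
      from this[symmetric] show "v \<in> loc y" unfolding loc_def u(2) by (rule rev_image_eqI[OF fu(2)])
    qed
    moreover have "card (loc y) \<le> card (loc ?f)" using y(2)[of ?f] f n by (simp add: idem_def)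
    moreover have "finite (loc y)" unfolding loc_def using fin by simp
    ultimately have "loc ?f = loc y" by (meson card_seteq)
    moreover have "y \<in> loc y" unfolding loc_def by (rule rev_image_eqI[OF yU(1)]) (simp add: yU(2))
    ultimately obtain u where u: "u \<in> carrier U" "y = ?f \<cdot>\<^bsub>U\<^esub> u \<cdot>\<^bsub>U\<^esub> ?f" unfolding loc_def by blast
    have fu: "?f \<cdot>\<^bsub>U\<^esub> u \<in> carrier U" using cl f u by blast
    have "?f \<cdot>\<^bsub>U\<^esub> (?f \<cdot>\<^bsub>U\<^esub> u \<cdot>\<^bsub>U\<^esub> ?f) = ?f \<cdot>\<^bsub>U\<^esub> u \<cdot>\<^bsub>U\<^esub> ?f"
      using as[OF f fu f] as[OF f f u(1)] n by metis
    then have "?f \<cdot>\<^bsub>U\<^esub> y = y" by (simp only: u(2)[symmetric])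
    then have fy: "?f = y" using py[of n] by simp
    \<comment> \<open>With f = w^(n + 1) = y this is w^(2n + 1), and one more factor w gives f f =
      y.\<close>
    let ?x' = "spow U ?w (n + n)"
    have x': "?x' \<in> carrier U" by (rule spow_closed[OF S w])
    have "?w \<cdot>\<^bsub>U\<^esub> ?x' = spow U ?w (Suc (n + n))" using spow_add[OF S w, of 0 "n + n"] by simp
    also have "\<dots> = y" using spow_add[OF S w, of n n] n fy by simp
    finally have "?w \<cdot>\<^bsub>U\<^esub> (y \<cdot>\<^bsub>U\<^esub> ?x' \<cdot>\<^bsub>U\<^esub> y) = y" using py[of "n + n"] by simp
    then show ?thesis using x' by blast
  qed
  then show ?thesis using yU by blast
qed

section \<open>The wreath product of a group with a transformation semigroup\<close>

text \<open>Elements of \<open>H \<wr> T\<close> are written as pairs \<open>(k, t)\<close>, where \<open>k\<close> takes values in \<open>H\<close> everywhere.\<close>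

locale group_wreath = H: Group.group H for H :: "'h monoid" (structure) +
  fixes T :: "'q ts"
  assumes T: "is_ts T" and finH: "finite (carrier H)"
begin

text \<open>Values outside the states are fixed at \<one> so that K is finite.\<close>

definition K :: "('q \<Rightarrow> 'h) set" where
  "K = {k. (\<forall>q. k q \<in> carrier H) \<and> (\<forall>q. q \<notin> states T \<longrightarrow> k q = \<one>)}"

definition kone :: "'q \<Rightarrow> 'h" where "kone = (\<lambda>q. \<one>)"

definition kmul :: "('q \<Rightarrow> 'h) \<Rightarrow> ('q \<Rightarrow> 'h) \<Rightarrow> ('q \<Rightarrow> 'h)" where
  "kmul k l = (\<lambda>q. k q \<otimes> l q)"

text \<open>The left action of t on functions in the semidirect product of K with T; the value
  \<one> off the domain of t keeps \<open>sh k t\<close> in K and \<open>sh\<close> compatible with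
  products.\<close>

definition sh :: "('q \<Rightarrow> 'h) \<Rightarrow> ('q \<rightharpoonup> 'q) \<Rightarrow> ('q \<Rightarrow> 'h)" where
  "sh k t = (\<lambda>q. case t q of None \<Rightarrow> \<one> | Some q' \<Rightarrow> k q')"

definition mul :: "('q \<Rightarrow> 'h) \<times> ('q \<rightharpoonup> 'q) \<Rightarrow> ('q \<Rightarrow> 'h) \<times> ('q \<rightharpoonup> 'q) \<Rightarrow> ('q \<Rightarrow> 'h) \<times> ('q \<rightharpoonup> 'q)" where
  "mul u v = (kmul (fst u) (sh (fst v) (snd u)), snd v \<circ>\<^sub>m snd u)"

lemma mul_pair: "mul (k, t) (k', t') = (kmul k (sh k' t), t' \<circ>\<^sub>m t)"
  by (simp add: mul_def)

lemma kval: "k \<in> K \<Longrightarrow> k q \<in> carrier H"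
  by (simp add: K_def)

lemma K_closed: "k \<in> K \<Longrightarrow> l \<in> K \<Longrightarrow> kmul k l \<in> K" "kone \<in> K"
  by (auto simp: K_def kmul_def kone_def)

lemma sh_K: "k \<in> K \<Longrightarrow> t \<in> pfuns T \<Longrightarrow> sh k t \<in> K"
  using is_tsD(5)[OF T] by (fastforce simp: K_def sh_def split: option.split)

lemma sh_kmul: "sh (kmul k l) t = kmul (sh k t) (sh l t)"
  by (auto simp: sh_def kmul_def fun_eq_iff split: option.split)

lemma sh_kone: "sh kone t = kone"
  by (auto simp: sh_def kone_def fun_eq_iff split: option.split)

lemma sh_sh: "sh (sh k s) t = sh k (s \<circ>\<^sub>m t)"
  by (auto simp: sh_def map_comp_def fun_eq_iff split: option.split)

lemma kmul_assoc: "k \<in> K \<Longrightarrow> l \<in> K \<Longrightarrow> m \<in> K \<Longrightarrow> kmul (kmul k l) m = kmul k (kmul l m)"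
  by (auto simp: kmul_def fun_eq_iff kval H.m_assoc)

lemma kmul_kone: "k \<in> K \<Longrightarrow> kmul kone k = k" "k \<in> K \<Longrightarrow> kmul k kone = k"
  by (auto simp: kmul_def kone_def fun_eq_iff kval)

lemma finite_K: "finite K"
proof -
  have "inj_on (\<lambda>k. restrict k (states T)) K"
  proof (rule inj_onI, rule ext)
    fix k l q assume h: "k \<in> K" "l \<in> K" "restrict k (states T) = restrict l (states T)"
    show "k q = l q"
    proof (cases "q \<in> states T")
      case True then show ?thesis using fun_cong[OF h(3), of q] by simp
    next
      case False then show ?thesis using h(1,2) by (simp add: K_def)
    qed
  qed
  moreover have "(\<lambda>k. restrict k (states T)) ` K \<subseteq> states T \<rightarrow>\<^sub>E carrier H" by (auto simp: K_def)
  moreover have "finite (states T \<rightarrow>\<^sub>E carrier H)" using is_tsD(1)[OF T] finH by (intro finite_PiE)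
  ultimately show ?thesis by (meson finite_imageD finite_subset)
qed

lemma mul_closed: "u \<in> K \<times> pfuns T \<Longrightarrow> v \<in> K \<times> pfuns T \<Longrightarrow> mul u v \<in> K \<times> pfuns T"
  using K_closed sh_K is_tsD(4)[OF T] by (auto simp: mul_def)

lemma mul_assoc:
  assumes "u \<in> K \<times> pfuns T" "v \<in> K \<times> pfuns T" "w \<in> K \<times> pfuns T"
  shows "mul (mul u v) w = mul u (mul v w)"
proof -
  have "fst u \<in> K" "sh (fst v) (snd u) \<in> K" "sh (fst w) (snd v \<circ>\<^sub>m snd u) \<in> K"
    using assms sh_K is_tsD(4)[OF T] by auto
  then show ?thesis by (simp add: mul_def kmul_assoc sh_kmul sh_sh map_comp_assoc)
qed

text \<open>The semidirect product of K with T. It maps onto \<open>H \<wr> T\<close> by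
  \<open>realize\<close>, which forgets k off the domain of t; working upstairs gives access to both
  components.\<close>

definition pairs :: "(('q \<Rightarrow> 'h) \<times> ('q \<rightharpoonup> 'q)) sgp" where
  "pairs = \<lparr>carrier = K \<times> pfuns T, sprod = mul\<rparr>"

lemma pairs_simps [simp]: "carrier pairs = K \<times> pfuns T" "u \<cdot>\<^bsub>pairs\<^esub> v = mul u v"
  by (simp_all add: pairs_def)

lemma finite_sgp_pairs: "finite_sgp pairs"
  unfolding finite_sgp_def is_sgp_def pairs_simps
proof (intro conjI ballI)
  show "K \<times> pfuns T \<noteq> {}" using K_closed(2) is_tsD(3)[OF T] by blast
  show "finite (K \<times> pfuns T)" using finite_K finite_pfuns[OF T] by (rule finite_cartesian_product)
qed (rule mul_closed mul_assoc; assumption)+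

definition realize :: "('q \<Rightarrow> 'h) \<times> ('q \<rightharpoonup> 'q) \<Rightarrow> ('h \<times> 'q \<rightharpoonup> 'h \<times> 'q)" where
  "realize u = wreath_act (\<lambda>q. rtrans H (fst u q)) (snd u)"

lemma realize_mul:
  assumes "u \<in> K \<times> pfuns T" "v \<in> K \<times> pfuns T"
  shows "realize v \<circ>\<^sub>m realize u = realize (mul u v)"
  unfolding realize_def wreath_act_comp mul_def fst_conv snd_conv
proof (rule wreath_act_cong)
  fix q q' assume "(snd v \<circ>\<^sub>m snd u) q = Some q'"
  then obtain p where p: "snd u q = Some p" by (auto simp: map_comp_Some_iff)
  have "fst u q \<in> carrier H" "fst v p \<in> carrier H" using assms kval by auto
  from rtrans_comp[OF H.is_monoid this]
  show "rtrans H (fst v (the (snd u q))) \<circ>\<^sub>m rtrans H (fst u q) = rtrans H (kmul (fst u) (sh (fst v) (snd u)) q)"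
    unfolding p option.sel kmul_def sh_def by (simp add: p cong: if_cong)
qed

lemma realize_surj:
  assumes "w \<in> pfuns (group_ts H \<wr> T)" shows "\<exists>u\<in>K \<times> pfuns T. realize u = w"
proof -
  obtain f t where w: "w = wreath_act f t" "t \<in> pfuns T" "\<forall>q\<in>dom t. f q \<in> pfuns (group_ts H)"
    using assms unfolding wreath_pfuns[of w] by blast
  have "\<forall>q\<in>dom t. \<exists>h. h \<in> carrier H \<and> f q = rtrans H h" using w(3) by auto
  from bchoice[OF this] obtain h where h: "\<forall>q\<in>dom t. h q \<in> carrier H \<and> f q = rtrans H (h q)" ..
  define k where "k q = (if q \<in> dom t then h q else \<one>)" for q
  have "k \<in> K" using h is_tsD(5)[OF T w(2)] unfolding K_def k_def by auto
  moreover have "realize (k, t) = w" unfolding realize_def w(1)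
    unfolding fst_conv snd_conv by (rule wreath_act_cong) (use h in \<open>auto simp: k_def dom_def\<close>)
  ultimately show ?thesis using w(2) by (intro bexI[of _ "(k, t)"]) auto
qed

definition maxgrp :: "('q \<rightharpoonup> 'q) \<Rightarrow> ('q \<rightharpoonup> 'q) set \<Rightarrow> (('q \<Rightarrow> 'h) \<times> ('q \<rightharpoonup> 'q)) monoid" where
  "maxgrp y Hy = \<lparr>carrier = {(k, x). x \<in> Hy \<and> k \<in> K \<and> sh k y = k}, mult = mul, one = (kone, y)\<rparr>"

text \<open>The condition \<open>sh k y = k\<close> makes (\<open>kone\<close>, y) an identity; the
  result is the semidirect product of the functions fixed by y with the group Hy.\<close>

lemma group_maxgrp:
  assumes Hy: "Hy \<subseteq> pfuns T" "y \<in> Hy" "\<And>x x'. x \<in> Hy \<Longrightarrow> x' \<in> Hy \<Longrightarrow> x' \<circ>\<^sub>m x \<in> Hy"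
    "\<And>x. x \<in> Hy \<Longrightarrow> x \<circ>\<^sub>m y = x" "\<And>x. x \<in> Hy \<Longrightarrow> y \<circ>\<^sub>m x = x"
    "\<And>x. x \<in> Hy \<Longrightarrow> \<exists>x'\<in>Hy. x \<circ>\<^sub>m x' = y"
  shows "Group.group (maxgrp y Hy)"
proof (rule groupI)
  show "\<one>\<^bsub>maxgrp y Hy\<^esub> \<in> carrier (maxgrp y Hy)" using Hy(2) K_closed(2) by (simp add: maxgrp_def sh_kone)
  fix u assume u: "u \<in> carrier (maxgrp y Hy)"
  obtain k x where kx: "u = (k, x)" "x \<in> Hy" "k \<in> K" "sh k y = k" using u by (auto simp: maxgrp_def)
  show "\<one>\<^bsub>maxgrp y Hy\<^esub> \<otimes>\<^bsub>maxgrp y Hy\<^esub> u = u" using kx Hy(4) kmul_kone by (simp add: maxgrp_def mul_pair)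
  show "\<exists>v\<in>carrier (maxgrp y Hy). v \<otimes>\<^bsub>maxgrp y Hy\<^esub> u = \<one>\<^bsub>maxgrp y Hy\<^esub>"
  proof -
    obtain x' where x': "x' \<in> Hy" "x \<circ>\<^sub>m x' = y" using Hy(6)[OF kx(2)] by blast
    \<comment> \<open>With x' inverse to x in Hy, the inverse of (k, x) is (\<open>sh i x'\<close>,
      x').\<close>
    define i where "i = (\<lambda>q. inv (k q))"
    have i: "i \<in> K" "kmul i k = kone" using kx(3) by (auto simp: i_def K_def kmul_def kone_def)
    have "sh (sh i x') y = sh i x'" using Hy(4)[OF x'(1)] by (simp add: sh_sh)
    moreover have "sh i x' \<in> K" using sh_K[OF i(1)] x'(1) Hy(1) by blast
    moreover have "kmul (sh i x') (sh k x') = kone" using sh_kmul[of i k x'] i(2) sh_kone by simp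
    ultimately show ?thesis using x' kx by (intro bexI[of _ "(sh i x', x')"]) (auto simp: maxgrp_def mul_pair)
  qed
  fix v assume v: "v \<in> carrier (maxgrp y Hy)"
  obtain l z where lz: "v = (l, z)" "z \<in> Hy" "l \<in> K" "sh l y = l" using v by (auto simp: maxgrp_def)
  have "sh (kmul k (sh l x)) y = kmul k (sh l x)" using kx lz Hy(4) by (simp add: sh_kmul sh_sh)
  then show "u \<otimes>\<^bsub>maxgrp y Hy\<^esub> v \<in> carrier (maxgrp y Hy)"
    using kx lz Hy(3) K_closed(1) sh_K[OF lz(3)] Hy(1) by (auto simp: maxgrp_def mul_pair)
  fix w assume w: "w \<in> carrier (maxgrp y Hy)"
  have "u \<in> K \<times> pfuns T" "v \<in> K \<times> pfuns T" "w \<in> K \<times> pfuns T" using u v w Hy(1) by (auto simp: maxgrp_def)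
  then show "u \<otimes>\<^bsub>maxgrp y Hy\<^esub> v \<otimes>\<^bsub>maxgrp y Hy\<^esub> w = u \<otimes>\<^bsub>maxgrp y Hy\<^esub> (v \<otimes>\<^bsub>maxgrp y Hy\<^esub> w)"
    using mul_assoc by (simp add: maxgrp_def)
qed

lemma finite_maxgrp: "Hy \<subseteq> pfuns T \<Longrightarrow> finite (carrier (maxgrp y Hy))"
  using finite_K finite_pfuns[OF T] by (auto simp: maxgrp_def intro: finite_subset[of _ "K \<times> pfuns T"])

end

text \<open>Left multiplication by a permutes the finite set Z, so Z contains the solutions b of a b
  = a and c of a c = \<one>.\<close>

lemma (in group) finite_closed_subset:
  assumes fin: "finite (carrier G)" and Z: "Z \<subseteq> carrier G" "\<And>a b. a \<in> Z \<Longrightarrow> b \<in> Z \<Longrightarrow> a \<otimes> b \<in> Z"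
    and a: "a \<in> Z"
  shows "\<one> \<in> Z" "inv a \<in> Z"
proof -
  have aG: "a \<in> carrier G" using a Z(1) by blast
  have "inj_on (\<lambda>b. a \<otimes> b) Z" using aG Z(1) by (auto simp: inj_on_def subset_iff)
  moreover have "(\<lambda>b. a \<otimes> b) ` Z \<subseteq> Z" using Z(2) a by blast
  ultimately have surj: "(\<lambda>b. a \<otimes> b) ` Z = Z" using fin Z(1) by (meson endo_inj_surj finite_subset)
  then obtain b where b: "b \<in> Z" "a \<otimes> b = a" using a by (metis imageE)
  then have "b = \<one>" using aG Z(1) by auto
  then show one: "\<one> \<in> Z" using b by simp
  then obtain c where c: "c \<in> Z" "a \<otimes> c = \<one>" using surj by (metis imageE)
  then have "inv a = c" using aG Z(1) by (metis inv_equality inv_inv subsetD)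
  then show "inv a \<in> Z" using c by simp
qed

lemma (in group) ex_pow_eq_one:
  assumes "finite (carrier G)" "a \<in> carrier G" shows "\<exists>n. a [^] Suc n = \<one>"
proof -
  have "\<one> \<in> range (\<lambda>n. a [^] Suc n)"
  proof (rule finite_closed_subset(1)[OF assms(1)])
    show "range (\<lambda>n. a [^] Suc n) \<subseteq> carrier G" using assms(2) by auto
    show "a [^] Suc 0 \<in> range (\<lambda>n. a [^] Suc n)" by (rule rangeI)
    show "x \<otimes> y \<in> range (\<lambda>n. a [^] Suc n)"
      if xy: "x \<in> range (\<lambda>n. a [^] Suc n)" "y \<in> range (\<lambda>n. a [^] Suc n)" for x y
    proof -
      obtain m n where "x = a [^] Suc m" "y = a [^] Suc n" using xy by blast
      then have "x \<otimes> y = a [^] Suc (m + Suc n)" using nat_pow_mult[OF assms(2), of "Suc m" "Suc n"] by simp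
      then show ?thesis by blast
    qed
  qed
  then show ?thesis by (metis imageE)
qed

section \<open>The flow of an aperiodic relational morphism\<close>

text \<open>The relational morphism lifted to pairs. Its aperiodicity is recorded for idempotents u,
  which correspond to one-element subsemigroups.\<close>

locale gm_wreath = gm S I G A B C \<phi> a0 + group_wreath H T
  for S :: "'s sgp" and I :: "'s set" and G :: "'g monoid" and A :: "'a set" and B :: "'b set"
    and C :: "'b \<Rightarrow> 'a \<Rightarrow> 'g option" and \<phi> :: "'s \<Rightarrow> ('a \<times> 'g \<times> 'b) option" and a0 :: 'a
    and H :: "'h monoid" (structure) and T :: "'q ts" +
  fixes \<Theta> :: "'s \<Rightarrow> (('q \<Rightarrow> 'h) \<times> ('q \<rightharpoonup> 'q)) set"
  assumes \<Theta>_nonempty: "s \<in> carrier S \<Longrightarrow> \<Theta> s \<noteq> {}"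
    and \<Theta>_sub: "s \<in> carrier S \<Longrightarrow> \<Theta> s \<subseteq> K \<times> pfuns T"
    and \<Theta>_mult: "s \<in> carrier S \<Longrightarrow> s' \<in> carrier S \<Longrightarrow> u \<in> \<Theta> s \<Longrightarrow> u' \<in> \<Theta> s' \<Longrightarrow> mul u u' \<in> \<Theta> (s \<cdot>\<^bsub>S\<^esub> s')"
    and \<Theta>_aperiodic: "s \<in> carrier S \<Longrightarrow> u \<in> \<Theta> s \<Longrightarrow> mul u u = u \<Longrightarrow> \<exists>n. spow S s (Suc n) = spow S s n"
begin

text \<open>Components over all \<open>lm g\<close> are collected, not only those over
  \<open>lm \<one>\<close>: this puts left translations by every g within reach of the group Hy (see
  \<open>ex_left\<close>).\<close>

definition E :: "('q \<rightharpoonup> 'q) set" where "E = {snd u | u g. g \<in> carrier G \<and> u \<in> \<Theta> (lm g)}"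

lemma E_I: "g \<in> carrier G \<Longrightarrow> (k, t) \<in> \<Theta> (lm g) \<Longrightarrow> t \<in> E"
  unfolding E_def by force

lemma E_sub: "E \<subseteq> pfuns T"
  using \<Theta>_sub[OF lm_closed] unfolding E_def by fastforce

lemma \<Theta>_lm: "g \<in> carrier G \<Longrightarrow> h \<in> carrier G \<Longrightarrow> u \<in> \<Theta> (lm g) \<Longrightarrow> v \<in> \<Theta> (lm h) \<Longrightarrow> mul u v \<in> \<Theta> (lm (g \<otimes>\<^bsub>G\<^esub> h))"
  using \<Theta>_mult[OF lm_closed lm_closed] lm_mult by simp

lemma E_closed: "s \<in> E \<Longrightarrow> t \<in> E \<Longrightarrow> t \<circ>\<^sub>m s \<in> E"
proof -
  assume "s \<in> E" "t \<in> E"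
  then obtain u g v h where h: "s = snd u" "g \<in> carrier G" "u \<in> \<Theta> (lm g)"
    "t = snd v" "h \<in> carrier G" "v \<in> \<Theta> (lm h)" unfolding E_def by blast
  have "snd (mul u v) \<in> E" unfolding E_def using \<Theta>_lm h G.m_closed by blast
  then show "t \<circ>\<^sub>m s \<in> E" using h by (simp add: mul_def)
qed

lemma ex_local_identity:
  "\<exists>y\<in>E. y \<circ>\<^sub>m y = y \<and> (\<forall>x\<in>E. \<exists>x'\<in>E. (y \<circ>\<^sub>m (x' \<circ>\<^sub>m y)) \<circ>\<^sub>m (y \<circ>\<^sub>m (x \<circ>\<^sub>m y)) = y)"
proof -
  obtain u where "u \<in> \<Theta> (lm \<one>\<^bsub>G\<^esub>)" using \<Theta>_nonempty[OF lm_closed] by blast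
  then have "E \<noteq> {}" unfolding E_def by blast
  moreover have "finite E" using E_sub finite_pfuns[OF T] by (rule finite_subset)
  ultimately have "finite_sgp (pfun_sgp E)" unfolding finite_sgp_def is_sgp_pfun using E_closed by simp
  from ex_local_group[OF this] show ?thesis by simp
qed

end

section \<open>The group J, its subgroup Z and the cosets of points\<close>

locale gm_wreath_local = gm_wreath S I G A B C \<phi> a0 H T \<Theta>
  for S :: "'s sgp" and I :: "'s set" and G :: "'g monoid" and A :: "'a set" and B :: "'b set"
    and C :: "'b \<Rightarrow> 'a \<Rightarrow> 'g option" and \<phi> :: "'s \<Rightarrow> ('a \<times> 'g \<times> 'b) option" and a0 :: 'a
    and H :: "'h monoid" (structure) and T :: "'q ts"
    and \<Theta> :: "'s \<Rightarrow> (('q \<Rightarrow> 'h) \<times> ('q \<rightharpoonup> 'q)) set" +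
  fixes y :: "'q \<rightharpoonup> 'q"
  assumes yE: "y \<in> E" and yy: "y \<circ>\<^sub>m y = y"
    and yinv: "x \<in> E \<Longrightarrow> \<exists>x'\<in>E. (y \<circ>\<^sub>m (x' \<circ>\<^sub>m y)) \<circ>\<^sub>m (y \<circ>\<^sub>m (x \<circ>\<^sub>m y)) = y"
begin

definition Hy :: "('q \<rightharpoonup> 'q) set" where "Hy = {y \<circ>\<^sub>m (x \<circ>\<^sub>m y) | x. x \<in> E}"

lemma Hy_E: "x \<in> Hy \<Longrightarrow> x \<in> E"
  unfolding Hy_def using E_closed yE by blast

lemma Hy_I: "x \<in> E \<Longrightarrow> y \<circ>\<^sub>m (x \<circ>\<^sub>m y) \<in> Hy"
  unfolding Hy_def by blast

lemma Hy_unit: "x \<in> Hy \<Longrightarrow> x \<circ>\<^sub>m y = x" "x \<in> Hy \<Longrightarrow> y \<circ>\<^sub>m x = x"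
  unfolding Hy_def using yy by (auto simp: map_comp_assoc) (metis map_comp_assoc)+

lemma y_Hy: "y \<in> Hy"
  using Hy_I[OF yE] yy by simp

lemma Hy_closed: "x \<in> Hy \<Longrightarrow> x' \<in> Hy \<Longrightarrow> x' \<circ>\<^sub>m x \<in> Hy"
proof -
  assume h: "x \<in> Hy" "x' \<in> Hy"
  have "y \<circ>\<^sub>m ((x' \<circ>\<^sub>m x) \<circ>\<^sub>m y) = x' \<circ>\<^sub>m x" using Hy_unit h by (metis map_comp_assoc)
  then show "x' \<circ>\<^sub>m x \<in> Hy" using Hy_I[OF E_closed] Hy_E h by metis
qed

text \<open>The choice of y gives one-sided inverses in Hy; applied twice they become
  two-sided.\<close>

lemma Hy_inverse:
  assumes x: "x \<in> Hy" shows "\<exists>x'\<in>Hy. x \<circ>\<^sub>m x' = y \<and> x' \<circ>\<^sub>m x = y"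
proof -
  have right: "\<exists>x'\<in>Hy. x' \<circ>\<^sub>m x = y" if "x \<in> Hy" for x
  proof -
    have "y \<circ>\<^sub>m (x \<circ>\<^sub>m y) = x" using Hy_unit that by simp
    then show ?thesis using yinv[OF Hy_E[OF that]] Hy_I by metis
  qed
  obtain x' where x': "x' \<in> Hy" "x' \<circ>\<^sub>m x = y" using right[OF x] by blast
  obtain x'' where x'': "x'' \<in> Hy" "x'' \<circ>\<^sub>m x' = y" using right[OF x'(1)] by blast
  have "x'' = x'' \<circ>\<^sub>m (x' \<circ>\<^sub>m x)" using x'(2) Hy_unit(1)[OF x''(1)] by simp
  also have "\<dots> = x" using x''(2) Hy_unit(2)[OF x] by (simp add: map_comp_assoc)
  finally show ?thesis using x' x'' by blast
qed

lemma Hy_sub: "Hy \<subseteq> pfuns T"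
  using Hy_E E_sub by blast

sublocale J: Group.group "maxgrp y Hy"
proof (rule group_maxgrp[OF Hy_sub y_Hy])
  show "\<exists>x'\<in>Hy. x \<circ>\<^sub>m x' = y" if "x \<in> Hy" for x using Hy_inverse[OF that] by blast
qed (fact Hy_closed Hy_unit)+

abbreviation J where "J \<equiv> maxgrp y Hy"

lemma J_simps: "(k, x) \<in> carrier J \<longleftrightarrow> x \<in> Hy \<and> k \<in> K \<and> sh k y = k"
  "(k, x) \<otimes>\<^bsub>J\<^esub> (k', x') = (kmul k (sh k' x), x' \<circ>\<^sub>m x)"
  by (auto simp: maxgrp_def mul_pair)

text \<open>Any element over y is related to some \<open>lm g\<close>. A power brings g to \<one>
  without changing y, and an idempotent power of the result satisfies n (\<open>sh n y\<close>) = n,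
  so that \<open>sh n y\<close> is trivial by cancellation in H. Hence a left factor
  (\<open>zeta\<close>, y) leaves no trace after restriction by \<open>sh _ y\<close>.\<close>

lemma ex_zeta: "\<exists>n. (n, y) \<in> \<Theta> (lm \<one>\<^bsub>G\<^esub>) \<and> sh n y = kone"
proof -
  have pw: "spow pairs u j \<in> \<Theta> (lm (g [^]\<^bsub>G\<^esub> Suc j)) \<and> snd (spow pairs u j) = y"
    if u: "u \<in> \<Theta> (lm g)" "snd u = y" and g: "g \<in> carrier G" for u g j
  proof (induction j)
    case (Suc j)
    have "mul (spow pairs u j) u \<in> \<Theta> (lm (g [^]\<^bsub>G\<^esub> Suc j \<otimes>\<^bsub>G\<^esub> g))"
      using \<Theta>_lm Suc u(1) g G.nat_pow_closed by blast
    then show ?case using Suc u(2) yy by (simp add: mul_def)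
  qed (use u g in simp)
  obtain u g where u: "u \<in> \<Theta> (lm g)" "snd u = y" "g \<in> carrier G" using yE unfolding E_def by blast
  obtain j where j: "g [^]\<^bsub>G\<^esub> Suc j = \<one>\<^bsub>G\<^esub>" using G.ex_pow_eq_one[OF finite_Y(1) u(3)] by blast
  define v where "v = spow pairs u j"
  have v: "v \<in> \<Theta> (lm \<one>\<^bsub>G\<^esub>)" "snd v = y" using pw[OF u, of j] unfolding v_def j by auto
  then have "v \<in> carrier pairs" using \<Theta>_sub[OF lm_closed[OF G.one_closed]] by auto
  then obtain m where m: "spow pairs v m \<cdot>\<^bsub>pairs\<^esub> spow pairs v m = spow pairs v m"
    by (rule ex_idempotent_spow[OF finite_sgp_pairs])
  obtain n t where n: "spow pairs v m = (n, t)" by (metis prod.exhaust)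
  have e: "(n, t) \<in> \<Theta> (lm (\<one>\<^bsub>G\<^esub> [^]\<^bsub>G\<^esub> Suc m))" "t = y"
    using pw[OF v G.one_closed, of m] unfolding n by auto
  have e1: "(n, y) \<in> \<Theta> (lm \<one>\<^bsub>G\<^esub>)" using e by simp
  then have nK: "n \<in> K" using \<Theta>_sub[OF lm_closed[OF G.one_closed]] by auto
  have "kmul n (sh n y) = n" using m unfolding n e(2) by (simp add: mul_pair)
  then have "n q \<otimes> sh n y q = n q" for q by (metis kmul_def)
  moreover have "sh n y q \<in> carrier H" for q using kval[OF sh_K[OF nK]] E_sub yE by blast
  ultimately have "sh n y = kone" using kval[OF nK] H.l_cancel_one unfolding kone_def by blast
  then show ?thesis using e1 by blast
qed

definition zeta :: "'q \<Rightarrow> 'h" where "zeta = (SOME n. (n, y) \<in> \<Theta> (lm \<one>\<^bsub>G\<^esub>) \<and> sh n y = kone)"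

lemma zeta: "(zeta, y) \<in> \<Theta> (lm \<one>\<^bsub>G\<^esub>)" "sh zeta y = kone" "zeta \<in> K"
proof -
  have h: "(zeta, y) \<in> \<Theta> (lm \<one>\<^bsub>G\<^esub>) \<and> sh zeta y = kone" unfolding zeta_def by (rule someI_ex[OF ex_zeta])
  then show "(zeta, y) \<in> \<Theta> (lm \<one>\<^bsub>G\<^esub>)" "sh zeta y = kone" by auto
  then show "zeta \<in> K" using \<Theta>_sub[OF lm_closed[OF G.one_closed]] by auto
qed

text \<open>The block of \<open>v\<close> at the state \<open>q\<close> of the flow is determined by \<open>F v q\<close>, which turns out to be
  empty or a single coset of the subgroup \<open>Z\<close> of \<open>J\<close>.\<close>

definition F :: "'g \<times> 'b \<Rightarrow> ('q \<rightharpoonup> 'q) \<Rightarrow> (('q \<Rightarrow> 'h) \<times> ('q \<rightharpoonup> 'q)) set" where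
  "F v q = {(k, x). x \<in> Hy \<and> (\<exists>k'. (k', q \<circ>\<^sub>m x) \<in> \<Theta> (\<iota> v) \<and> sh k' y = k)}"

definition Z :: "(('q \<Rightarrow> 'h) \<times> ('q \<rightharpoonup> 'q)) set" where
  "Z = {(sh n y, x) | n x. (n, x) \<in> \<Theta> (lm \<one>\<^bsub>G\<^esub>) \<and> x \<in> Hy}"

lemma \<Theta>_K: "s \<in> carrier S \<Longrightarrow> (k, t) \<in> \<Theta> s \<Longrightarrow> k \<in> K" "s \<in> carrier S \<Longrightarrow> (k, t) \<in> \<Theta> s \<Longrightarrow> t \<in> pfuns T"
  using \<Theta>_sub by blast+

lemma y_T: "y \<in> pfuns T" using Hy_sub y_Hy by blast

lemma sh_y_J: "k \<in> K \<Longrightarrow> x \<in> Hy \<Longrightarrow> (sh k y, x) \<in> carrier J"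
  using sh_K y_T yy by (simp add: J_simps sh_sh)

lemma F_J: "v \<in> Y \<Longrightarrow> F v q \<subseteq> carrier J"
  unfolding F_def using sh_y_J \<Theta>_K(1)[OF iota_S] by auto

lemma Z_J: "Z \<subseteq> carrier J"
  unfolding Z_def using sh_y_J \<Theta>_K(1)[OF lm_closed[OF G.one_closed]] by auto

text \<open>Restriction by \<open>sh _ y\<close> is compatible with multiplication because y is an
  identity for x. With g = \<one> this gives the action of Z on \<open>F v q\<close>; for general g
  it moves v by left translation.\<close>

lemma left_act:
  assumes g: "g \<in> carrier G" and n: "(n, x) \<in> \<Theta> (lm g)" "x \<in> Hy" and v: "v \<in> Y" and j: "j \<in> F v q"
  shows "(sh n y, x) \<otimes>\<^bsub>J\<^esub> j \<in> F (g \<otimes>\<^bsub>G\<^esub> fst v, snd v) q"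
proof -
  obtain k x1 k' where k: "j = (k, x1)" "x1 \<in> Hy" "(k', q \<circ>\<^sub>m x1) \<in> \<Theta> (\<iota> v)" "sh k' y = k"
    using j unfolding F_def by blast
  have "mul (n, x) (k', q \<circ>\<^sub>m x1) \<in> \<Theta> (\<iota> (g \<otimes>\<^bsub>G\<^esub> fst v, snd v))"
    using \<Theta>_mult[OF lm_closed[OF g] iota_S[OF v] n(1) k(3)] lm_iota[OF g v] by simp
  then have a: "(kmul n (sh k' x), q \<circ>\<^sub>m (x1 \<circ>\<^sub>m x)) \<in> \<Theta> (\<iota> (g \<otimes>\<^bsub>G\<^esub> fst v, snd v))"
    by (simp add: mul_pair map_comp_assoc)
  have "sh (kmul n (sh k' x)) y = kmul (sh n y) (sh k x)"
    unfolding k(4)[symmetric] sh_kmul sh_sh using Hy_unit n(2) by simp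
  then show ?thesis unfolding k(1) J_simps F_def using a Hy_closed[OF n(2) k(2)] by auto
qed

lemma Z_F: "v \<in> Y \<Longrightarrow> z \<in> Z \<Longrightarrow> j \<in> F v q \<Longrightarrow> z \<otimes>\<^bsub>J\<^esub> j \<in> F v q"
  unfolding Z_def using left_act[OF G.one_closed, of _ _ v j q] by auto

lemma Z_closed: "a \<in> Z \<Longrightarrow> b \<in> Z \<Longrightarrow> a \<otimes>\<^bsub>J\<^esub> b \<in> Z"
proof -
  assume "a \<in> Z" "b \<in> Z"
  then obtain n x n' x' where h: "a = (sh n y, x)" "(n, x) \<in> \<Theta> (lm \<one>\<^bsub>G\<^esub>)" "x \<in> Hy"
    "b = (sh n' y, x')" "(n', x') \<in> \<Theta> (lm \<one>\<^bsub>G\<^esub>)" "x' \<in> Hy" unfolding Z_def by blast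
  have "mul (n, x) (n', x') \<in> \<Theta> (lm \<one>\<^bsub>G\<^esub>)" using \<Theta>_lm[OF G.one_closed G.one_closed h(2,5)] by simp
  then have "(kmul n (sh n' x), x' \<circ>\<^sub>m x) \<in> \<Theta> (lm \<one>\<^bsub>G\<^esub>)" by (simp add: mul_pair)
  moreover have "a \<otimes>\<^bsub>J\<^esub> b = (sh (kmul n (sh n' x)) y, x' \<circ>\<^sub>m x)"
    unfolding h(1,4) J_simps sh_kmul sh_sh using Hy_unit h(3) by simp
  ultimately show "a \<otimes>\<^bsub>J\<^esub> b \<in> Z" unfolding Z_def using Hy_closed[OF h(3,6)] by blast
qed

lemma Z_inv: "a \<in> Z \<Longrightarrow> inv\<^bsub>J\<^esub> a \<in> Z"
  using J.finite_closed_subset(2)[OF finite_maxgrp[OF Hy_sub] Z_J Z_closed] .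

text \<open>Multiplying the two elements on the right by an element related to a right inverse of
  \<open>\<iota> v\<close>, and on both sides by \<open>(zeta, y)\<close>, leads into \<open>Z\<close>; in \<open>J\<close> both are multiplied on the right
  by the same element.\<close>

lemma F_coset:
  assumes v: "v \<in> Y" and q: "q \<in> pfuns T" and j: "j1 \<in> F v q" "j2 \<in> F v q"
  shows "j1 \<otimes>\<^bsub>J\<^esub> inv\<^bsub>J\<^esub> j2 \<in> Z"
proof -
  obtain r where r: "r \<in> carrier S" "\<iota> v \<cdot>\<^bsub>S\<^esub> r = lm \<one>\<^bsub>G\<^esub>" using iota_right_inverse[OF v] by blast
  obtain d p where dp: "(d, p) \<in> \<Theta> r" using \<Theta>_nonempty[OF r(1)] by (metis equals0I prod.exhaust)
  note d = \<Theta>_K(1)[OF r(1) dp] and p = \<Theta>_K(2)[OF r(1) dp]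
  \<comment> \<open>The components of (d, p) followed by (\<open>zeta\<close>, y), pulled back along
    q and y; the element j does not enter into them.\<close>
  define m1 where "m1 = kmul (sh d (q \<circ>\<^sub>m y)) (sh zeta (p \<circ>\<^sub>m (q \<circ>\<^sub>m y)))"
  define m2 where "m2 = y \<circ>\<^sub>m (p \<circ>\<^sub>m (q \<circ>\<^sub>m y))"
  have key: "j \<otimes>\<^bsub>J\<^esub> (m1, m2) \<in> Z \<and> m2 \<in> Hy" if j: "j \<in> F v q" for j
  proof -
    obtain k x k' where k: "j = (k, x)" "x \<in> Hy" "(k', q \<circ>\<^sub>m x) \<in> \<Theta> (\<iota> v)" "sh k' y = k"
      using j unfolding F_def by blast
    have k': "k' \<in> K" using \<Theta>_K(1)[OF iota_S[OF v] k(3)] .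
    let ?t = "p \<circ>\<^sub>m (q \<circ>\<^sub>m x)" and ?k = "kmul k' (sh d (q \<circ>\<^sub>m x))"
    have "mul (k', q \<circ>\<^sub>m x) (d, p) \<in> \<Theta> (lm \<one>\<^bsub>G\<^esub>)"
      using \<Theta>_mult[OF iota_S[OF v] r(1) k(3) dp] r(2) by simp
    then have u: "(?k, ?t) \<in> \<Theta> (lm \<one>\<^bsub>G\<^esub>)" by (simp add: mul_pair)
    have "mul (zeta, y) (?k, ?t) \<in> \<Theta> (lm \<one>\<^bsub>G\<^esub>)"
      using \<Theta>_lm[OF G.one_closed G.one_closed zeta(1) u] by simp
    from \<Theta>_lm[OF G.one_closed G.one_closed this zeta(1)]
    have "mul (mul (zeta, y) (?k, ?t)) (zeta, y) \<in> \<Theta> (lm \<one>\<^bsub>G\<^esub>)" by simp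
    then have w: "(kmul (kmul zeta (sh ?k y)) (sh zeta (?t \<circ>\<^sub>m y)), y \<circ>\<^sub>m (?t \<circ>\<^sub>m y)) \<in> \<Theta> (lm \<one>\<^bsub>G\<^esub>)"
      by (simp add: mul_pair)
    have tE: "?t \<in> E" using E_I[OF G.one_closed u] .
    have xx: "x \<circ>\<^sub>m y = x" "y \<circ>\<^sub>m x = x" using Hy_unit k(2) by auto
    have ty: "?t \<circ>\<^sub>m y = ?t" "(q \<circ>\<^sub>m x) \<circ>\<^sub>m y = q \<circ>\<^sub>m x" "(q \<circ>\<^sub>m y) \<circ>\<^sub>m x = q \<circ>\<^sub>m x"
      using xx by (metis map_comp_assoc)+
    have X: "m2 \<circ>\<^sub>m x = y \<circ>\<^sub>m (?t \<circ>\<^sub>m y)" unfolding m2_def ty(1) using ty(3) by (metis map_comp_assoc)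
    have XH: "m2 \<circ>\<^sub>m x \<in> Hy" unfolding X by (rule Hy_I[OF tE])
    \<comment> \<open>m2 lies in Hy because its product with x does and x is invertible
      there.\<close>
    obtain x' where x': "x' \<in> Hy" "x \<circ>\<^sub>m x' = y" using Hy_inverse[OF k(2)] by blast
    have "m2 \<circ>\<^sub>m y = m2" unfolding m2_def using yy by (metis map_comp_assoc)
    then have "(m2 \<circ>\<^sub>m x) \<circ>\<^sub>m x' = m2" using x'(2) by (metis map_comp_assoc)
    then have m2: "m2 \<in> Hy" using Hy_closed[OF x'(1) XH] by simp
    have sk: "sh ?k y = kmul k (sh d (q \<circ>\<^sub>m x))" unfolding sh_kmul sh_sh ty(2) k(4) ..
    have kK: "k \<in> K" "sh k y = k" using subsetD[OF F_J[OF v] j] unfolding k(1) by (auto simp: J_simps)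
    have tT: "?t \<in> pfuns T" using tE E_sub by blast
    have qx: "q \<circ>\<^sub>m x \<in> pfuns T" using is_tsD(4)[OF T] q k(2) Hy_sub by blast
    have sd: "sh d (q \<circ>\<^sub>m x) \<in> K" "sh zeta ?t \<in> K" using sh_K[OF d qx] sh_K[OF zeta(3) tT] .
    have "sh (kmul (kmul zeta (sh ?k y)) (sh zeta (?t \<circ>\<^sub>m y))) y =
        kmul (kmul kone (kmul k (sh d (q \<circ>\<^sub>m x)))) (sh zeta ?t)"
      unfolding sk unfolding sh_kmul sh_sh zeta(2) ty kK(2) by simp
    also have "\<dots> = kmul k (kmul (sh d (q \<circ>\<^sub>m x)) (sh zeta ?t))"
      using kmul_kone(1)[OF K_closed(1)[OF kK(1) sd(1)]] kmul_assoc[OF kK(1) sd] by simp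
    also have "\<dots> = kmul k (sh m1 x)"
    proof -
      have "(p \<circ>\<^sub>m (q \<circ>\<^sub>m y)) \<circ>\<^sub>m x = ?t" using ty(3) by (metis map_comp_assoc)
      then show ?thesis unfolding m1_def sh_kmul sh_sh ty(3) by simp
    qed
    finally have "j \<otimes>\<^bsub>J\<^esub> (m1, m2) = (sh (kmul (kmul zeta (sh ?k y)) (sh zeta (?t \<circ>\<^sub>m y))) y, y \<circ>\<^sub>m (?t \<circ>\<^sub>m y))"
      unfolding k(1) J_simps X by simp
    moreover have "y \<circ>\<^sub>m (?t \<circ>\<^sub>m y) \<in> Hy" by (rule Hy_I[OF tE])
    ultimately show ?thesis unfolding Z_def using w m2 by blast
  qed
  have m1: "m1 \<in> K" "sh m1 y = m1"
  proof -
    have qy: "q \<circ>\<^sub>m y \<in> pfuns T" "p \<circ>\<^sub>m (q \<circ>\<^sub>m y) \<in> pfuns T" using is_tsD(4)[OF T] q p y_T by blast+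
    then show "m1 \<in> K" unfolding m1_def using K_closed(1) sh_K d zeta(3) by blast
    have "(q \<circ>\<^sub>m y) \<circ>\<^sub>m y = q \<circ>\<^sub>m y" "(p \<circ>\<^sub>m (q \<circ>\<^sub>m y)) \<circ>\<^sub>m y = p \<circ>\<^sub>m (q \<circ>\<^sub>m y)" using yy by (metis map_comp_assoc)+
    then show "sh m1 y = m1" unfolding m1_def sh_kmul sh_sh by simp
  qed
  have mJ: "(m1, m2) \<in> carrier J" using m1 key[OF j(1)] by (simp add: J_simps)
  have jJ: "j1 \<in> carrier J" "j2 \<in> carrier J" using F_J[OF v] j by blast+
  have "j1 \<otimes>\<^bsub>J\<^esub> inv\<^bsub>J\<^esub> j2 = (j1 \<otimes>\<^bsub>J\<^esub> (m1, m2)) \<otimes>\<^bsub>J\<^esub> inv\<^bsub>J\<^esub> (j2 \<otimes>\<^bsub>J\<^esub> (m1, m2))"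
  proof -
    have "(j1 \<otimes>\<^bsub>J\<^esub> (m1, m2)) \<otimes>\<^bsub>J\<^esub> (inv\<^bsub>J\<^esub> (m1, m2) \<otimes>\<^bsub>J\<^esub> inv\<^bsub>J\<^esub> j2) = j1 \<otimes>\<^bsub>J\<^esub> inv\<^bsub>J\<^esub> j2"
      using mJ jJ J.m_assoc J.inv_closed J.m_closed J.r_inv J.l_one by metis
    then show ?thesis using J.inv_mult_group[OF jJ(2) mJ] by simp
  qed
  also have "\<dots> \<in> Z" using key j Z_inv Z_closed by blast
  finally show ?thesis .
qed

text \<open>\<open>F_coset\<close> confines \<open>F v q\<close> to one coset and \<open>Z_F\<close>
  fills this coset; applied in both directions between j and j' this gives both inclusions.\<close>

lemma F_eqI:
  assumes v: "v \<in> Y" "v' \<in> Y" and q: "q \<in> pfuns T" and j: "j \<in> F v q" "j' \<in> F v' q" "j \<otimes>\<^bsub>J\<^esub> inv\<^bsub>J\<^esub> j' \<in> Z"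
  shows "F v q = F v' q"
proof -
  have sub: "F v q \<subseteq> F v' q" if h: "v \<in> Y" "v' \<in> Y" "j \<in> F v q" "j' \<in> F v' q" "j \<otimes>\<^bsub>J\<^esub> inv\<^bsub>J\<^esub> j' \<in> Z" for v v' j j'
  proof
    fix i assume i: "i \<in> F v q"
    have c: "i \<in> carrier J" "j \<in> carrier J" "j' \<in> carrier J" using F_J h i by blast+
    have "(i \<otimes>\<^bsub>J\<^esub> inv\<^bsub>J\<^esub> j) \<otimes>\<^bsub>J\<^esub> (j \<otimes>\<^bsub>J\<^esub> inv\<^bsub>J\<^esub> j') \<in> Z" using Z_closed F_coset[OF h(1) q i h(3)] h(5) by blast
    from Z_F[OF h(2) this h(4)] have "((i \<otimes>\<^bsub>J\<^esub> inv\<^bsub>J\<^esub> j) \<otimes>\<^bsub>J\<^esub> (j \<otimes>\<^bsub>J\<^esub> inv\<^bsub>J\<^esub> j')) \<otimes>\<^bsub>J\<^esub> j' \<in> F v' q" .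
    moreover have "((i \<otimes>\<^bsub>J\<^esub> inv\<^bsub>J\<^esub> j) \<otimes>\<^bsub>J\<^esub> (j \<otimes>\<^bsub>J\<^esub> inv\<^bsub>J\<^esub> j')) \<otimes>\<^bsub>J\<^esub> j' = i"
      using c by (simp add: J.m_assoc)
    ultimately show "i \<in> F v' q" by simp
  qed
  have c: "j \<in> carrier J" "j' \<in> carrier J" using F_J v j by blast+
  have "j' \<otimes>\<^bsub>J\<^esub> inv\<^bsub>J\<^esub> j = inv\<^bsub>J\<^esub> (j \<otimes>\<^bsub>J\<^esub> inv\<^bsub>J\<^esub> j')" using c by (simp add: J.inv_mult_group)
  then have "j' \<otimes>\<^bsub>J\<^esub> inv\<^bsub>J\<^esub> j \<in> Z" using Z_inv[OF j(3)] by simp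
  then show ?thesis using sub[OF v j] sub[OF v(2,1) j(2,1)] by blast
qed

text \<open>The element (\<open>zeta\<close>, y) restricts to the identity of J.\<close>

lemma Z_one: "\<one>\<^bsub>J\<^esub> \<in> Z"
  unfolding Z_def using zeta y_Hy by (auto simp: maxgrp_def) metis

lemma F_eq_common:
  assumes v: "v \<in> Y" "v' \<in> Y" and q: "q \<in> pfuns T" and j: "j \<in> F v q" "j \<in> F v' q"
  shows "F v q = F v' q"
proof -
  have "j \<in> carrier J" using F_J v j by blast
  then have "j \<otimes>\<^bsub>J\<^esub> inv\<^bsub>J\<^esub> j \<in> Z" using Z_one by simp
  then show ?thesis by (rule F_eqI[OF v q j])
qed

text \<open>The right factor is built from \<open>\<sigma>\<close> and q but not from v: a letter
  moves all cosets at q by the same element of J.\<close>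

lemma right_act:
  assumes s: "s \<in> carrier S" and a: "act s v = Some w" and \<sigma>: "(\<sigma>, t) \<in> \<Theta> s" and q: "q \<in> pfuns T" and j: "j \<in> F v q"
  shows "j \<otimes>\<^bsub>J\<^esub> (sh \<sigma> (q \<circ>\<^sub>m y), y) \<in> F w (t \<circ>\<^sub>m q)" "(sh \<sigma> (q \<circ>\<^sub>m y), y) \<in> carrier J"
proof -
  have v: "v \<in> Y" "\<iota> v \<cdot>\<^bsub>S\<^esub> s = \<iota> w" using act_Some[OF s] a by blast+
  obtain k x k' where k: "j = (k, x)" "x \<in> Hy" "(k', q \<circ>\<^sub>m x) \<in> \<Theta> (\<iota> v)" "sh k' y = k"
    using j unfolding F_def by blast
  have "mul (k', q \<circ>\<^sub>m x) (\<sigma>, t) \<in> \<Theta> (\<iota> w)" using \<Theta>_mult[OF iota_S[OF v(1)] s k(3) \<sigma>] v(2) by simp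
  then have u: "(kmul k' (sh \<sigma> (q \<circ>\<^sub>m x)), (t \<circ>\<^sub>m q) \<circ>\<^sub>m x) \<in> \<Theta> (\<iota> w)" by (simp add: mul_pair map_comp_assoc)
  have xx: "(q \<circ>\<^sub>m x) \<circ>\<^sub>m y = q \<circ>\<^sub>m x" "(q \<circ>\<^sub>m y) \<circ>\<^sub>m x = q \<circ>\<^sub>m x" "y \<circ>\<^sub>m x = x"
    using Hy_unit[OF k(2)] by (metis map_comp_assoc)+
  have "sh (kmul k' (sh \<sigma> (q \<circ>\<^sub>m x))) y = kmul k (sh (sh \<sigma> (q \<circ>\<^sub>m y)) x)"
    unfolding sh_kmul sh_sh xx k(4) ..
  then show "j \<otimes>\<^bsub>J\<^esub> (sh \<sigma> (q \<circ>\<^sub>m y), y) \<in> F w (t \<circ>\<^sub>m q)"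
    unfolding k(1) J_simps F_def using u k(2) xx(3) by auto
  have "q \<circ>\<^sub>m y \<in> pfuns T" using is_tsD(4)[OF T] q y_T by blast
  then show "(sh \<sigma> (q \<circ>\<^sub>m y), y) \<in> carrier J"
    using sh_K[OF \<Theta>_K(1)[OF s \<sigma>]] y_Hy yy by (simp add: J_simps sh_sh map_comp_assoc[symmetric])
qed

text \<open>The backward direction cancels the common right factor, which is possible because J is a
  group.\<close>

lemma right_act_iff:
  assumes s: "s \<in> carrier S" and a: "act s v = Some w" "act s v' = Some w'" and \<sigma>: "(\<sigma>, t) \<in> \<Theta> s" and q: "q \<in> pfuns T"
    and ne: "F v q \<noteq> {}" "F v' q \<noteq> {}"
  shows "F v q = F v' q \<longleftrightarrow> F w (t \<circ>\<^sub>m q) = F w' (t \<circ>\<^sub>m q)"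
proof -
  let ?l = "(sh \<sigma> (q \<circ>\<^sub>m y), y)"
  have Ys: "v \<in> Y" "v' \<in> Y" "w \<in> Y" "w' \<in> Y" using act_Some[OF s] a by blast+
  have tq: "t \<circ>\<^sub>m q \<in> pfuns T" using is_tsD(4)[OF T q \<Theta>_K(2)[OF s \<sigma>]] .
  obtain j j' where j: "j \<in> F v q" "j' \<in> F v' q" using ne by blast
  note r = right_act[OF s a(1) \<sigma> q j(1)] and r' = right_act[OF s a(2) \<sigma> q j(2)]
  show ?thesis
  proof
    assume "F v q = F v' q"
    then have "j \<otimes>\<^bsub>J\<^esub> ?l \<in> F w' (t \<circ>\<^sub>m q)" using right_act(1)[OF s a(2) \<sigma> q] j(1) by simp
    then show "F w (t \<circ>\<^sub>m q) = F w' (t \<circ>\<^sub>m q)" using F_eq_common[OF Ys(3,4) tq r(1)] by blast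
  next
    assume e: "F w (t \<circ>\<^sub>m q) = F w' (t \<circ>\<^sub>m q)"
    have c: "j \<in> carrier J" "j' \<in> carrier J" using F_J Ys j by blast+
    have "(j \<otimes>\<^bsub>J\<^esub> ?l) \<otimes>\<^bsub>J\<^esub> inv\<^bsub>J\<^esub> (j' \<otimes>\<^bsub>J\<^esub> ?l) \<in> Z" using F_coset[OF Ys(4) tq] r(1) r'(1) e by simp
    moreover have "(j \<otimes>\<^bsub>J\<^esub> ?l) \<otimes>\<^bsub>J\<^esub> (inv\<^bsub>J\<^esub> ?l \<otimes>\<^bsub>J\<^esub> inv\<^bsub>J\<^esub> j') = j \<otimes>\<^bsub>J\<^esub> inv\<^bsub>J\<^esub> j'"
      using c r(2) J.m_assoc J.inv_closed J.m_closed J.r_inv J.l_one by metis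
    ultimately have "j \<otimes>\<^bsub>J\<^esub> inv\<^bsub>J\<^esub> j' \<in> Z" using J.inv_mult_group[OF c(2) r(2)] by simp
    then show "F v q = F v' q" by (rule F_eqI[OF Ys(1,2) q j])
  qed
qed

text \<open>Cutting an element over \<open>lm g\<close> down by (\<open>zeta\<close>, y) on both
  sides keeps it over \<open>lm g\<close> and brings its T-component into Hy.\<close>

lemma ex_left: assumes g: "g \<in> carrier G" shows "\<exists>n x. (n, x) \<in> \<Theta> (lm g) \<and> x \<in> Hy"
proof -
  obtain k t where k: "(k, t) \<in> \<Theta> (lm g)" using \<Theta>_nonempty[OF lm_closed[OF g]] by (metis equals0I prod.exhaust)
  have "mul (mul (zeta, y) (k, t)) (zeta, y) \<in> \<Theta> (lm g)"
    using \<Theta>_lm[OF g G.one_closed, of "mul (zeta, y) (k, t)" "(zeta, y)"] \<Theta>_lm[OF G.one_closed g zeta(1) k] zeta(1) g by simp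
  moreover have "mul (mul (zeta, y) (k, t)) (zeta, y) =
     (kmul (kmul zeta (sh k y)) (sh zeta (t \<circ>\<^sub>m y)), y \<circ>\<^sub>m (t \<circ>\<^sub>m y))" by (simp add: mul_pair)
  ultimately show ?thesis using Hy_I[OF E_I[OF g k]] by metis
qed

lemma F_translate:
  assumes g: "g \<in> carrier G" and v: "v \<in> Y" "v' \<in> Y" and q: "q \<in> pfuns T"
  shows "F v q \<noteq> {} \<Longrightarrow> F (g \<otimes>\<^bsub>G\<^esub> fst v, snd v) q \<noteq> {}"
    "F v q \<noteq> {} \<Longrightarrow> F v q = F v' q \<Longrightarrow> F (g \<otimes>\<^bsub>G\<^esub> fst v, snd v) q = F (g \<otimes>\<^bsub>G\<^esub> fst v', snd v') q"
proof -
  obtain n x where n: "(n, x) \<in> \<Theta> (lm g)" "x \<in> Hy" using ex_left[OF g] by blast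
  note l = left_act[OF g n]
  show "F v q \<noteq> {} \<Longrightarrow> F (g \<otimes>\<^bsub>G\<^esub> fst v, snd v) q \<noteq> {}" using l[OF v(1)] by blast
  assume "F v q \<noteq> {}" and e: "F v q = F v' q"
  then obtain j where j: "j \<in> F v q" "j \<in> F v' q" by blast
  have "(g \<otimes>\<^bsub>G\<^esub> fst v, snd v) \<in> Y" "(g \<otimes>\<^bsub>G\<^esub> fst v', snd v') \<in> Y" using g v by auto
  then show "F (g \<otimes>\<^bsub>G\<^esub> fst v, snd v) q = F (g \<otimes>\<^bsub>G\<^esub> fst v', snd v') q"
    using F_eq_common[OF _ _ q l[OF v(1) j(1)] l[OF v(2) j(2)]] by blast
qed

lemma F_separates:
  assumes v: "(g, b) \<in> Y" "(h, b) \<in> Y" and q: "q \<in> pfuns T" and j: "j \<in> F (g, b) q" "j \<in> F (h, b) q"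
  shows "g = h"
proof -
  obtain k x k1 where k1: "j = (k, x)" "x \<in> Hy" "(k1, q \<circ>\<^sub>m x) \<in> \<Theta> (\<iota> (g, b))" "sh k1 y = k"
    using j(1) unfolding F_def by blast
  obtain k2 where k2: "(k2, q \<circ>\<^sub>m x) \<in> \<Theta> (\<iota> (h, b))" "sh k2 y = k"
    using j(2) k1(1) unfolding F_def by blast
  have xy: "(q \<circ>\<^sub>m x) \<circ>\<^sub>m y = q \<circ>\<^sub>m x" using Hy_unit[OF k1(2)] by (metis map_comp_assoc)
  \<comment> \<open>A left factor (\<open>zeta\<close>, y) replaces k1 and k2 by their common
    restriction k, so one and the same w is related to both points.\<close>
  define w where "w = (kmul zeta k, q \<circ>\<^sub>m x)"
  have "mul (zeta, y) (k1, q \<circ>\<^sub>m x) \<in> \<Theta> (lm \<one>\<^bsub>G\<^esub> \<cdot>\<^bsub>S\<^esub> \<iota> (g, b))"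
    "mul (zeta, y) (k2, q \<circ>\<^sub>m x) \<in> \<Theta> (lm \<one>\<^bsub>G\<^esub> \<cdot>\<^bsub>S\<^esub> \<iota> (h, b))"
    using \<Theta>_mult[OF lm_closed[OF G.one_closed] iota_S[OF v(1)] zeta(1) k1(3)]
      \<Theta>_mult[OF lm_closed[OF G.one_closed] iota_S[OF v(2)] zeta(1) k2(1)] by auto
  then have w: "w \<in> \<Theta> (\<iota> (g, b))" "w \<in> \<Theta> (\<iota> (h, b))"
    unfolding lm_one_iota[OF v(1)] lm_one_iota[OF v(2)] mul_pair k1(4) k2(2) xy w_def .
  obtain r where r: "r \<in> carrier S" "\<iota> (g, b) \<cdot>\<^bsub>S\<^esub> r = lm \<one>\<^bsub>G\<^esub>" using iota_right_inverse[OF v(1)] by blast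
  obtain c where c: "c \<in> \<Theta> r" using \<Theta>_nonempty[OF r(1)] by blast
  define \<gamma> where "\<gamma> = h \<otimes>\<^bsub>G\<^esub> inv\<^bsub>G\<^esub> g"
  have gG: "g \<in> carrier G" "h \<in> carrier G" using v by auto
  have \<gamma>: "\<gamma> \<in> carrier G" "\<gamma> \<otimes>\<^bsub>G\<^esub> g = h" unfolding \<gamma>_def using gG by (simp_all add: G.m_assoc)
  have "\<iota> (h, b) = lm \<gamma> \<cdot>\<^bsub>S\<^esub> \<iota> (g, b)" using lm_iota[OF \<gamma>(1) v(1)] \<gamma>(2) by simp
  then have "\<iota> (h, b) \<cdot>\<^bsub>S\<^esub> r = lm \<gamma> \<cdot>\<^bsub>S\<^esub> lm \<one>\<^bsub>G\<^esub>"
    using is_sgpD(3)[OF S lm_closed[OF \<gamma>(1)] iota_S[OF v(1)] r(1)] r(2) by simp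
  then have hr: "\<iota> (h, b) \<cdot>\<^bsub>S\<^esub> r = lm \<gamma>" using lm_mult[OF \<gamma>(1) G.one_closed] \<gamma>(1) by simp
  define u where "u = mul w c"
  have u: "u \<in> \<Theta> (lm \<one>\<^bsub>G\<^esub>)" "u \<in> \<Theta> (lm \<gamma>)"
    unfolding u_def using \<Theta>_mult[OF iota_S[OF v(1)] r(1) w(1) c] \<Theta>_mult[OF iota_S[OF v(2)] r(1) w(2) c] r(2) hr by auto
  \<comment> \<open>The further factors u are read as related to \<open>lm \<one>\<close>, so every
    power of u, in particular an idempotent one, stays related to
    \<open>lm \<gamma>\<close>.\<close>
  have pw: "spow pairs u n \<in> \<Theta> (lm \<gamma>)" for n
  proof (induction n)
    case (Suc n)
    then show ?case using \<Theta>_lm[OF \<gamma>(1) G.one_closed Suc u(1)] \<gamma>(1) by simp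
  qed (use u in simp)
  have "u \<in> carrier pairs" using u(1) \<Theta>_sub[OF lm_closed[OF G.one_closed]] by auto
  then obtain n where "spow pairs u n \<cdot>\<^bsub>pairs\<^esub> spow pairs u n = spow pairs u n"
    by (rule ex_idempotent_spow[OF finite_sgp_pairs])
  then have "\<exists>m. spow S (lm \<gamma>) (Suc m) = spow S (lm \<gamma>) m"
    using \<Theta>_aperiodic[OF lm_closed[OF \<gamma>(1)] pw[of n]] by simp
  then have "\<gamma> = \<one>\<^bsub>G\<^esub>" using lm_stable[OF \<gamma>(1)] by blast
  then show "g = h" using \<gamma>(2) gG by simp
qed

text \<open>A left factor (\<open>zeta\<close>, y) makes the T-component factor through y, which
  produces a member of F at the original component t.\<close>

lemma F_covers: assumes v: "v \<in> Y" shows "\<exists>q\<in>pfuns T. F v q \<noteq> {}"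
proof -
  obtain k t where k: "(k, t) \<in> \<Theta> (\<iota> v)" using \<Theta>_nonempty[OF iota_S[OF v]] by (metis equals0I prod.exhaust)
  have "mul (zeta, y) (k, t) \<in> \<Theta> (\<iota> v)"
    using \<Theta>_mult[OF lm_closed[OF G.one_closed] iota_S[OF v] zeta(1) k] lm_one_iota[OF v] by simp
  then have "(sh (kmul zeta (sh k y)) y, y) \<in> F v t" unfolding F_def mul_pair using y_Hy by blast
  then show ?thesis using \<Theta>_K(2)[OF iota_S[OF v] k] by blast
qed

section \<open>The invariant cross-sections and the automaton of the flow\<close>

definition dom_at :: "('q \<rightharpoonup> 'q) \<Rightarrow> ('g \<times> 'b) set" where "dom_at q = {v \<in> Y. F v q \<noteq> {}}"

definition block_at :: "('q \<rightharpoonup> 'q) \<Rightarrow> 'g \<times> 'b \<Rightarrow> ('g \<times> 'b) set" where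
  "block_at q v = {w \<in> dom_at q. F w q = F v q}"

lemma same_block_at:
  assumes "v \<in> dom_at q" "w \<in> dom_at q"
  shows "same_block (block_at q ` dom_at q) v w \<longleftrightarrow> F v q = F w q"
  using assms unfolding same_block_def block_at_def by auto

text \<open>Translation by g preserves equality of cosets, and translating back by the inverse of g
  turns the inclusions into equalities.\<close>

lemma cross_section_at:
  assumes q: "q \<in> pfuns T"
  shows "(dom_at q, block_at q ` dom_at q) \<in> invariant_cross_sections G B"
  unfolding invariant_cross_sections_def
proof (intro CollectI case_prodI conjI ballI allI impI)
  show "dom_at q \<subseteq> Y" unfolding dom_at_def by blast
  show "partition_on (dom_at q) (block_at q ` dom_at q)"
    unfolding partition_on_def disjoint_def block_at_def by auto
  show "g = h" if P: "P \<in> block_at q ` dom_at q" and gh: "(g, b) \<in> P \<and> (h, b) \<in> P" for P g h b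
  proof -
    have d: "(g, b) \<in> dom_at q" "(h, b) \<in> dom_at q" "F (g, b) q = F (h, b) q"
      using P gh unfolding block_at_def by auto
    then obtain j where "j \<in> F (g, b) q" unfolding dom_at_def by blast
    then show ?thesis using F_separates[of g b h q j] d q unfolding dom_at_def by auto
  qed
  have bk: "g \<otimes>\<^bsub>G\<^esub> (inv\<^bsub>G\<^esub> g \<otimes>\<^bsub>G\<^esub> h) = h" "inv\<^bsub>G\<^esub> g \<otimes>\<^bsub>G\<^esub> (g \<otimes>\<^bsub>G\<^esub> h) = h"
    if "g \<in> carrier G" "h \<in> carrier G" for g h using that by (simp_all add: G.m_assoc[symmetric])
  have tr: "(g \<otimes>\<^bsub>G\<^esub> fst v, snd v) \<in> dom_at q" if "g \<in> carrier G" "v \<in> dom_at q" for g v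
    using that F_translate(1)[OF that(1) _ _ q, of v v] unfolding dom_at_def by auto
  have same: "F (g \<otimes>\<^bsub>G\<^esub> fst v, snd v) q = F (g \<otimes>\<^bsub>G\<^esub> fst w, snd w) q"
    if "g \<in> carrier G" "v \<in> dom_at q" "w \<in> dom_at q" "F v q = F w q" for g v w
    using that F_translate(2)[OF that(1) _ _ q, of v w] unfolding dom_at_def by blast
  have lt: "left_translate G g V = (\<lambda>v. (g \<otimes>\<^bsub>G\<^esub> fst v, snd v)) ` V" for g and V :: "('g \<times> 'b) set"
    unfolding left_translate_def by (simp add: case_prod_unfold)
  fix g assume g: "g \<in> carrier G"
  have gi: "inv\<^bsub>G\<^esub> g \<in> carrier G" using g by simp
  show "left_translate G g (dom_at q) = dom_at q"
  proof
    show "left_translate G g (dom_at q) \<subseteq> dom_at q" unfolding lt using tr[OF g] by blast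
    show "dom_at q \<subseteq> left_translate G g (dom_at q)"
    proof
      fix v assume v: "v \<in> dom_at q"
      then have "fst v \<in> carrier G" unfolding dom_at_def by auto
      then have "v = (g \<otimes>\<^bsub>G\<^esub> fst (inv\<^bsub>G\<^esub> g \<otimes>\<^bsub>G\<^esub> fst v, snd v), snd (inv\<^bsub>G\<^esub> g \<otimes>\<^bsub>G\<^esub> fst v, snd v))"
        using bk(1)[OF g] by simp
      then show "v \<in> left_translate G g (dom_at q)" unfolding lt using tr[OF gi v] by (rule image_eqI)
    qed
  qed
  have bt: "left_translate G g (block_at q v) = block_at q (g \<otimes>\<^bsub>G\<^esub> fst v, snd v)"
    if g: "g \<in> carrier G" and v: "v \<in> dom_at q" for g v
  proof
    have gi: "inv\<^bsub>G\<^esub> g \<in> carrier G" using g by simp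
    show "left_translate G g (block_at q v) \<subseteq> block_at q (g \<otimes>\<^bsub>G\<^esub> fst v, snd v)"
      unfolding lt block_at_def using tr[OF g] same[OF g _ v] by auto
    show "block_at q (g \<otimes>\<^bsub>G\<^esub> fst v, snd v) \<subseteq> left_translate G g (block_at q v)"
    proof
      fix w assume "w \<in> block_at q (g \<otimes>\<^bsub>G\<^esub> fst v, snd v)"
      then have w: "w \<in> dom_at q" "F w q = F (g \<otimes>\<^bsub>G\<^esub> fst v, snd v) q" unfolding block_at_def by auto
      have c: "fst w \<in> carrier G" "fst v \<in> carrier G" using w(1) v unfolding dom_at_def by auto
      have "F (inv\<^bsub>G\<^esub> g \<otimes>\<^bsub>G\<^esub> fst w, snd w) q = F v q"
        using same[OF gi w(1) tr[OF g v] w(2)] bk(2)[OF g c(2)] by simp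
      then have "(inv\<^bsub>G\<^esub> g \<otimes>\<^bsub>G\<^esub> fst w, snd w) \<in> block_at q v" unfolding block_at_def using tr[OF gi w(1)] by simp
      moreover have "w = (g \<otimes>\<^bsub>G\<^esub> fst (inv\<^bsub>G\<^esub> g \<otimes>\<^bsub>G\<^esub> fst w, snd w), snd (inv\<^bsub>G\<^esub> g \<otimes>\<^bsub>G\<^esub> fst w, snd w))"
        using bk(1)[OF g c(1)] by simp
      ultimately show "w \<in> left_translate G g (block_at q v)" unfolding lt by (rule rev_image_eqI)
    qed
  qed
  show "left_translate G g ` block_at q ` dom_at q = block_at q ` dom_at q"
  proof
    show "left_translate G g ` block_at q ` dom_at q \<subseteq> block_at q ` dom_at q" using bt[OF g] tr[OF g] by auto
    show "block_at q ` dom_at q \<subseteq> left_translate G g ` block_at q ` dom_at q"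
    proof
      fix P assume "P \<in> block_at q ` dom_at q"
      then obtain v where v: "v \<in> dom_at q" "P = block_at q v" by blast
      have c: "fst v \<in> carrier G" using v unfolding dom_at_def by auto
      have "left_translate G g (block_at q (inv\<^bsub>G\<^esub> g \<otimes>\<^bsub>G\<^esub> fst v, snd v)) = P"
        using bt[OF g tr[OF gi v(1)]] bk(1)[OF g c] v(2) by simp
      then show "P \<in> left_translate G g ` block_at q ` dom_at q" using tr[OF gi v(1)] by blast
    qed
  qed
qed

lemma flow:
  assumes X: "X \<subseteq> carrier S" "X \<noteq> {}" and n: "complexity (sgp_of T) + 1 \<le> enat n"
  shows "\<exists>T' :: nat ts. is_ts T' \<and> complexity (sgp_of T') + 1 \<le> enat n \<and> admits_flow_from G B act X T'"
proof -
  obtain e :: "('q \<rightharpoonup> 'q) \<Rightarrow> nat" where e: "inj_on e (pfuns T)"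
    using finite_imp_inj_to_nat_seg[OF finite_pfuns[OF T]] by blast
  define Q where "Q = e ` pfuns T"
  define dec where "dec = inv_into (pfuns T) e"
  have dec: "dec (e q) = q" if "q \<in> pfuns T" for q unfolding dec_def using e that by simp
  have decT: "dec i \<in> pfuns T" "e (dec i) = i" if "i \<in> Q" for i using that dec unfolding Q_def by auto
  have "\<forall>s\<in>carrier S. \<exists>u. u \<in> \<Theta> s" using \<Theta>_nonempty by blast
  from bchoice[OF this] obtain c where c: "\<forall>s\<in>carrier S. c s \<in> \<Theta> s" ..
  define t where "t s = snd (c s)" for s
  have ct: "(fst (c s), t s) \<in> \<Theta> s" if "s \<in> carrier S" for s using c that unfolding t_def by simp
  have tT: "t s \<in> pfuns T" if "s \<in> carrier S" for s using \<Theta>_K(2)[OF that ct[OF that]] .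
  \<comment> \<open>T acts on its own elements, coded by numbers, by right multiplication. The
    action is total, so transitions are always defined.\<close>
  define \<tau> where "\<tau> u = (\<lambda>i. if i \<in> Q then Some (e (u \<circ>\<^sub>m dec i)) else None)" for u
  define \<delta> where "\<delta> x = \<tau> (t x)" for x
  have \<tau>Q: "e (u \<circ>\<^sub>m dec i) \<in> Q" if "u \<in> pfuns T" "i \<in> Q" for u i
    unfolding Q_def using is_tsD(4)[OF T decT(1)[OF that(2)] that(1)] by blast
  have \<tau>comp: "\<tau> v \<circ>\<^sub>m \<tau> u = \<tau> (v \<circ>\<^sub>m u)" if u: "u \<in> pfuns T" and v: "v \<in> pfuns T" for u v
  proof
    fix i show "(\<tau> v \<circ>\<^sub>m \<tau> u) i = \<tau> (v \<circ>\<^sub>m u) i"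
    proof (cases "i \<in> Q")
      case True
      then show ?thesis
        using \<tau>Q[OF u True] dec[OF is_tsD(4)[OF T decT(1)[OF True] u]]
        by (simp add: \<tau>_def map_comp_def[of "\<lambda>i. if i \<in> Q then _ i else None"] map_comp_assoc)
    qed (simp add: \<tau>_def map_comp_def)
  qed
  \<comment> \<open>The semigroup generated by the components chosen for the letters; through
    \<open>\<tau>\<close> it divides T, which bounds its complexity.\<close>
  define T' where "T' = \<lparr>states = Q, pfuns = transition_sgp X \<delta>\<rparr>"
  have rng: "\<exists>u\<in>pfuns T. p = \<tau> u" if "p \<in> pfuns T'" for p
  proof -
    have "p \<in> sgp_generated (pfun_sgp UNIV) (\<delta> ` X)" using that by (simp add: T'_def transition_sgp_def)
    then show ?thesis
    proof induction
      case (gen p) then show ?case using tT X(1) unfolding \<delta>_def by blast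
    next
      case (prod p p')
      then show ?case using \<tau>comp is_tsD(4)[OF T] by (metis pfun_sgp_simps(2))
    qed
  qed
  have dr: "dom (\<tau> u) \<subseteq> Q \<and> ran (\<tau> u) \<subseteq> Q" if "u \<in> pfuns T" for u
    using \<tau>Q[OF that] unfolding \<tau>_def by (auto simp: dom_def ran_def split: if_splits)
  have cl: "g \<circ>\<^sub>m f \<in> pfuns T'" if "f \<in> pfuns T'" "g \<in> pfuns T'" for f g
    using sgp_generated.prod[of f "pfun_sgp UNIV" "\<delta> ` X" g] that by (simp add: T'_def transition_sgp_def)
  have "\<delta> x \<in> pfuns T'" if "x \<in> X" for x
    using sgp_generated.gen[of "\<delta> x" "\<delta> ` X"] that by (simp add: T'_def transition_sgp_def)
  then have ne: "pfuns T' \<noteq> {}" using X(2) by blast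
  have T': "is_ts T'" unfolding is_ts_def is_sgp_pfun
  proof (intro conjI ballI)
    show "finite (states T')" using finite_pfuns[OF T] by (simp add: T'_def Q_def)
    show "dom p \<subseteq> states T'" "ran p \<subseteq> states T'" if "p \<in> pfuns T'" for p
      using rng[OF that] dr by (auto simp: T'_def)
  qed (use ne cl in auto)
  have "sgp_of T' \<prec>\<^sub>s sgp_of T"
  proof (rule divides_rel[where \<rho> = "\<lambda>u p. p = \<tau> u"])
    show "is_sgp (sgp_of T')" using is_tsD(2)[OF T'] .
    show "\<exists>u\<in>carrier (sgp_of T). p = \<tau> u" if "p \<in> carrier (sgp_of T')" for p using rng that by simp
  qed (use is_tsD(4)[OF T] \<tau>comp in auto)
  moreover obtain m where m: "n = Suc m" "complexity (sgp_of T) \<le> enat m" by (rule enat_Suc_le[OF n])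
  ultimately have "complexity (sgp_of T') \<le> enat m" using complexity_mono is_tsD(2)[OF T'] by blast
  then have "complexity (sgp_of T') + 1 \<le> enat m + 1" by (rule add_right_mono)
  also have "enat m + 1 = enat n" using m(1) by (simp add: plus_1_eSuc(2) eSuc_enat)
  finally have cx: "complexity (sgp_of T') + 1 \<le> enat n" .
  define f where "f i = (dom_at (dec i), block_at (dec i) ` dom_at (dec i))" for i
  have "automaton_flow G B act X Q \<delta> f" unfolding automaton_flow_def
  proof (intro conjI)
    show "\<forall>i\<in>Q. f i \<in> invariant_cross_sections G B" unfolding f_def using cross_section_at decT by blast
    show "\<forall>v\<in>Y. \<exists>i\<in>Q. v \<in> fst (f i)"
    proof
      fix v assume v: "v \<in> Y"
      obtain q where q: "q \<in> pfuns T" "F v q \<noteq> {}" using F_covers[OF v] by blast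
      then have "v \<in> fst (f (e q))" using dec v by (simp add: f_def dom_at_def)
      moreover have "e q \<in> Q" using q(1) unfolding Q_def by blast
      ultimately show "\<exists>i\<in>Q. v \<in> fst (f i)" by blast
    qed
    have main: "(\<forall>v\<in>fst (f i). \<forall>w. act x v = Some w \<longrightarrow> w \<in> fst (f i')) \<and>
        (\<forall>v\<in>fst (f i). \<forall>v'\<in>fst (f i). \<forall>w w'. act x v = Some w \<and> act x v' = Some w' \<longrightarrow>
           (same_block (snd (f i)) v v' \<longleftrightarrow> same_block (snd (f i')) w w'))"
      if i: "i \<in> Q" and x: "x \<in> X" and i': "\<delta> x i = Some i'" for i x i'
    proof -
      let ?q = "dec i"
      have xS: "x \<in> carrier S" using x X(1) by blast
      have q: "?q \<in> pfuns T" using decT i by blast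
      have i'e: "i' = e (t x \<circ>\<^sub>m ?q)" using i' i unfolding \<delta>_def \<tau>_def by simp
      have dq: "dec i' = t x \<circ>\<^sub>m ?q" unfolding i'e using dec is_tsD(4)[OF T q tT[OF xS]] by blast
      have st: "w \<in> dom_at (t x \<circ>\<^sub>m ?q)" if vw: "v \<in> dom_at ?q" "act x v = Some w" for v w
      proof -
        obtain j where j: "j \<in> F v ?q" using vw(1) unfolding dom_at_def by blast
        have "w \<in> Y" using act_Some[OF xS] vw(2) by blast
        then show ?thesis using right_act(1)[OF xS vw(2) ct[OF xS] q j] unfolding dom_at_def by blast
      qed
      have "same_block (block_at ?q ` dom_at ?q) v v' \<longleftrightarrow>
          same_block (block_at (t x \<circ>\<^sub>m ?q) ` dom_at (t x \<circ>\<^sub>m ?q)) w w'"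
        if h: "v \<in> dom_at ?q" "v' \<in> dom_at ?q" "act x v = Some w" "act x v' = Some w'" for v v' w w'
      proof -
        have "F v ?q \<noteq> {}" "F v' ?q \<noteq> {}" using h unfolding dom_at_def by auto
        from right_act_iff[OF xS h(3,4) ct[OF xS] q this]
        show ?thesis using same_block_at[OF h(1,2)] same_block_at[OF st[OF h(1,3)] st[OF h(2,4)]] by simp
      qed
      then show ?thesis unfolding f_def fst_conv snd_conv dq using st by blast
    qed
    show "\<forall>i\<in>Q. \<forall>x\<in>X. \<forall>U \<P> V \<Psi>. f i = (U, \<P>) \<and>
       (V, \<Psi>) = (case \<delta> x i of None \<Rightarrow> ({}, {}) | Some i' \<Rightarrow> f i') \<longrightarrow>
        (\<forall>v\<in>U. \<forall>w. act x v = Some w \<longrightarrow> w \<in> V) \<and>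
        (\<forall>v\<in>U. \<forall>v'\<in>U. \<forall>w w'. act x v = Some w \<and> act x v' = Some w' \<longrightarrow>
           (same_block \<P> v v' \<longleftrightarrow> same_block \<Psi> w w'))"
    proof (intro ballI allI impI, elim conjE)
      fix i x U \<P> V \<Psi> assume i: "i \<in> Q" and x: "x \<in> X" and U: "f i = (U, \<P>)"
        and V: "(V, \<Psi>) = (case \<delta> x i of None \<Rightarrow> ({}, {}) | Some i' \<Rightarrow> f i')"
      obtain i' where i': "\<delta> x i = Some i'" using i unfolding \<delta>_def \<tau>_def by simp
      have V': "f i' = (V, \<Psi>)" using V i' by simp
      show "(\<forall>v\<in>U. \<forall>w. act x v = Some w \<longrightarrow> w \<in> V) \<and>
        (\<forall>v\<in>U. \<forall>v'\<in>U. \<forall>w w'. act x v = Some w \<and> act x v' = Some w' \<longrightarrow>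
           (same_block \<P> v v' \<longleftrightarrow> same_block \<Psi> w w'))"
        using main[OF i x i'] unfolding U V' fst_conv snd_conv .
    qed
  qed
  moreover have "automaton X Q \<delta>" unfolding automaton_def
    using finite_pfuns[OF T] dr[OF tT[OF subsetD[OF X(1)]]] by (simp add: Q_def \<delta>_def)
  ultimately have "admits_flow_from G B act X T'" unfolding admits_flow_from_def
    by (intro exI[of _ \<delta>] exI[of _ f]) (simp add: T'_def)
  then show ?thesis using T' cx by blast
qed

end

section \<open>Condition 2 implies condition 5\<close>

context gm
begin

lemma aperiodic_morphism_imp_flow:
  fixes H :: "nat monoid" and T :: "nat ts"
  assumes H: "Group.group H" "finite (carrier H)" and T: "is_ts T" "complexity (sgp_of T) + 1 \<le> enat n"
    and \<Theta>: "aperiodic_rel_morphism S (sgp_of (group_ts H \<wr> T)) \<Theta>"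
    and X: "X \<subseteq> carrier S" "X \<noteq> {}"
  shows "\<exists>T' :: nat ts. is_ts T' \<and> complexity (sgp_of T') + 1 \<le> enat n \<and> admits_flow_from G B act X T'"
proof -
  interpret gw: group_wreath H T
    by (rule group_wreath.intro[OF H(1)]) (unfold_locales; fact T(1) H(2))
  have r: "rel_morphism S (sgp_of (group_ts H \<wr> T)) \<Theta>"
    and ap: "\<And>V. subsgp V (sgp_of (group_ts H \<wr> T)) \<Longrightarrow> aperiodic ((sgp_of (group_ts H \<wr> T))\<lparr>carrier := V\<rparr>) \<Longrightarrow>
        aperiodic (S\<lparr>carrier := {s \<in> carrier S. \<Theta> s \<inter> V \<noteq> {}}\<rparr>)"
    using \<Theta> unfolding aperiodic_rel_morphism_def by blast+
  define \<Psi> where "\<Psi> s = {u \<in> gw.K \<times> pfuns T. gw.realize u \<in> \<Theta> s}" for s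
  have W: "is_ts (group_ts H \<wr> T)"
    using is_ts_wreath[OF is_ts_group_ts[OF gw.H.is_monoid H(2)] T(1)] .
  interpret gm_wreath S I G A B C \<phi> a0 H T \<Psi>
  proof
    fix s assume s: "s \<in> carrier S"
    show "\<Psi> s \<noteq> {}"
    proof -
      obtain w where "w \<in> \<Theta> s" "w \<in> pfuns (group_ts H \<wr> T)" using r s unfolding rel_morphism_def by fastforce
      then show ?thesis using gw.realize_surj[of w] unfolding \<Psi>_def by auto
    qed
    show "\<Psi> s \<subseteq> gw.K \<times> pfuns T" unfolding \<Psi>_def by blast
    show "gw.mul u u' \<in> \<Psi> (s \<cdot>\<^bsub>S\<^esub> s')" if h: "s' \<in> carrier S" "u \<in> \<Psi> s" "u' \<in> \<Psi> s'" for s' u u'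
    proof -
      have u: "u \<in> gw.K \<times> pfuns T" "u' \<in> gw.K \<times> pfuns T" "gw.realize u \<in> \<Theta> s" "gw.realize u' \<in> \<Theta> s'"
        using h unfolding \<Psi>_def by auto
      have "gw.realize u' \<circ>\<^sub>m gw.realize u \<in> \<Theta> (s \<cdot>\<^bsub>S\<^esub> s')" using r s h(1) u(3,4) unfolding rel_morphism_def by simp
      then show ?thesis using gw.realize_mul[OF u(1,2)] gw.mul_closed[OF u(1,2)] unfolding \<Psi>_def by simp
    qed
    show "\<exists>n. spow S s (Suc n) = spow S s n" if h: "u \<in> \<Psi> s" "gw.mul u u = u" for u
    proof -
      have u: "u \<in> gw.K \<times> pfuns T" "gw.realize u \<in> \<Theta> s" using h unfolding \<Psi>_def by auto
      \<comment> \<open>For idempotent u this is a one-element subsemigroup, trivially aperiodic;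
        the elements related to it therefore form an aperiodic subsemigroup of S.\<close>
      let ?V = "{gw.realize u}"
      have id: "gw.realize u \<circ>\<^sub>m gw.realize u = gw.realize u" using gw.realize_mul[OF u(1,1)] h(2) by simp
      have "gw.realize u \<in> pfuns (group_ts H \<wr> T)" using r s u(2) unfolding rel_morphism_def by auto
      then have "subsgp ?V (sgp_of (group_ts H \<wr> T))" using id unfolding subsgp_def by simp
      moreover have "aperiodic ((sgp_of (group_ts H \<wr> T))\<lparr>carrier := ?V\<rparr>)"
        by (rule aperiodicI) (use id in \<open>auto simp: spow_carrier_update intro!: exI[of _ 0]\<close>)
      ultimately have apS: "aperiodic (S\<lparr>carrier := {s \<in> carrier S. \<Theta> s \<inter> ?V \<noteq> {}}\<rparr>)" by (rule ap)
      let ?S = "S\<lparr>carrier := {s \<in> carrier S. \<Theta> s \<inter> ?V \<noteq> {}}\<rparr>"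
      have cl: "a \<cdot>\<^bsub>S\<^esub> b \<in> {s \<in> carrier S. \<Theta> s \<inter> ?V \<noteq> {}}"
        if ab: "a \<in> {s \<in> carrier S. \<Theta> s \<inter> ?V \<noteq> {}}" "b \<in> {s \<in> carrier S. \<Theta> s \<inter> ?V \<noteq> {}}" for a b
      proof -
        have "a \<in> carrier S" "b \<in> carrier S" "gw.realize u \<in> \<Theta> a" "gw.realize u \<in> \<Theta> b" using ab by auto
        then have "gw.realize u \<circ>\<^sub>m gw.realize u \<in> \<Theta> (a \<cdot>\<^bsub>S\<^esub> b)" "a \<cdot>\<^bsub>S\<^esub> b \<in> carrier S"
          using r is_sgpD(2)[OF S] unfolding rel_morphism_def by auto
        then show ?thesis using id by simp
      qed
      have sV: "s \<in> {s \<in> carrier S. \<Theta> s \<inter> ?V \<noteq> {}}" using s u(2) by simp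
      have "subsgp {s \<in> carrier S. \<Theta> s \<inter> ?V \<noteq> {}} S" unfolding subsgp_def using cl sV by blast
      then have "finite_sgp ?S" unfolding finite_sgp_def using is_sgp_subsgp[OF S] finS by simp
      from aperiodicD[OF this apS] have "\<exists>n. spow ?S s (Suc n) = spow ?S s n" using sV by simp
      then show ?thesis unfolding spow_carrier_update .
    qed
  qed
  obtain y where y: "y \<in> E" "y \<circ>\<^sub>m y = y" "\<forall>x\<in>E. \<exists>x'\<in>E. (y \<circ>\<^sub>m (x' \<circ>\<^sub>m y)) \<circ>\<^sub>m (y \<circ>\<^sub>m (x \<circ>\<^sub>m y)) = y"
    using ex_local_identity by blast
  interpret gm_wreath_local S I G A B C \<phi> a0 H T \<Psi> y
    by unfold_locales (use y in blast)+
  show ?thesis by (rule flow[OF X T(2)])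
qed

end

theorem theorem6p1:
  fixes S :: "'s sgp" and I X :: "'s set"
    and G :: "'g monoid" and A :: "'a set" and B :: "'b set"
    and C :: "'b \<Rightarrow> 'a \<Rightarrow> 'g option" and \<phi> :: "'s \<Rightarrow> ('a \<times> 'g \<times> 'b) option" and a0 :: 'a
    and n :: nat
  assumes "GM S I G A B C \<phi>" and "a0 \<in> A"
    and "X \<subseteq> carrier S" and "sgp_generated S X = carrier S"
    and "complexity (sgp_of (RLM S I G B \<phi> a0)) \<le> enat n"
  shows
    "(complexity S \<le> enat n \<longleftrightarrow>
       (\<exists>(H :: nat monoid) (T :: nat ts) \<Theta>.
          Group.group H \<and> finite (carrier H) \<and> is_ts T \<and> complexity (sgp_of T) + 1 \<le> enat n \<and>
          aperiodic_rel_morphism S (sgp_of (group_ts H \<wr> T)) \<Theta>)) \<and>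
     (complexity S \<le> enat n \<longleftrightarrow>
       (\<exists>(T :: nat ts) \<Phi>Q \<Phi>T.
          is_ts T \<and> complexity (sgp_of T) + 1 \<le> enat n \<and>
          ts_rel_morphism (GM_ts S I G B \<phi> a0) T \<Phi>Q \<Phi>T \<and>
          in_Ap_Gp (sgp_of (derived_ts (GM_ts S I G B \<phi> a0) T \<Phi>Q \<Phi>T)))) \<and>
     (complexity S \<le> enat n \<longleftrightarrow>
       (\<exists>(T :: nat ts) \<Phi>Q \<Phi>T.
          is_ts T \<and> complexity (sgp_of T) + 1 \<le> enat n \<and>
          ts_rel_morphism (GM_ts S I G B \<phi> a0) T \<Phi>Q \<Phi>T \<and>
          is_cross_section G B (states T)
            (tilson_congruence (derived_ts (GM_ts S I G B \<phi> a0) T \<Phi>Q \<Phi>T)))) \<and>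
     (complexity S \<le> enat n \<longleftrightarrow>
       (\<exists>T :: nat ts.
          is_ts T \<and> complexity (sgp_of T) + 1 \<le> enat n \<and>
          admits_flow_from G B (GM_act S I G B \<phi> a0) X T)) \<and>
     (complexity S \<le> enat n \<longleftrightarrow>
       (\<exists>T :: nat ts.
          is_ts T \<and> complexity (sgp_of T) + 1 \<le> enat n \<and>
          S \<prec>\<^sub>s sgp_times (sgp_of (group_ts G \<wr> sym_ts B \<wr> T))
                         (sgp_of (RLM S I G B \<phi> a0))))"
    (is "(?c \<longleftrightarrow> ?two) \<and> (_ \<longleftrightarrow> ?three) \<and> (_ \<longleftrightarrow> ?four) \<and> (_ \<longleftrightarrow> ?five) \<and> (_ \<longleftrightarrow> ?six)")
proof -
  interpret gm S I G A B C \<phi> a0 by (rule gm.intro[OF assms(1,2)])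
  note RL = assms(5)
  \<comment> \<open>A generating letter keeps the transition semigroup of the flow
    non-empty.\<close>
  have X: "X \<noteq> {}"
  proof
    assume "X = {}"
    then have "sgp_generated S X \<subseteq> {}" by (intro sgp_generated_closed) auto
    then show False using assms(4) is_sgpD(1)[OF S] by blast
  qed
  have 12: ?two if ?c using complexity_imp_aperiodic_morphism[OF that] .
  have 13: ?three if ?c using complexity_imp_derived_Ap_Gp[OF that] .
  have 32: ?two if ?three using that derived_Ap_Gp_imp_aperiodic_morphism by blast
  have 25: ?five if two: ?two
  proof -
    obtain H :: "nat monoid" and T :: "nat ts" and \<Theta> where "Group.group H" "finite (carrier H)" "is_ts T"
      "complexity (sgp_of T) + 1 \<le> enat n" "aperiodic_rel_morphism S (sgp_of (group_ts H \<wr> T)) \<Theta>"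
      using two by blast
    from aperiodic_morphism_imp_flow[OF this assms(3) X] show ?thesis .
  qed
  have 54: ?four if five: ?five
  proof -
    obtain T :: "nat ts" where T: "is_ts T" "complexity (sgp_of T) + 1 \<le> enat n" "admits_flow_from G B act X T"
      using five by blast
    obtain f R where "flow_rel T f R" using flow_rel_exists[OF T(1) assms(3,4) T(3)] by blast
    from flow_imp_cross_section[OF T(1) this] show ?thesis using T(1,2) by blast
  qed
  have 56: ?six if five: ?five
  proof -
    obtain T :: "nat ts" where T: "is_ts T" "complexity (sgp_of T) + 1 \<le> enat n" "admits_flow_from G B act X T"
      using five by blast
    obtain f R where "flow_rel T f R" using flow_rel_exists[OF T(1) assms(3,4) T(3)] by blast
    from flow_imp_division[OF T(1) this] show ?thesis using T(1,2) by blast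
  qed
  have 41: ?c if ?four using that complexity_le_of_cross_section[OF _ _ RL] by blast
  have 61: ?c if ?six using that complexity_le_of_division[OF _ _ RL] by blast
  show ?thesis using 12 13 32 25 54 56 41 61 by blast
qed

end
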